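(* Let $\underline{C}$ be a triangulated category endowed with a weight structure $w$ with heart $\underline{Hw}$, let $\underline{C}'$ be a full triangulated subcategory of $\underline{C}$, let $\underline{B}$ be a full additive subcategory of $\underline{Hw}$, let $N$ be an object of $\underline{C}'$, and let $F:\underline{B}\to\underline{A}$ be an additive functor into an additive category $\underline{A}$. Assume that for every object $M$ of $\underline{C}'$ the weight complex $t(M)$ is homotopy equivalent to a complex $(M^i)\in \operatorname{Obj}K(\underline{B})$ such that $F(M^i)=0$ for almost all $i\in\mathbb{Z}$. **I.** 1. The correspondence $M\mapsto\sum_{i\in\mathbb{Z}}(-1)^i[F(M^i)]$ gives a well-defined homomorphism $F_{K_0}:K_0^{\mathrm{tr}}(\underline{C}')\to K_0^{\mathrm{add}}(\underline{A})$. 2. Assume that $\underline{B}=\underline{Hw}\subset\underline{C}'$, that $\underline{A}$ is abelian, and that there exist $N'\in\underline{C}_{w=0}$ and a $\underline{C}'$-morphism $h$, either from $N'$ to $N$ or from $N$ to $N'$, such that $F_{K_0}([\operatorname{Cone}(h)])=0$. Then $F_{K_0}([N])=[F(N')]$. Moreover, if $H^F_j(\operatorname{Cone}(h))=0$ for $j=0,1$, then $F_{K_0}([N])=[H^F(N)]$. 3. Assume that $\underline{A}$ is abelian semi-simple. Then $F_{K_0}([N])=\sum_{i\in\mathbb{Z}}(-1)^i[H^F_i(N)]$. **II.** Assume that $\underline{C}'=\underline{C}$ and that $\underline{B}$ strongly generates $\underline{C}$. 1. Then the homomorphism $\operatorname{id}_{\underline{B},K_0}:K_0^{\mathrm{tr}}(\underline{C})\to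 K_0^{\mathrm{add}}(\underline{B})$ (corresponding to $F=\operatorname{id}_{\underline{B}}$) is an isomorphism. In particular, this is the case for $\underline{B}=\underline{Hw}$, i.e., if $w$ is bounded then $\operatorname{id}_{\underline{Hw},K_0}:K_0^{\mathrm{tr}}(\underline{C})\to K_0^{\mathrm{add}}(\underline{Hw})$ is an isomorphism. 2. Assume that $\underline{B}=\underline{Hw}$, that $\underline{A}$ is abelian, and that $F=F'\circ\underline{HG}$, where $\underline{HG}:\underline{Hw}\to\underline{Hv}$ is the restriction to hearts of a weight-exact functor $G:(\underline{C},w)\to(\underline{D},v)$ and $F':\underline{Hv}\to\underline{A}$ is an additive functor; assume also that for some $j\in\mathbb{Z}$ the object $G(N)$ belongs to $\underline{D}_{v=j}$. Then $F_{K_0}([N])=(-1)^j[H^F_j(N)]$.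
   Context: **Weight structures.** A weight structure $w$ on a triangulated category $\underline{C}$ is a pair of classes of objects $\underline{C}_{w\le 0},\underline{C}_{w\ge 0}$ that are closed under retracts in $\underline{C}$ and satisfy: $\underline{C}_{w\le 0}\subset\underline{C}_{w\le 0}[1]$ and $\underline{C}_{w\ge 0}[1]\subset\underline{C}_{w\ge 0}$; $\underline{C}(X,Y)=0$ for $X\in\underline{C}_{w\le 0}$, $Y\in\underline{C}_{w\ge 0}[1]$; every object $M$ fits into a distinguished triangle $LM\to M\to RM\to LM[1]$ with $LM\in\underline{C}_{w\le 0}$, $RM\in\underline{C}_{w\ge 0}[1]$. Put $\underline{C}_{w\le i}=\underline{C}_{w\le 0}[i]$, $\underline{C}_{w\ge i}=\underline{C}_{w\ge 0}[i]$, $\underline{C}_{w=i}=\underline{C}_{w\le i}\cap\underline{C}_{w\ge i}$. The heart $\underline{Hw}$ is the full subcategory with object class $\underline{C}_{w=0}$. $w$ is bounded if $\bigcup_i\underline{C}_{w\le i}=\operatorname{Obj}\underline{C}=\bigcup_i\underline{C}_{w\ge i}$. An exact functor $G:(\underline{C},w)\to(\underline{D},v)$ is weight-exact if $G(\underline{C}_{w\le 0})\subset\underline{D}_{v\le 0}$ and $G(\underline{C}_{w\ge 0})\subset\underline{D}_{v\ge 0}$. A subcategory $\underline{B}$ strongly generates $\underline{C}$ if $\underline{C}$ is the smallest strictly full triangulated subcategory of $\underline{C}$ containing $\underline{B}$. **Weight complexes.** For $M\in\operatorname{Obj}\underline{C}$ choose for every $n\in\mathbb{Z}$ a distinguished triangle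 $w_{\le n}M\to M\to w_{\ge n+1}M\to (w_{\le n}M)[1]$ with $w_{\le n}M\in\underline{C}_{w\le n}$ and $w_{\ge n+1}M\in\underline{C}_{w\ge n+1}$. There are unique morphisms $w_{\le n-1}M\to w_{\le n}M$ compatible with the morphisms to $M$. Set $M^{-n}=\operatorname{Cone}(w_{\le n-1}M\to w_{\le n}M)[-n]$; this is an object of $\underline{Hw}$. The weight complex $t(M)=(M^i)$ is the cohomological complex over $\underline{Hw}$ whose differential $M^{-n}\to M^{-n+1}$ is the composition $M^{-n}\to(w_{\le n-1}M)[1-n]\to M^{-n+1}$ of the obvious morphisms. It is known that the isomorphism class of $t(M)$ in the homotopy category $K(\underline{Hw})$ does not depend on choices, and that $t$ yields an additive functor from $\underline{C}$ into the quotient of $K(\underline{Hw})$ by the relation of weak homotopy ($m_1\backsim m_2$ if $m_1-m_2=d h+j d$ for some collections of arrows $h^*,j^*$ of degree $-1$). **The functors $H^F$.** If $\underline{A}$ is abelian, $H^F(M)$ denotes the zeroth (co)homology of the complex $(F(M^i))$, where $(M^i)$ is a complex over $\underline{B}$ homotopy equivalent to $t(M)$. For $\underline{B}=\underline{Hw}$ this is a homological functor on $\underline{C}$. For a homological functor $H$ put $H_i=H\circ[-i]$. **Grothendieck groups.** (Categories whose $K_0$ is considered are assumed to be essentially small.) For an additive category $\underline{B}$, $K_0^{\mathrm{add}}(\underline{B})$ is generated by isomorphism classes of objects with relations $[B]=[A]+[C]$ whenever $B\cong A\oplus C$. For a triangulated category, $K_0^{\mathrm{tr}}$ is generated by isomorphism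 classes of objects with relations $[B]=[A]+[C]$ for all distinguished triangles $A\to B\to C\to A[1]$. *)

theory Defs
  imports "HOL-Algebra.Free_Abelian_Groups"
begin

section \<open>Additive and abelian categories\<close>

text \<open>
  Objects and arrows are elements of two types; the object class and the arrow class are carrier
  sets. Composition is written in the applicative order: \<open>g \<cdot> f\<close> is \<open>f\<close> followed by \<open>g\<close>.
  Values outside of the carriers (and of non-composable or non-parallel arrows) are irrelevant.
\<close>

record ('o, 'm) cat =
  Ob :: "'o set"
  Ar :: "'m set"
  Dom :: "'m \<Rightarrow> 'o"
  Cod :: "'m \<Rightarrow> 'o"
  Idn :: "'o \<Rightarrow> 'm"
  Cmp :: "'m \<Rightarrow> 'm \<Rightarrow> 'm"  (infixl "\<cdot>\<index>" 70)
  Pls :: "'m \<Rightarrow> 'm \<Rightarrow> 'm"  (infixl "\<boxplus>\<index>" 65)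
  Zro :: "'o \<Rightarrow> 'o \<Rightarrow> 'm"

definition Homs :: "('o, 'm, 'e) cat_scheme \<Rightarrow> 'o \<Rightarrow> 'o \<Rightarrow> 'm set" where
  "Homs C X Y = {f \<in> Ar C. Dom C f = X \<and> Cod C f = Y}"

definition hom_group :: "('o, 'm, 'e) cat_scheme \<Rightarrow> 'o \<Rightarrow> 'o \<Rightarrow> 'm monoid" where
  "hom_group C X Y = \<lparr>carrier = Homs C X Y, monoid.mult = Pls C, one = Zro C X Y\<rparr>"

definition neg_arrow :: "('o, 'm, 'e) cat_scheme \<Rightarrow> 'm \<Rightarrow> 'm" where
  "neg_arrow C f = inv\<^bsub>hom_group C (Dom C f) (Cod C f)\<^esub> f"

locale preadditive_category =
  fixes C :: "('o, 'm, 'e) cat_scheme" (structure)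
  assumes Dom_in: "f \<in> Ar C \<Longrightarrow> Dom C f \<in> Ob C"
    and Cod_in: "f \<in> Ar C \<Longrightarrow> Cod C f \<in> Ob C"
    and Idn_in: "X \<in> Ob C \<Longrightarrow> Idn C X \<in> Homs C X X"
    and Cmp_in: "f \<in> Homs C X Y \<Longrightarrow> g \<in> Homs C Y Z \<Longrightarrow> g \<cdot> f \<in> Homs C X Z"
    and Idn_left: "f \<in> Homs C X Y \<Longrightarrow> Idn C Y \<cdot> f = f"
    and Idn_right: "f \<in> Homs C X Y \<Longrightarrow> f \<cdot> Idn C X = f"
    and Cmp_assoc: "f \<in> Homs C W X \<Longrightarrow> g \<in> Homs C X Y \<Longrightarrow> h \<in> Homs C Y Z
      \<Longrightarrow> (h \<cdot> g) \<cdot> f = h \<cdot> (g \<cdot> f)"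
    and hom_comm_group: "X \<in> Ob C \<Longrightarrow> Y \<in> Ob C \<Longrightarrow> comm_group (hom_group C X Y)"
    and Cmp_Pls_left: "f \<in> Homs C X Y \<Longrightarrow> g \<in> Homs C Y Z \<Longrightarrow> g' \<in> Homs C Y Z
      \<Longrightarrow> (g \<boxplus> g') \<cdot> f = g \<cdot> f \<boxplus> g' \<cdot> f"
    and Cmp_Pls_right: "f \<in> Homs C X Y \<Longrightarrow> f' \<in> Homs C X Y \<Longrightarrow> g \<in> Homs C Y Z
      \<Longrightarrow> g \<cdot> (f \<boxplus> f') = g \<cdot> f \<boxplus> g \<cdot> f'"

definition is_zero_object :: "('o, 'm, 'e) cat_scheme \<Rightarrow> 'o \<Rightarrow> bool" where
  "is_zero_object C Z \<longleftrightarrow> Z \<in> Ob C \<and>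
     (\<forall>X \<in> Ob C. (\<exists>!f. f \<in> Homs C Z X) \<and> (\<exists>!f. f \<in> Homs C X Z))"

text \<open>\<open>is_biproduct C X Y S\<close>: \<open>S\<close> is (isomorphic to) the direct sum of \<open>X\<close> and \<open>Y\<close>.\<close>

definition is_biproduct :: "('o, 'm, 'e) cat_scheme \<Rightarrow> 'o \<Rightarrow> 'o \<Rightarrow> 'o \<Rightarrow> bool" where
  "is_biproduct C X Y S \<longleftrightarrow> X \<in> Ob C \<and> Y \<in> Ob C \<and> S \<in> Ob C \<and>
     (\<exists>i \<in> Homs C X S. \<exists>j \<in> Homs C Y S. \<exists>p \<in> Homs C S X. \<exists>q \<in> Homs C S Y.
        p \<cdot>\<^bsub>C\<^esub> i = Idn C X \<and> q \<cdot>\<^bsub>C\<^esub> j = Idn C Y \<and>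
        q \<cdot>\<^bsub>C\<^esub> i = Zro C X Y \<and> p \<cdot>\<^bsub>C\<^esub> j = Zro C Y X \<and>
        i \<cdot>\<^bsub>C\<^esub> p \<boxplus>\<^bsub>C\<^esub> j \<cdot>\<^bsub>C\<^esub> q = Idn C S)"

locale additive_category = preadditive_category +
  assumes has_zero: "\<exists>Z. is_zero_object C Z"
    and has_biproducts: "X \<in> Ob C \<Longrightarrow> Y \<in> Ob C \<Longrightarrow> \<exists>S. is_biproduct C X Y S"

definition is_iso_arrow :: "('o, 'm, 'e) cat_scheme \<Rightarrow> 'm \<Rightarrow> bool" where
  "is_iso_arrow C f \<longleftrightarrow> f \<in> Ar C \<and>
     (\<exists>g \<in> Homs C (Cod C f) (Dom C f).
        g \<cdot>\<^bsub>C\<^esub> f = Idn C (Dom C f) \<and> f \<cdot>\<^bsub>C\<^esub> g = Idn C (Cod C f))"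

definition isomorphic :: "('o, 'm, 'e) cat_scheme \<Rightarrow> 'o \<Rightarrow> 'o \<Rightarrow> bool" where
  "isomorphic C X Y \<longleftrightarrow> (\<exists>f \<in> Homs C X Y. is_iso_arrow C f)"

definition iso_class :: "('o, 'm, 'e) cat_scheme \<Rightarrow> 'o \<Rightarrow> 'o set" where
  "iso_class C X = {Y \<in> Ob C. isomorphic C X Y}"

definition full_sub :: "('o, 'm, 'e) cat_scheme \<Rightarrow> 'o set \<Rightarrow> ('o, 'm) cat" where
  "full_sub C S = \<lparr>Ob = S, Ar = {f \<in> Ar C. Dom C f \<in> S \<and> Cod C f \<in> S},
     Dom = Dom C, Cod = Cod C, Idn = Idn C, Cmp = Cmp C, Pls = Pls C, Zro = Zro C\<rparr>"

definition is_kernel :: "('o, 'm, 'e) cat_scheme \<Rightarrow> 'm \<Rightarrow> 'm \<Rightarrow> bool" where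
  "is_kernel C f k \<longleftrightarrow> f \<in> Ar C \<and> k \<in> Ar C \<and> Cod C k = Dom C f \<and>
     f \<cdot>\<^bsub>C\<^esub> k = Zro C (Dom C k) (Cod C f) \<and>
     (\<forall>t \<in> Ar C. Cod C t = Dom C f \<and> f \<cdot>\<^bsub>C\<^esub> t = Zro C (Dom C t) (Cod C f) \<longrightarrow>
        (\<exists>!u. u \<in> Homs C (Dom C t) (Dom C k) \<and> k \<cdot>\<^bsub>C\<^esub> u = t))"

definition is_cokernel :: "('o, 'm, 'e) cat_scheme \<Rightarrow> 'm \<Rightarrow> 'm \<Rightarrow> bool" where
  "is_cokernel C f c \<longleftrightarrow> f \<in> Ar C \<and> c \<in> Ar C \<and> Dom C c = Cod C f \<and>
     c \<cdot>\<^bsub>C\<^esub> f = Zro C (Dom C f) (Cod C c) \<and>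
     (\<forall>t \<in> Ar C. Dom C t = Cod C f \<and> t \<cdot>\<^bsub>C\<^esub> f = Zro C (Dom C f) (Cod C t) \<longrightarrow>
        (\<exists>!u. u \<in> Homs C (Cod C c) (Cod C t) \<and> u \<cdot>\<^bsub>C\<^esub> c = t))"

definition is_mono :: "('o, 'm, 'e) cat_scheme \<Rightarrow> 'm \<Rightarrow> bool" where
  "is_mono C f \<longleftrightarrow> f \<in> Ar C \<and>
     (\<forall>W. \<forall>s \<in> Homs C W (Dom C f). \<forall>t \<in> Homs C W (Dom C f).
        f \<cdot>\<^bsub>C\<^esub> s = f \<cdot>\<^bsub>C\<^esub> t \<longrightarrow> s = t)"

definition is_epi :: "('o, 'm, 'e) cat_scheme \<Rightarrow> 'm \<Rightarrow> bool" where
  "is_epi C f \<longleftrightarrow> f \<in> Ar C \<and>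
     (\<forall>W. \<forall>s \<in> Homs C (Cod C f) W. \<forall>t \<in> Homs C (Cod C f) W.
        s \<cdot>\<^bsub>C\<^esub> f = t \<cdot>\<^bsub>C\<^esub> f \<longrightarrow> s = t)"

locale abelian_category = additive_category +
  assumes has_kernels: "f \<in> Ar C \<Longrightarrow> \<exists>k. is_kernel C f k"
    and has_cokernels: "f \<in> Ar C \<Longrightarrow> \<exists>c. is_cokernel C f c"
    and mono_is_kernel: "is_mono C f \<Longrightarrow> \<exists>g. is_kernel C g f"
    and epi_is_cokernel: "is_epi C f \<Longrightarrow> \<exists>g. is_cokernel C g f"

text \<open>Semi-simplicity: every short exact sequence splits.\<close>

locale semisimple_abelian_category = abelian_category +
  assumes short_exact_splits: "is_kernel C g f \<Longrightarrow> is_cokernel C f g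
      \<Longrightarrow> \<exists>s \<in> Homs C (Cod C g) (Dom C g). g \<cdot> s = Idn C (Cod C g)"

record ('o, 'm, 'p, 'q) fnctr =
  FOb :: "'o \<Rightarrow> 'p"
  FAr :: "'m \<Rightarrow> 'q"

definition additive_functor ::
  "('o, 'm, 'e) cat_scheme \<Rightarrow> ('p, 'q, 'f) cat_scheme \<Rightarrow> ('o, 'm, 'p, 'q) fnctr \<Rightarrow> bool" where
  "additive_functor C D F \<longleftrightarrow>
     (\<forall>X \<in> Ob C. FOb F X \<in> Ob D) \<and>
     (\<forall>X Y. \<forall>f \<in> Homs C X Y. FAr F f \<in> Homs D (FOb F X) (FOb F Y)) \<and>
     (\<forall>X \<in> Ob C. FAr F (Idn C X) = Idn D (FOb F X)) \<and>
     (\<forall>X Y Z. \<forall>f \<in> Homs C X Y. \<forall>g \<in> Homs C Y Z.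
        FAr F (g \<cdot>\<^bsub>C\<^esub> f) = FAr F g \<cdot>\<^bsub>D\<^esub> FAr F f) \<and>
     (\<forall>X Y. \<forall>f \<in> Homs C X Y. \<forall>g \<in> Homs C X Y.
        FAr F (f \<boxplus>\<^bsub>C\<^esub> g) = FAr F f \<boxplus>\<^bsub>D\<^esub> FAr F g)"

definition id_functor :: "('o, 'm, 'o, 'm) fnctr" where
  "id_functor = \<lparr>FOb = (\<lambda>X. X), FAr = (\<lambda>f. f)\<rparr>"


section \<open>Cohomological complexes and homotopy equivalence\<close>

record ('o, 'm) cpx =
  obj :: "int \<Rightarrow> 'o"
  dif :: "int \<Rightarrow> 'm"

definition is_complex :: "('o, 'm, 'e) cat_scheme \<Rightarrow> ('o, 'm) cpx \<Rightarrow> bool" where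
  "is_complex C K \<longleftrightarrow>
     (\<forall>i. obj K i \<in> Ob C) \<and>
     (\<forall>i. dif K i \<in> Homs C (obj K i) (obj K (i + 1))) \<and>
     (\<forall>i. dif K (i + 1) \<cdot>\<^bsub>C\<^esub> dif K i = Zro C (obj K i) (obj K (i + 2)))"

definition is_chain_map ::
  "('o, 'm, 'e) cat_scheme \<Rightarrow> ('o, 'm) cpx \<Rightarrow> ('o, 'm) cpx \<Rightarrow> (int \<Rightarrow> 'm) \<Rightarrow> bool" where
  "is_chain_map C K L f \<longleftrightarrow>
     (\<forall>i. f i \<in> Homs C (obj K i) (obj L i)) \<and>
     (\<forall>i. f (i + 1) \<cdot>\<^bsub>C\<^esub> dif K i = dif L i \<cdot>\<^bsub>C\<^esub> f i)"

definition chain_homotopic ::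
  "('o, 'm, 'e) cat_scheme \<Rightarrow> ('o, 'm) cpx \<Rightarrow> ('o, 'm) cpx \<Rightarrow> (int \<Rightarrow> 'm) \<Rightarrow> (int \<Rightarrow> 'm) \<Rightarrow> bool"
  where
  "chain_homotopic C K L f g \<longleftrightarrow>
     (\<exists>h. (\<forall>i. h i \<in> Homs C (obj K i) (obj L (i - 1))) \<and>
          (\<forall>i. f i = g i \<boxplus>\<^bsub>C\<^esub> (dif L (i - 1) \<cdot>\<^bsub>C\<^esub> h i \<boxplus>\<^bsub>C\<^esub> h (i + 1) \<cdot>\<^bsub>C\<^esub> dif K i)))"

definition homotopy_equivalent ::
  "('o, 'm, 'e) cat_scheme \<Rightarrow> ('o, 'm) cpx \<Rightarrow> ('o, 'm) cpx \<Rightarrow> bool" where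
  "homotopy_equivalent C K L \<longleftrightarrow> is_complex C K \<and> is_complex C L \<and>
     (\<exists>f g. is_chain_map C K L f \<and> is_chain_map C L K g \<and>
        chain_homotopic C K K (\<lambda>i. g i \<cdot>\<^bsub>C\<^esub> f i) (\<lambda>i. Idn C (obj K i)) \<and>
        chain_homotopic C L L (\<lambda>i. f i \<cdot>\<^bsub>C\<^esub> g i) (\<lambda>i. Idn C (obj L i)))"

definition map_cpx :: "('o, 'm, 'p, 'q) fnctr \<Rightarrow> ('o, 'm) cpx \<Rightarrow> ('p, 'q) cpx" where
  "map_cpx F K = \<lparr>obj = (\<lambda>i. FOb F (obj K i)), dif = (\<lambda>i. FAr F (dif K i))\<rparr>"

text \<open>\<open>H\<close> is the zeroth cohomology: the cokernel of the map from \<open>K\<^sup>-\<^sup>1\<close> to the zero-cocycles.\<close>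

definition is_cohomology0 :: "('o, 'm, 'e) cat_scheme \<Rightarrow> ('o, 'm) cpx \<Rightarrow> 'o \<Rightarrow> bool" where
  "is_cohomology0 A K H \<longleftrightarrow>
     (\<exists>k e c. is_kernel A (dif K 0) k \<and>
        e \<in> Homs A (obj K (- 1)) (Dom A k) \<and> k \<cdot>\<^bsub>A\<^esub> e = dif K (- 1) \<and>
        is_cokernel A e c \<and> Cod A c = H)"


section \<open>Triangulated categories\<close>

text \<open>
  The shift \<open>[1]\<close> is an automorphism, encoded by its action of the integers: \<open>ShO C i X\<close> is
  \<open>X[i]\<close> and \<open>ShA C i f\<close> is \<open>f[i]\<close>. A triangle \<open>X \<rightarrow> Y \<rightarrow> Z \<rightarrow> X[1]\<close> is given by its three arrows.
\<close>

record ('o, 'm) tricat = "('o, 'm) cat" +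
  ShO :: "int \<Rightarrow> 'o \<Rightarrow> 'o"
  ShA :: "int \<Rightarrow> 'm \<Rightarrow> 'm"
  dist_tri :: "'m \<Rightarrow> 'm \<Rightarrow> 'm \<Rightarrow> bool"

locale triangulated_category = additive_category C
  for C :: "('o, 'm, 'e) tricat_scheme" (structure) +
  assumes ShO_in: "X \<in> Ob C \<Longrightarrow> ShO C i X \<in> Ob C"
    and ShA_in: "f \<in> Homs C X Y \<Longrightarrow> ShA C i f \<in> Homs C (ShO C i X) (ShO C i Y)"
    and ShA_Idn: "X \<in> Ob C \<Longrightarrow> ShA C i (Idn C X) = Idn C (ShO C i X)"
    and ShA_Cmp: "f \<in> Homs C X Y \<Longrightarrow> g \<in> Homs C Y Z
      \<Longrightarrow> ShA C i (g \<cdot> f) = ShA C i g \<cdot> ShA C i f"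
    and ShA_Pls: "f \<in> Homs C X Y \<Longrightarrow> g \<in> Homs C X Y
      \<Longrightarrow> ShA C i (f \<boxplus> g) = ShA C i f \<boxplus> ShA C i g"
    and ShO_0: "X \<in> Ob C \<Longrightarrow> ShO C 0 X = X"
    and ShA_0: "f \<in> Ar C \<Longrightarrow> ShA C 0 f = f"
    and ShO_add: "X \<in> Ob C \<Longrightarrow> ShO C (i + j) X = ShO C i (ShO C j X)"
    and ShA_add: "f \<in> Ar C \<Longrightarrow> ShA C (i + j) f = ShA C i (ShA C j f)"
    and tri_in: "dist_tri C f g h \<Longrightarrow> f \<in> Ar C \<and> g \<in> Homs C (Cod C f) (Cod C g) \<and>
      h \<in> Homs C (Cod C g) (ShO C 1 (Dom C f))"
    and TR1_iso: "dist_tri C f g h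
      \<Longrightarrow> a \<in> Homs C (Dom C f) X \<Longrightarrow> b \<in> Homs C (Cod C f) Y \<Longrightarrow> c \<in> Homs C (Cod C g) Z
      \<Longrightarrow> is_iso_arrow C a \<Longrightarrow> is_iso_arrow C b \<Longrightarrow> is_iso_arrow C c
      \<Longrightarrow> f' \<in> Homs C X Y \<Longrightarrow> g' \<in> Homs C Y Z \<Longrightarrow> h' \<in> Homs C Z (ShO C 1 X)
      \<Longrightarrow> f' \<cdot> a = b \<cdot> f \<Longrightarrow> g' \<cdot> b = c \<cdot> g \<Longrightarrow> h' \<cdot> c = ShA C 1 a \<cdot> h
      \<Longrightarrow> dist_tri C f' g' h'"
    and TR1_id: "X \<in> Ob C \<Longrightarrow> is_zero_object C Z
      \<Longrightarrow> dist_tri C (Idn C X) (Zro C X Z) (Zro C Z (ShO C 1 X))"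
    and TR1_cone: "f \<in> Ar C \<Longrightarrow> \<exists>g h. dist_tri C f g h"
    and TR2: "f \<in> Homs C X Y \<Longrightarrow> g \<in> Homs C Y Z \<Longrightarrow> h \<in> Homs C Z (ShO C 1 X)
      \<Longrightarrow> dist_tri C f g h \<longleftrightarrow> dist_tri C g h (neg_arrow C (ShA C 1 f))"
    and TR3: "dist_tri C f g h \<Longrightarrow> dist_tri C f' g' h'
      \<Longrightarrow> a \<in> Homs C (Dom C f) (Dom C f') \<Longrightarrow> b \<in> Homs C (Cod C f) (Cod C f')
      \<Longrightarrow> b \<cdot> f = f' \<cdot> a
      \<Longrightarrow> \<exists>c \<in> Homs C (Cod C g) (Cod C g'). c \<cdot> g = g' \<cdot> b \<and> h' \<cdot> c = ShA C 1 a \<cdot> h"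
    and TR4: "u \<in> Homs C X Y \<Longrightarrow> v \<in> Homs C Y Z
      \<Longrightarrow> dist_tri C u a a' \<Longrightarrow> dist_tri C v b b' \<Longrightarrow> dist_tri C (v \<cdot> u) c c'
      \<Longrightarrow> \<exists>m \<in> Homs C (Cod C a) (Cod C c). \<exists>n \<in> Homs C (Cod C c) (Cod C b).
            dist_tri C m n (ShA C 1 a \<cdot> b') \<and>
            m \<cdot> a = c \<cdot> v \<and> c' \<cdot> m = a' \<and> n \<cdot> c = b \<and> b' \<cdot> n = ShA C 1 u \<cdot> c'"

definition is_cone :: "('o, 'm, 'e) tricat_scheme \<Rightarrow> 'm \<Rightarrow> 'o \<Rightarrow> bool" where
  "is_cone C f Z \<longleftrightarrow> (\<exists>g h. dist_tri C f g h \<and> Cod C g = Z)"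

definition full_tri :: "('o, 'm) tricat \<Rightarrow> 'o set \<Rightarrow> ('o, 'm) tricat" where
  "full_tri C S = C\<lparr>Ob := S, Ar := {f \<in> Ar C. Dom C f \<in> S \<and> Cod C f \<in> S},
     dist_tri := (\<lambda>f g h. dist_tri C f g h \<and> Dom C f \<in> S \<and> Cod C f \<in> S \<and> Cod C g \<in> S)\<rparr>"

text \<open>
  A full triangulated subcategory need not be closed under isomorphism; it is required to be a
  triangulated category for the restricted shift and the distinguished triangles with vertices in it.
\<close>

definition full_triangulated_subcategory :: "('o, 'm) tricat \<Rightarrow> 'o set \<Rightarrow> bool" where
  "full_triangulated_subcategory C S \<longleftrightarrow> S \<subseteq> Ob C \<and> triangulated_category (full_tri C S)"

definition strictly_full_triangulated_subcategory :: "('o, 'm) tricat \<Rightarrow> 'o set \<Rightarrow> bool" where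
  "strictly_full_triangulated_subcategory C S \<longleftrightarrow> full_triangulated_subcategory C S \<and>
     (\<forall>X \<in> S. \<forall>Y \<in> Ob C. isomorphic C X Y \<longrightarrow> Y \<in> S)"

definition strongly_generates :: "('o, 'm) tricat \<Rightarrow> 'o set \<Rightarrow> bool" where
  "strongly_generates C B \<longleftrightarrow>
     Ob C = \<Inter>{S. strictly_full_triangulated_subcategory C S \<and> B \<subseteq> S}"

text \<open>An exact functor commutes with \<open>[1]\<close> up to a natural isomorphism \<open>\<theta>\<close>.\<close>

definition exact_functor ::
  "('o, 'm) tricat \<Rightarrow> ('p, 'q) tricat \<Rightarrow> ('o, 'm, 'p, 'q) fnctr \<Rightarrow> bool" where
  "exact_functor C D G \<longleftrightarrow> additive_functor C D G \<and>
     (\<exists>\<theta>. (\<forall>X \<in> Ob C. \<theta> X \<in> Homs D (FOb G (ShO C 1 X)) (ShO D 1 (FOb G X)) \<and>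
                      is_iso_arrow D (\<theta> X)) \<and>
          (\<forall>X Y. \<forall>f \<in> Homs C X Y. \<theta> Y \<cdot>\<^bsub>D\<^esub> FAr G (ShA C 1 f) = ShA D 1 (FAr G f) \<cdot>\<^bsub>D\<^esub> \<theta> X) \<and>
          (\<forall>f g h. dist_tri C f g h \<longrightarrow>
             dist_tri D (FAr G f) (FAr G g) (\<theta> (Dom C f) \<cdot>\<^bsub>D\<^esub> FAr G h)))"


section \<open>Weight structures and weight complexes\<close>

record 'o wstr =
  w_le0 :: "'o set"
  w_ge0 :: "'o set"

definition w_le :: "('o, 'm) tricat \<Rightarrow> 'o wstr \<Rightarrow> int \<Rightarrow> 'o set" where
  "w_le C w i = ShO C i ` w_le0 w"

definition w_ge :: "('o, 'm) tricat \<Rightarrow> 'o wstr \<Rightarrow> int \<Rightarrow> 'o set" where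
  "w_ge C w i = ShO C i ` w_ge0 w"

definition w_eq :: "('o, 'm) tricat \<Rightarrow> 'o wstr \<Rightarrow> int \<Rightarrow> 'o set" where
  "w_eq C w i = w_le C w i \<inter> w_ge C w i"

definition heart :: "('o, 'm) tricat \<Rightarrow> 'o wstr \<Rightarrow> ('o, 'm) cat" where
  "heart C w = full_sub C (w_eq C w 0)"

definition retract_closed :: "('o, 'm, 'e) cat_scheme \<Rightarrow> 'o set \<Rightarrow> bool" where
  "retract_closed C S \<longleftrightarrow>
     (\<forall>X \<in> S. \<forall>Y \<in> Ob C.
        (\<exists>i \<in> Homs C Y X. \<exists>r \<in> Homs C X Y. r \<cdot>\<^bsub>C\<^esub> i = Idn C Y) \<longrightarrow> Y \<in> S)"

locale weight_structure = triangulated_category C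
  for C :: "('o, 'm) tricat" (structure) and w :: "'o wstr" +
  assumes le0_sub: "w_le0 w \<subseteq> Ob C"
    and ge0_sub: "w_ge0 w \<subseteq> Ob C"
    and le0_retract: "retract_closed C (w_le0 w)"
    and ge0_retract: "retract_closed C (w_ge0 w)"
    and le0_shift: "w_le0 w \<subseteq> w_le C w 1"
    and ge0_shift: "w_ge C w 1 \<subseteq> w_ge0 w"
    and orthogonality: "X \<in> w_le0 w \<Longrightarrow> Y \<in> w_ge C w 1 \<Longrightarrow> Homs C X Y = {Zro C X Y}"
    and decomposition: "M \<in> Ob C \<Longrightarrow>
      \<exists>f g h. dist_tri C f g h \<and> Dom C f \<in> w_le0 w \<and> Cod C f = M \<and> Cod C g \<in> w_ge C w 1"

definition bounded_weight_structure :: "('o, 'm) tricat \<Rightarrow> 'o wstr \<Rightarrow> bool" where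
  "bounded_weight_structure C w \<longleftrightarrow> (\<Union>i. w_le C w i) = Ob C \<and> (\<Union>i. w_ge C w i) = Ob C"

definition weight_exact_functor ::
  "('o, 'm) tricat \<Rightarrow> 'o wstr \<Rightarrow> ('p, 'q) tricat \<Rightarrow> 'p wstr \<Rightarrow> ('o, 'm, 'p, 'q) fnctr \<Rightarrow> bool" where
  "weight_exact_functor C w D v G \<longleftrightarrow> exact_functor C D G \<and>
     FOb G ` w_le0 w \<subseteq> w_le0 v \<and> FOb G ` w_ge0 w \<subseteq> w_ge0 v"

text \<open>
  \<open>is_weight_complex C w M K\<close>: the complex \<open>K\<close> arises as \<open>t(M)\<close> from some choice of
  weight decompositions \<open>w\<^bsub>\<le>n\<^esub>M \<rightarrow> M \<rightarrow> w\<^bsub>\<ge>n+1\<^esub>M \<rightarrow> (w\<^bsub>\<le>n\<^esub>M)[1]\<close> with arrows \<open>a n, b n, e n\<close>,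
  connecting arrows \<open>c n\<close> from \<open>w\<^bsub>\<le>n-1\<^esub>M\<close> to \<open>w\<^bsub>\<le>n\<^esub>M\<close> and their cones, the
  latter given by the distinguished triangles with arrows \<open>c n, p n, q n\<close>.
  The differential \<open>dif K (- n)\<close> is the composition
  \<open>Cone(c n)[-n] \<rightarrow> (w\<^bsub>\<le>n-1\<^esub>M)[1-n] \<rightarrow> Cone(c (n-1))[1-n]\<close>.
\<close>

definition is_weight_complex ::
  "('o, 'm) tricat \<Rightarrow> 'o wstr \<Rightarrow> 'o \<Rightarrow> ('o, 'm) cpx \<Rightarrow> bool" where
  "is_weight_complex C w M K \<longleftrightarrow>
     (\<exists>a b e c p q :: int \<Rightarrow> 'm. \<forall>n.
        dist_tri C (a n) (b n) (e n) \<and>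
        Dom C (a n) \<in> w_le C w n \<and> Cod C (a n) = M \<and> Cod C (b n) \<in> w_ge C w (n + 1) \<and>
        c n \<in> Homs C (Dom C (a (n - 1))) (Dom C (a n)) \<and> a n \<cdot>\<^bsub>C\<^esub> c n = a (n - 1) \<and>
        dist_tri C (c n) (p n) (q n) \<and>
        obj K (- n) = ShO C (- n) (Cod C (p n)) \<and>
        dif K (- n) = ShA C (1 - n) (p (n - 1)) \<cdot>\<^bsub>C\<^esub> ShA C (- n) (q n))"

text \<open>\<open>L\<close> is a complex over the full subcategory \<open>B\<close> of the heart that is homotopy equivalent to
  \<open>t(M)\<close>.\<close>

definition represents_t ::
  "('o, 'm) tricat \<Rightarrow> 'o wstr \<Rightarrow> 'o set \<Rightarrow> 'o \<Rightarrow> ('o, 'm) cpx \<Rightarrow> bool" where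
  "represents_t C w B M L \<longleftrightarrow> is_complex (full_sub C B) L \<and>
     (\<exists>K. is_weight_complex C w M K \<and> homotopy_equivalent (heart C w) K L)"

definition almost_all_zero :: "('p, 'q, 'f) cat_scheme \<Rightarrow> ('p, 'q) cpx \<Rightarrow> bool" where
  "almost_all_zero A K \<longleftrightarrow> finite {i. \<not> is_zero_object A (obj K i)}"

definition is_HF ::
  "('o, 'm) tricat \<Rightarrow> 'o wstr \<Rightarrow> 'o set \<Rightarrow> ('p, 'q) cat \<Rightarrow> ('o, 'm, 'p, 'q) fnctr
     \<Rightarrow> 'o \<Rightarrow> 'p \<Rightarrow> bool" where
  "is_HF C w B A F M H \<longleftrightarrow>
     (\<exists>L. represents_t C w B M L \<and> is_cohomology0 A (map_cpx F L) H)"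

text \<open>\<open>HF C w B A F i M\<close> is (a representative of the isomorphism class of) \<open>H\<^sup>F\<^sub>i(M) = H\<^sup>F(M[-i])\<close>.\<close>

definition HF ::
  "('o, 'm) tricat \<Rightarrow> 'o wstr \<Rightarrow> 'o set \<Rightarrow> ('p, 'q) cat \<Rightarrow> ('o, 'm, 'p, 'q) fnctr
     \<Rightarrow> int \<Rightarrow> 'o \<Rightarrow> 'p" where
  "HF C w B A F i M = (SOME H. is_HF C w B A F (ShO C (- i) M) H)"


section \<open>Grothendieck groups\<close>

text \<open>
  The free abelian group on isomorphism classes of objects modulo the subgroup generated by
  \<open>[Y] - [X] - [Z]\<close> for \<open>(X, Y, Z)\<close> in \<open>R\<close>. Quotients are written multiplicatively.
\<close>

definition free_on_classes :: "('o, 'm, 'e) cat_scheme \<Rightarrow> ('o set \<Rightarrow>\<^sub>0 int) monoid" where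
  "free_on_classes C = free_Abelian_group (iso_class C ` Ob C)"

definition K0_relations ::
  "('o, 'm, 'e) cat_scheme \<Rightarrow> ('o \<times> 'o \<times> 'o) set \<Rightarrow> ('o set \<Rightarrow>\<^sub>0 int) set" where
  "K0_relations C R = generate (free_on_classes C)
     {frag_of (iso_class C Y) - frag_of (iso_class C X) - frag_of (iso_class C Z) | X Y Z.
        (X, Y, Z) \<in> R}"

definition K0_group ::
  "('o, 'm, 'e) cat_scheme \<Rightarrow> ('o \<times> 'o \<times> 'o) set \<Rightarrow> ('o set \<Rightarrow>\<^sub>0 int) set monoid" where
  "K0_group C R = free_on_classes C Mod K0_relations C R"

definition K0_class ::
  "('o, 'm, 'e) cat_scheme \<Rightarrow> ('o \<times> 'o \<times> 'o) set \<Rightarrow> 'o \<Rightarrow> ('o set \<Rightarrow>\<^sub>0 int) set" where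
  "K0_class C R X = K0_relations C R #>\<^bsub>free_on_classes C\<^esub> frag_of (iso_class C X)"

definition split_triples :: "('o, 'm, 'e) cat_scheme \<Rightarrow> ('o \<times> 'o \<times> 'o) set" where
  "split_triples A = {(X, Y, Z). is_biproduct A X Z Y}"

definition triangle_triples :: "('o, 'm, 'e) tricat_scheme \<Rightarrow> ('o \<times> 'o \<times> 'o) set" where
  "triangle_triples C = {(Dom C f, Cod C f, Cod C g) | f g h. dist_tri C f g h}"

definition K0_add :: "('o, 'm, 'e) cat_scheme \<Rightarrow> ('o set \<Rightarrow>\<^sub>0 int) set monoid" where
  "K0_add A = K0_group A (split_triples A)"

definition K0_add_class :: "('o, 'm, 'e) cat_scheme \<Rightarrow> 'o \<Rightarrow> ('o set \<Rightarrow>\<^sub>0 int) set" where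
  "K0_add_class A X = K0_class A (split_triples A) X"

definition K0_tr :: "('o, 'm, 'e) tricat_scheme \<Rightarrow> ('o set \<Rightarrow>\<^sub>0 int) set monoid" where
  "K0_tr C = K0_group C (triangle_triples C)"

definition K0_tr_class :: "('o, 'm, 'e) tricat_scheme \<Rightarrow> 'o \<Rightarrow> ('o set \<Rightarrow>\<^sub>0 int) set" where
  "K0_tr_class C X = K0_class C (triangle_triples C) X"

text \<open>\<open>signed_class A j X\<close> is \<open>(-1)\<^sup>j[X]\<close> and \<open>euler_class A X\<close> is the sum of \<open>(-1)\<^sup>i[X\<^sup>i]\<close> over all
  integers \<open>i\<close>, in the multiplicatively written group; \<open>gfinprod\<close> is the product of a family
  with finite support.\<close>

definition signed_class ::
  "('o, 'm, 'e) cat_scheme \<Rightarrow> int \<Rightarrow> 'o \<Rightarrow> ('o set \<Rightarrow>\<^sub>0 int) set" where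
  "signed_class A j X = K0_add_class A X [^]\<^bsub>K0_add A\<^esub> (if even j then 1 else - 1 :: int)"

definition euler_class ::
  "('o, 'm, 'e) cat_scheme \<Rightarrow> (int \<Rightarrow> 'o) \<Rightarrow> ('o set \<Rightarrow>\<^sub>0 int) set" where
  "euler_class A X = gfinprod (K0_add A) (\<lambda>i. signed_class A i (X i)) UNIV"


section \<open>The homomorphism induced by an additive functor on a subcategory of the heart\<close>

definition has_F_finite_complexes ::
  "('o, 'm) tricat \<Rightarrow> 'o wstr \<Rightarrow> 'o set \<Rightarrow> 'o set \<Rightarrow> ('p, 'q) cat \<Rightarrow> ('o, 'm, 'p, 'q) fnctr
     \<Rightarrow> bool" where
  "has_F_finite_complexes C w C' B A F \<longleftrightarrow>
     (\<forall>M \<in> C'. \<exists>L. represents_t C w B M L \<and> almost_all_zero A (map_cpx F L))"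

text \<open>
  The value at \<open>[M]\<close> is prescribed for \<^emph>\<open>every\<close> object \<open>M\<close> and every admissible complex \<open>L\<close>.
  Homomorphisms are taken to be extensional, so that existence of exactly one \<open>\<phi>\<close> is meaningful.
\<close>

definition is_FK0 ::
  "('o, 'm) tricat \<Rightarrow> 'o wstr \<Rightarrow> 'o set \<Rightarrow> 'o set \<Rightarrow> ('p, 'q) cat \<Rightarrow> ('o, 'm, 'p, 'q) fnctr
     \<Rightarrow> (('o set \<Rightarrow>\<^sub>0 int) set \<Rightarrow> ('p set \<Rightarrow>\<^sub>0 int) set) \<Rightarrow> bool" where
  "is_FK0 C w C' B A F \<phi> \<longleftrightarrow>
     \<phi> \<in> hom (K0_tr (full_tri C C')) (K0_add A) \<and>
     \<phi> \<in> extensional (carrier (K0_tr (full_tri C C'))) \<and>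
     (\<forall>M \<in> C'. \<forall>L. represents_t C w B M L \<and> almost_all_zero A (map_cpx F L) \<longrightarrow>
        \<phi> (K0_tr_class (full_tri C C') M) = euler_class A (obj (map_cpx F L)))"

definition FK0 ::
  "('o, 'm) tricat \<Rightarrow> 'o wstr \<Rightarrow> 'o set \<Rightarrow> 'o set \<Rightarrow> ('p, 'q) cat \<Rightarrow> ('o, 'm, 'p, 'q) fnctr
     \<Rightarrow> ('o set \<Rightarrow>\<^sub>0 int) set \<Rightarrow> ('p set \<Rightarrow>\<^sub>0 int) set" where
  "FK0 C w C' B A F = (THE \<phi>. is_FK0 C w C' B A F \<phi>)"

end

theory Submission
  imports Defs
begin

text \<open>
  A distinguished triangle \<open>X \<rightarrow> Y \<rightarrow> Z\<close> admits weight complexes with \<open>t(Y)\<close> a termwise split extension of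
  \<open>t(Z)\<close> by \<open>t(X)\<close>: starting from compatible decompositions at level 0, one builds those of \<open>Y\<close> downwards on
  the truncations \<open>w\<^bsub>\<le>n\<^esub>\<close> and upwards on the \<open>w\<^bsub>\<ge>n\<^esub>\<close>, since orthogonality lets the heart-valued cones be split.
  Replacing the outer terms by homotopy equivalent complexes over \<open>B\<close> perturbs the extension within its homotopy
  type, and a bounded contractible complex has Euler class zero; so the Euler class of \<open>F(t(M))\<close> is a well-defined
  additive invariant. Parts I.2 and I.3 are then computations of cohomology, part II.1 holds because \<open>[X] \<mapsto> [X]\<close> is
  an inverse on a strongly generating \<open>B\<close>, and for II.2 the image of \<open>t(N)\<close> under \<open>G\<close> is a weight complex of
  \<open>G(N)\<close>, hence homotopy equivalent to one concentrated in degree \<open>-j\<close>.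
\<close>

section \<open>Calculus in preadditive categories\<close>

text \<open>Two obstacles shape the argument. A morphism of \<open>C\<close> determines a map of
  weight complexes only up to \<open>d h + j d\<close> with \<open>h\<close> and \<open>j\<close>
  unrelated, so neither uniqueness of t(M) nor its behaviour on triangles can be read off from
  functoriality. Uniqueness is rescued because an endomorphism of the shape
  \<open>1 + d h + j d\<close> is still invertible up to homotopy; for a triangle, the
  decompositions of the middle object are built so that its complex is an extension on the nose. The
  second obstacle is that \<open>A\<close> is only additive: idempotents need not split, so a
  bounded contractible complex cannot be cut along its kernels. Instead its top term is moved two
  degrees down, which keeps the parity and shortens the complex. Finally, the complexes over
  \<open>B\<close> may be unbounded and only their images under \<open>F\<close> are bounded; hence
  homotopies are produced over \<open>B\<close>, transported by \<open>F\<close>, and Euler classes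
  are compared only in \<open>A\<close>.\<close>

lemma HomsI: "f \<in> Ar C \<Longrightarrow> Dom C f = X \<Longrightarrow> Cod C f = Y \<Longrightarrow> f \<in> Homs C X Y"
  by (simp add: Homs_def)

lemma HomsD:
  assumes "f \<in> Homs C X Y"
  shows "f \<in> Ar C" "Dom C f = X" "Cod C f = Y"
  using assms by (simp_all add: Homs_def)

context preadditive_category
begin

lemma Homs_Ob:
  assumes "f \<in> Homs C X Y"
  shows "X \<in> Ob C" "Y \<in> Ob C"
  using assms Dom_in Cod_in by (auto simp: Homs_def)

lemma hom_group_simps [simp]:
  "carrier (hom_group C X Y) = Homs C X Y"
  "monoid.mult (hom_group C X Y) = Pls C"
  "one (hom_group C X Y) = Zro C X Y"
  by (simp_all add: hom_group_def)

lemma Cmp_arr: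
  assumes "f \<in> Ar C" "g \<in> Ar C" "Cod C f = Dom C g"
  shows "g \<cdot> f \<in> Ar C" "Dom C (g \<cdot> f) = Dom C f" "Cod C (g \<cdot> f) = Cod C g"
  using Cmp_in[of f "Dom C f" "Cod C f" g "Cod C g"] assms by (simp_all add: Homs_def)

lemma Cmp_assoc':
  assumes "f \<in> Ar C" "g \<in> Ar C" "h \<in> Ar C" "Cod C f = Dom C g" "Cod C g = Dom C h"
  shows "(h \<cdot> g) \<cdot> f = h \<cdot> (g \<cdot> f)"
  using Cmp_assoc[of f "Dom C f" "Cod C f" g "Cod C g" h "Cod C h"] assms by (simp add: Homs_def)

lemma Idn_arr:
  assumes "X \<in> Ob C"
  shows "Idn C X \<in> Ar C" "Dom C (Idn C X) = X" "Cod C (Idn C X) = X"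
  using Idn_in[OF assms] by (simp_all add: Homs_def)

lemma Idn_left': "f \<in> Ar C \<Longrightarrow> Cod C f = Y \<Longrightarrow> Idn C Y \<cdot> f = f"
  using Idn_left[of f "Dom C f" Y] by (simp add: Homs_def)

lemma Idn_right': "f \<in> Ar C \<Longrightarrow> Dom C f = X \<Longrightarrow> f \<cdot> Idn C X = f"
  using Idn_right[of f X "Cod C f"] by (simp add: Homs_def)

lemma Zro_in: "X \<in> Ob C \<Longrightarrow> Y \<in> Ob C \<Longrightarrow> Zro C X Y \<in> Homs C X Y"
  using group.is_monoid[OF comm_group.axioms(2)[OF hom_comm_group[of X Y]]]
  by (metis hom_group_simps(1,3) monoid.one_closed)

lemma Zro_arr:
  assumes "X \<in> Ob C" "Y \<in> Ob C"
  shows "Zro C X Y \<in> Ar C" "Dom C (Zro C X Y) = X" "Cod C (Zro C X Y) = Y"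
  using Zro_in[OF assms] by (simp_all add: Homs_def)

lemma Pls_in: "f \<in> Homs C X Y \<Longrightarrow> g \<in> Homs C X Y \<Longrightarrow> f \<boxplus> g \<in> Homs C X Y"
  using monoid.m_closed[OF group.is_monoid[OF comm_group.axioms(2)[OF hom_comm_group[of X Y]]], of f g]
    Homs_Ob[of f X Y]
  by simp

lemma neg_arrow_in: "f \<in> Homs C X Y \<Longrightarrow> neg_arrow C f \<in> Homs C X Y"
  using group.inv_closed[OF comm_group.axioms(2)[OF hom_comm_group[of X Y]], of f] Homs_Ob[of f X Y]
  by (simp add: neg_arrow_def HomsD)

lemma Pls_arr:
  assumes "f \<in> Ar C" "g \<in> Ar C" "Dom C f = Dom C g" "Cod C f = Cod C g"
  shows "f \<boxplus> g \<in> Ar C" "Dom C (f \<boxplus> g) = Dom C f" "Cod C (f \<boxplus> g) = Cod C f"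
  using Pls_in[of f "Dom C f" "Cod C f" g] assms by (simp_all add: Homs_def)

lemma neg_arr:
  assumes "f \<in> Ar C"
  shows "neg_arrow C f \<in> Ar C" "Dom C (neg_arrow C f) = Dom C f" "Cod C (neg_arrow C f) = Cod C f"
  using neg_arrow_in[of f "Dom C f" "Cod C f"] assms by (simp_all add: Homs_def)

lemma Pls_Zro:
  assumes "f \<in> Homs C X Y"
  shows "f \<boxplus> Zro C X Y = f" "Zro C X Y \<boxplus> f = f"
  using assms group.is_monoid[OF comm_group.axioms(2)[OF hom_comm_group[of X Y]]] Homs_Ob[OF assms]
    monoid.r_one[of "hom_group C X Y" f] monoid.l_one[of "hom_group C X Y" f]
  by simp_all

lemma Pls_neg:
  assumes "f \<in> Homs C X Y"
  shows "f \<boxplus> neg_arrow C f = Zro C X Y" "neg_arrow C f \<boxplus> f = Zro C X Y"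
  using assms comm_group.axioms(2)[OF hom_comm_group[of X Y]] Homs_Ob[OF assms]
    group.r_inv[of "hom_group C X Y" f] group.l_inv[of "hom_group C X Y" f]
  by (simp_all add: neg_arrow_def HomsD)

lemma Pls_assoc:
  assumes "f \<in> Homs C X Y" "g \<in> Homs C X Y" "h \<in> Homs C X Y"
  shows "(f \<boxplus> g) \<boxplus> h = f \<boxplus> (g \<boxplus> h)"
  using assms group.is_monoid[OF comm_group.axioms(2)[OF hom_comm_group[of X Y]]] Homs_Ob[OF assms(1)]
    monoid.m_assoc[of "hom_group C X Y" f g h]
  by simp

lemma Pls_comm:
  assumes "f \<in> Homs C X Y" "g \<in> Homs C X Y"
  shows "f \<boxplus> g = g \<boxplus> f"
  using assms comm_group.axioms(1)[OF hom_comm_group[of X Y]] Homs_Ob[OF assms(1)]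
    comm_monoid.m_comm[of "hom_group C X Y" f g]
  by simp

lemma Pls_left_cancel:
  assumes "f \<in> Homs C X Y" "g \<in> Homs C X Y" "h \<in> Homs C X Y" "f \<boxplus> g = f \<boxplus> h"
  shows "g = h"
  using assms comm_group.axioms(2)[OF hom_comm_group[of X Y]] Homs_Ob[OF assms(1)]
    group.is_monoid[of "hom_group C X Y"]
    group.Units_eq[of "hom_group C X Y"] monoid.Units_l_cancel[of "hom_group C X Y" f g h]
  by simp

lemma Pls_self_zero: "f \<in> Homs C X Y \<Longrightarrow> f \<boxplus> f = f \<Longrightarrow> f = Zro C X Y"
  by (metis Homs_Ob Pls_Zro(1) Pls_left_cancel Zro_in)

lemma Cmp_Zro:
  assumes "f \<in> Homs C X Y" "Z \<in> Ob C"
  shows "f \<cdot> Zro C Z X = Zro C Z Y" "Zro C Y Z \<cdot> f = Zro C X Z"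
proof -
  have z: "Zro C Z X \<in> Homs C Z X" "Zro C Y Z \<in> Homs C Y Z"
    using assms Zro_in Homs_Ob[OF assms(1)] by auto
  have "f \<cdot> Zro C Z X \<boxplus> f \<cdot> Zro C Z X = f \<cdot> Zro C Z X"
    using Cmp_Pls_right[OF z(1) z(1) assms(1)] Pls_Zro(1)[OF z(1)] by simp
  then show "f \<cdot> Zro C Z X = Zro C Z Y"
    using Pls_self_zero Cmp_in[OF z(1) assms(1)] by blast
  have "Zro C Y Z \<cdot> f \<boxplus> Zro C Y Z \<cdot> f = Zro C Y Z \<cdot> f"
    using Cmp_Pls_left[OF assms(1) z(2) z(2)] Pls_Zro(1)[OF z(2)] by simp
  then show "Zro C Y Z \<cdot> f = Zro C X Z"
    using Pls_self_zero Cmp_in[OF assms(1) z(2)] by blast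
qed

lemma neg_unique:
  assumes "f \<in> Homs C X Y" "g \<in> Homs C X Y" "f \<boxplus> g = Zro C X Y"
  shows "g = neg_arrow C f"
  by (rule Pls_left_cancel[OF assms(1,2) neg_arrow_in[OF assms(1)]]) (simp add: assms Pls_neg[OF assms(1)])

lemma Cmp_neg:
  assumes "f \<in> Homs C X Y" "g \<in> Homs C Y Z"
  shows "g \<cdot> neg_arrow C f = neg_arrow C (g \<cdot> f)" "neg_arrow C g \<cdot> f = neg_arrow C (g \<cdot> f)"
proof -
  note n = neg_arrow_in[OF assms(1)] neg_arrow_in[OF assms(2)]
  show "g \<cdot> neg_arrow C f = neg_arrow C (g \<cdot> f)"
    by (rule neg_unique[OF Cmp_in[OF assms] Cmp_in[OF n(1) assms(2)]])
      (simp add: Cmp_Pls_right[OF assms(1) n(1) assms(2), symmetric] Pls_neg[OF assms(1)]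
        Cmp_Zro[OF assms(2)] Homs_Ob[OF assms(1)])
  show "neg_arrow C g \<cdot> f = neg_arrow C (g \<cdot> f)"
    by (rule neg_unique[OF Cmp_in[OF assms] Cmp_in[OF assms(1) n(2)]])
      (simp add: Cmp_Pls_left[OF assms(1) assms(2) n(2), symmetric] Pls_neg[OF assms(2)]
        Cmp_Zro[OF assms(1)] Homs_Ob[OF assms(2)])
qed

lemma neg_neg: "f \<in> Ar C \<Longrightarrow> neg_arrow C (neg_arrow C f) = f"
  using neg_unique[of "neg_arrow C f" "Dom C f" "Cod C f" f] Pls_neg(2)[of f "Dom C f" "Cod C f"]
  by (simp add: Homs_def neg_arr)

lemma Cmp_neg':
  assumes "f \<in> Ar C" "g \<in> Ar C" "Cod C f = Dom C g"
  shows "g \<cdot> neg_arrow C f = neg_arrow C (g \<cdot> f)" "neg_arrow C g \<cdot> f = neg_arrow C (g \<cdot> f)"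
  using Cmp_neg[of f "Dom C f" "Cod C f" g "Cod C g"] assms by (simp_all add: Homs_def)

lemma Cmp_Zro':
  assumes "f \<in> Ar C" "Z \<in> Ob C"
  shows "Dom C f = X \<Longrightarrow> f \<cdot> Zro C Z X = Zro C Z (Cod C f)"
    "Cod C f = Y \<Longrightarrow> Zro C Y Z \<cdot> f = Zro C (Dom C f) Z"
  using Cmp_Zro[of f "Dom C f" "Cod C f" Z] assms by (auto simp add: Homs_def)

lemma Cmp_Pls':
  assumes "f \<in> Ar C" "g \<in> Ar C" "h \<in> Ar C" "Dom C f = Dom C g" "Cod C f = Cod C g"
  shows "Cod C f = Dom C h \<Longrightarrow> h \<cdot> (f \<boxplus> g) = h \<cdot> f \<boxplus> h \<cdot> g"
    "Cod C h = Dom C f \<Longrightarrow> (f \<boxplus> g) \<cdot> h = f \<cdot> h \<boxplus> g \<cdot> h"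
  using assms Cmp_Pls_right[of f "Dom C f" "Cod C f" g h "Cod C h"]
    Cmp_Pls_left[of h "Dom C h" "Dom C f" f "Cod C f" g]
  by (simp_all add: Homs_def)

lemma Pls_Zro':
  assumes "f \<in> Ar C" "Dom C f = X" "Cod C f = Y"
  shows "f \<boxplus> Zro C X Y = f" "Zro C X Y \<boxplus> f = f"
  using Pls_Zro[of f X Y] assms by (simp_all add: Homs_def)

lemma Dom_Ob: "f \<in> Ar C \<Longrightarrow> Dom C f \<in> Ob C" and Cod_Ob: "f \<in> Ar C \<Longrightarrow> Cod C f \<in> Ob C"
  using Dom_in Cod_in by auto

lemma neg_Zro: "X \<in> Ob C \<Longrightarrow> Y \<in> Ob C \<Longrightarrow> neg_arrow C (Zro C X Y) = Zro C X Y"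
  using neg_unique[of "Zro C X Y" X Y "Zro C X Y"] Zro_in[of X Y] Pls_Zro(1)[of "Zro C X Y" X Y] by simp

lemma neg_Pls:
  assumes "f \<in> Homs C X Y" "g \<in> Homs C X Y"
  shows "neg_arrow C (f \<boxplus> g) = neg_arrow C f \<boxplus> neg_arrow C g"
  using assms comm_group.inv_mult[OF hom_comm_group[of X Y], of f g] Homs_Ob[OF assms(1)] Pls_in[OF assms]
  by (simp add: neg_arrow_def HomsD)

lemma neg_Pls':
  assumes "f \<in> Ar C" "g \<in> Ar C" "Dom C f = Dom C g" "Cod C f = Cod C g"
  shows "neg_arrow C (f \<boxplus> g) = neg_arrow C f \<boxplus> neg_arrow C g"
  using neg_Pls[of f "Dom C f" "Cod C f" g] assms by (simp add: Homs_def)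

lemmas arr_simps = Homs_def Cmp_arr Idn_arr Zro_arr Pls_arr neg_arr Dom_Ob Cod_Ob
text \<open>The normal form is a sum of right-nested composites with signs pushed to the summands.
  The order and bracketing of sums are deliberately left alone; they are handled by formal
  combinations, see \<open>lin\<close> below.\<close>

lemmas cat_simps = arr_simps Cmp_assoc' Idn_left' Idn_right' Cmp_Zro' Pls_Zro' Cmp_neg' Cmp_Pls' neg_neg neg_Pls' neg_Zro

text \<open>\<open>lin X Y u f\<close> evaluates the formal integer combination \<open>u\<close> of arrows, so that identities
  between sums of parallel arrows reduce to identities in the type of formal combinations.\<close>

definition lin_eval :: "'o \<Rightarrow> 'o \<Rightarrow> ('m \<Rightarrow>\<^sub>0 int) \<Rightarrow> 'm" where
  "lin_eval X Y = (SOME h. h \<in> hom (free_Abelian_group (Homs C X Y)) (hom_group C X Y) \<and>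
     (\<forall>f \<in> Homs C X Y. h (frag_of f) = f))"

lemma lin_eval:
  assumes "X \<in> Ob C" "Y \<in> Ob C"
  shows "lin_eval X Y \<in> hom (free_Abelian_group (Homs C X Y)) (hom_group C X Y)"
    "f \<in> Homs C X Y \<Longrightarrow> lin_eval X Y (frag_of f) = f"
proof -
  interpret comm_group "hom_group C X Y" using hom_comm_group assms .
  have "\<exists>h. h \<in> hom (free_Abelian_group (Homs C X Y)) (hom_group C X Y) \<and>
     (\<forall>f \<in> Homs C X Y. h (frag_of f) = f)"
    using free_Abelian_group_universal[of "\<lambda>f. f" "Homs C X Y"]
    by (metis hom_group_simps(1) image_ident order_refl)
  from someI_ex[OF this] show "lin_eval X Y \<in> hom (free_Abelian_group (Homs C X Y)) (hom_group C X Y)"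
    "f \<in> Homs C X Y \<Longrightarrow> lin_eval X Y (frag_of f) = f"
    unfolding lin_eval_def by blast+
qed

definition lin :: "'o \<Rightarrow> 'o \<Rightarrow> ('m \<Rightarrow>\<^sub>0 int) \<Rightarrow> 'm \<Rightarrow> bool" where
  "lin X Y u f \<longleftrightarrow> X \<in> Ob C \<and> Y \<in> Ob C \<and> Poly_Mapping.keys u \<subseteq> Homs C X Y \<and> lin_eval X Y u = f"

lemma lin_Homs: "lin X Y u f \<Longrightarrow> f \<in> Homs C X Y"
  using hom_in_carrier[OF lin_eval(1)[of X Y], of u] by (auto simp: lin_def)

lemma lin_Pls: "lin X Y u f \<Longrightarrow> lin X Y v g \<Longrightarrow> lin X Y (u + v) (f \<boxplus> g)"
  using hom_mult[OF lin_eval(1)[of X Y], of u v] Poly_Mapping.keys_add[of u v] by (auto simp: lin_def)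

lemma lin_Zro: "X \<in> Ob C \<Longrightarrow> Y \<in> Ob C \<Longrightarrow> lin X Y 0 (Zro C X Y)"
  using hom_one[OF lin_eval(1)[of X Y]] hom_comm_group[of X Y]
  by (auto simp: lin_def comm_group.axioms(2))

lemma lin_neg: "lin X Y u f \<Longrightarrow> lin X Y (- u) (neg_arrow C f)"
  using lin_Pls[of X Y u f "-u"] lin_Homs[of X Y u f] lin_Zro[of X Y]
  by (auto simp: lin_def keys_minus intro!: neg_unique dest: lin_Homs)
    (metis (no_types, lifting) keys_minus lin_Homs lin_def)

lemma lin_atom: "f \<in> Homs C X Y \<Longrightarrow> lin X Y (frag_of f) f"
  using lin_eval(2)[of X Y f] Homs_Ob[of f X Y] by (auto simp: lin_def)

lemma lin_atom': "f \<in> Ar C \<Longrightarrow> Dom C f = X \<Longrightarrow> Cod C f = Y \<Longrightarrow> lin X Y (frag_of f) f"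
  using lin_atom[of f X Y] by (simp add: Homs_def)

lemma lin_eqI: "lin X Y u f \<Longrightarrow> lin X Y v g \<Longrightarrow> u = v \<Longrightarrow> f = g"
  by (auto simp: lin_def)

end

section \<open>Complexes up to homotopy\<close>

context preadditive_category
begin

lemma is_complexD:
  assumes "is_complex C K"
  shows "obj K i \<in> Ob C" "dif K i \<in> Ar C" "Dom C (dif K i) = obj K i" "Cod C (dif K i) = obj K (i + 1)"
  using assms unfolding is_complex_def Homs_def by auto

text \<open>The side condition \<open>j = i + 1\<close> lets the equation fire however the index is
  written, and the second form works below a trailing arrow, since composites are kept right-nested.
  The same pair of forms recurs for all such equations below.\<close>

lemma complex_dd:
  assumes "is_complex C K" "j = i + 1"
  shows "dif K j \<cdot> dif K i = Zro C (obj K i) (obj K (j + 1))"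
    "t \<in> Ar C \<Longrightarrow> Cod C t = obj K i \<Longrightarrow> dif K j \<cdot> (dif K i \<cdot> t) = Zro C (Dom C t) (obj K (j + 1))"
proof -
  have "dif K (i + 1) \<cdot> dif K i = Zro C (obj K i) (obj K (i + 2))"
    using assms(1) unfolding is_complex_def by blast
  moreover have "i + 2 = j + 1" using assms(2) by simp
  ultimately show 1: "dif K j \<cdot> dif K i = Zro C (obj K i) (obj K (j + 1))" using assms(2) by simp
  show "dif K j \<cdot> (dif K i \<cdot> t) = Zro C (Dom C t) (obj K (j + 1))"
    if "t \<in> Ar C" "Cod C t = obj K i"
  proof -
    have "dif K j \<cdot> (dif K i \<cdot> t) = (dif K j \<cdot> dif K i) \<cdot> t"
      using that is_complexD[OF assms(1)] assms(2) by (simp add: Cmp_assoc')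
    then show ?thesis using that is_complexD[OF assms(1)] by (simp add: 1 cat_simps)
  qed
qed

lemma chain_mapD:
  assumes "is_chain_map C K L f"
  shows "f i \<in> Ar C" "Dom C (f i) = obj K i" "Cod C (f i) = obj L i"
  using assms unfolding is_chain_map_def Homs_def by auto

lemma chain_map_dif:
  assumes "is_complex C K" "is_complex C L" "is_chain_map C K L f" "j = i + 1"
  shows "f j \<cdot> dif K i = dif L i \<cdot> f i"
    "t \<in> Ar C \<Longrightarrow> Cod C t = obj K i \<Longrightarrow> f j \<cdot> (dif K i \<cdot> t) = dif L i \<cdot> (f i \<cdot> t)"
proof -
  show 1: "f j \<cdot> dif K i = dif L i \<cdot> f i"
    using assms(3,4) unfolding is_chain_map_def by blast
  show "f j \<cdot> (dif K i \<cdot> t) = dif L i \<cdot> (f i \<cdot> t)" if "t \<in> Ar C" "Cod C t = obj K i"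
  proof -
    have "f j \<cdot> (dif K i \<cdot> t) = (f j \<cdot> dif K i) \<cdot> t"
      using that is_complexD[OF assms(1)] chain_mapD[OF assms(3)] assms(4) by (simp add: Cmp_assoc')
    also have "\<dots> = dif L i \<cdot> (f i \<cdot> t)"
      using that is_complexD[OF assms(2)] chain_mapD[OF assms(3)] by (simp add: 1 Cmp_assoc')
    finally show ?thesis .
  qed
qed

text \<open>Indexing the square by its target degree keeps all indices in the shape
  \<open>m - k\<close>, which simplifies better than iterated \<open>+ 1\<close>.\<close>

lemma chain_mapI:
  assumes "\<And>m. f m \<in> Homs C (obj K m) (obj L m)"
    and "\<And>m. f m \<cdot> dif K (m - 1) = dif L (m - 1) \<cdot> f (m - 1)"
  shows "is_chain_map C K L f"
proof -
  have "f (i + 1) \<cdot> dif K i = dif L i \<cdot> f i" for i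
    using assms(2)[of "i + 1"] by simp
  with assms(1) show ?thesis unfolding is_chain_map_def by blast
qed

lemma chain_map_comp:
  assumes "is_complex C K" "is_complex C L" "is_complex C M" "is_chain_map C K L f" "is_chain_map C L M g"
  shows "is_chain_map C K M (\<lambda>i. g i \<cdot> f i)"
  using is_complexD[OF assms(1)] is_complexD[OF assms(2)] is_complexD[OF assms(3)] chain_mapD[OF assms(4)]
    chain_mapD[OF assms(5)] chain_map_dif[OF assms(1,2,4)] chain_map_dif[OF assms(2,3,5)]
  by (simp add: is_chain_map_def cat_simps)

lemma chain_map_id: "is_complex C K \<Longrightarrow> is_chain_map C K K (\<lambda>i. Idn C (obj K i))"
  using is_complexD[of K] by (simp add: is_chain_map_def cat_simps)

lemma chain_homotopicD:
  assumes "chain_homotopic C K L f g"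
  obtains h where "\<And>i. h i \<in> Ar C" "\<And>i. Dom C (h i) = obj K i" "\<And>i. Cod C (h i) = obj L (i - 1)"
    "\<And>i. f i = g i \<boxplus> (dif L (i - 1) \<cdot> h i \<boxplus> h (i + 1) \<cdot> dif K i)"
  using assms unfolding chain_homotopic_def Homs_def by blast

lemma chain_homotopic_refl:
  assumes "is_complex C K" "is_complex C L" "is_chain_map C K L f"
  shows "chain_homotopic C K L f f"
proof -
  note [simp] = is_complexD[OF assms(1)] is_complexD[OF assms(2)] chain_mapD[OF assms(3)]
  show ?thesis unfolding chain_homotopic_def
    by (rule exI[of _ "\<lambda>i. Zro C (obj K i) (obj L (i - 1))"]) (simp add: cat_simps)
qed

lemma chain_homotopic_sym:
  assumes "is_complex C K" "is_complex C L" "is_chain_map C K L g" "chain_homotopic C K L f g"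
  shows "chain_homotopic C K L g f"
proof -
  note [simp] = is_complexD[OF assms(1)] is_complexD[OF assms(2)] chain_mapD[OF assms(3)]
  obtain h where [simp]: "\<And>i. h i \<in> Ar C" "\<And>i. Dom C (h i) = obj K i" "\<And>i. Cod C (h i) = obj L (i - 1)"
    and f: "\<And>i. f i = g i \<boxplus> (dif L (i - 1) \<cdot> h i \<boxplus> h (i + 1) \<cdot> dif K i)"
    using chain_homotopicD[OF assms(4)] by metis
  have "g i = f i \<boxplus> (dif L (i - 1) \<cdot> neg_arrow C (h i) \<boxplus> neg_arrow C (h (i + 1)) \<cdot> dif K i)" for i
    unfolding f
    apply (simp add: cat_simps)
    \<comment> \<open>Both sides are now sums of normalised composites. The rules for
      \<open>lin\<close> read off a formal combination of each side with the composites as atoms,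
      and the two combinations agree by commutative algebra. This pattern recurs throughout.\<close>
    apply (rule lin_eqI[of "obj K i" "obj L i"])
    apply (rule lin_Pls lin_neg lin_Zro lin_atom' | (simp add: cat_simps; fail) | (simp add: algebra_simps; fail))+
    done
  then show ?thesis unfolding chain_homotopic_def
    by (intro exI[of _ "\<lambda>i. neg_arrow C (h i)"]) (simp add: cat_simps)
qed

lemma chain_homotopic_trans:
  assumes "is_complex C K" "is_complex C L" "is_chain_map C K L e"
    "chain_homotopic C K L f g" "chain_homotopic C K L g e"
  shows "chain_homotopic C K L f e"
proof -
  note [simp] = is_complexD[OF assms(1)] is_complexD[OF assms(2)] chain_mapD[OF assms(3)]
  obtain h where [simp]: "\<And>i. h i \<in> Ar C" "\<And>i. Dom C (h i) = obj K i" "\<And>i. Cod C (h i) = obj L (i - 1)"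
    and f: "\<And>i. f i = g i \<boxplus> (dif L (i - 1) \<cdot> h i \<boxplus> h (i + 1) \<cdot> dif K i)"
    using chain_homotopicD[OF assms(4)] by metis
  obtain k where [simp]: "\<And>i. k i \<in> Ar C" "\<And>i. Dom C (k i) = obj K i" "\<And>i. Cod C (k i) = obj L (i - 1)"
    and g: "\<And>i. g i = e i \<boxplus> (dif L (i - 1) \<cdot> k i \<boxplus> k (i + 1) \<cdot> dif K i)"
    using chain_homotopicD[OF assms(5)] by metis
  have "f i = e i \<boxplus> (dif L (i - 1) \<cdot> (h i \<boxplus> k i) \<boxplus> (h (i + 1) \<boxplus> k (i + 1)) \<cdot> dif K i)" for i
    unfolding f g
    apply (simp add: cat_simps)
    apply (rule lin_eqI[of "obj K i" "obj L i"])
    apply (rule lin_Pls lin_neg lin_Zro lin_atom' | (simp add: cat_simps; fail) | (simp add: algebra_simps; fail))+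
    done
  then show ?thesis unfolding chain_homotopic_def
    by (intro exI[of _ "\<lambda>i. h i \<boxplus> k i"]) (simp add: cat_simps)
qed

lemma chain_homotopic_comp:
  assumes "is_complex C J" "is_complex C K" "is_complex C L" "is_complex C M"
    "is_chain_map C J K b" "is_chain_map C L M a" "is_chain_map C K L g" "chain_homotopic C K L f g"
  shows "chain_homotopic C J M (\<lambda>i. a i \<cdot> (f i \<cdot> b i)) (\<lambda>i. a i \<cdot> (g i \<cdot> b i))"
proof -
  note [simp] = is_complexD[OF assms(1)] is_complexD[OF assms(2)] is_complexD[OF assms(3)]
    is_complexD[OF assms(4)] chain_mapD[OF assms(5)] chain_mapD[OF assms(6)] chain_mapD[OF assms(7)]
    chain_map_dif[OF assms(1,2,5)] chain_map_dif[OF assms(3,4,6)]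
  obtain h where [simp]: "\<And>i. h i \<in> Ar C" "\<And>i. Dom C (h i) = obj K i" "\<And>i. Cod C (h i) = obj L (i - 1)"
    and f: "\<And>i. f i = g i \<boxplus> (dif L (i - 1) \<cdot> h i \<boxplus> h (i + 1) \<cdot> dif K i)"
    using chain_homotopicD[OF assms(8)] by metis
  show ?thesis unfolding chain_homotopic_def f
    by (rule exI[of _ "\<lambda>i. a (i - 1) \<cdot> (h i \<cdot> b i)"]) (simp add: cat_simps)
qed

text \<open>A left inverse \<open>v\<close> and a right inverse \<open>v'\<close> up to homotopy
  agree up to homotopy, since both are homotopic to \<open>v u v'\<close>. This is the form in which
  invertibility arises below: a composite is known to be invertible, its factors are not.\<close>

lemma homotopy_equivalentI_one_sided:
  assumes K: "is_complex C K" and L: "is_complex C L" and u: "is_chain_map C K L u"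
    and v: "is_chain_map C L K v" and v': "is_chain_map C L K v'"
    and vu: "chain_homotopic C K K (\<lambda>i. v i \<cdot> u i) (\<lambda>i. Idn C (obj K i))"
    and uv': "chain_homotopic C L L (\<lambda>i. u i \<cdot> v' i) (\<lambda>i. Idn C (obj L i))"
  shows "homotopy_equivalent C K L"
proof -
  note [simp] = is_complexD[OF K] is_complexD[OF L] chain_mapD[OF u] chain_mapD[OF v] chain_mapD[OF v']
  note idK = chain_map_id[OF K] and idL = chain_map_id[OF L]
  note uv'c = chain_map_comp[OF L K L v' u]
  have "chain_homotopic C L K (\<lambda>i. v i \<cdot> ((u i \<cdot> v' i) \<cdot> Idn C (obj L i))) (\<lambda>i. v i \<cdot> (Idn C (obj L i) \<cdot> Idn C (obj L i)))"
    by (rule chain_homotopic_comp[OF L L L K idL v idL uv'])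
  then have 1: "chain_homotopic C L K (\<lambda>i. v i \<cdot> (u i \<cdot> v' i)) v"
    by (simp add: cat_simps)
  have "chain_homotopic C L K (\<lambda>i. Idn C (obj K i) \<cdot> ((v i \<cdot> u i) \<cdot> v' i)) (\<lambda>i. Idn C (obj K i) \<cdot> (Idn C (obj K i) \<cdot> v' i))"
    by (rule chain_homotopic_comp[OF L K K K v' idK idK vu])
  then have 2: "chain_homotopic C L K (\<lambda>i. v i \<cdot> (u i \<cdot> v' i)) v'"
    by (simp add: cat_simps)
  have 3: "chain_homotopic C L K v v'"
    using chain_homotopic_trans[OF L K v' chain_homotopic_sym[OF L K v 1] 2] .
  have "chain_homotopic C L L (\<lambda>i. u i \<cdot> (v i \<cdot> Idn C (obj L i))) (\<lambda>i. u i \<cdot> (v' i \<cdot> Idn C (obj L i)))"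
    by (rule chain_homotopic_comp[OF L L K L idL u v' 3])
  then have "chain_homotopic C L L (\<lambda>i. u i \<cdot> v i) (\<lambda>i. u i \<cdot> v' i)"
    by (simp add: cat_simps)
  then have "chain_homotopic C L L (\<lambda>i. u i \<cdot> v i) (\<lambda>i. Idn C (obj L i))"
    using chain_homotopic_trans[OF L L idL _ uv'] by blast
  then show ?thesis
    using K L u v vu unfolding homotopy_equivalent_def by blast
qed

lemma homotopy_equivalentE:
  assumes "homotopy_equivalent C K L"
  obtains f g where "is_complex C K" "is_complex C L" "is_chain_map C K L f" "is_chain_map C L K g"
    "chain_homotopic C K K (\<lambda>i. g i \<cdot> f i) (\<lambda>i. Idn C (obj K i))"
    "chain_homotopic C L L (\<lambda>i. f i \<cdot> g i) (\<lambda>i. Idn C (obj L i))"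
  using assms unfolding homotopy_equivalent_def by blast

lemma homotopy_equivalent_refl: "is_complex C K \<Longrightarrow> homotopy_equivalent C K K"
  using chain_map_id[of K] chain_homotopic_refl[of K K "\<lambda>i. Idn C (obj K i)"] is_complexD[of K]
  unfolding homotopy_equivalent_def by (auto simp: cat_simps intro!: exI[of _ "\<lambda>i. Idn C (obj K i)"])

lemma homotopy_equivalent_sym: "homotopy_equivalent C K L \<Longrightarrow> homotopy_equivalent C L K"
  unfolding homotopy_equivalent_def by blast

lemma chain_homotopic_comp_id:
  assumes K: "is_complex C K" and L: "is_complex C L" and M: "is_complex C M"
    and f: "is_chain_map C K L f" and g: "is_chain_map C L K g"
    and f': "is_chain_map C L M f'" and g': "is_chain_map C M L g'"
    and gf: "chain_homotopic C K K (\<lambda>i. g i \<cdot> f i) (\<lambda>i. Idn C (obj K i))"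
    and gf': "chain_homotopic C L L (\<lambda>i. g' i \<cdot> f' i) (\<lambda>i. Idn C (obj L i))"
  shows "chain_homotopic C K K (\<lambda>i. (g i \<cdot> g' i) \<cdot> (f' i \<cdot> f i)) (\<lambda>i. Idn C (obj K i))"
proof -
  note [simp] = is_complexD[OF K] is_complexD[OF L] is_complexD[OF M]
    chain_mapD[OF f] chain_mapD[OF g] chain_mapD[OF f'] chain_mapD[OF g']
  have "chain_homotopic C K K (\<lambda>i. g i \<cdot> ((g' i \<cdot> f' i) \<cdot> f i)) (\<lambda>i. g i \<cdot> (Idn C (obj L i) \<cdot> f i))"
    by (rule chain_homotopic_comp[OF K L L K f g chain_map_id[OF L] gf'])
  then have "chain_homotopic C K K (\<lambda>i. (g i \<cdot> g' i) \<cdot> (f' i \<cdot> f i)) (\<lambda>i. g i \<cdot> f i)"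
    by (simp add: cat_simps)
  then show ?thesis using chain_homotopic_trans[OF K K chain_map_id[OF K] _ gf] by blast
qed

lemma homotopy_equivalent_trans:
  assumes "homotopy_equivalent C K L" "homotopy_equivalent C L M"
  shows "homotopy_equivalent C K M"
proof -
  obtain f g where 1: "is_complex C K" "is_complex C L" "is_chain_map C K L f" "is_chain_map C L K g"
    "chain_homotopic C K K (\<lambda>i. g i \<cdot> f i) (\<lambda>i. Idn C (obj K i))"
    "chain_homotopic C L L (\<lambda>i. f i \<cdot> g i) (\<lambda>i. Idn C (obj L i))"
    by (rule homotopy_equivalentE[OF assms(1)])
  obtain f' g' where 2: "is_complex C L" "is_complex C M" "is_chain_map C L M f'" "is_chain_map C M L g'"
    "chain_homotopic C L L (\<lambda>i. g' i \<cdot> f' i) (\<lambda>i. Idn C (obj L i))"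
    "chain_homotopic C M M (\<lambda>i. f' i \<cdot> g' i) (\<lambda>i. Idn C (obj M i))"
    by (rule homotopy_equivalentE[OF assms(2)])
  show ?thesis unfolding homotopy_equivalent_def
    using 1(1) 2(2) chain_map_comp[OF 1(1,2) 2(2) 1(3) 2(3)] chain_map_comp[OF 2(2) 1(2,1) 2(4) 1(4)]
      chain_homotopic_comp_id[OF 1(1,2) 2(2) 1(3,4) 2(3,4) 1(5) 2(5)]
      chain_homotopic_comp_id[OF 2(2,1) 1(1) 2(4,3) 1(4,3) 2(6) 1(6)]
    by blast
qed

text \<open>A perturbation \<open>\<epsilon> = d h + j d\<close> of the identity has \<open>\<epsilon>\<^sup>2\<close> null-homotopic by \<open>j d h + h j d\<close>,
  so that \<open>1 - \<epsilon>\<close> is a homotopy inverse of \<open>1 + \<epsilon>\<close>.\<close>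

lemma weakly_homotopic_id_invertible:
  assumes K: "is_complex C K" and u: "is_chain_map C K K u"
    and h: "\<And>i. h i \<in> Homs C (obj K i) (obj K (i - 1))" and j: "\<And>i. j i \<in> Homs C (obj K i) (obj K (i - 1))"
    and eq: "\<And>i. u i = Idn C (obj K i) \<boxplus> (dif K (i - 1) \<cdot> h i \<boxplus> j (i + 1) \<cdot> dif K i)"
  shows "\<exists>v. is_chain_map C K K v \<and> chain_homotopic C K K (\<lambda>i. v i \<cdot> u i) (\<lambda>i. Idn C (obj K i)) \<and>
    chain_homotopic C K K (\<lambda>i. u i \<cdot> v i) (\<lambda>i. Idn C (obj K i))"
proof -
  note [simp] = is_complexD[OF K] complex_dd[OF K] HomsD[OF h] HomsD[OF j]
  \<comment> \<open>Since \<open>u\<close> commutes with \<open>d\<close> and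
    \<open>d d = 0\<close>, the two unrelated families satisfy \<open>d j d = d h d\<close>. This is
    the only relation between \<open>h\<close> and \<open>j\<close>, and it suffices.\<close>
  have djd0: "dif K (m - 1) \<cdot> (j m \<cdot> dif K (m - 1)) = dif K (m - 1) \<cdot> (h m \<cdot> dif K (m - 1))" for m
  proof -
    have "u m \<cdot> dif K (m - 1) = dif K (m - 1) \<cdot> u (m - 1)" using chain_map_dif(1)[OF K K u, of m "m - 1"] by simp
    then have "dif K (m - 1) \<boxplus> dif K (m - 1) \<cdot> (h m \<cdot> dif K (m - 1))
      = dif K (m - 1) \<boxplus> dif K (m - 1) \<cdot> (j m \<cdot> dif K (m - 1))"
      unfolding eq by (simp add: cat_simps)
    note eq2 = this[symmetric]
    show ?thesis
      by (rule Pls_left_cancel[of "dif K (m - 1)" "obj K (m - 1)" "obj K m"]) (use eq2 in \<open>simp_all add: cat_simps\<close>)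
  qed
  have djd: "dif K i \<cdot> (j m \<cdot> dif K l) = dif K i \<cdot> (h m \<cdot> dif K i)" if "m = i + 1" "l = i" for i m l
    using djd0[of m] that by simp
  have djd': "dif K i \<cdot> (j m \<cdot> (dif K l \<cdot> t)) = dif K i \<cdot> (h m \<cdot> (dif K i \<cdot> t))"
    if "m = i + 1" "l = i" "t \<in> Ar C" "Cod C t = obj K i" for i m l t
  proof -
    have "dif K i \<cdot> (j m \<cdot> (dif K l \<cdot> t)) = (dif K i \<cdot> (j m \<cdot> dif K i)) \<cdot> t"
      using that by (simp add: cat_simps)
    also have "\<dots> = dif K i \<cdot> (h m \<cdot> (dif K i \<cdot> t))"
      unfolding djd[OF that(1) refl] using that by (simp add: cat_simps)
    finally show ?thesis .
  qed
  note dj = djd djd'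
  define v where "v i = Idn C (obj K i) \<boxplus> neg_arrow C (dif K (i - 1) \<cdot> h i \<boxplus> j (i + 1) \<cdot> dif K i)" for i
  have vc: "is_chain_map C K K v"
    by (rule chain_mapI; unfold v_def) (simp_all add: cat_simps neg_Pls' dj)
  \<comment> \<open>The sign is negative because both composites of \<open>v\<close> and
    \<open>u\<close> equal \<open>1 - \<epsilon> \<epsilon>\<close>.\<close>
  define H where "H i = neg_arrow C (j i \<cdot> (dif K (i - 1) \<cdot> h i) \<boxplus> h i \<cdot> (j (i + 1) \<cdot> dif K i))" for i
  have "v (m - 1) \<cdot> u (m - 1) = Idn C (obj K (m - 1)) \<boxplus> (dif K (m - 1 - 1) \<cdot> H (m - 1) \<boxplus> H m \<cdot> dif K (m - 1))" for m
    unfolding v_def eq H_def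
    apply (simp add: cat_simps dj)
    apply (rule lin_eqI[of "obj K (m - 1)" "obj K (m - 1)"])
    apply (rule lin_Pls lin_neg lin_Zro lin_atom' | (simp add: cat_simps; fail) | (simp add: algebra_simps; fail))+
    done
  from this[of "i + 1" for i] have 1: "v i \<cdot> u i = Idn C (obj K i) \<boxplus> (dif K (i - 1) \<cdot> H i \<boxplus> H (i + 1) \<cdot> dif K i)" for i
    by simp
  have "u (m - 1) \<cdot> v (m - 1) = Idn C (obj K (m - 1)) \<boxplus> (dif K (m - 1 - 1) \<cdot> H (m - 1) \<boxplus> H m \<cdot> dif K (m - 1))" for m
    unfolding v_def eq H_def
    apply (simp add: cat_simps dj)
    apply (rule lin_eqI[of "obj K (m - 1)" "obj K (m - 1)"])
    apply (rule lin_Pls lin_neg lin_Zro lin_atom' | (simp add: cat_simps; fail) | (simp add: algebra_simps; fail))+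
    done
  from this[of "i + 1" for i] have 2: "u i \<cdot> v i = Idn C (obj K i) \<boxplus> (dif K (i - 1) \<cdot> H i \<boxplus> H (i + 1) \<cdot> dif K i)" for i
    by simp
  have "H i \<in> Homs C (obj K i) (obj K (i - 1))" for i
    unfolding H_def by (simp add: cat_simps)
  then have "chain_homotopic C K K (\<lambda>i. v i \<cdot> u i) (\<lambda>i. Idn C (obj K i))"
    "chain_homotopic C K K (\<lambda>i. u i \<cdot> v i) (\<lambda>i. Idn C (obj K i))"
    unfolding chain_homotopic_def using 1 2 by blast+
  with vc show ?thesis by blast
qed

end

section \<open>Termwise split extensions of complexes\<close>

text \<open>\<open>Y\<close> is an extension of \<open>Z\<close> by \<open>X\<close>, split in every degree by \<open>p\<close> and \<open>j\<close>; its differential is upper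
  triangular with off-diagonal part \<open>\<delta>\<close>.\<close>

definition split_extension ::
  "('o, 'm, 'e) cat_scheme \<Rightarrow> ('o, 'm) cpx \<Rightarrow> ('o, 'm) cpx \<Rightarrow> ('o, 'm) cpx
     \<Rightarrow> (int \<Rightarrow> 'm) \<Rightarrow> (int \<Rightarrow> 'm) \<Rightarrow> (int \<Rightarrow> 'm) \<Rightarrow> (int \<Rightarrow> 'm) \<Rightarrow> (int \<Rightarrow> 'm) \<Rightarrow> bool" where
  "split_extension C X Y Z i p j q \<delta> \<longleftrightarrow>
     is_complex C X \<and> is_complex C Y \<and> is_complex C Z \<and>
     (\<forall>n. i n \<in> Homs C (obj X n) (obj Y n) \<and> p n \<in> Homs C (obj Y n) (obj X n) \<and>
          j n \<in> Homs C (obj Z n) (obj Y n) \<and> q n \<in> Homs C (obj Y n) (obj Z n) \<and>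
          \<delta> n \<in> Homs C (obj Z n) (obj X (n + 1)) \<and>
          p n \<cdot>\<^bsub>C\<^esub> i n = Idn C (obj X n) \<and> q n \<cdot>\<^bsub>C\<^esub> j n = Idn C (obj Z n) \<and>
          q n \<cdot>\<^bsub>C\<^esub> i n = Zro C (obj X n) (obj Z n) \<and> p n \<cdot>\<^bsub>C\<^esub> j n = Zro C (obj Z n) (obj X n) \<and>
          i n \<cdot>\<^bsub>C\<^esub> p n \<boxplus>\<^bsub>C\<^esub> j n \<cdot>\<^bsub>C\<^esub> q n = Idn C (obj Y n) \<and>
          dif Y n = i (n + 1) \<cdot>\<^bsub>C\<^esub> (dif X n \<cdot>\<^bsub>C\<^esub> p n) \<boxplus>\<^bsub>C\<^esub>
            (j (n + 1) \<cdot>\<^bsub>C\<^esub> (dif Z n \<cdot>\<^bsub>C\<^esub> q n) \<boxplus>\<^bsub>C\<^esub> i (n + 1) \<cdot>\<^bsub>C\<^esub> (\<delta> n \<cdot>\<^bsub>C\<^esub> q n)) \<and>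
          dif X n \<cdot>\<^bsub>C\<^esub> \<delta> (n - 1) \<boxplus>\<^bsub>C\<^esub> \<delta> n \<cdot>\<^bsub>C\<^esub> dif Z (n - 1) = Zro C (obj Z (n - 1)) (obj X (n + 1)))"

context preadditive_category
begin

text \<open>Instantiated as \<open>eq[THEN Cmp_assoc_eq]\<close>, it makes an equation between
  arrows applicable in front of a further arrow of a right-nested composite.\<close>

lemma Cmp_assoc_eq:
  assumes "g \<cdot> f = k" "f \<in> Ar C" "g \<in> Ar C" "Cod C f = Dom C g" "t \<in> Ar C" "Cod C t = Dom C f"
  shows "g \<cdot> (f \<cdot> t) = k \<cdot> t"
  using Cmp_assoc'[of t f g] assms by simp

lemma split_extensionD:
  assumes "split_extension C X Y Z i p j q \<delta>"
  shows "is_complex C X" "is_complex C Y" "is_complex C Z"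
    "i n \<in> Ar C" "Dom C (i n) = obj X n" "Cod C (i n) = obj Y n"
    "p n \<in> Ar C" "Dom C (p n) = obj Y n" "Cod C (p n) = obj X n"
    "j n \<in> Ar C" "Dom C (j n) = obj Z n" "Cod C (j n) = obj Y n"
    "q n \<in> Ar C" "Dom C (q n) = obj Y n" "Cod C (q n) = obj Z n"
    "\<delta> n \<in> Ar C" "Dom C (\<delta> n) = obj Z n" "Cod C (\<delta> n) = obj X (n + 1)"
  using assms unfolding split_extension_def Homs_def by blast+

lemma split_extension_eqs:
  assumes "split_extension C X Y Z i p j q \<delta>"
  shows "p n \<cdot> i n = Idn C (obj X n)" "q n \<cdot> j n = Idn C (obj Z n)"
    "q n \<cdot> i n = Zro C (obj X n) (obj Z n)" "p n \<cdot> j n = Zro C (obj Z n) (obj X n)"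
  using assms unfolding split_extension_def by blast+

lemma split_extension_eqs':
  assumes "split_extension C X Y Z i p j q \<delta>" "t \<in> Ar C"
  shows "Cod C t = obj X n \<Longrightarrow> p n \<cdot> (i n \<cdot> t) = t" "Cod C t = obj Z n \<Longrightarrow> q n \<cdot> (j n \<cdot> t) = t"
    "Cod C t = obj X n \<Longrightarrow> q n \<cdot> (i n \<cdot> t) = Zro C (Dom C t) (obj Z n)"
    "Cod C t = obj Z n \<Longrightarrow> p n \<cdot> (j n \<cdot> t) = Zro C (Dom C t) (obj X n)"
  using split_extensionD[OF assms(1)] split_extension_eqs[OF assms(1), THEN Cmp_assoc_eq, of n t] assms(2)
    is_complexD(1)[of X] is_complexD(1)[of Z]
  by (simp_all add: cat_simps)

lemma split_extension_sum:
  assumes "split_extension C X Y Z i p j q \<delta>"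
  shows "i n \<cdot> p n \<boxplus> j n \<cdot> q n = Idn C (obj Y n)"
  using assms unfolding split_extension_def by blast

lemma split_extension_facts:
  assumes "split_extension C X Y Z i p j q \<delta>"
  shows "i n \<in> Homs C (obj X n) (obj Y n)" "p n \<in> Homs C (obj Y n) (obj X n)"
    "j n \<in> Homs C (obj Z n) (obj Y n)" "q n \<in> Homs C (obj Y n) (obj Z n)" "\<delta> n \<in> Homs C (obj Z n) (obj X (n + 1))"
    "p n \<cdot> i n = Idn C (obj X n)" "q n \<cdot> j n = Idn C (obj Z n)"
    "q n \<cdot> i n = Zro C (obj X n) (obj Z n)" "p n \<cdot> j n = Zro C (obj Z n) (obj X n)"
    "i n \<cdot> p n \<boxplus> j n \<cdot> q n = Idn C (obj Y n)"
    "dif Y n = i (n + 1) \<cdot> (dif X n \<cdot> p n) \<boxplus> (j (n + 1) \<cdot> (dif Z n \<cdot> q n) \<boxplus> i (n + 1) \<cdot> (\<delta> n \<cdot> q n))"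
    "dif X n \<cdot> \<delta> (n - 1) \<boxplus> \<delta> n \<cdot> dif Z (n - 1) = Zro C (obj Z (n - 1)) (obj X (n + 1))"
  using assms unfolding split_extension_def by blast+

lemma split_extension_dif:
  assumes "split_extension C X Y Z i p j q \<delta>" "m = n + 1"
  shows "dif Y n \<cdot> i n = i m \<cdot> dif X n"
    "t \<in> Ar C \<Longrightarrow> Cod C t = obj X n \<Longrightarrow> dif Y n \<cdot> (i n \<cdot> t) = i m \<cdot> (dif X n \<cdot> t)"
    "q m \<cdot> dif Y n = dif Z n \<cdot> q n"
    "t \<in> Ar C \<Longrightarrow> Cod C t = obj Y n \<Longrightarrow> q m \<cdot> (dif Y n \<cdot> t) = dif Z n \<cdot> (q n \<cdot> t)"
    "p m \<cdot> dif Y n = dif X n \<cdot> p n \<boxplus> \<delta> n \<cdot> q n"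
    "t \<in> Ar C \<Longrightarrow> Cod C t = obj Y n \<Longrightarrow> p m \<cdot> (dif Y n \<cdot> t) = dif X n \<cdot> (p n \<cdot> t) \<boxplus> \<delta> n \<cdot> (q n \<cdot> t)"
    "dif Y n \<cdot> j n = j m \<cdot> dif Z n \<boxplus> i m \<cdot> \<delta> n"
    "t \<in> Ar C \<Longrightarrow> Cod C t = obj Z n \<Longrightarrow> dif Y n \<cdot> (j n \<cdot> t) = j m \<cdot> (dif Z n \<cdot> t) \<boxplus> i m \<cdot> (\<delta> n \<cdot> t)"
proof -
  note [simp] = split_extensionD[OF assms(1)] split_extension_eqs[OF assms(1)]
    split_extension_eqs'[OF assms(1)] is_complexD[of X] is_complexD[of Y] is_complexD[of Z]
  have d: "dif Y n = i (n + 1) \<cdot> (dif X n \<cdot> p n) \<boxplus>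
            (j (n + 1) \<cdot> (dif Z n \<cdot> q n) \<boxplus> i (n + 1) \<cdot> (\<delta> n \<cdot> q n))"
    using assms unfolding split_extension_def by blast
  show 1: "dif Y n \<cdot> i n = i m \<cdot> dif X n" and 2: "q m \<cdot> dif Y n = dif Z n \<cdot> q n" and
    3: "p m \<cdot> dif Y n = dif X n \<cdot> p n \<boxplus> \<delta> n \<cdot> q n" and 4: "dif Y n \<cdot> j n = j m \<cdot> dif Z n \<boxplus> i m \<cdot> \<delta> n"
    unfolding d assms(2) by (simp_all add: cat_simps)
  show "t \<in> Ar C \<Longrightarrow> Cod C t = obj X n \<Longrightarrow> dif Y n \<cdot> (i n \<cdot> t) = i m \<cdot> (dif X n \<cdot> t)"
    using 1[THEN Cmp_assoc_eq, of t] assms(2) by (simp add: cat_simps)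
  show "t \<in> Ar C \<Longrightarrow> Cod C t = obj Y n \<Longrightarrow> q m \<cdot> (dif Y n \<cdot> t) = dif Z n \<cdot> (q n \<cdot> t)"
    using 2[THEN Cmp_assoc_eq, of t] assms(2) by (simp add: cat_simps)
  show "t \<in> Ar C \<Longrightarrow> Cod C t = obj Y n \<Longrightarrow> p m \<cdot> (dif Y n \<cdot> t) = dif X n \<cdot> (p n \<cdot> t) \<boxplus> \<delta> n \<cdot> (q n \<cdot> t)"
    using 3[THEN Cmp_assoc_eq, of t] assms(2) by (simp add: cat_simps)
  show "t \<in> Ar C \<Longrightarrow> Cod C t = obj Z n \<Longrightarrow> dif Y n \<cdot> (j n \<cdot> t) = j m \<cdot> (dif Z n \<cdot> t) \<boxplus> i m \<cdot> (\<delta> n \<cdot> t)"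
    using 4[THEN Cmp_assoc_eq, of t] assms(2) by (simp add: cat_simps)
qed

text \<open>This is the off-diagonal entry of \<open>d d = 0\<close>, that is, \<delta> is a chain
  map from \<open>Z\<close> to a shift of \<open>X\<close> up to sign. It is oriented so that
  \<delta> moves to the right past differentials.\<close>

lemma split_extension_delta:
  assumes "split_extension C X Y Z i p j q \<delta>" "m = n + 1"
  shows "\<delta> m \<cdot> dif Z n = neg_arrow C (dif X m \<cdot> \<delta> n)"
    "t \<in> Ar C \<Longrightarrow> Cod C t = obj Z n \<Longrightarrow> \<delta> m \<cdot> (dif Z n \<cdot> t) = neg_arrow C (dif X m \<cdot> (\<delta> n \<cdot> t))"
proof -
  note [simp] = split_extensionD[OF assms(1)] is_complexD[of X] is_complexD[of Y] is_complexD[of Z]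
  have "dif X m \<cdot> \<delta> (m - 1) \<boxplus> \<delta> m \<cdot> dif Z (m - 1) = Zro C (obj Z (m - 1)) (obj X (m + 1))"
    using assms unfolding split_extension_def by blast
  then have "dif X m \<cdot> \<delta> n \<boxplus> \<delta> m \<cdot> dif Z n = Zro C (obj Z n) (obj X (m + 1))"
    using assms(2) by simp
  then show 1: "\<delta> m \<cdot> dif Z n = neg_arrow C (dif X m \<cdot> \<delta> n)"
    using assms(2) by (intro neg_unique[of _ "obj Z n" "obj X (m + 1)"]) (simp_all add: cat_simps)
  show "t \<in> Ar C \<Longrightarrow> Cod C t = obj Z n \<Longrightarrow> \<delta> m \<cdot> (dif Z n \<cdot> t) = neg_arrow C (dif X m \<cdot> (\<delta> n \<cdot> t))"
    using 1[THEN Cmp_assoc_eq, of t] assms(2) by (simp add: cat_simps)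
qed

text \<open>Once the splittings are fixed, the off-diagonal part is forced to be
  \<open>p d j\<close>; its compatibility with the differentials is \<open>p d d j = 0\<close> with
  the middle term resolved by the splitting.\<close>

lemma split_extensionI:
  assumes X: "is_complex C X" and Y: "is_complex C Y" and Z: "is_complex C Z"
    and i: "is_chain_map C X Y i" and q: "is_chain_map C Y Z q"
    and p: "\<And>n. p n \<in> Homs C (obj Y n) (obj X n)" and j: "\<And>n. j n \<in> Homs C (obj Z n) (obj Y n)"
    and r: "\<And>n. p n \<cdot> i n = Idn C (obj X n)" "\<And>n. q n \<cdot> j n = Idn C (obj Z n)"
      "\<And>n. q n \<cdot> i n = Zro C (obj X n) (obj Z n)" "\<And>n. p n \<cdot> j n = Zro C (obj Z n) (obj X n)"
    and s: "\<And>n. i n \<cdot> p n \<boxplus> j n \<cdot> q n = Idn C (obj Y n)"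
  shows "split_extension C X Y Z i p j q (\<lambda>n. p (n + 1) \<cdot> (dif Y n \<cdot> j n))"
proof -
  note [simp] = is_complexD[OF X] is_complexD[OF Y] is_complexD[OF Z] chain_mapD[OF i] chain_mapD[OF q]
    HomsD[OF p] HomsD[OF j] r chain_map_dif[OF Y Z q]
  have i': "dif Y n \<cdot> i n = i m \<cdot> dif X n" "t \<in> Ar C \<Longrightarrow> Cod C t = obj X n \<Longrightarrow> dif Y n \<cdot> (i n \<cdot> t) = i m \<cdot> (dif X n \<cdot> t)"
    if "m = n + 1" for n m t
    using chain_map_dif[OF X Y i that] by simp_all
  have r': "t \<in> Ar C \<Longrightarrow> Cod C t = obj X n \<Longrightarrow> p n \<cdot> (i n \<cdot> t) = t"
    "t \<in> Ar C \<Longrightarrow> Cod C t = obj X n \<Longrightarrow> q n \<cdot> (i n \<cdot> t) = Zro C (Dom C t) (obj Z n)"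
    "t \<in> Ar C \<Longrightarrow> Cod C t = obj Z n \<Longrightarrow> q n \<cdot> (j n \<cdot> t) = t"
    "t \<in> Ar C \<Longrightarrow> Cod C t = obj Z n \<Longrightarrow> p n \<cdot> (j n \<cdot> t) = Zro C (Dom C t) (obj X n)" for n t
    using r(1,3,2,4)[of n, THEN Cmp_assoc_eq, of t] by (simp_all add: cat_simps)
  have dj: "dif Y n \<cdot> j n = i m \<cdot> (p m \<cdot> (dif Y n \<cdot> j n)) \<boxplus> j m \<cdot> dif Z n" if m: "m = n + 1" for n m
  proof -
    have "dif Y n \<cdot> j n = (i m \<cdot> p m \<boxplus> j m \<cdot> q m) \<cdot> (dif Y n \<cdot> j n)"
      unfolding s using m by (simp add: cat_simps)
    also have "\<dots> = i m \<cdot> (p m \<cdot> (dif Y n \<cdot> j n)) \<boxplus> j m \<cdot> dif Z n"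
      using m by (simp add: cat_simps)
    finally show ?thesis .
  qed
  have "dif Y n = i (n + 1) \<cdot> (dif X n \<cdot> p n) \<boxplus>
            (j (n + 1) \<cdot> (dif Z n \<cdot> q n) \<boxplus> i (n + 1) \<cdot> ((p (n + 1) \<cdot> (dif Y n \<cdot> j n)) \<cdot> q n))" for n
  proof -
    have "dif Y n = dif Y n \<cdot> (i n \<cdot> p n \<boxplus> j n \<cdot> q n)"
      unfolding s by (simp add: cat_simps)
    also have "\<dots> = i (n + 1) \<cdot> (dif X n \<cdot> p n) \<boxplus> (dif Y n \<cdot> j n) \<cdot> q n"
      by (simp add: cat_simps i')
    also have "(dif Y n \<cdot> j n) \<cdot> q n = (i (n + 1) \<cdot> (p (n + 1) \<cdot> (dif Y n \<cdot> j n)) \<boxplus> j (n + 1) \<cdot> dif Z n) \<cdot> q n"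
      using dj[of "n + 1" n] by simp
    also have "\<dots> = j (n + 1) \<cdot> (dif Z n \<cdot> q n) \<boxplus> i (n + 1) \<cdot> ((p (n + 1) \<cdot> (dif Y n \<cdot> j n)) \<cdot> q n)"
      by (simp add: cat_simps Pls_comm[of _ "obj Y n" "obj Y (n + 1)"])
    finally show ?thesis .
  qed
  moreover have "dif X m \<cdot> (p m \<cdot> (dif Y (m - 1) \<cdot> j (m - 1))) \<boxplus> (p (m + 1) \<cdot> (dif Y m \<cdot> j m)) \<cdot> dif Z (m - 1)
      = Zro C (obj Z (m - 1)) (obj X (m + 1))" for m
  proof -
    have "Zro C (obj Z (m - 1)) (obj X (m + 1)) = p (m + 1) \<cdot> (dif Y m \<cdot> (dif Y (m - 1) \<cdot> j (m - 1)))"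
      using complex_dd(2)[OF Y, of m "m - 1"] by (simp add: cat_simps)
    also have "dif Y (m - 1) \<cdot> j (m - 1) = i m \<cdot> (p m \<cdot> (dif Y (m - 1) \<cdot> j (m - 1))) \<boxplus> j m \<cdot> dif Z (m - 1)"
      using dj[of m "m - 1"] by simp
    also have "p (m + 1) \<cdot> (dif Y m \<cdot> \<dots>) = dif X m \<cdot> (p m \<cdot> (dif Y (m - 1) \<cdot> j (m - 1))) \<boxplus> (p (m + 1) \<cdot> (dif Y m \<cdot> j m)) \<cdot> dif Z (m - 1)"
      by (simp add: cat_simps i' r')
    finally show ?thesis by simp
  qed
  ultimately show ?thesis
    unfolding split_extension_def using X Y Z p j r s chain_mapD[OF i] chain_mapD[OF q]
    by (simp add: arr_simps)
qed

text \<open>Any family \<open>d h + h d\<close> commutes with \<open>d\<close>, so a family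
  differing from a chain map by it is a chain map as well. This saves a direct verification for the
  unipotent maps below.\<close>

lemma chain_homotopic_chain_map:
  assumes K: "is_complex C K" and L: "is_complex C L" and f: "is_chain_map C K L f"
    and u: "\<And>n. u n \<in> Homs C (obj K n) (obj L n)" and fu: "chain_homotopic C K L f u"
  shows "is_chain_map C K L u"
proof (rule chain_mapI[OF u])
  fix m
  note [simp] = is_complexD[OF K] is_complexD[OF L] chain_mapD[OF f] HomsD[OF u] complex_dd[OF K] complex_dd[OF L]
  obtain h where [simp]: "\<And>i. h i \<in> Ar C" "\<And>i. Dom C (h i) = obj K i" "\<And>i. Cod C (h i) = obj L (i - 1)"
    and eq: "\<And>i. f i = u i \<boxplus> (dif L (i - 1) \<cdot> h i \<boxplus> h (i + 1) \<cdot> dif K i)"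
    using chain_homotopicD[OF fu] by metis
  have "f m \<cdot> dif K (m - 1) = dif L (m - 1) \<cdot> f (m - 1)" using chain_map_dif(1)[OF K L f, of m "m - 1"] by simp
  then have "dif L (m - 1) \<cdot> (h m \<cdot> dif K (m - 1)) \<boxplus> u m \<cdot> dif K (m - 1)
      = dif L (m - 1) \<cdot> (h m \<cdot> dif K (m - 1)) \<boxplus> dif L (m - 1) \<cdot> u (m - 1)"
    unfolding eq by (simp add: cat_simps Pls_comm[of _ "obj K (m - 1)" "obj L m"])
  from Pls_left_cancel[OF _ _ _ this, of "obj K (m - 1)" "obj L m"]
  show "u m \<cdot> dif K (m - 1) = dif L (m - 1) \<cdot> u (m - 1)" by (simp add: cat_simps)
qed

lemma chain_map_inverse:
  assumes K: "is_complex C K" and L: "is_complex C L" and f: "is_chain_map C K L f"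
    and g: "\<And>n. g n \<in> Homs C (obj L n) (obj K n)"
    and gf: "\<And>n. g n \<cdot> f n = Idn C (obj K n)" and fg: "\<And>n. f n \<cdot> g n = Idn C (obj L n)"
  shows "is_chain_map C L K g"
proof (rule chain_mapI[OF g])
  fix m
  note [simp] = is_complexD[OF K] is_complexD[OF L] chain_mapD[OF f] HomsD[OF g]
  have "f m \<cdot> dif K (m - 1) = dif L (m - 1) \<cdot> f (m - 1)" using chain_map_dif(1)[OF K L f, of m "m - 1"] by simp
  then have "g m \<cdot> ((f m \<cdot> dif K (m - 1)) \<cdot> g (m - 1)) = g m \<cdot> ((dif L (m - 1) \<cdot> f (m - 1)) \<cdot> g (m - 1))"
    by simp
  also have "\<dots> = g m \<cdot> (dif L (m - 1) \<cdot> (f (m - 1) \<cdot> g (m - 1)))" by (simp add: cat_simps)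
  also have "\<dots> = g m \<cdot> dif L (m - 1)" unfolding fg by (simp add: cat_simps)
  finally have "g m \<cdot> dif L (m - 1) = (g m \<cdot> f m) \<cdot> (dif K (m - 1) \<cdot> g (m - 1))" by (simp add: cat_simps)
  then show "g m \<cdot> dif L (m - 1) = dif K (m - 1) \<cdot> g (m - 1)" unfolding gf by (simp add: cat_simps)
qed

text \<open>The homotopies of the two diagonal entries, placed on the diagonal of \<open>Y\<close>,
  turn \<open>f\<close> into a map with identities on the diagonal. Such a map is
  \<open>1 + i \<eta> q\<close>, with inverse \<open>1 - i \<eta> q\<close> because
  \<open>q i = 0\<close>.\<close>

lemma unipotent_homotopy_invertible:
  assumes E: "split_extension C X Y Z i p j q \<delta>" and f: "is_chain_map C Y Y f"
    and h: "\<And>n. h n \<in> Homs C (obj X n) (obj X (n - 1))" and k: "\<And>n. k n \<in> Homs C (obj Z n) (obj Z (n - 1))"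
    and s: "\<And>n. s n \<in> Homs C (obj Z n) (obj X n)"
    and eq: "\<And>n. f n = i n \<cdot> ((Idn C (obj X n) \<boxplus> (dif X (n - 1) \<cdot> h n \<boxplus> h (n + 1) \<cdot> dif X n)) \<cdot> p n) \<boxplus>
       (j n \<cdot> ((Idn C (obj Z n) \<boxplus> (dif Z (n - 1) \<cdot> k n \<boxplus> k (n + 1) \<cdot> dif Z n)) \<cdot> q n) \<boxplus> i n \<cdot> (s n \<cdot> q n))"
  shows "\<exists>v. is_chain_map C Y Y v \<and> chain_homotopic C Y Y (\<lambda>i. v i \<cdot> f i) (\<lambda>i. Idn C (obj Y i)) \<and>
    chain_homotopic C Y Y (\<lambda>i. f i \<cdot> v i) (\<lambda>i. Idn C (obj Y i))"
proof -
  note Y = split_extensionD(2)[OF E]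
  note [simp] = split_extensionD(4-)[OF E] is_complexD[OF split_extensionD(1)[OF E]]
    is_complexD[OF split_extensionD(2)[OF E]] is_complexD[OF split_extensionD(3)[OF E]]
    split_extension_eqs[OF E] split_extension_eqs'[OF E] split_extension_dif[OF E] split_extension_delta[OF E]
    HomsD[OF h] HomsD[OF k] HomsD[OF s]
  \<comment> \<open>The diagonal homotopy does not commute with \<delta>; its contribution
    \<open>\<delta> k + h \<delta>\<close> to the off-diagonal entry has to be subtracted from
    \<open>s\<close>.\<close>
  define \<eta> where "\<eta> n = s n \<boxplus> neg_arrow C (\<delta> (n - 1) \<cdot> k n \<boxplus> h (n + 1) \<cdot> \<delta> n)" for n
  have [simp]: "\<eta> n \<in> Ar C" "Dom C (\<eta> n) = obj Z n" "Cod C (\<eta> n) = obj X n" for n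
    unfolding \<eta>_def by (simp_all add: cat_simps)
  define U where "U n = Idn C (obj Y n) \<boxplus> i n \<cdot> (\<eta> n \<cdot> q n)" for n
  define V where "V n = Idn C (obj Y n) \<boxplus> neg_arrow C (i n \<cdot> (\<eta> n \<cdot> q n))" for n
  define H where "H n = i (n - 1) \<cdot> (h n \<cdot> p n) \<boxplus> j (n - 1) \<cdot> (k n \<cdot> q n)" for n
  have fU: "f n = U n \<boxplus> (dif Y (n - 1) \<cdot> H n \<boxplus> H (n + 1) \<cdot> dif Y n)" for n
    unfolding U_def split_extension_sum[OF E, symmetric] eq H_def \<eta>_def
    apply (simp add: cat_simps)
    apply (rule lin_eqI[of "obj Y n" "obj Y n"])
    apply (rule lin_Pls lin_neg lin_Zro lin_atom' | (simp add: cat_simps; fail) | (simp add: algebra_simps; fail))+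
    done
  have U: "U n \<in> Homs C (obj Y n) (obj Y n)" and V: "V n \<in> Homs C (obj Y n) (obj Y n)"
    and H: "H n \<in> Homs C (obj Y n) (obj Y (n - 1))" for n
    unfolding U_def V_def H_def by (simp_all add: cat_simps)
  have hfU: "chain_homotopic C Y Y f U"
    unfolding chain_homotopic_def using H fU by blast
  have Uc: "is_chain_map C Y Y U" by (rule chain_homotopic_chain_map[OF Y Y f U hfU])
  have VU: "V n \<cdot> U n = Idn C (obj Y n)" and UV: "U n \<cdot> V n = Idn C (obj Y n)" for n
    unfolding U_def V_def
     apply (simp_all add: cat_simps)
     apply (rule lin_eqI[of "obj Y n" "obj Y n"],
      (rule lin_Pls lin_neg lin_Zro lin_atom' | (simp add: cat_simps; fail) | (simp add: algebra_simps; fail))+)+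
    done
  have Vc: "is_chain_map C Y Y V" by (rule chain_map_inverse[OF Y Y Uc V VU UV])
  note id = chain_map_id[OF Y]
  have "chain_homotopic C Y Y (\<lambda>n. V n \<cdot> (f n \<cdot> Idn C (obj Y n))) (\<lambda>n. V n \<cdot> (U n \<cdot> Idn C (obj Y n)))"
    "chain_homotopic C Y Y (\<lambda>n. Idn C (obj Y n) \<cdot> (f n \<cdot> V n)) (\<lambda>n. Idn C (obj Y n) \<cdot> (U n \<cdot> V n))"
    by (rule chain_homotopic_comp[OF Y Y Y Y id Vc Uc hfU] chain_homotopic_comp[OF Y Y Y Y Vc id Uc hfU])+
  then have "chain_homotopic C Y Y (\<lambda>n. V n \<cdot> f n) (\<lambda>n. Idn C (obj Y n))"
    "chain_homotopic C Y Y (\<lambda>n. f n \<cdot> V n) (\<lambda>n. Idn C (obj Y n))"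
    using chain_mapD[OF f] HomsD[OF U] HomsD[OF V] by (simp_all add: cat_simps VU UV)
  with Vc show ?thesis by blast
qed

text \<open>The objects \<open>S n\<close> are prescribed, since they will have to lie in
  \<open>B\<close>. The off-diagonal part is transported along the equivalences, and the comparison
  maps are upper triangular with the given equivalences on the diagonal. Both composites are then of
  the kind treated in the preceding lemma.\<close>

lemma split_extension_homotopy_equivalent:
  assumes E: "split_extension C X Y Z i p j q \<delta>"
    and heX: "homotopy_equivalent C X X'" and heZ: "homotopy_equivalent C Z Z'"
    and S: "\<And>n. is_biproduct C (obj X' n) (obj Z' n) (S n)"
  shows "\<exists>Y'. obj Y' = S \<and> homotopy_equivalent C Y Y'"
proof -
  have "\<forall>n. \<exists>i j p q. i \<in> Homs C (obj X' n) (S n) \<and> j \<in> Homs C (obj Z' n) (S n) \<and>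
      p \<in> Homs C (S n) (obj X' n) \<and> q \<in> Homs C (S n) (obj Z' n) \<and>
      p \<cdot> i = Idn C (obj X' n) \<and> q \<cdot> j = Idn C (obj Z' n) \<and>
      q \<cdot> i = Zro C (obj X' n) (obj Z' n) \<and> p \<cdot> j = Zro C (obj Z' n) (obj X' n) \<and> i \<cdot> p \<boxplus> j \<cdot> q = Idn C (S n)"
    using S unfolding is_biproduct_def by blast
  from this[unfolded choice_iff] obtain i' j' p' q' where bp: "\<And>n. i' n \<in> Homs C (obj X' n) (S n)" "\<And>n. j' n \<in> Homs C (obj Z' n) (S n)"
      "\<And>n. p' n \<in> Homs C (S n) (obj X' n)" "\<And>n. q' n \<in> Homs C (S n) (obj Z' n)"
      "\<And>n. p' n \<cdot> i' n = Idn C (obj X' n)" "\<And>n. q' n \<cdot> j' n = Idn C (obj Z' n)"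
      "\<And>n. q' n \<cdot> i' n = Zro C (obj X' n) (obj Z' n)" "\<And>n. p' n \<cdot> j' n = Zro C (obj Z' n) (obj X' n)"
      "\<And>n. i' n \<cdot> p' n \<boxplus> j' n \<cdot> q' n = Idn C (S n)"
    by blast
  obtain a a' where X: "is_complex C X" and X': "is_complex C X'" and a: "is_chain_map C X X' a"
    and a': "is_chain_map C X' X a'"
    and aa: "chain_homotopic C X X (\<lambda>i. a' i \<cdot> a i) (\<lambda>i. Idn C (obj X i))"
    and aa': "chain_homotopic C X' X' (\<lambda>i. a i \<cdot> a' i) (\<lambda>i. Idn C (obj X' i))"
    by (rule homotopy_equivalentE[OF heX])
  obtain b b' where Z: "is_complex C Z" and Z': "is_complex C Z'" and b: "is_chain_map C Z Z' b"
    and b': "is_chain_map C Z' Z b'"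
    and bb: "chain_homotopic C Z Z (\<lambda>i. b' i \<cdot> b i) (\<lambda>i. Idn C (obj Z i))"
    and bb': "chain_homotopic C Z' Z' (\<lambda>i. b i \<cdot> b' i) (\<lambda>i. Idn C (obj Z' i))"
    by (rule homotopy_equivalentE[OF heZ])
  obtain h where h: "\<And>n. h n \<in> Ar C" "\<And>n. Dom C (h n) = obj X n" "\<And>n. Cod C (h n) = obj X (n - 1)"
    and aah: "\<And>n. a' n \<cdot> a n = Idn C (obj X n) \<boxplus> (dif X (n - 1) \<cdot> h n \<boxplus> h (n + 1) \<cdot> dif X n)"
    using chain_homotopicD[OF aa] by metis
  obtain h' where h': "\<And>n. h' n \<in> Ar C" "\<And>n. Dom C (h' n) = obj X' n" "\<And>n. Cod C (h' n) = obj X' (n - 1)"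
    and aah': "\<And>n. a n \<cdot> a' n = Idn C (obj X' n) \<boxplus> (dif X' (n - 1) \<cdot> h' n \<boxplus> h' (n + 1) \<cdot> dif X' n)"
    using chain_homotopicD[OF aa'] by metis
  obtain k where k: "\<And>n. k n \<in> Ar C" "\<And>n. Dom C (k n) = obj Z n" "\<And>n. Cod C (k n) = obj Z (n - 1)"
    and bbk: "\<And>n. b' n \<cdot> b n = Idn C (obj Z n) \<boxplus> (dif Z (n - 1) \<cdot> k n \<boxplus> k (n + 1) \<cdot> dif Z n)"
    using chain_homotopicD[OF bb] by metis
  obtain k' where k': "\<And>n. k' n \<in> Ar C" "\<And>n. Dom C (k' n) = obj Z' n" "\<And>n. Cod C (k' n) = obj Z' (n - 1)"
    and bbk': "\<And>n. b n \<cdot> b' n = Idn C (obj Z' n) \<boxplus> (dif Z' (n - 1) \<cdot> k' n \<boxplus> k' (n + 1) \<cdot> dif Z' n)"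
    using chain_homotopicD[OF bb'] by metis
  note Y = split_extensionD(2)[OF E]
  have ob: "S n \<in> Ob C" for n using S[of n] unfolding is_biproduct_def by blast
  note [simp] = split_extensionD(4-)[OF E] is_complexD[OF X] is_complexD[OF X'] is_complexD[OF Z] is_complexD[OF Z']
    is_complexD[OF Y] split_extension_eqs[OF E] split_extension_eqs'[OF E] split_extension_dif[OF E]
    split_extension_delta[OF E] HomsD[OF bp(1)] HomsD[OF bp(2)] HomsD[OF bp(3)] HomsD[OF bp(4)]
    bp(5-8) chain_mapD[OF a] chain_mapD[OF a'] chain_mapD[OF b] chain_mapD[OF b'] h h' k k' ob
    chain_map_dif[OF X X' a] chain_map_dif[OF X' X a'] chain_map_dif[OF Z Z' b] chain_map_dif[OF Z' Z b']
    complex_dd[OF X] complex_dd[OF X'] complex_dd[OF Z] complex_dd[OF Z']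
  \<comment> \<open>The only candidate: go back from \<open>Z'\<close> to \<open>Z\<close>, apply
    \<delta>, and go forward from \<open>X\<close> to \<open>X'\<close>.\<close>
  define \<delta>' where "\<delta>' n = a (n + 1) \<cdot> (\<delta> n \<cdot> b' n)" for n
  define Y' where "Y' = \<lparr>obj = S, dif = (\<lambda>n. i' (n + 1) \<cdot> (dif X' n \<cdot> p' n) \<boxplus>
            (j' (n + 1) \<cdot> (dif Z' n \<cdot> q' n) \<boxplus> i' (n + 1) \<cdot> (\<delta>' n \<cdot> q' n)))\<rparr>"
  have [simp]: "obj Y' = S" by (simp add: Y'_def)
  have [simp]: "\<delta>' n \<in> Ar C" "Dom C (\<delta>' n) = obj Z' n" "Cod C (\<delta>' n) = obj X' (n + 1)" for n
    unfolding \<delta>'_def by (simp_all add: cat_simps)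
  have bp': "t \<in> Ar C \<Longrightarrow> Cod C t = obj X' n \<Longrightarrow> p' n \<cdot> (i' n \<cdot> t) = t"
    "t \<in> Ar C \<Longrightarrow> Cod C t = obj X' n \<Longrightarrow> q' n \<cdot> (i' n \<cdot> t) = Zro C (Dom C t) (obj Z' n)"
    "t \<in> Ar C \<Longrightarrow> Cod C t = obj Z' n \<Longrightarrow> q' n \<cdot> (j' n \<cdot> t) = t"
    "t \<in> Ar C \<Longrightarrow> Cod C t = obj Z' n \<Longrightarrow> p' n \<cdot> (j' n \<cdot> t) = Zro C (Dom C t) (obj X' n)" for n t
    using bp(5,7,6,8)[of n, THEN Cmp_assoc_eq, of t] by (simp_all add: cat_simps)
  have d1: "dif X' m \<cdot> \<delta>' (m - 1) \<boxplus> \<delta>' m \<cdot> dif Z' (m - 1) = Zro C (obj Z' (m - 1)) (obj X' (m + 1))" for m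
    unfolding \<delta>'_def
    apply (simp add: cat_simps)
    apply (rule lin_eqI[of "obj Z' (m - 1)" "obj X' (m + 1)"])
    apply (rule lin_Pls lin_neg lin_Zro lin_atom' | (simp add: cat_simps; fail) | (simp add: algebra_simps; fail))+
    done
  then have d2: "\<delta>' m \<cdot> dif Z' (m - 1) = neg_arrow C (dif X' m \<cdot> \<delta>' (m - 1))" for m
    by (rule neg_unique[rotated -1]) (simp_all add: cat_simps)
  have d2': "\<delta>' m \<cdot> (dif Z' (m - 1) \<cdot> t) = neg_arrow C (dif X' m \<cdot> (\<delta>' (m - 1) \<cdot> t))"
    if "t \<in> Ar C" "Cod C t = obj Z' (m - 1)" for m t
    using d2[of m, THEN Cmp_assoc_eq, of t] that by (simp add: cat_simps)
  have Y': "is_complex C Y'"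
  proof -
    have "dif Y' n \<in> Homs C (S n) (S (n + 1))" for n
      unfolding Y'_def by (simp add: cat_simps)
    moreover have "dif Y' m \<cdot> dif Y' (m - 1) = Zro C (S (m - 1)) (S (m + 1))" for m
      unfolding Y'_def
      apply (simp add: cat_simps bp' d2 d2')
      apply (rule lin_eqI[of "S (m - 1)" "S (m + 1)"])
      apply (rule lin_Pls lin_neg lin_Zro lin_atom' | (simp add: cat_simps; fail) | (simp add: algebra_simps; fail))+
      done
    from this[of "n + 1" for n] have "dif Y' (n + 1) \<cdot> dif Y' n = Zro C (S n) (S (n + 2))" for n
      by (simp only: add.assoc one_add_one add_diff_cancel_right')
    ultimately show ?thesis unfolding is_complex_def by simp
  qed
  have E': "split_extension C X' Y' Z' i' p' j' q' \<delta>'"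
    unfolding split_extension_def using X' Y' Z' bp d1 by (simp add: Y'_def HomsI)
  note [simp] = is_complexD[OF Y'] split_extension_dif[OF E'] split_extension_delta[OF E'] bp'
  \<comment> \<open>The diagonal maps alone do not commute with the off-diagonal parts: going
    through \<delta>' inserts \<open>b' b\<close>, respectively \<open>a' a\<close>, instead of an
    identity. The homotopies \<open>k\<close> and \<open>h\<close> supply the corrections.\<close>
  define s where "s n = a n \<cdot> (\<delta> (n - 1) \<cdot> k n)" for n
  define t where "t n = h (n + 1) \<cdot> (\<delta> n \<cdot> b' n)" for n
  define \<Phi> where "\<Phi> n = i' n \<cdot> (a n \<cdot> p n) \<boxplus> (j' n \<cdot> (b n \<cdot> q n) \<boxplus> i' n \<cdot> (s n \<cdot> q n))" for n
  define \<Psi> where "\<Psi> n = i n \<cdot> (a' n \<cdot> p' n) \<boxplus> (j n \<cdot> (b' n \<cdot> q' n) \<boxplus> i n \<cdot> (t n \<cdot> q' n))" for n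
  have bbk1: "b' n \<cdot> (b n \<cdot> f) = f \<boxplus> (dif Z (n - 1) \<cdot> (k n \<cdot> f) \<boxplus> k (n + 1) \<cdot> (dif Z n \<cdot> f))"
    if "f \<in> Ar C" "Cod C f = obj Z n" for n f
    using bbk[of n, THEN Cmp_assoc_eq, of f] that by (simp add: cat_simps)
  have aah1: "a' n \<cdot> (a n \<cdot> f) = f \<boxplus> (dif X (n - 1) \<cdot> (h n \<cdot> f) \<boxplus> h (n + 1) \<cdot> (dif X n \<cdot> f))"
    if "f \<in> Ar C" "Cod C f = obj X n" for n f
    using aah[of n, THEN Cmp_assoc_eq, of f] that by (simp add: cat_simps)
  have st: "s n \<in> Homs C (obj Z n) (obj X' n)" "t n \<in> Homs C (obj Z' n) (obj X n)" for n
    unfolding s_def t_def by (simp_all add: cat_simps)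
  note [simp] = HomsD[OF st(1)] HomsD[OF st(2)]
  have \<Phi>: "is_chain_map C Y Y' \<Phi>"
  proof (rule chain_mapI)
    show "\<Phi> m \<in> Homs C (obj Y m) (obj Y' m)" for m
      unfolding \<Phi>_def by (simp add: cat_simps)
    show "\<Phi> m \<cdot> dif Y (m - 1) = dif Y' (m - 1) \<cdot> \<Phi> (m - 1)" for m
      unfolding \<Phi>_def
      apply (simp add: cat_simps s_def)
      apply (simp add: cat_simps \<delta>'_def bbk1)
      apply (rule lin_eqI[of "obj Y (m - 1)" "S m"])
      apply (rule lin_Pls lin_neg lin_Zro lin_atom' | (simp add: cat_simps; fail) | (simp add: algebra_simps; fail))+
      done
  qed
  have \<Psi>: "is_chain_map C Y' Y \<Psi>"
  proof (rule chain_mapI)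
    show "\<Psi> m \<in> Homs C (obj Y' m) (obj Y m)" for m
      unfolding \<Psi>_def by (simp add: cat_simps)
    show "\<Psi> m \<cdot> dif Y' (m - 1) = dif Y (m - 1) \<cdot> \<Psi> (m - 1)" for m
      unfolding \<Psi>_def
      apply (simp add: cat_simps t_def)
      apply (simp add: cat_simps \<delta>'_def aah1)
      apply (rule lin_eqI[of "S (m - 1)" "obj Y m"])
      apply (rule lin_Pls lin_neg lin_Zro lin_atom' | (simp add: cat_simps; fail) | (simp add: algebra_simps; fail))+
      done
  qed
  have 1: "\<Psi> n \<cdot> \<Phi> n = i n \<cdot> ((Idn C (obj X n) \<boxplus> (dif X (n - 1) \<cdot> h n \<boxplus> h (n + 1) \<cdot> dif X n)) \<cdot> p n) \<boxplus>
       (j n \<cdot> ((Idn C (obj Z n) \<boxplus> (dif Z (n - 1) \<cdot> k n \<boxplus> k (n + 1) \<cdot> dif Z n)) \<cdot> q n) \<boxplus>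
        i n \<cdot> ((a' n \<cdot> s n \<boxplus> t n \<cdot> b n) \<cdot> q n))" for n
    unfolding aah[symmetric] bbk[symmetric] \<Phi>_def \<Psi>_def
    apply (simp add: cat_simps)
    apply (rule lin_eqI[of "obj Y n" "obj Y n"])
    apply (rule lin_Pls lin_neg lin_Zro lin_atom' | (simp add: cat_simps; fail) | (simp add: algebra_simps; fail))+
    done
  have 2: "\<Phi> n \<cdot> \<Psi> n = i' n \<cdot> ((Idn C (obj X' n) \<boxplus> (dif X' (n - 1) \<cdot> h' n \<boxplus> h' (n + 1) \<cdot> dif X' n)) \<cdot> p' n) \<boxplus>
       (j' n \<cdot> ((Idn C (obj Z' n) \<boxplus> (dif Z' (n - 1) \<cdot> k' n \<boxplus> k' (n + 1) \<cdot> dif Z' n)) \<cdot> q' n) \<boxplus>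
        i' n \<cdot> ((a n \<cdot> t n \<boxplus> s n \<cdot> b' n) \<cdot> q' n))" for n
    unfolding aah'[symmetric] bbk'[symmetric] \<Phi>_def \<Psi>_def
    apply (simp add: cat_simps)
    apply (rule lin_eqI[of "S n" "S n"])
    apply (rule lin_Pls lin_neg lin_Zro lin_atom' | (simp add: cat_simps; fail) | (simp add: algebra_simps; fail))+
    done
  \<comment> \<open>Neither composite is claimed to be homotopic to the identity; both are only
    invertible up to homotopy, giving a left inverse \<open>v \<Psi>\<close> and a right inverse
    \<open>\<Psi> v'\<close> of \<Phi>.\<close>
  obtain v where v: "is_chain_map C Y Y v" "chain_homotopic C Y Y (\<lambda>n. v n \<cdot> (\<Psi> n \<cdot> \<Phi> n)) (\<lambda>n. Idn C (obj Y n))"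
    using unipotent_homotopy_invertible[OF E chain_map_comp[OF Y Y' Y \<Phi> \<Psi>] _ _ _ 1]
    by (auto simp: cat_simps)
  obtain v' where v': "is_chain_map C Y' Y' v'" "chain_homotopic C Y' Y' (\<lambda>n. (\<Phi> n \<cdot> \<Psi> n) \<cdot> v' n) (\<lambda>n. Idn C (obj Y' n))"
    using unipotent_homotopy_invertible[OF E' chain_map_comp[OF Y' Y Y' \<Psi> \<Phi>] _ _ _ 2]
    by (auto simp: cat_simps)
  note [simp] = chain_mapD[OF v(1)] chain_mapD[OF v'(1)] chain_mapD[OF \<Phi>] chain_mapD[OF \<Psi>]
  have "homotopy_equivalent C Y Y'"
    by (rule homotopy_equivalentI_one_sided[OF Y Y' \<Phi> chain_map_comp[OF Y' Y Y \<Psi> v(1)] chain_map_comp[OF Y' Y' Y v'(1) \<Psi>]])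
      (use v(2) v'(2) in \<open>simp_all add: Cmp_assoc'\<close>)
  then show ?thesis by (intro exI[of _ Y']) simp
qed

end

section \<open>Full subcategories and additive functors\<close>

context preadditive_category
begin

text \<open>Reduces a universal property to one equation between arrows, which passes to full
  subcategories and through additive functors.\<close>

lemma zero_object_iff: "is_zero_object C Z \<longleftrightarrow> Z \<in> Ob C \<and> Idn C Z = Zro C Z Z"
proof
  assume *: "is_zero_object C Z"
  then have "Z \<in> Ob C" "\<exists>!f. f \<in> Homs C Z Z" unfolding is_zero_object_def by blast+
  then show "Z \<in> Ob C \<and> Idn C Z = Zro C Z Z" using Idn_in[of Z] Zro_in[of Z Z] by blast
next
  assume *: "Z \<in> Ob C \<and> Idn C Z = Zro C Z Z"
  have "f = Zro C Z X" if "f \<in> Homs C Z X" for f X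
    using Idn_right[OF that] Cmp_Zro(1)[OF that, of Z] * by simp
  moreover have "f = Zro C X Z" if "f \<in> Homs C X Z" for f X
    using Idn_left[OF that] Cmp_Zro(2)[OF that, of Z] * by simp
  ultimately show "is_zero_object C Z" unfolding is_zero_object_def using * Zro_in by metis
qed

lemma zero_object_arrow:
  assumes "is_zero_object C Z"
  shows "f \<in> Homs C Z X \<Longrightarrow> f = Zro C Z X" "f \<in> Homs C X Z \<Longrightarrow> f = Zro C X Z"
  using assms Zro_in Homs_Ob unfolding is_zero_object_def by metis+

lemma isomorphicI:
  assumes "f \<in> Homs C X Y" "g \<in> Homs C Y X" "g \<cdot> f = Idn C X" "f \<cdot> g = Idn C Y"
  shows "isomorphic C X Y" "is_iso_arrow C f"
  using assms unfolding isomorphic_def is_iso_arrow_def by (auto simp: Homs_def)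

lemma is_iso_arrowE:
  assumes "is_iso_arrow C f" "f \<in> Homs C X Y"
  obtains g where "g \<in> Homs C Y X" "g \<cdot> f = Idn C X" "f \<cdot> g = Idn C Y"
  using assms unfolding is_iso_arrow_def by (auto simp: Homs_def)

lemma isomorphicE:
  assumes "isomorphic C X Y"
  obtains f g where "f \<in> Homs C X Y" "g \<in> Homs C Y X" "g \<cdot> f = Idn C X" "f \<cdot> g = Idn C Y"
  using assms is_iso_arrowE unfolding isomorphic_def by metis

lemma isomorphic_refl: "X \<in> Ob C \<Longrightarrow> isomorphic C X X"
  using isomorphicI(1)[OF Idn_in Idn_in] Idn_left[OF Idn_in] by blast

lemma isomorphic_sym: "isomorphic C X Y \<Longrightarrow> isomorphic C Y X"
  by (elim isomorphicE) (rule isomorphicI)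

lemma isomorphic_Ob:
  assumes "isomorphic C X Y"
  shows "X \<in> Ob C" "Y \<in> Ob C"
  using assms Homs_Ob by (auto elim!: isomorphicE)

lemma iso_arrow_Cmp:
  assumes "is_iso_arrow C f" "is_iso_arrow C g" "Cod C f = Dom C g"
  shows "is_iso_arrow C (g \<cdot> f)"
proof -
  obtain f' where f: "f \<in> Ar C" "f' \<in> Homs C (Cod C f) (Dom C f)" "f' \<cdot> f = Idn C (Dom C f)" "f \<cdot> f' = Idn C (Cod C f)"
    using assms(1) unfolding is_iso_arrow_def by blast
  obtain g' where g: "g \<in> Ar C" "g' \<in> Homs C (Cod C g) (Dom C g)" "g' \<cdot> g = Idn C (Dom C g)" "g \<cdot> g' = Idn C (Cod C g)"
    using assms(2) unfolding is_iso_arrow_def by blast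
  note [simp] = f(1) g(1) HomsD[OF f(2)] HomsD[OF g(2)] assms(3)
  have "f' \<cdot> g' \<cdot> (g \<cdot> f) = Idn C (Dom C (g \<cdot> f))"
    using g(3)[THEN Cmp_assoc_eq, of f] f(3) by (simp add: cat_simps Dom_Ob Cod_Ob)
  moreover have "g \<cdot> f \<cdot> (f' \<cdot> g') = Idn C (Cod C (g \<cdot> f))"
    using f(4)[THEN Cmp_assoc_eq, of g'] g(4) by (simp add: cat_simps Dom_Ob Cod_Ob)
  ultimately show ?thesis unfolding is_iso_arrow_def
    by (intro conjI bexI[of _ "f' \<cdot> g'"]) (simp_all add: HomsI cat_simps)
qed

lemma isomorphic_trans: "isomorphic C X Y \<Longrightarrow> isomorphic C Y Z \<Longrightarrow> isomorphic C X Z"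
  unfolding isomorphic_def using iso_arrow_Cmp Cmp_in by (metis HomsD(2,3))

lemma iso_class_eq_iff: "X \<in> Ob C \<Longrightarrow> Y \<in> Ob C \<Longrightarrow> iso_class C X = iso_class C Y \<longleftrightarrow> isomorphic C X Y"
  unfolding iso_class_def using isomorphic_refl isomorphic_sym isomorphic_trans by blast

lemma zero_object_isomorphic:
  assumes "is_zero_object C Z" "is_zero_object C Z'"
  shows "isomorphic C Z Z'"
  using assms Zro_in[of Z Z'] Zro_in[of Z' Z] Cmp_Zro[OF Zro_in[of Z Z'], of Z'] Cmp_Zro[OF Zro_in[of Z' Z], of Z]
  by (intro isomorphicI(1)[of "Zro C Z Z'" _ _ "Zro C Z' Z"]) (auto simp: zero_object_iff Cmp_Zro)

lemma zero_object_iso: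
  assumes "isomorphic C X Y" "is_zero_object C X"
  shows "is_zero_object C Y"
proof -
  obtain f g where 1: "f \<in> Homs C X Y" "g \<in> Homs C Y X" "f \<cdot> g = Idn C Y"
    by (rule isomorphicE[OF assms(1)])
  then have "Idn C Y = Zro C Y Y"
    using zero_object_arrow(1)[OF assms(2) 1(1)] Cmp_Zro(2)[OF 1(2)] Homs_Ob[OF 1(1)] by metis
  then show ?thesis using Homs_Ob[OF 1(1)] by (simp add: zero_object_iff)
qed

lemma full_sub_simps [simp]:
  "Ob (full_sub C S) = S" "Dom (full_sub C S) = Dom C" "Cod (full_sub C S) = Cod C"
  "Idn (full_sub C S) = Idn C" "Cmp (full_sub C S) = Cmp C" "Pls (full_sub C S) = Pls C"
  "Zro (full_sub C S) = Zro C"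
  "f \<in> Ar (full_sub C S) \<longleftrightarrow> f \<in> Ar C \<and> Dom C f \<in> S \<and> Cod C f \<in> S"
  "f \<in> Homs (full_sub C S) X Y \<longleftrightarrow> f \<in> Homs C X Y \<and> X \<in> S \<and> Y \<in> S"
  by (auto simp: full_sub_def Homs_def)

lemma full_sub_hom_group: "X \<in> S \<Longrightarrow> Y \<in> S \<Longrightarrow> hom_group (full_sub C S) X Y = hom_group C X Y"
  by (auto simp: hom_group_def)

lemma full_sub_preadditive:
  assumes "S \<subseteq> Ob C"
  shows "preadditive_category (full_sub C S)"
proof -
  have "comm_group (hom_group (full_sub C S) X Y)" if "X \<in> S" "Y \<in> S" for X Y
    using that hom_comm_group[of X Y] assms by (auto simp: full_sub_hom_group)
  then show ?thesis
    unfolding preadditive_category_def using assms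
    by (auto simp: Idn_in Cmp_in Idn_left Idn_right Cmp_assoc Cmp_Pls_left Cmp_Pls_right)
qed

lemma full_sub_Homs: "X \<in> S \<Longrightarrow> Y \<in> S \<Longrightarrow> Homs (full_sub C S) X Y = Homs C X Y"
  by auto

lemma full_sub_zero_object: "S \<subseteq> Ob C \<Longrightarrow> is_zero_object (full_sub C S) Z \<longleftrightarrow> is_zero_object C Z \<and> Z \<in> S"
  using preadditive_category.zero_object_iff[OF full_sub_preadditive] by (auto simp: zero_object_iff)

lemma full_sub_biproduct:
  "S \<subseteq> Ob C \<Longrightarrow> is_biproduct (full_sub C S) X Y Z \<longleftrightarrow> is_biproduct C X Y Z \<and> X \<in> S \<and> Y \<in> S \<and> Z \<in> S"
  by (cases "X \<in> S \<and> Y \<in> S \<and> Z \<in> S") (auto simp: is_biproduct_def full_sub_Homs simp del: full_sub_simps(9))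

lemma full_sub_iso: "is_iso_arrow (full_sub C S) f \<longleftrightarrow> is_iso_arrow C f \<and> Dom C f \<in> S \<and> Cod C f \<in> S"
  by (auto simp: is_iso_arrow_def)

lemma full_sub_isomorphic: "isomorphic (full_sub C S) X Y \<longleftrightarrow> isomorphic C X Y \<and> X \<in> S \<and> Y \<in> S"
  by (auto simp: isomorphic_def full_sub_iso Homs_def)

lemma full_sub_complex:
  "S \<subseteq> Ob C \<Longrightarrow> is_complex (full_sub C S) K \<longleftrightarrow> is_complex C K \<and> (\<forall>i. obj K i \<in> S)"
  by (auto simp: is_complex_def)

text \<open>By fullness, the arrows of chain maps and homotopies between complexes with terms in
  \<open>S\<close> already belong to the subcategory.\<close>

lemma full_sub_homotopy_equivalent:
  assumes "S \<subseteq> Ob C"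
  shows "homotopy_equivalent (full_sub C S) K L \<longleftrightarrow>
    homotopy_equivalent C K L \<and> (\<forall>i. obj K i \<in> S \<and> obj L i \<in> S)"
proof (cases "\<forall>i. obj K i \<in> S \<and> obj L i \<in> S")
  case True
  then show ?thesis
    by (simp add: homotopy_equivalent_def full_sub_complex[OF assms] is_chain_map_def chain_homotopic_def)
next
  case False
  then show ?thesis
    by (auto simp: homotopy_equivalent_def full_sub_complex[OF assms])
qed

end

lemma full_sub_full_sub: "T \<subseteq> S \<Longrightarrow> full_sub (full_sub C S) T = full_sub C T"
  by (auto simp: full_sub_def)

locale additive_functor_between = C: preadditive_category C + D: preadditive_category D
  for C :: "('o, 'm, 'e) cat_scheme" and D :: "('p, 'q, 'f) cat_scheme" (structure) +
  fixes F :: "('o, 'm, 'p, 'q) fnctr"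
  assumes F: "additive_functor C D F"
begin

lemma FOb_in: "X \<in> Ob C \<Longrightarrow> FOb F X \<in> Ob D"
  using F by (simp add: additive_functor_def)

lemma FAr_in: "f \<in> Homs C X Y \<Longrightarrow> FAr F f \<in> Homs D (FOb F X) (FOb F Y)"
  using F by (simp add: additive_functor_def)

lemma FAr_Idn: "X \<in> Ob C \<Longrightarrow> FAr F (Idn C X) = Idn D (FOb F X)"
  using F by (simp add: additive_functor_def)

lemma FAr_Cmp: "f \<in> Homs C X Y \<Longrightarrow> g \<in> Homs C Y Z \<Longrightarrow> FAr F (g \<cdot>\<^bsub>C\<^esub> f) = FAr F g \<cdot> FAr F f"
  using F unfolding additive_functor_def by blast

lemma FAr_Pls: "f \<in> Homs C X Y \<Longrightarrow> g \<in> Homs C X Y \<Longrightarrow> FAr F (f \<boxplus>\<^bsub>C\<^esub> g) = FAr F f \<boxplus> FAr F g"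
  using F unfolding additive_functor_def by blast

lemma FAr_Zro: "X \<in> Ob C \<Longrightarrow> Y \<in> Ob C \<Longrightarrow> FAr F (Zro C X Y) = Zro D (FOb F X) (FOb F Y)"
  using FAr_Pls[OF C.Zro_in C.Zro_in, of X Y] C.Pls_Zro(1)[OF C.Zro_in[of X Y]]
  by (intro D.Pls_self_zero FAr_in[OF C.Zro_in]) auto

lemma FAr_arr:
  assumes "f \<in> Ar C"
  shows "FAr F f \<in> Ar D" "Dom D (FAr F f) = FOb F (Dom C f)" "Cod D (FAr F f) = FOb F (Cod C f)"
  using FAr_in[of f "Dom C f" "Cod C f"] assms by (simp_all add: Homs_def)

lemma FAr_Cmp': "f \<in> Ar C \<Longrightarrow> g \<in> Ar C \<Longrightarrow> Cod C f = Dom C g \<Longrightarrow> FAr F (g \<cdot>\<^bsub>C\<^esub> f) = FAr F g \<cdot> FAr F f"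
  using FAr_Cmp[of f "Dom C f" "Cod C f" g "Cod C g"] by (simp add: Homs_def)

lemma FAr_Pls': "f \<in> Ar C \<Longrightarrow> g \<in> Ar C \<Longrightarrow> Dom C f = Dom C g \<Longrightarrow> Cod C f = Cod C g
    \<Longrightarrow> FAr F (f \<boxplus>\<^bsub>C\<^esub> g) = FAr F f \<boxplus> FAr F g"
  using FAr_Pls[of f "Dom C f" "Cod C f" g] by (simp add: Homs_def)

lemma map_complex: "is_complex C K \<Longrightarrow> is_complex D (map_cpx F K)"
  unfolding is_complex_def map_cpx_def
  using FOb_in FAr_in FAr_Cmp FAr_Zro by (simp; metis)

lemma map_chain_map:
  assumes "is_complex C K" "is_complex C L" "is_chain_map C K L f"
  shows "is_chain_map D (map_cpx F K) (map_cpx F L) (\<lambda>i. FAr F (f i))"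
proof -
  note K = assms(1)[unfolded is_complex_def] and L = assms(2)[unfolded is_complex_def]
    and f = assms(3)[unfolded is_chain_map_def]
  have "FAr F (f (i + 1)) \<cdot> FAr F (dif K i) = FAr F (dif L i) \<cdot> FAr F (f i)" for i
    using FAr_Cmp[of "dif K i" "obj K i" "obj K (i + 1)" "f (i + 1)"]
      FAr_Cmp[of "f i" "obj K i" "obj L i" "dif L i"] K L f by metis
  then show ?thesis
    using f FAr_in unfolding is_chain_map_def map_cpx_def by simp
qed

lemma map_chain_homotopic:
  assumes "is_complex C K" "is_complex C L" "is_chain_map C K L g" "chain_homotopic C K L f g"
  shows "chain_homotopic D (map_cpx F K) (map_cpx F L) (\<lambda>i. FAr F (f i)) (\<lambda>i. FAr F (g i))"
proof -
  note [simp] = C.is_complexD[OF assms(1)] C.is_complexD[OF assms(2)] C.chain_mapD[OF assms(3)]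
  obtain h where h: "\<And>i. h i \<in> Homs C (obj K i) (obj L (i - 1))"
    and eq: "\<And>i. f i = g i \<boxplus>\<^bsub>C\<^esub> (dif L (i - 1) \<cdot>\<^bsub>C\<^esub> h i \<boxplus>\<^bsub>C\<^esub> h (i + 1) \<cdot>\<^bsub>C\<^esub> dif K i)"
    using assms(4) unfolding chain_homotopic_def by blast
  note [simp] = HomsD[OF h]
  have "FAr F (f i) = FAr F (g i) \<boxplus> (FAr F (dif L (i - 1)) \<cdot> FAr F (h i) \<boxplus> FAr F (h (i + 1)) \<cdot> FAr F (dif K i))" for i
  proof -
    have "FAr F (dif L (i - 1) \<cdot>\<^bsub>C\<^esub> h i) = FAr F (dif L (i - 1)) \<cdot> FAr F (h i)"
      by (rule FAr_Cmp[of _ "obj K i" "obj L (i - 1)" _ "obj L i"]) (simp_all add: C.cat_simps)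
    moreover have "FAr F (h (i + 1) \<cdot>\<^bsub>C\<^esub> dif K i) = FAr F (h (i + 1)) \<cdot> FAr F (dif K i)"
      by (rule FAr_Cmp[of _ "obj K i" "obj K (i + 1)" _ "obj L i"]) (simp_all add: C.cat_simps)
    moreover have "FAr F (dif L (i - 1) \<cdot>\<^bsub>C\<^esub> h i \<boxplus>\<^bsub>C\<^esub> h (i + 1) \<cdot>\<^bsub>C\<^esub> dif K i)
        = FAr F (dif L (i - 1) \<cdot>\<^bsub>C\<^esub> h i) \<boxplus> FAr F (h (i + 1) \<cdot>\<^bsub>C\<^esub> dif K i)"
      by (rule FAr_Pls[of _ "obj K i" "obj L i"]) (simp_all add: C.cat_simps)
    moreover have "FAr F (f i) = FAr F (g i) \<boxplus> FAr F (dif L (i - 1) \<cdot>\<^bsub>C\<^esub> h i \<boxplus>\<^bsub>C\<^esub> h (i + 1) \<cdot>\<^bsub>C\<^esub> dif K i)"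
      unfolding eq by (rule FAr_Pls[of _ "obj K i" "obj L i"]) (simp_all add: C.cat_simps)
    ultimately show ?thesis by simp
  qed
  then show ?thesis
    using FAr_in[OF h] unfolding chain_homotopic_def map_cpx_def by (intro exI[of _ "\<lambda>i. FAr F (h i)"]) simp
qed

lemma map_homotopy_equivalent:
  assumes "homotopy_equivalent C K L"
  shows "homotopy_equivalent D (map_cpx F K) (map_cpx F L)"
proof -
  obtain f g where fg: "is_complex C K" "is_complex C L" "is_chain_map C K L f" "is_chain_map C L K g"
    "chain_homotopic C K K (\<lambda>i. g i \<cdot>\<^bsub>C\<^esub> f i) (\<lambda>i. Idn C (obj K i))"
    "chain_homotopic C L L (\<lambda>i. f i \<cdot>\<^bsub>C\<^esub> g i) (\<lambda>i. Idn C (obj L i))"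
    by (rule C.homotopy_equivalentE[OF assms])
  have f: "f i \<in> Homs C (obj K i) (obj L i)" and g: "g i \<in> Homs C (obj L i) (obj K i)" for i
    using fg(3,4) unfolding is_chain_map_def by blast+
  have "FAr F (g i \<cdot>\<^bsub>C\<^esub> f i) = FAr F (g i) \<cdot> FAr F (f i)" "FAr F (f i \<cdot>\<^bsub>C\<^esub> g i) = FAr F (f i) \<cdot> FAr F (g i)" for i
    using FAr_Cmp[OF f g] FAr_Cmp[OF g f] by blast+
  then show ?thesis
    using map_complex[OF fg(1)] map_complex[OF fg(2)] map_chain_map[OF fg(1,2,3)] map_chain_map[OF fg(2,1,4)]
      map_chain_homotopic[OF fg(1,1) C.chain_map_id[OF fg(1)] fg(5)]
      map_chain_homotopic[OF fg(2,2) C.chain_map_id[OF fg(2)] fg(6)]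
      C.is_complexD(1)[OF fg(1)] C.is_complexD(1)[OF fg(2)]
    unfolding homotopy_equivalent_def by (auto simp: FAr_Idn map_cpx_def)
qed

lemma map_biproduct: "is_biproduct C X Y S \<Longrightarrow> is_biproduct D (FOb F X) (FOb F Y) (FOb F S)"
  unfolding is_biproduct_def
proof (elim conjE bexE, intro conjI)
  fix i j p q
  assume O: "X \<in> Ob C" "Y \<in> Ob C" "S \<in> Ob C"
    and h: "i \<in> Homs C X S" "j \<in> Homs C Y S" "p \<in> Homs C S X" "q \<in> Homs C S Y"
    and e: "p \<cdot>\<^bsub>C\<^esub> i = Idn C X" "q \<cdot>\<^bsub>C\<^esub> j = Idn C Y" "q \<cdot>\<^bsub>C\<^esub> i = Zro C X Y" "p \<cdot>\<^bsub>C\<^esub> j = Zro C Y X"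
      "i \<cdot>\<^bsub>C\<^esub> p \<boxplus>\<^bsub>C\<^esub> j \<cdot>\<^bsub>C\<^esub> q = Idn C S"
  show "FOb F X \<in> Ob D" "FOb F Y \<in> Ob D" "FOb F S \<in> Ob D" using O FOb_in by auto
  have "FAr F p \<cdot> FAr F i = Idn D (FOb F X)" "FAr F q \<cdot> FAr F j = Idn D (FOb F Y)"
    "FAr F q \<cdot> FAr F i = Zro D (FOb F X) (FOb F Y)" "FAr F p \<cdot> FAr F j = Zro D (FOb F Y) (FOb F X)"
    using FAr_Cmp[OF h(1,3)] FAr_Cmp[OF h(2,4)] FAr_Cmp[OF h(1,4)] FAr_Cmp[OF h(2,3)] e FAr_Idn FAr_Zro O
    by auto
  moreover have "FAr F i \<cdot> FAr F p \<boxplus> FAr F j \<cdot> FAr F q = Idn D (FOb F S)"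
    using FAr_Cmp[OF h(3,1)] FAr_Cmp[OF h(4,2)] FAr_Pls[OF C.Cmp_in[OF h(3,1)] C.Cmp_in[OF h(4,2)]] e(5) FAr_Idn O
    by simp
  ultimately show "\<exists>i \<in> Homs D (FOb F X) (FOb F S). \<exists>j \<in> Homs D (FOb F Y) (FOb F S).
     \<exists>p \<in> Homs D (FOb F S) (FOb F X). \<exists>q \<in> Homs D (FOb F S) (FOb F Y).
        p \<cdot> i = Idn D (FOb F X) \<and> q \<cdot> j = Idn D (FOb F Y) \<and>
        q \<cdot> i = Zro D (FOb F X) (FOb F Y) \<and> p \<cdot> j = Zro D (FOb F Y) (FOb F X) \<and>
        i \<cdot> p \<boxplus> j \<cdot> q = Idn D (FOb F S)"
    using h[THEN FAr_in] by blast
qed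

lemma map_zero_object: "is_zero_object C Z \<Longrightarrow> is_zero_object D (FOb F Z)"
  using FAr_Idn[of Z] FAr_Zro[of Z Z] FOb_in[of Z] by (simp add: C.zero_object_iff D.zero_object_iff)

end

section \<open>Contractible complexes\<close>

context preadditive_category
begin

lemma is_complexI:
  assumes "\<And>m. obj K m \<in> Ob C" "\<And>m. dif K m \<in> Homs C (obj K m) (obj K (m + 1))"
    and "\<And>m. dif K m \<cdot> dif K (m - 1) = Zro C (obj K (m - 1)) (obj K (m + 1))"
  shows "is_complex C K"
proof -
  have "dif K (n + 1) \<cdot> dif K n = Zro C (obj K n) (obj K (n + 2))" for n
    using assms(3)[of "n + 1"] by (simp only: add.assoc one_add_one add_diff_cancel_right')
  with assms show ?thesis unfolding is_complex_def by blast
qed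

definition contraction :: "('o, 'm) cpx \<Rightarrow> (int \<Rightarrow> 'm) \<Rightarrow> bool" where
  "contraction K h \<longleftrightarrow> is_complex C K \<and> (\<forall>n. h n \<in> Homs C (obj K n) (obj K (n - 1))) \<and>
     (\<forall>n. dif K (n - 1) \<cdot> h n \<boxplus> h (n + 1) \<cdot> dif K n = Idn C (obj K n))"

lemma contractionD:
  assumes "contraction K h"
  shows "is_complex C K" "h n \<in> Ar C" "Dom C (h n) = obj K n" "Cod C (h n) = obj K (n - 1)"
    "dif K (n - 1) \<cdot> h n \<boxplus> h (n + 1) \<cdot> dif K n = Idn C (obj K n)"
  using assms unfolding contraction_def Homs_def by blast+

text \<open>If \<delta> is invertible up to homotopy with inverse \<open>g\<close>, then
  \<open>Y\<close> is a mapping cone of a homotopy equivalence up to shift. The contraction has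
  \<open>g\<close> as its main entry and the two homotopies, with signs, on the diagonal; the rest
  repairs the lack of compatibility of \<open>k\<close> and \<open>l\<close>.\<close>

lemma split_extension_contraction:
  assumes E: "split_extension C X Y Z i p j q \<delta>"
    and g: "\<And>n. g n \<in> Homs C (obj X n) (obj Z (n - 1))"
    and gd: "\<And>n. g n \<cdot> dif X (n - 1) = neg_arrow C (dif Z (n - 2) \<cdot> g (n - 1))"
    and k: "\<And>n. k n \<in> Homs C (obj X n) (obj X (n - 1))" and l: "\<And>n. l n \<in> Homs C (obj Z n) (obj Z (n - 1))"
    and dg: "\<And>n. \<delta> (n - 1) \<cdot> g n = Idn C (obj X n) \<boxplus> (dif X (n - 1) \<cdot> k n \<boxplus> k (n + 1) \<cdot> dif X n)"
    and gdl: "\<And>n. g (n + 1) \<cdot> \<delta> n = Idn C (obj Z n) \<boxplus> (dif Z (n - 1) \<cdot> l n \<boxplus> l (n + 1) \<cdot> dif Z n)"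
  shows "\<exists>h. contraction Y h"
proof -
  note Y = split_extensionD(2)[OF E]
  note [simp] = split_extensionD(4-)[OF E] is_complexD[OF split_extensionD(1)[OF E]]
    is_complexD[OF split_extensionD(2)[OF E]] is_complexD[OF split_extensionD(3)[OF E]]
    split_extension_eqs[OF E] split_extension_eqs'[OF E] split_extension_dif[OF E] split_extension_delta[OF E]
    HomsD[OF g] HomsD[OF k] HomsD[OF l] complex_dd[OF split_extensionD(1)[OF E]] complex_dd[OF split_extensionD(3)[OF E]]
  have gd1: "g m \<cdot> dif X n = neg_arrow C (dif Z (n - 1) \<cdot> g n)" if "m = n + 1" for m n
    using gd[of m] that by simp
  have gd2: "g m \<cdot> (dif X n \<cdot> t) = neg_arrow C (dif Z (n - 1) \<cdot> (g n \<cdot> t))"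
    if "m = n + 1" "t \<in> Ar C" "Cod C t = obj X n" for m n t
    using gd1[OF that(1), THEN Cmp_assoc_eq, of t] that by (simp add: cat_simps)
  have dg1: "\<delta> m \<cdot> g n = Idn C (obj X n) \<boxplus> (dif X (n - 1) \<cdot> k n \<boxplus> k (n + 1) \<cdot> dif X n)" if "m = n - 1" for m n
    using dg[of n] that by simp
  have dg2: "\<delta> m \<cdot> (g n \<cdot> t) = t \<boxplus> (dif X (n - 1) \<cdot> (k n \<cdot> t) \<boxplus> k (n + 1) \<cdot> (dif X n \<cdot> t))"
    if "m = n - 1" "t \<in> Ar C" "Cod C t = obj X n" for m n t
    using dg1[OF that(1), THEN Cmp_assoc_eq, of t] that by (simp add: cat_simps)
  have gl1: "g m \<cdot> \<delta> n = Idn C (obj Z n) \<boxplus> (dif Z (n - 1) \<cdot> l n \<boxplus> l (n + 1) \<cdot> dif Z n)" if "m = n + 1" for m n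
    using gdl[of n] that by simp
  have gl2: "g m \<cdot> (\<delta> n \<cdot> t) = t \<boxplus> (dif Z (n - 1) \<cdot> (l n \<cdot> t) \<boxplus> l (n + 1) \<cdot> (dif Z n \<cdot> t))"
    if "m = n + 1" "t \<in> Ar C" "Cod C t = obj Z n" for m n t
    using gl1[OF that(1), THEN Cmp_assoc_eq, of t] that by (simp add: cat_simps)
  \<comment> \<open>This measures how far \<open>k\<close> and \<open>l\<close> are from being
    compatible with \<delta>. It is a chain map, and composing it with \<open>g\<close> and
    \<open>l\<close> gives the correction terms.\<close>
  define x where "x n = \<delta> (n - 1) \<cdot> l n \<boxplus> k (n + 1) \<cdot> \<delta> n" for n
  have [simp]: "x n \<in> Ar C" "Dom C (x n) = obj Z n" "Cod C (x n) = obj X n" for n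
    unfolding x_def by (simp_all add: cat_simps)
  have xd: "x m \<cdot> dif Z (m - 1) = dif X (m - 1) \<cdot> x (m - 1)" for m
  proof -
    let ?A = "dif X (m - 1) \<cdot> (\<delta> (m - 2) \<cdot> l (m - 1))" and ?B = "\<delta> (m - 1) \<cdot> (l m \<cdot> dif Z (m - 1))"
      and ?C = "dif X (m - 1) \<cdot> (k m \<cdot> \<delta> (m - 1))" and ?D = "k (m + 1) \<cdot> (dif X m \<cdot> \<delta> (m - 1))"
    \<comment> \<open>The composite \<open>\<delta> g \<delta>\<close> is expanded in two ways, once
      by each homotopy; comparing the results shows that \<open>x\<close> commutes with the
      differentials.\<close>
    have *: "\<delta> (m - 1) \<cdot> (g m \<cdot> \<delta> (m - 1)) = \<delta> (m - 1) \<boxplus> (neg_arrow C ?A \<boxplus> ?B)"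
      by (simp add: cat_simps gl1)
    have **: "\<delta> (m - 1) \<cdot> (g m \<cdot> \<delta> (m - 1)) = \<delta> (m - 1) \<boxplus> (?C \<boxplus> ?D)"
      by (simp add: cat_simps dg2)
    have e: "(\<delta> (m - 1) \<boxplus> neg_arrow C ?A) \<boxplus> ?B = \<delta> (m - 1) \<boxplus> (neg_arrow C ?A \<boxplus> ?B)"
      by (rule Pls_assoc[of _ "obj Z (m - 1)" "obj X m"]) (simp_all add: cat_simps)
    also have "\<dots> = \<delta> (m - 1) \<boxplus> (?C \<boxplus> ?D)" using * ** by simp
    also have "\<dots> = (\<delta> (m - 1) \<boxplus> neg_arrow C ?A) \<boxplus> (?A \<boxplus> (?C \<boxplus> ?D))"
      apply (rule lin_eqI[of "obj Z (m - 1)" "obj X m"])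
      apply (rule lin_Pls lin_neg lin_Zro lin_atom' | (simp add: cat_simps; fail) | (simp add: algebra_simps; fail))+
      done
    finally have B: "?B = ?A \<boxplus> (?C \<boxplus> ?D)"
      by (rule Pls_left_cancel[rotated -1, of _ _ _ "obj Z (m - 1)" "obj X m"]) (simp_all add: cat_simps)
    show ?thesis unfolding x_def
      apply (simp add: cat_simps B)
      apply (rule lin_eqI[of "obj Z (m - 1)" "obj X m"])
      apply (rule lin_Pls lin_neg lin_Zro lin_atom' | (simp add: cat_simps; fail) | (simp add: algebra_simps; fail))+
      done
  qed
  have xd1: "x m \<cdot> dif Z n = dif X n \<cdot> x n" if "m = n + 1" for m n
    using xd[of m] that by simp
  have xd2: "x m \<cdot> (dif Z n \<cdot> t) = dif X n \<cdot> (x n \<cdot> t)" if "m = n + 1" "t \<in> Ar C" "Cod C t = obj Z n" for m n t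
    using xd1[OF that(1), THEN Cmp_assoc_eq, of t] that by (simp add: cat_simps)
  \<comment> \<open>Entry by entry: \<open>g\<close> from \<open>X\<close> to \<open>Z\<close>, the
    negated homotopies on the diagonal with the one on \<open>X\<close> corrected by
    \<open>x g\<close>, and \<open>- x l\<close> from \<open>Z\<close> to \<open>X\<close>.\<close>
  define H where "H n = j (n - 1) \<cdot> (g n \<cdot> p n) \<boxplus> (neg_arrow C (i (n - 1) \<cdot> ((k n \<boxplus> neg_arrow C (x (n - 1) \<cdot> g n)) \<cdot> p n)) \<boxplus>
      (neg_arrow C (j (n - 1) \<cdot> (l n \<cdot> q n)) \<boxplus> neg_arrow C (i (n - 1) \<cdot> (x (n - 1) \<cdot> (l n \<cdot> q n)))))" for n
  have "dif Y (n - 1) \<cdot> H n \<boxplus> H (n + 1) \<cdot> dif Y n = Idn C (obj Y n)" for n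
    unfolding split_extension_sum[OF E, symmetric] H_def
    apply (simp add: cat_simps gd1 gd2 dg1 dg2 gl1 gl2 xd1 xd2)
    apply (simp add: cat_simps x_def)
    apply (rule lin_eqI[of "obj Y n" "obj Y n"])
    apply (rule lin_Pls lin_neg lin_Zro lin_atom' | (simp add: cat_simps; fail) | (simp add: algebra_simps; fail))+
    done
  moreover have "H n \<in> Homs C (obj Y n) (obj Y (n - 1))" for n
    unfolding H_def by (simp add: cat_simps)
  ultimately have "contraction Y H" unfolding contraction_def using Y by blast
  then show ?thesis by blast
qed

text \<open>For a contraction, \<open>d h\<close> and \<open>h d\<close> are complementary
  idempotents. Replacing \<open>h\<close> by \<open>h d h\<close> keeps the contraction, and its
  square contains the product of these two idempotents, which is zero. The vanishing square is what
  makes the shortening of a contractible complex work.\<close>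

lemma contraction_square_zero:
  assumes "contraction K h"
  shows "\<exists>h. contraction K h \<and> (\<forall>n. h (n - 1) \<cdot> h n = Zro C (obj K n) (obj K (n - 2)))"
proof -
  note K = contractionD(1)[OF assms]
  note [simp] = contractionD(2-4)[OF assms] is_complexD[OF K] complex_dd[OF K]
  have hd1: "dif K m \<cdot> h n = Idn C (obj K n) \<boxplus> neg_arrow C (h (n + 1) \<cdot> dif K n)" if "m = n - 1" for m n
  proof -
    have "(h (n + 1) \<cdot> dif K n) \<boxplus> dif K (n - 1) \<cdot> h n = (h (n + 1) \<cdot> dif K n) \<boxplus> (Idn C (obj K n) \<boxplus> neg_arrow C (h (n + 1) \<cdot> dif K n))"
      unfolding contractionD(5)[OF assms, of n, symmetric]
      apply (rule lin_eqI[of "obj K n" "obj K n"])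
      apply (rule lin_Pls lin_neg lin_Zro lin_atom' | (simp add: cat_simps; fail) | (simp add: algebra_simps; fail))+
      done
    from Pls_left_cancel[OF _ _ _ this, of "obj K n" "obj K n"] show ?thesis using that by (simp add: cat_simps)
  qed
  have hd2: "dif K m \<cdot> (h n \<cdot> t) = t \<boxplus> neg_arrow C (h (n + 1) \<cdot> (dif K n \<cdot> t))"
    if "m = n - 1" "t \<in> Ar C" "Cod C t = obj K n" for m n t
    using hd1[OF that(1), THEN Cmp_assoc_eq, of t] that by (simp add: cat_simps)
  \<comment> \<open>The identity \<open>d h = 1 - h d\<close> used as a rewrite rule decides
    everything from here.\<close>
  define h' where "h' n = h n \<cdot> (dif K (n - 1) \<cdot> h n)" for n
  have "dif K (m - 1 - 1) \<cdot> h' (m - 1) \<boxplus> h' m \<cdot> dif K (m - 1) = Idn C (obj K (m - 1))" for m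
    unfolding h'_def
    apply (simp add: cat_simps hd1 hd2)
    apply (rule lin_eqI[of "obj K (m - 1)" "obj K (m - 1)"])
    apply (rule lin_Pls lin_neg lin_Zro lin_atom' | (simp add: cat_simps; fail) | (simp add: algebra_simps; fail))+
    done
  from this[of "n + 1" for n] have "dif K (n - 1) \<cdot> h' n \<boxplus> h' (n + 1) \<cdot> dif K n = Idn C (obj K n)" for n
    by simp
  moreover have "h' n \<in> Homs C (obj K n) (obj K (n - 1))" for n
    unfolding h'_def by (simp add: cat_simps)
  moreover have hh: "h' (m - 2) \<cdot> h' (m - 1) = Zro C (obj K (m - 1)) (obj K (m - 3))" for m
    unfolding h'_def
    apply (simp add: cat_simps hd1 hd2)
    apply (rule lin_eqI[of "obj K (m - 1)" "obj K (m - 3)"])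
    apply (rule lin_Pls lin_neg lin_Zro lin_atom' | (simp add: cat_simps; fail) | (simp add: algebra_simps; fail))+
    done
  have "h' (n - 1) \<cdot> h' n = Zro C (obj K n) (obj K (n - 2))" for n
    using hh[of "n + 1"] by simp
  ultimately have "contraction K h' \<and> (\<forall>n. h' (n - 1) \<cdot> h' n = Zro C (obj K n) (obj K (n - 2)))"
    unfolding contraction_def using K by blast
  then show ?thesis by blast
qed

text \<open>The complex is the mapping cone of the equivalence, viewed as an extension of the
  shifted \<open>K\<close> by \<open>L\<close> with the equivalence as off-diagonal part.\<close>

lemma homotopy_equivalent_cone_contractible:
  assumes he: "homotopy_equivalent C K L" and S: "\<And>n. is_biproduct C (obj L n) (obj K (n + 1)) (S n)"
  shows "\<exists>Q h. obj Q = S \<and> contraction Q h"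
proof -
  obtain f g where K: "is_complex C K" and L: "is_complex C L" and f: "is_chain_map C K L f"
    and g: "is_chain_map C L K g"
    and gf: "chain_homotopic C K K (\<lambda>i. g i \<cdot> f i) (\<lambda>i. Idn C (obj K i))"
    and fg: "chain_homotopic C L L (\<lambda>i. f i \<cdot> g i) (\<lambda>i. Idn C (obj L i))"
    by (rule homotopy_equivalentE[OF he])
  obtain h where h: "\<And>n. h n \<in> Ar C" "\<And>n. Dom C (h n) = obj K n" "\<And>n. Cod C (h n) = obj K (n - 1)"
    and gfh: "\<And>n. g n \<cdot> f n = Idn C (obj K n) \<boxplus> (dif K (n - 1) \<cdot> h n \<boxplus> h (n + 1) \<cdot> dif K n)"
    using chain_homotopicD[OF gf] by metis
  obtain k where k: "\<And>n. k n \<in> Ar C" "\<And>n. Dom C (k n) = obj L n" "\<And>n. Cod C (k n) = obj L (n - 1)"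
    and fgk: "\<And>n. f n \<cdot> g n = Idn C (obj L n) \<boxplus> (dif L (n - 1) \<cdot> k n \<boxplus> k (n + 1) \<cdot> dif L n)"
    using chain_homotopicD[OF fg] by metis
  have "\<forall>n. \<exists>i j p q. i \<in> Homs C (obj L n) (S n) \<and> j \<in> Homs C (obj K (n + 1)) (S n) \<and>
      p \<in> Homs C (S n) (obj L n) \<and> q \<in> Homs C (S n) (obj K (n + 1)) \<and>
      p \<cdot> i = Idn C (obj L n) \<and> q \<cdot> j = Idn C (obj K (n + 1)) \<and>
      q \<cdot> i = Zro C (obj L n) (obj K (n + 1)) \<and> p \<cdot> j = Zro C (obj K (n + 1)) (obj L n) \<and>
      i \<cdot> p \<boxplus> j \<cdot> q = Idn C (S n)"
    using S unfolding is_biproduct_def by metis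
  then obtain i j p q where bp: "\<And>n. i n \<in> Homs C (obj L n) (S n)" "\<And>n. j n \<in> Homs C (obj K (n + 1)) (S n)"
      "\<And>n. p n \<in> Homs C (S n) (obj L n)" "\<And>n. q n \<in> Homs C (S n) (obj K (n + 1))"
      "\<And>n. p n \<cdot> i n = Idn C (obj L n)" "\<And>n. q n \<cdot> j n = Idn C (obj K (n + 1))"
      "\<And>n. q n \<cdot> i n = Zro C (obj L n) (obj K (n + 1))" "\<And>n. p n \<cdot> j n = Zro C (obj K (n + 1)) (obj L n)"
      "\<And>n. i n \<cdot> p n \<boxplus> j n \<cdot> q n = Idn C (S n)"
    by metis
  have ob: "S n \<in> Ob C" for n using S[of n] unfolding is_biproduct_def by blast
  \<comment> \<open>The shift of \<open>K\<close> by one, with the sign of the differential that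
    makes the off-diagonal entry of \<open>d d\<close> cancel.\<close>
  define Z where "Z = \<lparr>obj = (\<lambda>n. obj K (n + 1)), dif = (\<lambda>n. neg_arrow C (dif K (n + 1)))\<rparr>"
  have Zo: "obj Z n = obj K (n + 1)" and Zd: "dif Z n = neg_arrow C (dif K (n + 1))" for n
    by (simp_all add: Z_def)
  note [simp] = is_complexD[OF K] is_complexD[OF L] complex_dd[OF K] complex_dd[OF L] ob
    chain_mapD[OF f] chain_mapD[OF g] chain_map_dif[OF K L f] chain_map_dif[OF L K g] h k
    HomsD[OF bp(1)] HomsD[OF bp(2)] HomsD[OF bp(3)] HomsD[OF bp(4)] bp(5-8)
  have Z: "is_complex C Z"
    by (rule is_complexI) (simp_all add: Zo Zd cat_simps)
  have bp': "t \<in> Ar C \<Longrightarrow> Cod C t = obj L n \<Longrightarrow> p n \<cdot> (i n \<cdot> t) = t"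
    "t \<in> Ar C \<Longrightarrow> Cod C t = obj L n \<Longrightarrow> q n \<cdot> (i n \<cdot> t) = Zro C (Dom C t) (obj K (n + 1))"
    "t \<in> Ar C \<Longrightarrow> Cod C t = obj K (n + 1) \<Longrightarrow> q n \<cdot> (j n \<cdot> t) = t"
    "t \<in> Ar C \<Longrightarrow> Cod C t = obj K (n + 1) \<Longrightarrow> p n \<cdot> (j n \<cdot> t) = Zro C (Dom C t) (obj L n)" for n t
    using bp(5,7,6,8)[of n, THEN Cmp_assoc_eq, of t] by (simp_all add: cat_simps)
  define Q where "Q = \<lparr>obj = S, dif = (\<lambda>n. i (n + 1) \<cdot> (dif L n \<cdot> p n) \<boxplus>
            (j (n + 1) \<cdot> (dif Z n \<cdot> q n) \<boxplus> i (n + 1) \<cdot> (f (n + 1) \<cdot> q n)))\<rparr>"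
  have Qo [simp]: "obj Q = S" by (simp add: Q_def)
  have Q: "is_complex C Q"
  proof (rule is_complexI)
    show "dif Q m \<in> Homs C (obj Q m) (obj Q (m + 1))" for m
      by (simp add: Q_def Zd cat_simps)
    show "dif Q m \<cdot> dif Q (m - 1) = Zro C (obj Q (m - 1)) (obj Q (m + 1))" for m
      unfolding Q_def Zd
      apply (simp add: cat_simps bp')
      apply (rule lin_eqI[of "S (m - 1)" "S (m + 1)"])
      apply (rule lin_Pls lin_neg lin_Zro lin_atom' | (simp add: cat_simps; fail) | (simp add: algebra_simps; fail))+
      done
  qed simp
  have "split_extension C L Q Z i p j q (\<lambda>n. f (n + 1))"
    unfolding split_extension_def Qo Zo
    using L Q Z bp
    apply (simp add: HomsI Zd)
    apply (simp add: Q_def Zd cat_simps)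
    apply (intro allI)
    apply (rule lin_eqI)
    apply (rule lin_Pls lin_neg lin_Zro lin_atom' | (simp add: cat_simps; fail) | (simp add: algebra_simps; fail))+
    done
  then have "\<exists>h. contraction Q h"
  \<comment> \<open>The differential of \<open>Z\<close> is negated, so the homotopy on
    \<open>Z\<close> is the negated shift of \<open>h\<close>.\<close>
  proof (rule split_extension_contraction[where g = g and k = k and l = "\<lambda>n. neg_arrow C (h (n + 1))"])
    show "g n \<in> Homs C (obj L n) (obj Z (n - 1))" "k n \<in> Homs C (obj L n) (obj L (n - 1))"
      "neg_arrow C (h (n + 1)) \<in> Homs C (obj Z n) (obj Z (n - 1))" for n
      by (simp_all add: Zo cat_simps)
    show "g n \<cdot> dif L (n - 1) = neg_arrow C (dif Z (n - 2) \<cdot> g (n - 1))" for n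
      by (simp add: Zd cat_simps)
    show "f (n - 1 + 1) \<cdot> g n = Idn C (obj L n) \<boxplus> (dif L (n - 1) \<cdot> k n \<boxplus> k (n + 1) \<cdot> dif L n)" for n
      using fgk[of n] by simp
    show "g (n + 1) \<cdot> f (n + 1) = Idn C (obj Z n) \<boxplus>
       (dif Z (n - 1) \<cdot> neg_arrow C (h (n + 1)) \<boxplus> neg_arrow C (h (n + 1 + 1)) \<cdot> dif Z n)" for n
      unfolding gfh by (simp add: Zo Zd cat_simps)
  qed
  then show ?thesis using Qo by blast
qed

end

section \<open>Grothendieck groups\<close>

text \<open>Both Grothendieck groups are quotients of a free group by relations indexed by triples,
  split ones or triangles; everything that does not depend on the kind of triple is proved here
  once.\<close>

locale K0_presentation =
  fixes C :: "('o, 'm, 'e) cat_scheme" and R :: "('o \<times> 'o \<times> 'o) set"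
  assumes R_Ob: "R \<subseteq> Ob C \<times> Ob C \<times> Ob C"
begin

definition fr :: "'o \<Rightarrow> ('o set \<Rightarrow>\<^sub>0 int)" where "fr X = frag_of (iso_class C X)"

abbreviation "Fr \<equiv> free_on_classes C"
abbreviation "N \<equiv> K0_relations C R"

lemma Fr_simps [simp]:
  "u \<in> carrier Fr \<longleftrightarrow> Poly_Mapping.keys u \<subseteq> iso_class C ` Ob C" "\<one>\<^bsub>Fr\<^esub> = 0" "u \<otimes>\<^bsub>Fr\<^esub> v = u + v"
  by (simp_all add: free_on_classes_def)

sublocale Fr: comm_group Fr
  unfolding free_on_classes_def by (rule abelian_free_Abelian_group)

lemma Fr_closed:
  "u \<in> carrier Fr \<Longrightarrow> v \<in> carrier Fr \<Longrightarrow> u + v \<in> carrier Fr"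
  "u \<in> carrier Fr \<Longrightarrow> - u \<in> carrier Fr"
  "u \<in> carrier Fr \<Longrightarrow> v \<in> carrier Fr \<Longrightarrow> u - v \<in> carrier Fr"
  using keys_add[of u v] keys_diff[of u v] by auto

lemma fr_closed: "X \<in> Ob C \<Longrightarrow> fr X \<in> carrier Fr"
  by (simp add: fr_def)

lemma sum_closed: "(\<And>i. i \<in> I \<Longrightarrow> x i \<in> carrier Fr) \<Longrightarrow> sum x I \<in> carrier Fr"
  unfolding free_on_classes_def by (rule sum_closed_free_Abelian_group)

lemma inv_Fr: "u \<in> carrier Fr \<Longrightarrow> inv\<^bsub>Fr\<^esub> u = - u"
  by (simp add: free_on_classes_def)

lemma gens_closed: "{frag_of (iso_class C Y) - frag_of (iso_class C X) - frag_of (iso_class C Z) | X Y Z.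
        (X, Y, Z) \<in> R} \<subseteq> carrier Fr"
proof clarify
  fix X Y Z assume "(X, Y, Z) \<in> R"
  then have "X \<in> Ob C" "Y \<in> Ob C" "Z \<in> Ob C" using R_Ob by auto
  then show "frag_of (iso_class C Y) - frag_of (iso_class C X) - frag_of (iso_class C Z) \<in> carrier Fr"
    using fr_closed Fr_closed(3) unfolding fr_def by metis
qed

lemma N_subgroup: "subgroup N Fr"
  unfolding K0_relations_def by (rule Fr.generate_is_subgroup[OF gens_closed])

sublocale N: normal N Fr
  using Fr.subgroup_imp_normal[OF N_subgroup] .

lemma N_carrier: "u \<in> N \<Longrightarrow> u \<in> carrier Fr"
  using subgroup.subset[OF N_subgroup] by blast

lemma N_zero: "0 \<in> N"
  using subgroup.one_closed[OF N_subgroup] by simp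

lemma N_add: "u \<in> N \<Longrightarrow> v \<in> N \<Longrightarrow> u + v \<in> N"
  using subgroup.m_closed[OF N_subgroup] by simp

lemma N_minus: "u \<in> N \<Longrightarrow> - u \<in> N"
  using subgroup.m_inv_closed[OF N_subgroup, of u] inv_Fr[OF N_carrier] by simp

lemma N_diff: "u \<in> N \<Longrightarrow> v \<in> N \<Longrightarrow> u - v \<in> N"
  using N_add[OF _ N_minus] by fastforce

lemma N_sum: "(\<And>i. i \<in> I \<Longrightarrow> x i \<in> N) \<Longrightarrow> sum x I \<in> N"
  by (induction I rule: infinite_finite_induct) (auto intro: N_zero N_add)

lemma N_gen: "(X, Y, Z) \<in> R \<Longrightarrow> fr Y - fr X - fr Z \<in> N"
  unfolding K0_relations_def fr_def by (rule generate.incl) blast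

text \<open>Identities in the quotient, written multiplicatively, become membership of an ordinary
  difference in \<open>N\<close>. All computations with Euler classes are done on that side.\<close>

lemma coset_eq_iff:
  assumes "u \<in> carrier Fr" "v \<in> carrier Fr"
  shows "N #>\<^bsub>Fr\<^esub> u = N #>\<^bsub>Fr\<^esub> v \<longleftrightarrow> u - v \<in> N"
proof
  assume "N #>\<^bsub>Fr\<^esub> u = N #>\<^bsub>Fr\<^esub> v"
  then have "u \<in> N #>\<^bsub>Fr\<^esub> v" using Fr.rcos_self[OF assms(1) N_subgroup] by simp
  then show "u - v \<in> N" by (auto simp: r_coset_def)
next
  assume "u - v \<in> N"
  then have "u \<in> N #>\<^bsub>Fr\<^esub> v" unfolding r_coset_def by force
  then show "N #>\<^bsub>Fr\<^esub> u = N #>\<^bsub>Fr\<^esub> v" using Fr.repr_independence[OF _ assms(2) N_subgroup] by simp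
qed

sublocale K: comm_group "K0_group C R"
  unfolding K0_group_def by (rule Fr.abelian_FactGroup[OF N_subgroup])

lemma coset_closed: "u \<in> carrier Fr \<Longrightarrow> N #>\<^bsub>Fr\<^esub> u \<in> carrier (K0_group C R)"
  unfolding K0_group_def carrier_FactGroup by blast

lemma coset_mult:
  "u \<in> carrier Fr \<Longrightarrow> v \<in> carrier Fr \<Longrightarrow> (N #>\<^bsub>Fr\<^esub> u) \<otimes>\<^bsub>K0_group C R\<^esub> (N #>\<^bsub>Fr\<^esub> v) = N #>\<^bsub>Fr\<^esub> (u + v)"
  unfolding K0_group_def using N.rcos_sum by simp

lemma coset_one: "\<one>\<^bsub>K0_group C R\<^esub> = N #>\<^bsub>Fr\<^esub> 0"
  using Fr.coset_mult_one[of N] subgroup.subset[OF N_subgroup] unfolding K0_group_def by simp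

lemma coset_int_pow: "u \<in> carrier Fr \<Longrightarrow> (N #>\<^bsub>Fr\<^esub> u) [^]\<^bsub>K0_group C R\<^esub> (k :: int) = N #>\<^bsub>Fr\<^esub> (frag_cmul k u)"
  unfolding K0_group_def using N.FactGroup_int_pow[of u k] by (simp add: free_on_classes_def)

lemma class_coset: "K0_class C R X = N #>\<^bsub>Fr\<^esub> fr X"
  by (simp add: K0_class_def fr_def)

lemma class_closed: "X \<in> Ob C \<Longrightarrow> K0_class C R X \<in> carrier (K0_group C R)"
  unfolding class_coset by (rule coset_closed[OF fr_closed])

lemma class_mult:
  assumes "(X, Y, Z) \<in> R"
  shows "K0_class C R Y = K0_class C R X \<otimes>\<^bsub>K0_group C R\<^esub> K0_class C R Z"
proof -
  have O: "X \<in> Ob C" "Y \<in> Ob C" "Z \<in> Ob C" using assms R_Ob by auto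
  have "fr Y - (fr X + fr Z) \<in> N" using N_gen[OF assms] by (simp add: algebra_simps)
  then show ?thesis
    unfolding class_coset coset_mult[OF O(1,3)[THEN fr_closed]]
    using coset_eq_iff[OF fr_closed[OF O(2)] Fr_closed(1)[OF O(1,3)[THEN fr_closed]]] by simp
qed

lemma class_iso: "iso_class C X = iso_class C Y \<Longrightarrow> K0_class C R X = K0_class C R Y"
  by (simp add: K0_class_def)

lemma universal:
  assumes H: "comm_group H" and cl: "\<And>X. X \<in> Ob C \<Longrightarrow> \<psi> X \<in> carrier H"
    and iso: "\<And>X Y. X \<in> Ob C \<Longrightarrow> Y \<in> Ob C \<Longrightarrow> iso_class C X = iso_class C Y \<Longrightarrow> \<psi> X = \<psi> Y"
    and add: "\<And>X Y Z. (X, Y, Z) \<in> R \<Longrightarrow> \<psi> Y = \<psi> X \<otimes>\<^bsub>H\<^esub> \<psi> Z"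
  shows "\<exists>\<phi> \<in> hom (K0_group C R) H. \<forall>X \<in> Ob C. \<phi> (K0_class C R X) = \<psi> X"
proof -
  interpret H: comm_group H by fact
  \<comment> \<open>Values are given on objects while the generators are isomorphism classes; by
    \<open>iso\<close> the choice of the object does not matter.\<close>
  define \<psi>' where "\<psi>' c = \<psi> (SOME X. X \<in> Ob C \<and> iso_class C X = c)" for c
  have \<psi>': "\<psi>' (iso_class C X) = \<psi> X" if "X \<in> Ob C" for X
    unfolding \<psi>'_def using someI[of "\<lambda>Y. Y \<in> Ob C \<and> iso_class C Y = iso_class C X" X] that iso by metis
  have "\<psi>' ` (iso_class C ` Ob C) \<subseteq> carrier H" using \<psi>' cl by auto
  from H.free_Abelian_group_universal[OF this]
  obtain h where h: "h \<in> hom Fr H" and h': "\<And>X. X \<in> Ob C \<Longrightarrow> h (fr X) = \<psi> X"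
    unfolding free_on_classes_def fr_def using \<psi>' by (metis imageI)
  interpret h: group_hom Fr H h
    by (rule group_hom.intro) (auto simp: group_hom_axioms_def h)
  have hadd: "u \<in> carrier Fr \<Longrightarrow> v \<in> carrier Fr \<Longrightarrow> h (u + v) = h u \<otimes>\<^bsub>H\<^esub> h v" for u v
    using h.hom_mult[of u v] by simp
  have hneg: "u \<in> carrier Fr \<Longrightarrow> h (- u) = inv\<^bsub>H\<^esub> h u" for u
    using h.hom_inv[of u] inv_Fr[of u] by simp
  have "subgroup (kernel Fr H h) Fr" by (rule h.subgroup_kernel)
  moreover have "{frag_of (iso_class C Y) - frag_of (iso_class C X) - frag_of (iso_class C Z) | X Y Z.
        (X, Y, Z) \<in> R} \<subseteq> kernel Fr H h"
  proof clarify
    fix X Y Z assume r: "(X, Y, Z) \<in> R"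
    then have O: "fr X \<in> carrier Fr" "fr Y \<in> carrier Fr" "fr Z \<in> carrier Fr" and O': "X \<in> Ob C" "Y \<in> Ob C" "Z \<in> Ob C"
      using R_Ob fr_closed by auto
    have "h (fr Y + - (fr X + fr Z)) = \<psi> Y \<otimes>\<^bsub>H\<^esub> inv\<^bsub>H\<^esub> (\<psi> X \<otimes>\<^bsub>H\<^esub> \<psi> Z)"
      using hadd[OF O(2) Fr_closed(2)[OF Fr_closed(1)[OF O(1,3)]]] hneg[OF Fr_closed(1)[OF O(1,3)]] hadd[OF O(1,3)]
        h'[OF O'(1)] h'[OF O'(2)] h'[OF O'(3)] by simp
    also have "\<dots> = \<one>\<^bsub>H\<^esub>" using add[OF r] cl O' by simp
    finally have "h (fr Y + - (fr X + fr Z)) = \<one>\<^bsub>H\<^esub>" .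
    then show "frag_of (iso_class C Y) - frag_of (iso_class C X) - frag_of (iso_class C Z) \<in> kernel Fr H h"
      using Fr_closed(3)[OF Fr_closed(3)[OF O(2,1)] O(3)] unfolding kernel_def fr_def
      by (simp add: algebra_simps)
  qed
  ultimately have sub: "N \<subseteq> kernel Fr H h"
    unfolding K0_relations_def by (rule Fr.generate_subgroup_incl[rotated])
  have "h u = h v" if "u \<in> carrier Fr" "v \<in> carrier Fr" "N #>\<^bsub>Fr\<^esub> u = N #>\<^bsub>Fr\<^esub> v" for u v
  proof -
    have "u - v \<in> kernel Fr H h" using that coset_eq_iff sub by auto
    then have "h (u - v) = \<one>\<^bsub>H\<^esub>" unfolding kernel_def by simp
    then show ?thesis using hadd[OF Fr_closed(3)[OF that(1,2)] that(2)] h.hom_closed[OF that(2)] by simp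
  qed
  from FactGroup_universal[OF h N.normal_axioms this]
  obtain g where "g \<in> hom (K0_group C R) H" "\<And>u. u \<in> carrier Fr \<Longrightarrow> g (N #>\<^bsub>Fr\<^esub> u) = h u"
    unfolding K0_group_def by blast
  then show ?thesis using h' fr_closed unfolding class_coset by (intro bexI[of _ g]) auto
qed

text \<open>The classes of objects generate the group. It serves twice: for uniqueness of
  homomorphisms and for surjectivity onto the triangulated Grothendieck group.\<close>

lemma carrier_induct:
  assumes x: "x \<in> carrier (K0_group C R)" and S: "subgroup S (K0_group C R)"
    and cl: "\<And>X. X \<in> Ob C \<Longrightarrow> K0_class C R X \<in> S"
  shows "x \<in> S"
proof -
  obtain u where u: "u \<in> carrier Fr" "x = N #>\<^bsub>Fr\<^esub> u"
    using x unfolding K0_group_def carrier_FactGroup by blast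
  have "N #>\<^bsub>Fr\<^esub> u \<in> S"
  proof (rule free_Abelian_group_induct[where P = "\<lambda>u. N #>\<^bsub>Fr\<^esub> u \<in> S", OF u(1)[unfolded Fr_simps(1)]])
    show "N #>\<^bsub>Fr\<^esub> 0 \<in> S" using subgroup.one_closed[OF S] coset_one by simp
  next
    fix u v
    assume *: "Poly_Mapping.keys u \<subseteq> iso_class C ` Ob C" "Poly_Mapping.keys v \<subseteq> iso_class C ` Ob C"
      "N #>\<^bsub>Fr\<^esub> u \<in> S" "N #>\<^bsub>Fr\<^esub> v \<in> S"
    then have c: "u \<in> carrier Fr" "v \<in> carrier Fr" "- v \<in> carrier Fr" by (simp_all add: keys_minus)
    have "inv\<^bsub>K0_group C R\<^esub> (N #>\<^bsub>Fr\<^esub> v) = N #>\<^bsub>Fr\<^esub> (- v)"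
      by (rule K.inv_equality[OF _ coset_closed[OF c(2)] coset_closed[OF c(3)]])
        (simp only: coset_mult[OF c(3,2)] coset_one add.left_inverse)
    then have "N #>\<^bsub>Fr\<^esub> (- v) \<in> S" using subgroup.m_inv_closed[OF S *(4)] by simp
    then have "(N #>\<^bsub>Fr\<^esub> u) \<otimes>\<^bsub>K0_group C R\<^esub> (N #>\<^bsub>Fr\<^esub> (- v)) \<in> S"
      by (rule subgroup.m_closed[OF S *(3)])
    then show "N #>\<^bsub>Fr\<^esub> (u - v) \<in> S" using coset_mult[OF c(1,3)] by simp
  next
    fix a assume "a \<in> iso_class C ` Ob C"
    then show "N #>\<^bsub>Fr\<^esub> frag_of a \<in> S" using cl unfolding class_coset fr_def by auto
  qed
  with u show ?thesis by simp
qed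

lemma hom_eqI:
  assumes "comm_group H" "\<phi> \<in> hom (K0_group C R) H" "\<phi>' \<in> hom (K0_group C R) H"
    and eq: "\<And>X. X \<in> Ob C \<Longrightarrow> \<phi> (K0_class C R X) = \<phi>' (K0_class C R X)"
    and x: "x \<in> carrier (K0_group C R)"
  shows "\<phi> x = \<phi>' x"
proof -
  interpret H: comm_group H by fact
  interpret a: group_hom "K0_group C R" H \<phi> by (rule group_hom.intro) (auto simp: group_hom_axioms_def assms)
  interpret b: group_hom "K0_group C R" H \<phi>' by (rule group_hom.intro) (auto simp: group_hom_axioms_def assms)
  have "subgroup {x \<in> carrier (K0_group C R). \<phi> x = \<phi>' x} (K0_group C R)"
    by (rule K.subgroupI) auto
  from carrier_induct[OF x this] show ?thesis using eq class_closed by blast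
qed

end

section \<open>Euler characteristics\<close>

lemma additive_category_add_K0:
  "K0_presentation C (split_triples C)"
  by unfold_locales (auto simp: split_triples_def is_biproduct_def)

definition alt :: "int \<Rightarrow> 'a::ab_group_add \<Rightarrow> 'a" where
  "alt i u = (if even i then u else - u)"

lemma alt_add: "alt i (u + v) = alt i u + alt i v" and alt_diff: "alt i (u - v) = alt i u - alt i v"
  and alt_minus: "alt i (- u) = - alt i u" and alt_zero [simp]: "alt i 0 = 0"
  by (simp_all add: alt_def)

lemma alt_shift: "alt (i + 1) u = - alt i u" "alt (i - 1) u = - alt i u" "alt (- i) u = alt i u"
  by (simp_all add: alt_def)

context preadditive_category
begin

sublocale add: K0_presentation C "split_triples C"
  by (rule additive_category_add_K0)

lemma N_alt: "u \<in> add.N \<Longrightarrow> alt i u \<in> add.N"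
  using add.N_minus by (simp add: alt_def)

lemma fr_iso: "isomorphic C X Y \<Longrightarrow> add.fr X = add.fr Y"
  using iso_class_eq_iff isomorphic_Ob unfolding add.fr_def by metis

lemma fr_biproduct: "is_biproduct C X Y S \<Longrightarrow> add.fr S - add.fr X - add.fr Y \<in> add.N"
  by (rule add.N_gen) (simp add: split_triples_def)

lemma zero_biproduct:
  assumes "is_zero_object C Z"
  shows "X \<in> Ob C \<Longrightarrow> is_biproduct C X Z X" "X \<in> Ob C \<Longrightarrow> is_biproduct C Z X X"
proof -
  have Z: "Z \<in> Ob C" "Idn C Z = Zro C Z Z" using assms by (simp_all add: zero_object_iff)
  show "is_biproduct C X Z X" if "X \<in> Ob C"
    unfolding is_biproduct_def
    using that Z by (intro conjI bexI[of _ "Idn C X"] bexI[of _ "Zro C X Z"] bexI[of _ "Zro C Z X"])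
      (simp_all add: cat_simps)
  show "is_biproduct C Z X X" if "X \<in> Ob C"
    unfolding is_biproduct_def
    using that Z by (intro conjI bexI[of _ "Idn C X"] bexI[of _ "Zro C X Z"] bexI[of _ "Zro C Z X"])
      (simp_all add: cat_simps)
qed

lemma fr_zero: "is_zero_object C Z \<Longrightarrow> add.fr Z \<in> add.N"
  using fr_biproduct[OF zero_biproduct(1), of Z Z] add.N_minus[of "- add.fr Z"]
  by (simp add: zero_object_iff)

text \<open>The top term \<open>obj Q n\<close> is a retract of the preceding one, but its
  complement need not exist in an additive category. Instead of removing it from degree
  \<open>n - 1\<close>, one adds a copy in degree \<open>n - 2\<close> which maps there by
  \<open>h\<close>. The vanishing of \<open>h h\<close> is needed for the new contraction and is
  passed on for the next round.\<close>

lemma contraction_drop_top: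
  assumes c: "contraction Q h" and hh: "\<And>n. h (n - 1) \<cdot> h n = Zro C (obj Q n) (obj Q (n - 2))"
    and z: "is_zero_object C (obj Q (n + 1))" and S: "is_biproduct C (obj Q (n - 2)) (obj Q n) S"
    and Z: "is_zero_object C Z"
  shows "\<exists>Q' h'. contraction Q' h' \<and> (\<forall>n. h' (n - 1) \<cdot> h' n = Zro C (obj Q' n) (obj Q' (n - 2))) \<and>
    obj Q' = (\<lambda>i. if i = n - 2 then S else if n \<le> i then Z else obj Q i)"
proof -
  note Q = contractionD(1)[OF c]
  obtain i j p q where bp: "i \<in> Homs C (obj Q (n - 2)) S" "j \<in> Homs C (obj Q n) S"
      "p \<in> Homs C S (obj Q (n - 2))" "q \<in> Homs C S (obj Q n)"
      "p \<cdot> i = Idn C (obj Q (n - 2))" "q \<cdot> j = Idn C (obj Q n)"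
      "q \<cdot> i = Zro C (obj Q (n - 2)) (obj Q n)" "p \<cdot> j = Zro C (obj Q n) (obj Q (n - 2))"
      "i \<cdot> p \<boxplus> j \<cdot> q = Idn C S" and So: "S \<in> Ob C"
    using S unfolding is_biproduct_def by blast
  have Zo: "Z \<in> Ob C" "Idn C Z = Zro C Z Z" using Z by (simp_all add: zero_object_iff)
  note [simp] = contractionD(2-4)[OF c] is_complexD[OF Q] complex_dd[OF Q] HomsD[OF bp(1)] HomsD[OF bp(2)]
    HomsD[OF bp(3)] HomsD[OF bp(4)] bp(5-8) So Zo
  have bp': "t \<in> Ar C \<Longrightarrow> Cod C t = obj Q (n - 2) \<Longrightarrow> p \<cdot> (i \<cdot> t) = t"
    "t \<in> Ar C \<Longrightarrow> Cod C t = obj Q (n - 2) \<Longrightarrow> q \<cdot> (i \<cdot> t) = Zro C (Dom C t) (obj Q n)"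
    "t \<in> Ar C \<Longrightarrow> Cod C t = obj Q n \<Longrightarrow> q \<cdot> (j \<cdot> t) = t"
    "t \<in> Ar C \<Longrightarrow> Cod C t = obj Q n \<Longrightarrow> p \<cdot> (j \<cdot> t) = Zro C (Dom C t) (obj Q (n - 2))" for t
    using bp(5,7,6,8)[THEN Cmp_assoc_eq, of t] by (simp_all add: cat_simps)
  have hh1: "h m \<cdot> h l = Zro C (obj Q l) (obj Q (l - 2))" if "m = l - 1" for m l
    using hh[of l] that by simp
  have hh2: "h m \<cdot> (h l \<cdot> t) = Zro C (Dom C t) (obj Q (l - 2))" if "m = l - 1" "t \<in> Ar C" "Cod C t = obj Q l" for m l t
    using hh1[OF that(1), THEN Cmp_assoc_eq, of t] that by (simp add: cat_simps)
  have hd: "dif Q m \<cdot> h l = Idn C (obj Q l) \<boxplus> neg_arrow C (h (l + 1) \<cdot> dif Q l)" if "m = l - 1" for m l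
  proof -
    have "(h (l + 1) \<cdot> dif Q l) \<boxplus> dif Q (l - 1) \<cdot> h l = (h (l + 1) \<cdot> dif Q l) \<boxplus> (Idn C (obj Q l) \<boxplus> neg_arrow C (h (l + 1) \<cdot> dif Q l))"
      unfolding contractionD(5)[OF c, of l, symmetric]
      apply (rule lin_eqI[of "obj Q l" "obj Q l"])
      apply (rule lin_Pls lin_neg lin_Zro lin_atom' | (simp add: cat_simps; fail) | (simp add: algebra_simps; fail))+
      done
    from Pls_left_cancel[OF _ _ _ this, of "obj Q l" "obj Q l"] show ?thesis using that by (simp add: cat_simps)
  qed
  \<comment> \<open>Nothing follows the top term, so the contraction identity there reduces to
    \<open>d h = 1\<close>.\<close>
  have "dif Q n = Zro C (obj Q n) (obj Q (n + 1))"
    using zero_object_arrow(2)[OF z, of "dif Q n" "obj Q n"] by (simp add: Homs_def)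
  then have top: "dif Q (n - 1) \<cdot> h n = Idn C (obj Q n)"
    unfolding hd[of "n - 1" n, simplified] by (simp add: cat_simps)
  have top': "dif Q (n - 1) \<cdot> (h n \<cdot> t) = t" if "t \<in> Ar C" "Cod C t = obj Q n" for t
    using top[THEN Cmp_assoc_eq, of t] that by (simp add: cat_simps)
  \<comment> \<open>With \<open>S\<close> the sum of the terms in degrees \<open>n - 2\<close> and
    \<open>n\<close>, the new differential out of \<open>S\<close> is \<open>(d, h)\<close> and the
    new homotopy into \<open>S\<close> is \<open>(h, d)\<close>; below these degrees nothing changes
    except for an inclusion or a projection.\<close>
  define O' where "O' l = (if l = n - 2 then S else if n \<le> l then Z else obj Q l)" for l
  define D' where "D' l = (if l = n - 3 then i \<cdot> dif Q (n - 3) else if l = n - 2 then dif Q (n - 2) \<cdot> p \<boxplus> h n \<cdot> q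
     else if n - 1 \<le> l then Zro C (O' l) (O' (l + 1)) else dif Q l)" for l
  define H' where "H' l = (if l = n - 2 then h (n - 2) \<cdot> p else if l = n - 1 then i \<cdot> h (n - 1) \<boxplus> j \<cdot> dif Q (n - 1)
     else if n \<le> l then Zro C (O' l) (O' (l - 1)) else h l)" for l
  have cases: "m < n - 3 \<or> m = n - 3 \<or> m = n - 2 \<or> m = n - 1 \<or> m = n \<or> n < m" for m by arith
  have O'_Ob: "O' m \<in> Ob C" for m by (simp add: O'_def)
  have Zth: "Zro C Z Z \<boxplus> Zro C Z Z = Zro C Z Z" by (simp add: cat_simps)
  have D'_in: "D' m \<in> Homs C (O' m) (O' (m + 1))" for m
    using cases[of m] by (elim disjE) (simp_all add: D'_def O'_def cat_simps)
  have H'_in: "H' m \<in> Homs C (O' m) (O' (m - 1))" for m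
    using cases[of m] by (elim disjE) (simp_all add: H'_def O'_def cat_simps)
  define Q' where "Q' = \<lparr>obj = O', dif = D'\<rparr>"
  have "is_complex C Q'"
  proof (rule is_complexI)
    show "dif Q' m \<cdot> dif Q' (m - 1) = Zro C (obj Q' (m - 1)) (obj Q' (m + 1))" for m
    proof -
      consider "m < n - 3" | "m = n - 3" | "m = n - 2" | "n - 1 \<le> m" by arith
      then show ?thesis
      proof cases
        case 4
        then have "D' m = Zro C (O' m) (O' (m + 1))" by (auto simp: D'_def)
        then show ?thesis using Cmp_Zro(2)[OF D'_in[of "m - 1"] O'_Ob[of "m + 1"]] by (simp add: Q'_def)
      qed (simp_all add: Q'_def D'_def O'_def cat_simps bp')
    qed
  qed (use D'_in O'_Ob in \<open>simp_all add: Q'_def\<close>)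
  moreover have "D' (m - 1) \<cdot> H' m \<boxplus> H' (m + 1) \<cdot> D' m = Idn C (O' m)" for m
  proof -
    consider "m < n - 3" | "m = n - 3" | "m = n - 2" | "m = n - 1" | "n \<le> m" by arith
    then show ?thesis
    proof cases
      case 1
      then show ?thesis using contractionD(5)[OF c, of m] by (simp add: D'_def H'_def O'_def)
    next
      case 2
      then show ?thesis using contractionD(5)[OF c, of m] by (simp add: D'_def H'_def O'_def cat_simps bp')
    next
      case 3
      have "i \<cdot> (dif Q (n - 3) \<cdot> (h (n - 2) \<cdot> p)) \<boxplus> i \<cdot> (h (n - 1) \<cdot> (dif Q (n - 2) \<cdot> p))
          = i \<cdot> ((dif Q (n - 2 - 1) \<cdot> h (n - 2) \<boxplus> h (n - 2 + 1) \<cdot> dif Q (n - 2)) \<cdot> p)"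
        by (simp add: cat_simps)
      also have "\<dots> = i \<cdot> p" unfolding contractionD(5)[OF c] by (simp add: cat_simps)
      finally have e: "i \<cdot> (dif Q (n - 3) \<cdot> (h (n - 2) \<cdot> p)) \<boxplus> i \<cdot> (h (n - 1) \<cdot> (dif Q (n - 2) \<cdot> p)) = i \<cdot> p" .
      show ?thesis using 3 bp(9) e
        by (simp add: D'_def H'_def O'_def cat_simps bp' hh2 top' Pls_assoc[of _ S S, symmetric])
    next
      case 4
      then show ?thesis using contractionD(5)[OF c, of m] by (simp add: D'_def H'_def O'_def cat_simps bp')
    next
      case 5
      then have "O' m = Z" by (simp add: O'_def)
      then have "is_zero_object C (O' m)" using Z by simp
      moreover have "D' (m - 1) \<cdot> H' m \<boxplus> H' (m + 1) \<cdot> D' m \<in> Homs C (O' m) (O' m)"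
        using H'_in[of m] H'_in[of "m + 1"] D'_in[of m] D'_in[of "m - 1"] by (simp add: cat_simps)
      ultimately show ?thesis using Idn_in[OF O'_Ob] zero_object_arrow(1) by metis
    qed
  qed
  moreover have "H' (m - 1) \<cdot> H' m = Zro C (O' m) (O' (m - 2))" for m
  proof -
    consider "m < n - 2" | "m = n - 2" | "m = n - 1" | "n \<le> m" by arith
    then show ?thesis
    proof cases
      case 4
      then have "H' m = Zro C (O' m) (O' (m - 1))" by (auto simp: H'_def)
      then show ?thesis using Cmp_Zro(1)[OF H'_in[of "m - 1"] O'_Ob[of m]] by simp
    qed (simp_all add: H'_def O'_def cat_simps bp' hh1 hh2)
  qed
  ultimately show ?thesis
    using H'_in unfolding contraction_def
    by (intro exI[of _ Q'] exI[of _ H']) (auto simp: Q'_def O'_def)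
qed

text \<open>This lemma and the next are the two bases of the shortening: a contractible complex of
  length one is zero, one of length two is an isomorphism.\<close>

lemma contraction_single:
  assumes c: "contraction Q h" and z: "is_zero_object C (obj Q (n - 1))" "is_zero_object C (obj Q (n + 1))"
  shows "is_zero_object C (obj Q n)"
proof -
  note [simp] = contractionD(2-4)[OF c] is_complexD[OF contractionD(1)[OF c]]
  have "dif Q n = Zro C (obj Q n) (obj Q (n + 1))" "h n = Zro C (obj Q n) (obj Q (n - 1))"
    using zero_object_arrow(2)[OF z(2), of "dif Q n" "obj Q n"] zero_object_arrow(2)[OF z(1), of "h n" "obj Q n"]
    by (simp_all add: Homs_def)
  then have "Idn C (obj Q n) = Zro C (obj Q n) (obj Q n)"
    unfolding contractionD(5)[OF c, symmetric] by (simp add: cat_simps)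
  then show ?thesis by (simp add: zero_object_iff)
qed

lemma contraction_pair:
  assumes c: "contraction Q h" and z: "is_zero_object C (obj Q (n - 1))" "is_zero_object C (obj Q (n + 2))"
  shows "isomorphic C (obj Q n) (obj Q (n + 1))"
proof -
  note Q = contractionD(1)[OF c]
  note [simp] = contractionD(2-4)[OF c] is_complexD[OF Q]
  have 1: "h n = Zro C (obj Q n) (obj Q (n - 1))"
    using zero_object_arrow(2)[OF z(1), of "h n" "obj Q n"] by (simp add: Homs_def)
  have 2: "h (n + 1 + 1) = Zro C (obj Q (n + 1 + 1)) (obj Q (n + 1))"
  proof -
    have n: "n + 1 + 1 = n + 2" "n + 2 - 1 = n + 1" by simp_all
    have "h (n + 2) \<in> Homs C (obj Q (n + 2)) (obj Q (n + 2 - 1))" by (simp only: Homs_def) simp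
    then show ?thesis unfolding n by (rule zero_object_arrow(1)[OF z(2)])
  qed
  have 3: "h (n + 1) \<cdot> dif Q n = Idn C (obj Q n)"
    unfolding contractionD(5)[OF c, of n, symmetric] by (simp add: 1 cat_simps)
  have "dif Q n \<cdot> h (n + 1) = Idn C (obj Q (n + 1))"
    unfolding contractionD(5)[OF c, of "n + 1", symmetric] 2 by (simp add: cat_simps)
  with 3 show ?thesis by (intro isomorphicI(1)[of "dif Q n" _ _ "h (n + 1)"]) (simp_all add: Homs_def)
qed

end

context additive_category
begin

text \<open>Induction on the length by folding the top term down. A copy of \<open>obj Q n\<close>
  reappears in degree \<open>n - 2\<close>, which has the same parity, so the alternating sum
  changes only by the relation for the biproduct \<open>S\<close>.\<close>

lemma euler_contraction:
  assumes "contraction Q h" "\<And>n. h (n - 1) \<cdot> h n = Zro C (obj Q n) (obj Q (n - 2))"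
    and "\<And>i. i < b \<or> b + int m < i \<Longrightarrow> is_zero_object C (obj Q i)"
  shows "(\<Sum>i = b..b + int m. alt i (add.fr (obj Q i))) \<in> add.N"
  using assms
proof (induction m arbitrary: Q h rule: less_induct)
  case (less m)
  consider "m = 0" | "m = 1" | k where "m = Suc (Suc k)" by (metis One_nat_def not0_implies_Suc)
  then show ?case
  proof cases
    case 1
    then have "is_zero_object C (obj Q b)"
      using less.prems(3)[of "b - 1"] less.prems(3)[of "b + 1"] contraction_single[OF less.prems(1), of b] by simp
    then show ?thesis using 1 N_alt[OF fr_zero] by simp
  next
    case 2
    have "isomorphic C (obj Q b) (obj Q (b + 1))"
      using less.prems(3)[of "b - 1"] less.prems(3)[of "b + 2"] 2 contraction_pair[OF less.prems(1), of b] by simp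
    moreover have "{b..b + int m} = {b, b + 1}" using 2 by auto
    ultimately show ?thesis using add.N_zero by (simp add: fr_iso alt_shift)
  next
    case 3
    define n where "n = b + int m"
    have n: "n - 2 \<in> {b..n}" "b \<le> n - 2" using 3 by (auto simp: n_def)
    note Q = contractionD(1)[OF less.prems(1)]
    obtain S where S: "is_biproduct C (obj Q (n - 2)) (obj Q n) S"
      using has_biproducts is_complexD(1)[OF Q] by blast
    obtain Z where Z: "is_zero_object C Z" using has_zero by blast
    obtain Q' h' where Q': "contraction Q' h'" "\<And>n. h' (n - 1) \<cdot> h' n = Zro C (obj Q' n) (obj Q' (n - 2))"
      "obj Q' = (\<lambda>i. if i = n - 2 then S else if n \<le> i then Z else obj Q i)"
      using contraction_drop_top[OF less.prems(1,2) _ S Z] less.prems(3)[of "n + 1"] unfolding n_def by auto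
    \<comment> \<open>The folded complex ends in degree \<open>n - 1\<close>, one degree lower, so
      the induction hypothesis is used for \<open>Suc k = m - 1\<close>.\<close>
    have "(\<Sum>i = b..b + int (Suc k). alt i (add.fr (obj Q' i))) \<in> add.N"
      by (rule less.IH[OF _ Q'(1,2)]) (use 3 Z less.prems(3) in \<open>auto simp: Q'(3) n_def\<close>)
    moreover have "{b..b + int (Suc k)} = insert (n - 2) ({b..n} - {n, n - 2})" using 3 n by (auto simp: n_def)
    ultimately have "alt (n - 2) (add.fr S) + (\<Sum>i \<in> {b..n} - {n, n - 2}. alt i (add.fr (obj Q' i))) \<in> add.N"
      by (simp add: Q'(3))
    moreover have "(\<Sum>i \<in> {b..n} - {n, n - 2}. alt i (add.fr (obj Q' i))) = (\<Sum>i \<in> {b..n} - {n, n - 2}. alt i (add.fr (obj Q i)))"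
      by (rule sum.cong) (auto simp: Q'(3))
    moreover have "alt (n - 2) (add.fr S - add.fr (obj Q (n - 2)) - add.fr (obj Q n)) \<in> add.N"
      by (rule N_alt[OF fr_biproduct[OF S]])
    ultimately have 1: "alt (n - 2) (add.fr S) + (\<Sum>i \<in> {b..n} - {n, n - 2}. alt i (add.fr (obj Q i)))
       - alt (n - 2) (add.fr S - add.fr (obj Q (n - 2)) - add.fr (obj Q n)) \<in> add.N"
      by (intro add.N_diff) simp_all
    have "(\<Sum>i = b..n. alt i (add.fr (obj Q i))) = alt n (add.fr (obj Q n)) + (alt (n - 2) (add.fr (obj Q (n - 2))) +
        (\<Sum>i \<in> {b..n} - {n, n - 2}. alt i (add.fr (obj Q i))))"
    proof -
      have "{b..n} = insert n (insert (n - 2) ({b..n} - {n, n - 2}))" using n by auto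
      then have "(\<Sum>i = b..n. alt i (add.fr (obj Q i))) =
          (\<Sum>i \<in> insert n (insert (n - 2) ({b..n} - {n, n - 2})). alt i (add.fr (obj Q i)))" by simp
      also have "\<dots> = alt n (add.fr (obj Q n)) + (\<Sum>i \<in> insert (n - 2) ({b..n} - {n, n - 2}). alt i (add.fr (obj Q i)))"
        by (rule sum.insert) auto
      also have "(\<Sum>i \<in> insert (n - 2) ({b..n} - {n, n - 2}). alt i (add.fr (obj Q i)))
          = alt (n - 2) (add.fr (obj Q (n - 2))) + (\<Sum>i \<in> {b..n} - {n, n - 2}. alt i (add.fr (obj Q i)))"
        by (rule sum.insert) auto
      finally show ?thesis .
    qed
    moreover have "alt n (add.fr (obj Q n)) = alt (n - 2) (add.fr (obj Q n))" by (simp add: alt_def)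
    ultimately have "(\<Sum>i = b..n. alt i (add.fr (obj Q i))) = alt (n - 2) (add.fr S) + (\<Sum>i \<in> {b..n} - {n, n - 2}. alt i (add.fr (obj Q i)))
       - alt (n - 2) (add.fr S - add.fr (obj Q (n - 2)) - add.fr (obj Q n))"
      by (simp only: alt_diff) simp
    then show ?thesis using 1 unfolding n_def by simp
  qed
qed

end

context preadditive_category
begin

lemma K0_add_simps: "K0_add C = K0_group C (split_triples C)" "K0_add_class C X = add.N #>\<^bsub>add.Fr\<^esub> add.fr X"
  by (simp_all add: K0_add_def K0_add_class_def add.class_coset)

lemma K0_add_class_closed: "X \<in> Ob C \<Longrightarrow> K0_add_class C X \<in> carrier (K0_add C)"
  by (simp add: K0_add_def K0_add_class_def add.class_closed)

lemma K0_add_comm_group: "comm_group (K0_add C)"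
  unfolding K0_add_def by (rule add.K.comm_group_axioms)

lemma K0_add_class_iso: "isomorphic C X Y \<Longrightarrow> K0_add_class C X = K0_add_class C Y"
  by (simp add: K0_add_simps fr_iso)

lemma alt_fr_closed: "X \<in> Ob C \<Longrightarrow> alt i (add.fr X) \<in> carrier add.Fr"
  using add.fr_closed[of X] add.Fr_closed(2)[of "add.fr X"] by (simp add: alt_def del: add.Fr_simps)

lemma signed_class_coset: "X \<in> Ob C \<Longrightarrow> signed_class C i X = add.N #>\<^bsub>add.Fr\<^esub> alt i (add.fr X)"
  using add.coset_int_pow[OF add.fr_closed, of X "if even i then 1 else - 1"]
  by (simp add: signed_class_def K0_add_simps alt_def)

text \<open>Zero objects have trivial class, so the product over all integers collapses to
  \<open>I\<close>. The set may exceed the support, which lets several complexes share one index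
  set.\<close>

lemma euler_class_coset:
  assumes X: "\<And>i. X i \<in> Ob C" and I: "finite I" and z: "\<And>i. i \<notin> I \<Longrightarrow> is_zero_object C (X i)"
  shows "euler_class C X = add.N #>\<^bsub>add.Fr\<^esub> (\<Sum>i\<in>I. alt i (add.fr (X i)))"
proof -
  interpret K: comm_group "K0_add C" by (rule K0_add_comm_group)
  let ?s = "\<lambda>i. signed_class C i (X i)"
  have s: "?s i = add.N #>\<^bsub>add.Fr\<^esub> alt i (add.fr (X i))" for i by (rule signed_class_coset[OF X])
  have cl: "?s i \<in> carrier (K0_add C)" for i
    unfolding s K0_add_def by (rule add.coset_closed[OF alt_fr_closed[OF X]])
  have "?s i = \<one>\<^bsub>K0_add C\<^esub>" if "i \<notin> I" for i
  proof -
    have "alt i (add.fr (X i)) - 0 \<in> add.N" using N_alt[OF fr_zero[OF z[OF that]]] by simp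
    then show ?thesis unfolding s K0_add_def add.coset_one
      using add.coset_eq_iff[OF alt_fr_closed[OF X], of 0] by simp
  qed
  then have "euler_class C X = gfinprod (K0_add C) ?s I"
    unfolding euler_class_def using cl by (intro K.gfinprod_mono_neutral_cong_right) auto
  also have "\<dots> = finprod (K0_add C) ?s I" using I cl by (intro K.gfinprod_eq_finprod) auto
  also have "\<dots> = add.N #>\<^bsub>add.Fr\<^esub> (\<Sum>i\<in>I. alt i (add.fr (X i)))"
    using I
  proof (induction I rule: finite_induct)
    case empty
    then show ?case using add.coset_one by (simp add: K0_add_def)
  next
    case (insert i I)
    then show ?case
      using add.coset_mult[OF alt_fr_closed[OF X, of i i] add.sum_closed[OF alt_fr_closed[OF X]]] cl s
      by (simp add: K0_add_def Pi_def)
  qed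
  finally show ?thesis .
qed

lemma biproduct_zero:
  assumes "is_biproduct C X Y S" "is_zero_object C X" "is_zero_object C Y"
  shows "is_zero_object C S"
proof -
  obtain i j p q where bp: "i \<in> Homs C X S" "j \<in> Homs C Y S" "p \<in> Homs C S X" "q \<in> Homs C S Y"
      "i \<cdot> p \<boxplus> j \<cdot> q = Idn C S" and S: "S \<in> Ob C"
    using assms(1) unfolding is_biproduct_def by blast
  have "p = Zro C S X" "q = Zro C S Y" using zero_object_arrow(2) assms(2,3) bp by blast+
  then have "Idn C S = Zro C S S"
    using bp(1,2,5) S Homs_Ob[OF bp(1)] Homs_Ob[OF bp(2)] by (simp add: cat_simps)
  then show ?thesis using S by (simp add: zero_object_iff)
qed

lemma almost_all_zero_interval:
  assumes "almost_all_zero C K"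
  obtains b m where "\<And>i. i < b \<or> b + int m < i \<Longrightarrow> is_zero_object C (obj K i)"
proof -
  let ?I = "{i. \<not> is_zero_object C (obj K i)}"
  have "finite ?I" using assms unfolding almost_all_zero_def .
  then obtain b c where "\<forall>i \<in> ?I. b \<le> i" "\<forall>i \<in> ?I. i \<le> c"
    by (metis bdd_above_finite bdd_above.E bdd_below_finite bdd_below.E)
  then have "i < b \<or> b + int (nat (c - b)) < i \<Longrightarrow> is_zero_object C (obj K i)" for i by fastforce
  then show ?thesis by (rule that)
qed

lemma euler_class_biproduct:
  assumes bp: "\<And>i. is_biproduct C (obj X i) (obj Z i) (obj Y i)"
    and X: "almost_all_zero C X" and Z: "almost_all_zero C Z"
  shows "almost_all_zero C Y"
    "euler_class C (obj Y) = euler_class C (obj X) \<otimes>\<^bsub>K0_add C\<^esub> euler_class C (obj Z)"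
proof -
  define I where "I = {i. \<not> is_zero_object C (obj X i)} \<union> {i. \<not> is_zero_object C (obj Z i)}"
  have I: "finite I" using X Z unfolding I_def almost_all_zero_def by blast
  have zX: "is_zero_object C (obj X i)" and zZ: "is_zero_object C (obj Z i)" if "i \<notin> I" for i
    using that by (auto simp: I_def)
  have zY: "is_zero_object C (obj Y i)" if "i \<notin> I" for i
    using biproduct_zero[OF bp zX[OF that] zZ[OF that]] .
  then have "{i. \<not> is_zero_object C (obj Y i)} \<subseteq> I" by blast
  then show "almost_all_zero C Y" unfolding almost_all_zero_def using I finite_subset by blast
  have O: "obj X i \<in> Ob C" "obj Y i \<in> Ob C" "obj Z i \<in> Ob C" for i using bp unfolding is_biproduct_def by blast+
  have sc: "(\<Sum>i\<in>I. alt i (add.fr (obj W i))) \<in> carrier add.Fr" if "\<And>i. obj W i \<in> Ob C" for W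
    by (rule add.sum_closed) (rule alt_fr_closed[OF that])
  have "(\<Sum>i\<in>I. alt i (add.fr (obj Y i) - add.fr (obj X i) - add.fr (obj Z i))) \<in> add.N"
    by (rule add.N_sum, rule N_alt, rule fr_biproduct, rule bp)
  then have "(\<Sum>i\<in>I. alt i (add.fr (obj Y i))) - ((\<Sum>i\<in>I. alt i (add.fr (obj X i))) + (\<Sum>i\<in>I. alt i (add.fr (obj Z i)))) \<in> add.N"
    by (simp add: alt_diff sum_subtractf) (simp add: algebra_simps)
  moreover have e: "euler_class C (obj X) = add.N #>\<^bsub>add.Fr\<^esub> (\<Sum>i\<in>I. alt i (add.fr (obj X i)))"
    "euler_class C (obj Y) = add.N #>\<^bsub>add.Fr\<^esub> (\<Sum>i\<in>I. alt i (add.fr (obj Y i)))"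
    "euler_class C (obj Z) = add.N #>\<^bsub>add.Fr\<^esub> (\<Sum>i\<in>I. alt i (add.fr (obj Z i)))"
    by (rule euler_class_coset[OF O(1) I zX] euler_class_coset[OF O(2) I zY] euler_class_coset[OF O(3) I zZ]; assumption)+
  ultimately show "euler_class C (obj Y) = euler_class C (obj X) \<otimes>\<^bsub>K0_add C\<^esub> euler_class C (obj Z)"
    unfolding e
      K0_add_def add.coset_mult[OF sc[OF O(1)] sc[OF O(3)]]
    using add.coset_eq_iff[OF sc[OF O(2)] add.Fr_closed(1)[OF sc[OF O(1)] sc[OF O(3)]]] by simp
qed

lemma euler_class_closed:
  assumes "\<And>i. obj X i \<in> Ob C" "almost_all_zero C X"
  shows "euler_class C (obj X) \<in> carrier (K0_add C)"
proof -
  have "euler_class C (obj X) = add.N #>\<^bsub>add.Fr\<^esub> (\<Sum>i \<in> {i. \<not> is_zero_object C (obj X i)}. alt i (add.fr (obj X i)))"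
    by (rule euler_class_coset[OF assms(1)]) (use assms(2) in \<open>auto simp: almost_all_zero_def\<close>)
  then show ?thesis
    unfolding K0_add_def using add.coset_closed[OF add.sum_closed[OF alt_fr_closed[OF assms(1)]]] by simp
qed

end

context additive_category
begin

text \<open>The cone of the equivalence has terms the sums of \<open>obj L n\<close> and
  \<open>obj K (n + 1)\<close>, so its vanishing alternating sum is the Euler class of
  \<open>L\<close> minus that of \<open>K\<close>. Both complexes are assumed bounded, so the cone
  is too.\<close>

lemma euler_class_homotopy_equivalent:
  assumes he: "homotopy_equivalent C K L" and zK: "almost_all_zero C K" and zL: "almost_all_zero C L"
  shows "euler_class C (obj K) = euler_class C (obj L)"
proof -
  have O: "obj K i \<in> Ob C" "obj L i \<in> Ob C" for i
    using he is_complexD(1) unfolding homotopy_equivalent_def by blast+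
  have "\<forall>n. \<exists>S. is_biproduct C (obj L n) (obj K (n + 1)) S"
    using has_biproducts[OF O(2) O(1)] by blast
  then obtain S where S: "\<And>n. is_biproduct C (obj L n) (obj K (n + 1)) (S n)"
    by metis
  obtain Q h where Q: "obj Q = S" "contraction Q h" "\<And>n. h (n - 1) \<cdot> h n = Zro C (obj Q n) (obj Q (n - 2))"
    using homotopy_equivalent_cone_contractible[OF he S] contraction_square_zero by metis
  obtain b m where bK: "\<And>i. i < b \<or> b + int m < i \<Longrightarrow> is_zero_object C (obj K i)"
    using almost_all_zero_interval[OF zK] by metis
  obtain b' m' where bL: "\<And>i. i < b' \<or> b' + int m' < i \<Longrightarrow> is_zero_object C (obj L i)"
    using almost_all_zero_interval[OF zL] by metis
  \<comment> \<open>The cone sees \<open>K\<close> one degree early, whence the extra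
    \<open>- 1\<close>; the window from \<open>c\<close> of length \<open>M\<close> then contains
    the cone and both complexes.\<close>
  define c where "c = min b b' - 1"
  define M where "M = nat (max (b + int m) (b' + int m') - c)"
  have zK': "is_zero_object C (obj K i)" if "i < c + 1 \<or> c + int M < i" for i
    using that bK[of i] unfolding c_def M_def by linarith
  have zL': "is_zero_object C (obj L i)" if "i < c \<or> c + int M < i" for i
    using that bL[of i] unfolding c_def M_def by linarith
  have "is_zero_object C (obj Q i)" if "i < c \<or> c + int M < i" for i
    unfolding Q by (rule biproduct_zero[OF S]) (use that in \<open>auto intro!: zK' zL'\<close>)
  then have "(\<Sum>i = c..c + int M. alt i (add.fr (S i))) \<in> add.N"
    using euler_contraction[OF Q(2,3), of c M] unfolding Q(1) by blast
  moreover have "(\<Sum>i = c..c + int M. alt i (add.fr (S i) - add.fr (obj L i) - add.fr (obj K (i + 1)))) \<in> add.N"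
    by (rule add.N_sum, rule N_alt, rule fr_biproduct, rule S)
  ultimately have "(\<Sum>i = c..c + int M. alt i (add.fr (S i)))
    - (\<Sum>i = c..c + int M. alt i (add.fr (S i) - add.fr (obj L i) - add.fr (obj K (i + 1)))) \<in> add.N"
    by (rule add.N_diff)
  then have 1: "(\<Sum>i = c..c + int M. alt i (add.fr (obj L i))) + (\<Sum>i = c..c + int M. alt i (add.fr (obj K (i + 1)))) \<in> add.N"
    by (simp add: alt_diff sum_subtractf add.commute)
  have "(\<Sum>i = c..c + int M. alt i (add.fr (obj K (i + 1)))) = (\<Sum>i \<in> {c + 1..c + int M + 1}. alt (i - 1) (add.fr (obj K i)))"
    by (rule sum.reindex_bij_witness[of _ "\<lambda>i. i - 1" "\<lambda>i. i + 1"]) auto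
  also have "\<dots> = - (\<Sum>i \<in> {c + 1..c + int M + 1}. alt i (add.fr (obj K i)))"
    by (simp add: alt_shift sum_negf)
  finally have 2: "(\<Sum>i = c..c + int M. alt i (add.fr (obj L i))) - (\<Sum>i \<in> {c + 1..c + int M + 1}. alt i (add.fr (obj K i))) \<in> add.N"
    using 1 by simp
  have e1: "euler_class C (obj K) = add.N #>\<^bsub>add.Fr\<^esub> (\<Sum>i \<in> {c + 1..c + int M + 1}. alt i (add.fr (obj K i)))"
    by (rule euler_class_coset[OF O(1)]) (auto intro!: zK')
  have e2: "euler_class C (obj L) = add.N #>\<^bsub>add.Fr\<^esub> (\<Sum>i \<in> {c..c + int M}. alt i (add.fr (obj L i)))"
    by (rule euler_class_coset[OF O(2)]) (auto intro!: zL')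
  show ?thesis
    unfolding e1 e2
    by (rule sym, subst add.coset_eq_iff) (use 2 in \<open>auto intro!: add.sum_closed alt_fr_closed O simp del: add.Fr_simps(1)\<close>)
qed

end

section \<open>Triangulated categories\<close>

lemma (in preadditive_category) minus_zero_eq:
  assumes "f \<in> Homs C X Y" "g \<in> Homs C X Y" "f \<boxplus> neg_arrow C g = Zro C X Y"
  shows "f = g"
proof -
  note [simp] = HomsD[OF assms(1)] HomsD[OF assms(2)]
  have "neg_arrow C g \<boxplus> f = neg_arrow C g \<boxplus> g"
    using assms(3) Pls_comm[of "neg_arrow C g" X Y f] Pls_neg(2)[OF assms(2)] by (simp add: cat_simps)
  then show ?thesis by (rule Pls_left_cancel[rotated -1, of _ _ _ X Y]) (simp_all add: cat_simps)
qed

context triangulated_category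
begin

lemma ShA_arr:
  assumes "f \<in> Ar C"
  shows "ShA C i f \<in> Ar C" "Dom C (ShA C i f) = ShO C i (Dom C f)" "Cod C (ShA C i f) = ShO C i (Cod C f)"
  using ShA_in[of f "Dom C f" "Cod C f" i] assms by (simp_all add: Homs_def)

lemma ShA_Cmp': "f \<in> Ar C \<Longrightarrow> g \<in> Ar C \<Longrightarrow> Cod C f = Dom C g \<Longrightarrow> ShA C i (g \<cdot> f) = ShA C i g \<cdot> ShA C i f"
  using ShA_Cmp[of f "Dom C f" "Cod C f" g "Cod C g"] by (simp add: Homs_def)

lemma ShA_Pls': "f \<in> Ar C \<Longrightarrow> g \<in> Ar C \<Longrightarrow> Dom C f = Dom C g \<Longrightarrow> Cod C f = Cod C g
    \<Longrightarrow> ShA C i (f \<boxplus> g) = ShA C i f \<boxplus> ShA C i g"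
  using ShA_Pls[of f "Dom C f" "Cod C f" g] by (simp add: Homs_def)

lemma ShA_Zro: "X \<in> Ob C \<Longrightarrow> Y \<in> Ob C \<Longrightarrow> ShA C i (Zro C X Y) = Zro C (ShO C i X) (ShO C i Y)"
  using ShA_Pls[OF Zro_in Zro_in, of X Y i] Pls_Zro(1)[OF Zro_in[of X Y]]
  by (intro Pls_self_zero ShA_in[OF Zro_in]) auto

lemma ShA_neg: "f \<in> Ar C \<Longrightarrow> ShA C i (neg_arrow C f) = neg_arrow C (ShA C i f)"
  using ShA_Pls'[of f "neg_arrow C f" i] Pls_neg(1)[of f "Dom C f" "Cod C f"] Dom_Ob[of f] Cod_Ob[of f]
  by (intro neg_unique[of _ "ShO C i (Dom C f)" "ShO C i (Cod C f)"])
    (simp_all add: cat_simps ShA_arr ShA_Zro)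

lemma ShO_ShO: "X \<in> Ob C \<Longrightarrow> ShO C i (ShO C j X) = ShO C (i + j) X"
  by (simp add: ShO_add)

lemma ShA_ShA: "f \<in> Ar C \<Longrightarrow> ShA C i (ShA C j f) = ShA C (i + j) f"
  by (simp add: ShA_add)

lemmas sh_simps = ShO_in ShA_arr ShA_Cmp' ShA_Pls' ShA_Idn ShA_Zro ShA_neg ShO_ShO ShA_ShA ShO_0 ShA_0
lemmas tcat_simps = cat_simps sh_simps

lemma ShA_inj: "f \<in> Ar C \<Longrightarrow> g \<in> Ar C \<Longrightarrow> ShA C i f = ShA C i g \<Longrightarrow> f = g"
  by (metis ShA_ShA[of _ "- i" i] ShA_0 add.left_inverse)

lemma triD:
  assumes "dist_tri C f g h"
  shows "f \<in> Ar C" "g \<in> Ar C" "h \<in> Ar C" "Dom C g = Cod C f" "Dom C h = Cod C g" "Cod C h = ShO C 1 (Dom C f)"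
  using tri_in[OF assms] by (simp_all add: Homs_def)

lemma rotate: "dist_tri C f g h \<Longrightarrow> dist_tri C g h (neg_arrow C (ShA C 1 f))"
  using TR2[of f "Dom C f" "Cod C f" g "Cod C g" h] triD[of f g h] by (simp add: Homs_def)

lemma rotate_back:
  assumes "dist_tri C f g h"
  shows "dist_tri C (neg_arrow C (ShA C (- 1) h)) f g"
proof -
  note [simp] = triD[OF assms]
  show ?thesis
    using TR2[of "neg_arrow C (ShA C (- 1) h)" "ShO C (- 1) (Cod C g)" "Dom C f" f "Cod C f" g] assms
    by (simp add: tcat_simps)
qed

lemma tri_iso:
  assumes t: "dist_tri C f g h"
    and a: "a \<in> Homs C (Dom C f) X" "is_iso_arrow C a" and b: "b \<in> Homs C (Cod C f) Y" "is_iso_arrow C b"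
    and c: "c \<in> Homs C (Cod C g) Z" "is_iso_arrow C c"
    and h: "f' \<in> Homs C X Y" "g' \<in> Homs C Y Z" "h' \<in> Homs C Z (ShO C 1 X)"
    and e: "f' \<cdot> a = b \<cdot> f" "g' \<cdot> b = c \<cdot> g" "h' \<cdot> c = ShA C 1 a \<cdot> h"
  shows "dist_tri C f' g' h'"
  using TR1_iso[OF t a(1) b(1) c(1) a(2) b(2) c(2) h e] .

lemma Idn_iso: "X \<in> Ob C \<Longrightarrow> is_iso_arrow C (Idn C X)" "X \<in> Ob C \<Longrightarrow> is_iso_arrow C (neg_arrow C (Idn C X))"
  by (rule isomorphicI(2)[of _ X X "Idn C X"]; simp add: cat_simps)
    (rule isomorphicI(2)[of _ X X "neg_arrow C (Idn C X)"]; simp add: cat_simps)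

text \<open>In each case the isomorphism of triangles is minus the identity at one vertex and the
  identity at the other two.\<close>

lemma tri_sign:
  assumes "dist_tri C f g h"
  shows "dist_tri C (neg_arrow C f) (neg_arrow C g) h" "dist_tri C f (neg_arrow C g) (neg_arrow C h)"
    "dist_tri C (neg_arrow C f) g (neg_arrow C h)"
proof -
  note [simp] = triD[OF assms]
  note i = Idn_iso
  show "dist_tri C (neg_arrow C f) (neg_arrow C g) h"
    by (rule tri_iso[OF assms _ i(1)[of "Dom C f"] _ i(2)[of "Cod C f"] _ i(1)[of "Cod C g"]])
      (simp_all add: tcat_simps)
  show "dist_tri C f (neg_arrow C g) (neg_arrow C h)"
    by (rule tri_iso[OF assms _ i(1)[of "Dom C f"] _ i(1)[of "Cod C f"] _ i(2)[of "Cod C g"]])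
      (simp_all add: tcat_simps)
  show "dist_tri C (neg_arrow C f) g (neg_arrow C h)"
    by (rule tri_iso[OF assms _ i(2)[of "Dom C f"] _ i(1)[of "Cod C f"] _ i(1)[of "Cod C g"]])
      (simp_all add: tcat_simps)
qed

text \<open>Rotating three times shifts the triangle and negates all three arrows; two of the signs
  cancel by the preceding lemma, and one must remain.\<close>

lemma tri_shift1:
  assumes "dist_tri C f g h"
  shows "dist_tri C (ShA C 1 f) (ShA C 1 g) (neg_arrow C (ShA C 1 h))"
    "dist_tri C (ShA C (- 1) f) (ShA C (- 1) g) (neg_arrow C (ShA C (- 1) h))"
proof -
  note [simp] = triD[OF assms]
  show "dist_tri C (ShA C 1 f) (ShA C 1 g) (neg_arrow C (ShA C 1 h))"
    using tri_sign(1)[OF rotate[OF rotate[OF rotate[OF assms]]]] by (simp add: tcat_simps)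
  show "dist_tri C (ShA C (- 1) f) (ShA C (- 1) g) (neg_arrow C (ShA C (- 1) h))"
    using tri_sign(1)[OF rotate_back[OF rotate_back[OF rotate_back[OF assms]]]] by (simp add: tcat_simps)
qed

definition sgn_arrow :: "int \<Rightarrow> 'm \<Rightarrow> 'm" where
  "sgn_arrow i f = (if even i then f else neg_arrow C f)"

lemma sgn_arr:
  assumes "f \<in> Ar C"
  shows "sgn_arrow i f \<in> Ar C" "Dom C (sgn_arrow i f) = Dom C f" "Cod C (sgn_arrow i f) = Cod C f"
    "sgn_arrow i (sgn_arrow j f) = sgn_arrow (i + j) f"
  using assms by (simp_all add: sgn_arrow_def cat_simps)

lemma tri_shift:
  assumes "dist_tri C f g h"
  shows "dist_tri C (ShA C i f) (ShA C i g) (sgn_arrow i (ShA C i h))"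
proof (induction i rule: int_induct[of _ 0])
  case base
  then show ?case using assms triD[OF assms] by (simp add: sgn_arrow_def ShA_0)
next
  case (step1 i)
  then show ?case using tri_shift1(1)[OF step1(2)] triD[OF assms]
    by (auto simp add: sgn_arrow_def tcat_simps add.commute)
next
  case (step2 i)
  then show ?case using tri_shift1(2)[OF step2(2)] triD[OF assms]
    by (auto simp add: sgn_arrow_def tcat_simps)
qed

lemma tri_id_right: "X \<in> Ob C \<Longrightarrow> is_zero_object C Z \<Longrightarrow> dist_tri C (Zro C Z X) (Idn C X) (Zro C X (ShO C 1 Z))"
proof -
  assume X: "X \<in> Ob C" and Z: "is_zero_object C Z"
  then have Zo: "Z \<in> Ob C" "Idn C Z = Zro C Z Z" by (simp_all add: zero_object_iff)
  then have Z1: "is_zero_object C (ShO C 1 Z)"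
    using ShA_Idn[of Z 1] by (simp add: zero_object_iff tcat_simps)
  have "dist_tri C (neg_arrow C (ShA C (- 1) (Zro C (ShO C 1 Z) (ShO C 1 X)))) (Idn C X) (Zro C X (ShO C 1 Z))"
    by (rule rotate_back[OF TR1_id[OF X Z1]])
  then show ?thesis using X Zo by (simp add: tcat_simps neg_Zro)
qed

lemma tri_comp_zero:
  assumes "dist_tri C f g h"
  shows "g \<cdot> f = Zro C (Dom C f) (Cod C g)" "h \<cdot> g = Zro C (Cod C f) (Cod C h)"
proof -
  have *: "g \<cdot> f = Zro C (Dom C f) (Cod C g)" if t: "dist_tri C f g h" for f g h
  proof -
    note [simp] = triD[OF t]
    obtain Z where Z: "is_zero_object C Z" using has_zero by blast
    then have Zo [simp]: "Z \<in> Ob C" by (simp add: zero_object_iff)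
    have t0: "dist_tri C (Idn C (Dom C f)) (Zro C (Dom C f) Z) (Zro C Z (ShO C 1 (Dom C f)))"
      by (rule TR1_id[OF _ Z]) (simp add: Dom_Ob)
    obtain c where c: "c \<in> Homs C Z (Cod C g)" "c \<cdot> Zro C (Dom C f) Z = g \<cdot> f"
      using TR3[OF t0 t, of "Idn C (Dom C f)" f] by (auto simp: tcat_simps)
    then show ?thesis by (simp add: tcat_simps)
  qed
  show "g \<cdot> f = Zro C (Dom C f) (Cod C g)" using *[OF assms] .
  show "h \<cdot> g = Zro C (Cod C f) (Cod C h)" using *[OF rotate[OF assms]] triD[OF assms] by simp
qed

text \<open>Exactness of the functor represented by \<open>W\<close>, derived from TR3: a morphism
  from the rotated trivial triangle on \<open>W\<close> to the rotated given one is filled in, and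
  the filler is shifted back.\<close>

lemma tri_lift:
  assumes t: "dist_tri C f g h" and s: "s \<in> Homs C W (Cod C f)" "g \<cdot> s = Zro C W (Cod C g)"
  shows "\<exists>r \<in> Homs C W (Dom C f). f \<cdot> r = s"
proof -
  note [simp] = triD[OF t] HomsD[OF s(1)]
  have W [simp]: "W \<in> Ob C" using Homs_Ob[OF s(1)] by blast
  obtain Z where Z: "is_zero_object C Z" using has_zero by blast
  then have Zo [simp]: "Z \<in> Ob C" by (simp add: zero_object_iff)
  obtain c where c: "c \<in> Homs C (ShO C 1 W) (ShO C 1 (Dom C f))"
    "neg_arrow C (ShA C 1 f) \<cdot> c = ShA C 1 s \<cdot> neg_arrow C (ShA C 1 (Idn C W))"
    using TR3[OF rotate[OF TR1_id[OF W Z]] rotate[OF t], of s "Zro C Z (Cod C g)"] s(2)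
    by (auto simp: tcat_simps)
  note [simp] = HomsD[OF c(1)]
  have "neg_arrow C (ShA C 1 (f \<cdot> ShA C (- 1) c)) = neg_arrow C (ShA C 1 s)"
    using c(2) by (simp add: tcat_simps)
  then have "neg_arrow C (neg_arrow C (ShA C 1 (f \<cdot> ShA C (- 1) c))) = neg_arrow C (neg_arrow C (ShA C 1 s))"
    by simp
  then have "ShA C 1 (f \<cdot> ShA C (- 1) c) = ShA C 1 s" by (simp add: neg_neg tcat_simps)
  then have "f \<cdot> ShA C (- 1) c = s" by (rule ShA_inj[rotated -1]) (simp_all add: tcat_simps)
  moreover have "ShA C (- 1) c \<in> Homs C W (Dom C f)" by (simp add: tcat_simps)
  ultimately show ?thesis by blast
qed

lemma tri_extend:
  assumes t: "dist_tri C f g h" and s: "s \<in> Homs C (Cod C f) W" "s \<cdot> f = Zro C (Dom C f) W"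
  shows "\<exists>r \<in> Homs C (Cod C g) W. r \<cdot> g = s"
proof -
  note [simp] = triD[OF t] HomsD[OF s(1)]
  have W [simp]: "W \<in> Ob C" using Homs_Ob[OF s(1)] by blast
  obtain Z where Z: "is_zero_object C Z" using has_zero by blast
  then have Zo [simp]: "Z \<in> Ob C" by (simp add: zero_object_iff)
  show ?thesis
    using TR3[OF t tri_id_right[OF W Z], of "Zro C (Dom C f) Z" s] s(2)
    by (auto simp: tcat_simps)
qed

lemma neg_eq_Zro: "f \<in> Ar C \<Longrightarrow> Dom C f = X \<Longrightarrow> Cod C f = Y \<Longrightarrow> neg_arrow C f = Zro C X Y \<longleftrightarrow> f = Zro C X Y"
  using neg_neg[of f] neg_Zro[of X Y] Dom_Ob[of f] Cod_Ob[of f] by metis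

lemma tri_lift2:
  assumes t: "dist_tri C f g h" and s: "s \<in> Homs C W (Cod C g)" "h \<cdot> s = Zro C W (Cod C h)"
  shows "\<exists>r \<in> Homs C W (Cod C f). g \<cdot> r = s"
  using tri_lift[OF rotate[OF t], of s W] s triD[OF t] by simp

lemma tri_extend2:
  assumes t: "dist_tri C f g h" and s: "s \<in> Homs C (Cod C g) W" "s \<cdot> g = Zro C (Cod C f) W"
  shows "\<exists>r \<in> Homs C (ShO C 1 (Dom C f)) W. r \<cdot> h = s"
  using tri_extend[OF rotate[OF t], of s W] s triD[OF t] by simp

text \<open>Exactness at the first vertex, expressed through the desuspended third arrow so that
  later statements need no sign.\<close>

lemma tri_lift0:
  assumes t: "dist_tri C f g h" and s: "s \<in> Homs C W (Dom C f)" "f \<cdot> s = Zro C W (Cod C f)"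
  shows "\<exists>r \<in> Homs C W (ShO C (- 1) (Cod C g)). ShA C (- 1) h \<cdot> r = s"
proof -
  note [simp] = triD[OF t] HomsD[OF s(1)]
  obtain r where r: "r \<in> Homs C W (ShO C (- 1) (Cod C g))" "neg_arrow C (ShA C (- 1) h) \<cdot> r = s"
    using tri_lift[OF rotate_back[OF t], of s W] s by (auto simp: tcat_simps)
  then show ?thesis
    by (intro bexI[of _ "neg_arrow C r"]) (auto simp: tcat_simps)
qed

lemma tri_extend0:
  assumes t: "dist_tri C f g h" and s: "s \<in> Homs C (Dom C f) W"
    "s \<cdot> ShA C (- 1) h = Zro C (ShO C (- 1) (Cod C g)) W"
  shows "\<exists>r \<in> Homs C (Cod C f) W. r \<cdot> f = s"
proof -
  note [simp] = triD[OF t] HomsD[OF s(1)]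
  have "W \<in> Ob C" using Homs_Ob[OF s(1)] by blast
  then show ?thesis
    using tri_extend[OF rotate_back[OF t], of s W] s by (auto simp: tcat_simps neg_Zro)
qed

text \<open>The difference \<open>e\<close> of \<open>u\<close> and the identity kills
  \<open>g\<close>, so it factors through \<open>h\<close>; since also \<open>h e = 0\<close>, its
  square vanishes, and \<open>1 - e\<close> is the inverse.\<close>

lemma cone_endo_iso:
  assumes t: "dist_tri C f g h" and u: "u \<in> Homs C (Cod C g) (Cod C g)" "u \<cdot> g = g" "h \<cdot> u = h"
  shows "\<exists>v \<in> Homs C (Cod C g) (Cod C g). v \<cdot> u = Idn C (Cod C g) \<and> u \<cdot> v = Idn C (Cod C g)"
proof -
  note [simp] = triD[OF t] HomsD[OF u(1)]
  let ?Z = "Cod C g"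
  define e where "e = u \<boxplus> neg_arrow C (Idn C ?Z)"
  have e: "e \<in> Homs C ?Z ?Z" unfolding e_def by (simp add: tcat_simps)
  note [simp] = HomsD[OF e]
  have "e \<cdot> g = Zro C (Cod C f) ?Z" unfolding e_def using u(2)
    by (simp add: tcat_simps Pls_neg(1)[of g "Cod C f" ?Z])
  then obtain s where s: "s \<in> Homs C (ShO C 1 (Dom C f)) ?Z" "s \<cdot> h = e" using tri_extend2[OF t e] by blast
  note [simp] = HomsD[OF s(1)]
  have "h \<cdot> e = Zro C ?Z (Cod C h)" unfolding e_def using u(3)
    by (simp add: tcat_simps Pls_neg(1)[of h ?Z "ShO C 1 (Dom C f)"])
  then have "s \<cdot> (h \<cdot> e) = Zro C ?Z ?Z" by (simp add: tcat_simps)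
  then have ee: "e \<cdot> e = Zro C ?Z ?Z" using s(2) by (simp add: Cmp_assoc'[symmetric])
  have ue: "u = e \<boxplus> Idn C ?Z"
    unfolding e_def
    apply (rule lin_eqI[of ?Z ?Z])
    apply (rule lin_Pls lin_neg lin_Zro lin_atom' | (simp add: cat_simps; fail) | (simp add: algebra_simps; fail))+
    done
  have "(Idn C ?Z \<boxplus> neg_arrow C e) \<cdot> u = Idn C ?Z" "u \<cdot> (Idn C ?Z \<boxplus> neg_arrow C e) = Idn C ?Z"
    unfolding ue
     apply (simp_all add: tcat_simps ee neg_Zro)
     apply (rule lin_eqI[of ?Z ?Z],
      (rule lin_Pls lin_neg lin_Zro lin_atom' | (simp add: cat_simps; fail) | (simp add: algebra_simps; fail))+)+
    done
  moreover have "Idn C ?Z \<boxplus> neg_arrow C e \<in> Homs C ?Z ?Z" by (simp add: tcat_simps)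
  ultimately show ?thesis by blast
qed

text \<open>A filler \<open>d\<close> in the opposite direction is chosen by TR3. The composites
  \<open>d c\<close> and \<open>c d\<close> need not be identities, but they fix the arrows of the
  cones and are invertible by the preceding lemma, so \<open>c\<close> has inverses on both
  sides.\<close>

lemma tri_fill_iso:
  assumes t: "dist_tri C f g h" and t': "dist_tri C f' g' h'"
    and a: "a \<in> Homs C (Dom C f) (Dom C f')" "is_iso_arrow C a"
    and b: "b \<in> Homs C (Cod C f) (Cod C f')" "is_iso_arrow C b"
    and e: "b \<cdot> f = f' \<cdot> a"
    and c: "c \<in> Homs C (Cod C g) (Cod C g')" "c \<cdot> g = g' \<cdot> b" "h' \<cdot> c = ShA C 1 a \<cdot> h"
  shows "is_iso_arrow C c"
proof -
  note [simp] = triD[OF t] triD[OF t'] HomsD[OF a(1)] HomsD[OF b(1)] HomsD[OF c(1)]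
  obtain a' where a': "a' \<in> Homs C (Dom C f') (Dom C f)" "a' \<cdot> a = Idn C (Dom C f)" "a \<cdot> a' = Idn C (Dom C f')"
    by (rule is_iso_arrowE[OF a(2,1)])
  obtain b' where b': "b' \<in> Homs C (Cod C f') (Cod C f)" "b' \<cdot> b = Idn C (Cod C f)" "b \<cdot> b' = Idn C (Cod C f')"
    by (rule is_iso_arrowE[OF b(2,1)])
  note [simp] = HomsD[OF a'(1)] HomsD[OF b'(1)]
  have "b' \<cdot> f' = b' \<cdot> (f' \<cdot> (a \<cdot> a'))" using a'(3) by (simp add: tcat_simps)
  also have "\<dots> = b' \<cdot> ((b \<cdot> f) \<cdot> a')" by (simp add: e Cmp_assoc' Cmp_arr)
  also have "\<dots> = (b' \<cdot> b) \<cdot> (f \<cdot> a')" by (simp add: tcat_simps)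
  also have "\<dots> = f \<cdot> a'" unfolding b'(2) by (simp add: tcat_simps)
  finally have e': "b' \<cdot> f' = f \<cdot> a'" .
  obtain d where d: "d \<in> Homs C (Cod C g') (Cod C g)" "d \<cdot> g' = g \<cdot> b'" "h \<cdot> d = ShA C 1 a' \<cdot> h'"
    using TR3[OF t' t a'(1) b'(1) e'] by blast
  note [simp] = HomsD[OF d(1)]
  have "(d \<cdot> c) \<cdot> g = (d \<cdot> g') \<cdot> b" using c(2) by (simp add: Cmp_assoc' Cmp_arr)
  then have 1: "(d \<cdot> c) \<cdot> g = g" using b'(2) d(2) by (simp add: tcat_simps)
  have "h \<cdot> (d \<cdot> c) = ShA C 1 a' \<cdot> (h' \<cdot> c)" using d(3) by (simp add: Cmp_assoc'[symmetric] Cmp_arr sh_simps)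
  also have "\<dots> = ShA C 1 (a' \<cdot> a) \<cdot> h" unfolding c(3) by (simp add: tcat_simps)
  finally have 2: "h \<cdot> (d \<cdot> c) = h" unfolding a'(2) by (simp add: tcat_simps)
  obtain v where v: "v \<in> Homs C (Cod C g) (Cod C g)" "v \<cdot> (d \<cdot> c) = Idn C (Cod C g)"
    using cone_endo_iso[OF t Cmp_in[OF c(1) d(1)] 1 2] by blast
  have "(c \<cdot> d) \<cdot> g' = (c \<cdot> g) \<cdot> b'" using d(2) by (simp add: Cmp_assoc' Cmp_arr)
  then have 3: "(c \<cdot> d) \<cdot> g' = g'" using b'(3) c(2) by (simp add: tcat_simps)
  have "h' \<cdot> (c \<cdot> d) = ShA C 1 a \<cdot> (h \<cdot> d)" using c(3) by (simp add: Cmp_assoc'[symmetric] Cmp_arr sh_simps)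
  also have "\<dots> = ShA C 1 (a \<cdot> a') \<cdot> h'" unfolding d(3) by (simp add: tcat_simps)
  finally have 4: "h' \<cdot> (c \<cdot> d) = h'" unfolding a'(3) by (simp add: tcat_simps)
  obtain v' where v': "v' \<in> Homs C (Cod C g') (Cod C g')" "(c \<cdot> d) \<cdot> v' = Idn C (Cod C g')"
    using cone_endo_iso[OF t' Cmp_in[OF d(1) c(1)] 3 4] by blast
  note [simp] = HomsD[OF v(1)] HomsD[OF v'(1)]
  have l: "(v \<cdot> d) \<cdot> c = Idn C (Cod C g)" and r: "c \<cdot> (d \<cdot> v') = Idn C (Cod C g')"
    using v(2) v'(2) by (simp_all add: Cmp_assoc' Cmp_arr)
  have "v \<cdot> d = (v \<cdot> d) \<cdot> (c \<cdot> (d \<cdot> v'))" unfolding r by (simp add: tcat_simps)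
  also have "\<dots> = ((v \<cdot> d) \<cdot> c) \<cdot> (d \<cdot> v')" by (simp add: Cmp_assoc' Cmp_arr)
  also have "\<dots> = d \<cdot> v'" unfolding l by (simp add: tcat_simps)
  finally have "c \<cdot> (v \<cdot> d) = Idn C (Cod C g')" using r by simp
  then show ?thesis by (intro isomorphicI(2)[OF c(1) Cmp_in[OF d(1) v(1)] l])
qed

lemma cone_unique:
  assumes t: "dist_tri C f g h" and t': "dist_tri C f g' h'"
  shows "\<exists>c \<in> Homs C (Cod C g) (Cod C g'). is_iso_arrow C c \<and> c \<cdot> g = g' \<and> h' \<cdot> c = h"
proof -
  note [simp] = triD[OF t] triD[OF t']
  have i: "Idn C (Dom C f) \<in> Homs C (Dom C f) (Dom C f)" "Idn C (Cod C f) \<in> Homs C (Cod C f) (Cod C f)"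
    by (simp_all add: tcat_simps)
  have e: "Idn C (Cod C f) \<cdot> f = f \<cdot> Idn C (Dom C f)" by (simp add: tcat_simps)
  obtain c where c: "c \<in> Homs C (Cod C g) (Cod C g')" "c \<cdot> g = g' \<cdot> Idn C (Cod C f)" "h' \<cdot> c = ShA C 1 (Idn C (Dom C f)) \<cdot> h"
    using TR3[OF t t' i e] by blast
  have "is_iso_arrow C c"
    by (rule tri_fill_iso[OF t t' i(1) _ i(2) _ e c]) (simp_all add: Idn_iso cat_simps)
  then show ?thesis using c by (intro bexI[of _ c]) (simp_all add: tcat_simps)
qed

text \<open>Any cone of \<open>i\<close> is compared with \<open>D\<close>. The retraction
  \<open>p\<close> forces the third arrow to vanish; hence the arrow \<open>r\<close> induced by
  \<open>q\<close> on the cone is an isomorphism with inverse \<open>g j\<close>.\<close>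

lemma split_tri:
  assumes "i \<in> Homs C A B" "j \<in> Homs C D B" "p \<in> Homs C B A" "q \<in> Homs C B D"
    and "p \<cdot> i = Idn C A" "q \<cdot> j = Idn C D" "q \<cdot> i = Zro C A D" "p \<cdot> j = Zro C D A"
    and "i \<cdot> p \<boxplus> j \<cdot> q = Idn C B"
  shows "dist_tri C i q (Zro C D (ShO C 1 A))"
proof -
  have O [simp]: "A \<in> Ob C" "B \<in> Ob C" "D \<in> Ob C"
    using Homs_Ob[OF assms(1)] Homs_Ob[OF assms(2)] by auto
  note [simp] = HomsD[OF assms(1)] HomsD[OF assms(2)] HomsD[OF assms(3)] HomsD[OF assms(4)] assms(5-8)
  obtain g h where t: "dist_tri C i g h" using TR1_cone[of i] by auto
  note [simp] = triD[OF t]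
  have "ShA C 1 i \<cdot> h = Zro C (Cod C g) (ShO C 1 B)"
    using tri_comp_zero(2)[OF rotate[OF t]] neg_eq_Zro[of "ShA C 1 i \<cdot> h" "Cod C g" "ShO C 1 B"]
    by (simp add: tcat_simps)
  then have "ShA C 1 p \<cdot> (ShA C 1 i \<cdot> h) = Zro C (Cod C g) (ShO C 1 A)" by (simp add: tcat_simps)
  moreover have "ShA C 1 p \<cdot> (ShA C 1 i \<cdot> h) = ShA C 1 (p \<cdot> i) \<cdot> h"
    by (simp add: sh_simps Cmp_assoc' del: assms(5))
  ultimately have h: "h = Zro C (Cod C g) (ShO C 1 A)" by (simp add: tcat_simps)
  obtain r where r: "r \<in> Homs C (Cod C g) D" "r \<cdot> g = q" using tri_extend[OF t, of q D] by (auto simp: tcat_simps)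
  note [simp] = HomsD[OF r(1)]
  have "r \<cdot> (g \<cdot> j) = (r \<cdot> g) \<cdot> j" by (simp add: Cmp_assoc')
  then have 1: "r \<cdot> (g \<cdot> j) = Idn C D" using r(2) by simp
  define e where "e = (g \<cdot> j) \<cdot> r \<boxplus> neg_arrow C (Idn C (Cod C g))"
  have e: "e \<in> Homs C (Cod C g) (Cod C g)" unfolding e_def by (simp add: tcat_simps)
  have "g = g \<cdot> (i \<cdot> p \<boxplus> j \<cdot> q)" unfolding assms(9) by (simp add: tcat_simps)
  also have "\<dots> = (g \<cdot> i) \<cdot> p \<boxplus> g \<cdot> (j \<cdot> q)" by (simp add: tcat_simps)
  also have "\<dots> = g \<cdot> (j \<cdot> q)" using tri_comp_zero(1)[OF t] by (simp add: tcat_simps)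
  finally have gjq: "g \<cdot> (j \<cdot> q) = g" ..
  have "e \<cdot> g = Zro C B (Cod C g)"
    unfolding e_def using gjq by (simp add: tcat_simps r(2) Pls_neg(1)[of g B "Cod C g"])
  then obtain s where s: "s \<in> Homs C (ShO C 1 A) (Cod C g)" "s \<cdot> h = e" using tri_extend2[OF t e] by auto
  then have "e = Zro C (Cod C g) (Cod C g)" by (simp add: h tcat_simps)
  then have "(g \<cdot> j) \<cdot> r = Idn C (Cod C g)"
    unfolding e_def
    using Pls_left_cancel[of "neg_arrow C (Idn C (Cod C g))" "Cod C g" "Cod C g" "(g \<cdot> j) \<cdot> r" "Idn C (Cod C g)"]
      Pls_comm[of "neg_arrow C (Idn C (Cod C g))" "Cod C g" "Cod C g" "(g \<cdot> j) \<cdot> r"]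
      Pls_neg(2)[of "Idn C (Cod C g)" "Cod C g" "Cod C g"]
    by (simp add: tcat_simps)
  then have iso: "is_iso_arrow C r"
    using 1 by (intro isomorphicI(2)[OF r(1), of "g \<cdot> j"]) (simp_all add: tcat_simps)
  show ?thesis
    by (rule tri_iso[OF t _ Idn_iso(1)[of A] _ Idn_iso(1)[of B] _ iso]) (use r(2) in \<open>simp_all add: tcat_simps h\<close>)
qed

text \<open>The 3 by 3 lemma, with one square anticommuting. The induced arrows \<open>w\<close> and
  \<open>f''\<close> are delivered first and the cone of \<open>w\<close> is quantified afterwards:
  in the applications \<open>w\<close> is computed from its equations, and a triangle already known
  can then be inserted.\<close>

lemma three_by_three:
  assumes tf: "dist_tri C f g h" and tf': "dist_tri C f' g' h'" and tu: "dist_tri C u u1 u2" and tv: "dist_tri C v v1 v2"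
    and O: "Dom C u = Dom C f" "Cod C u = Dom C f'" "Dom C v = Cod C f" "Cod C v = Cod C f'"
    and e: "v \<cdot> f = f' \<cdot> u"
  shows "\<exists>w \<in> Homs C (Cod C g) (Cod C g'). \<exists>f'' \<in> Homs C (Cod C u1) (Cod C v1).
    w \<cdot> g = g' \<cdot> v \<and> h' \<cdot> w = ShA C 1 u \<cdot> h \<and> f'' \<cdot> u1 = v1 \<cdot> f' \<and> v2 \<cdot> f'' = ShA C 1 f \<cdot> u2 \<and>
    (\<forall>w1 w2. dist_tri C w w1 w2 \<longrightarrow> (\<exists>g'' h''. dist_tri C f'' g'' h'' \<and> Cod C g'' = Cod C w1 \<and>
      g'' \<cdot> v1 = w1 \<cdot> g' \<and> w2 \<cdot> g'' = ShA C 1 g \<cdot> v2 \<and> h'' \<cdot> w1 = ShA C 1 u1 \<cdot> h' \<and>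
      ShA C 1 h \<cdot> w2 = neg_arrow C (ShA C 1 u2 \<cdot> h'')))"
proof -
  note [simp] = triD[OF tf] triD[OF tf'] triD[OF tu] triD[OF tv] O
  have vf: "v \<cdot> f \<in> Ar C" by (simp add: tcat_simps)
  obtain d1 d2 where td: "dist_tri C (v \<cdot> f) d1 d2" using TR1_cone[OF vf] by blast
  note td' = td[unfolded e]
  have [simp]: "d1 \<in> Ar C" "d2 \<in> Ar C" "Dom C d1 = Cod C f'" "Dom C d2 = Cod C d1" "Cod C d2 = ShO C 1 (Dom C f)"
    using triD[OF td] by (simp_all add: tcat_simps)
  obtain m1 n1 where m1: "m1 \<in> Homs C (Cod C g) (Cod C d1)" and n1: "n1 \<in> Homs C (Cod C d1) (Cod C v1)"
    and t1: "dist_tri C m1 n1 (ShA C 1 g \<cdot> v2)" and e1: "m1 \<cdot> g = d1 \<cdot> v" "d2 \<cdot> m1 = h" "n1 \<cdot> d1 = v1" "v2 \<cdot> n1 = ShA C 1 f \<cdot> d2"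
    using TR4[of f "Dom C f" "Cod C f" v "Cod C f'", OF _ _ tf tv td] by (auto simp: HomsI)
  obtain m2 n2 where m2: "m2 \<in> Homs C (Cod C u1) (Cod C d1)" and n2: "n2 \<in> Homs C (Cod C d1) (Cod C g')"
    and t2: "dist_tri C m2 n2 (ShA C 1 u1 \<cdot> h')" and e2: "m2 \<cdot> u1 = d1 \<cdot> f'" "d2 \<cdot> m2 = u2" "n2 \<cdot> d1 = g'" "h' \<cdot> n2 = ShA C 1 u \<cdot> d2"
    using TR4[of u "Dom C f" "Dom C f'" f' "Cod C f'", OF _ _ tu tf' td'] by (auto simp: HomsI)
  note [simp] = HomsD[OF m1] HomsD[OF n1] HomsD[OF m2] HomsD[OF n2]
  note ee = e1[THEN Cmp_assoc_eq] e2[THEN Cmp_assoc_eq] e1 e2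
  show ?thesis
  proof (rule bexI[of _ "n2 \<cdot> m1"], rule bexI[of _ "n1 \<cdot> m2"], intro conjI allI impI)
    show "n2 \<cdot> m1 \<cdot> g = g' \<cdot> v" "h' \<cdot> (n2 \<cdot> m1) = ShA C 1 u \<cdot> h" "n1 \<cdot> m2 \<cdot> u1 = v1 \<cdot> f'"
      "v2 \<cdot> (n1 \<cdot> m2) = ShA C 1 f \<cdot> u2"
      by (simp_all add: tcat_simps ee)
    fix w1 w2 assume tw: "dist_tri C (n2 \<cdot> m1) w1 w2"
    have [simp]: "w1 \<in> Ar C" "w2 \<in> Ar C" "Dom C w1 = Cod C g'" "Dom C w2 = Cod C w1" "Cod C w2 = ShO C 1 (Cod C g)"
      using triD[OF tw] by (simp_all add: tcat_simps)
    \<comment> \<open>The third octahedron belongs to the factorisation of \<open>w\<close> as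
      \<open>n2 m1\<close>.\<close>
    obtain m3 n3 where m3: "m3 \<in> Homs C (Cod C v1) (Cod C w1)" and n3: "n3 \<in> Homs C (Cod C w1) (ShO C 1 (Cod C u1))"
      and t3: "dist_tri C m3 n3 (ShA C 1 n1 \<cdot> neg_arrow C (ShA C 1 m2))"
      and e3: "m3 \<cdot> n1 = w1 \<cdot> n2" "w2 \<cdot> m3 = ShA C 1 g \<cdot> v2" "n3 \<cdot> w1 = ShA C 1 u1 \<cdot> h'"
        "neg_arrow C (ShA C 1 m2) \<cdot> n3 = ShA C 1 m1 \<cdot> w2"
      using TR4[OF m1 n2 t1 rotate[OF t2] tw] by (auto simp: tcat_simps)
    note [simp] = HomsD[OF m3] HomsD[OF n3]
    have "dist_tri C m3 n3 (neg_arrow C (ShA C 1 (n1 \<cdot> m2)))" using t3 by (simp add: tcat_simps)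
    then have "dist_tri C (n1 \<cdot> m2) m3 n3"
      using TR2[OF Cmp_in[OF m2 n1] m3 n3] by simp
    moreover have "m3 \<cdot> v1 = w1 \<cdot> g'"
    proof -
      have "m3 \<cdot> v1 = (m3 \<cdot> n1) \<cdot> d1" by (simp add: tcat_simps ee)
      also have "\<dots> = w1 \<cdot> g'" unfolding e3 by (simp add: tcat_simps ee)
      finally show ?thesis .
    qed
    moreover have "ShA C 1 h \<cdot> w2 = neg_arrow C (ShA C 1 u2 \<cdot> n3)"
    proof -
      have "ShA C 1 h \<cdot> w2 = ShA C 1 d2 \<cdot> (ShA C 1 m1 \<cdot> w2)"
        unfolding e1(2)[symmetric] by (simp add: tcat_simps)
      also have "\<dots> = neg_arrow C (ShA C 1 (d2 \<cdot> m2) \<cdot> n3)"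
        unfolding e3(4)[symmetric] by (simp add: tcat_simps)
      finally show ?thesis unfolding e2(2) .
    qed
    ultimately show "\<exists>g'' h''. dist_tri C (n1 \<cdot> m2) g'' h'' \<and> Cod C g'' = Cod C w1 \<and>
      g'' \<cdot> v1 = w1 \<cdot> g' \<and> w2 \<cdot> g'' = ShA C 1 g \<cdot> v2 \<and> h'' \<cdot> w1 = ShA C 1 u1 \<cdot> h' \<and>
      ShA C 1 h \<cdot> w2 = neg_arrow C (ShA C 1 u2 \<cdot> h'')"
      using e3 by (intro exI[of _ m3] exI[of _ n3]) simp
  qed (simp_all add: tcat_simps)
qed

end

section \<open>Weight structures\<close>

context weight_structure
begin

lemma w_le_Ob: "X \<in> w_le C w i \<Longrightarrow> X \<in> Ob C" and w_ge_Ob: "X \<in> w_ge C w i \<Longrightarrow> X \<in> Ob C"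
  using le0_sub ge0_sub ShO_in by (auto simp: w_le_def w_ge_def)

lemma w_le_iff: "X \<in> Ob C \<Longrightarrow> X \<in> w_le C w i \<longleftrightarrow> ShO C (- i) X \<in> w_le0 w"
proof -
  assume X: "X \<in> Ob C"
  have "X = ShO C i (ShO C (- i) X)" using X by (simp add: sh_simps)
  moreover have "ShO C (- i) (ShO C i Y) = Y" if "Y \<in> w_le0 w" for Y
    using that le0_sub by (auto simp: sh_simps)
  ultimately show ?thesis unfolding w_le_def by force
qed

lemma w_ge_iff: "X \<in> Ob C \<Longrightarrow> X \<in> w_ge C w i \<longleftrightarrow> ShO C (- i) X \<in> w_ge0 w"
proof -
  assume X: "X \<in> Ob C"
  have "X = ShO C i (ShO C (- i) X)" using X by (simp add: sh_simps)
  moreover have "ShO C (- i) (ShO C i Y) = Y" if "Y \<in> w_ge0 w" for Y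
    using that ge0_sub by (auto simp: sh_simps)
  ultimately show ?thesis unfolding w_ge_def by force
qed

lemma w_le_shift: "X \<in> Ob C \<Longrightarrow> ShO C j X \<in> w_le C w i \<longleftrightarrow> X \<in> w_le C w (i - j)"
  by (simp add: w_le_iff sh_simps)

lemma w_ge_shift: "X \<in> Ob C \<Longrightarrow> ShO C j X \<in> w_ge C w i \<longleftrightarrow> X \<in> w_ge C w (i - j)"
  by (simp add: w_ge_iff sh_simps)

lemma w_le_mono: "i \<le> j \<Longrightarrow> X \<in> w_le C w i \<Longrightarrow> X \<in> w_le C w j"
proof (induction j rule: int_ge_induct)
  case (step j)
  then have "ShO C (- j) X \<in> w_le0 w" and X: "X \<in> Ob C" using w_le_iff w_le_Ob by blast+
  then have "ShO C (- j) X \<in> w_le C w 1" using le0_shift by blast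
  then show ?case using X w_le_shift[OF X, of "- j" 1] by (simp add: add.commute)
qed

lemma w_ge_mono: "i \<le> j \<Longrightarrow> X \<in> w_ge C w j \<Longrightarrow> X \<in> w_ge C w i"
proof (induction i rule: int_le_induct)
  case (step i)
  then have X: "X \<in> Ob C" and "X \<in> w_ge C w i" using w_ge_Ob by blast+
  then have "ShO C (- i + 1) X \<in> w_ge C w 1" using w_ge_shift[OF X, of "- i + 1" 1] by simp
  then have "ShO C (- (i - 1)) X \<in> w_ge0 w" using ge0_shift by auto
  then show ?case using w_ge_iff[OF X] by blast
qed

lemma w_orth:
  assumes X: "X \<in> w_le C w i" and Y: "Y \<in> w_ge C w j" and "i < j" and f: "f \<in> Homs C X Y"
  shows "f = Zro C X Y"
proof -
  have O [simp]: "X \<in> Ob C" "Y \<in> Ob C" using w_le_Ob[OF X] w_ge_Ob[OF Y] .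
  note [simp] = HomsD[OF f]
  have 1: "ShO C (- i) X \<in> w_le0 w" using w_le_iff X by simp
  have "Y \<in> w_ge C w (i + 1)" using w_ge_mono[OF _ Y, of "i + 1"] \<open>i < j\<close> by simp
  then have 2: "ShO C (- i) Y \<in> w_ge C w 1" using w_ge_shift[OF O(2)] by (simp add: add.commute)
  have "ShA C (- i) f \<in> Homs C (ShO C (- i) X) (ShO C (- i) Y)" by (rule ShA_in[OF f])
  then have "ShA C (- i) f = Zro C (ShO C (- i) X) (ShO C (- i) Y)" using orthogonality[OF 1 2] by blast
  then have "ShA C (- i) f = ShA C (- i) (Zro C X Y)" by (simp add: ShA_Zro)
  then show ?thesis by (rule ShA_inj[rotated -1]) (simp_all add: tcat_simps)
qed

lemma retract_closedD:
  "retract_closed C S \<Longrightarrow> X \<in> S \<Longrightarrow> i \<in> Homs C Y X \<Longrightarrow> r \<in> Homs C X Y \<Longrightarrow> r \<cdot> i = Idn C Y \<Longrightarrow> Y \<in> S"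
  unfolding retract_closed_def using Homs_Ob by metis

lemma w_le_retract:
  assumes X: "X \<in> w_le C w n" and i: "i \<in> Homs C Y X" and r: "r \<in> Homs C X Y" and e: "r \<cdot> i = Idn C Y"
  shows "Y \<in> w_le C w n"
proof -
  have O: "X \<in> Ob C" "Y \<in> Ob C" using Homs_Ob[OF i] by auto
  have "ShA C (- n) r \<cdot> ShA C (- n) i = Idn C (ShO C (- n) Y)"
    using ShA_Cmp[OF i r, of "- n"] e O by (simp add: ShA_Idn)
  from retract_closedD[OF le0_retract _ ShA_in[OF i] ShA_in[OF r] this] show ?thesis
    using X O w_le_iff by blast
qed

lemma w_ge_retract:
  assumes X: "X \<in> w_ge C w n" and i: "i \<in> Homs C Y X" and r: "r \<in> Homs C X Y" and e: "r \<cdot> i = Idn C Y"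
  shows "Y \<in> w_ge C w n"
proof -
  have O: "X \<in> Ob C" "Y \<in> Ob C" using Homs_Ob[OF i] by auto
  have "ShA C (- n) r \<cdot> ShA C (- n) i = Idn C (ShO C (- n) Y)"
    using ShA_Cmp[OF i r, of "- n"] e O by (simp add: ShA_Idn)
  from retract_closedD[OF ge0_retract _ ShA_in[OF i] ShA_in[OF r] this] show ?thesis
    using X O w_ge_iff by blast
qed

lemma w_le_iso: "isomorphic C X Y \<Longrightarrow> X \<in> w_le C w n \<Longrightarrow> Y \<in> w_le C w n"
  and w_ge_iso: "isomorphic C X Y \<Longrightarrow> X \<in> w_ge C w n \<Longrightarrow> Y \<in> w_ge C w n"
  by (elim isomorphicE, use w_le_retract in blast) (elim isomorphicE, use w_ge_retract in blast)

definition wdec :: "int \<Rightarrow> 'o \<Rightarrow> 'm \<Rightarrow> 'm \<Rightarrow> 'm \<Rightarrow> bool" where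
  "wdec n M a b e \<longleftrightarrow> dist_tri C a b e \<and> Dom C a \<in> w_le C w n \<and> Cod C a = M \<and> Cod C b \<in> w_ge C w (n + 1)"

lemma wdecD:
  assumes "wdec n M a b e"
  shows "dist_tri C a b e" "Dom C a \<in> w_le C w n" "Cod C a = M" "Cod C b \<in> w_ge C w (n + 1)"
    "a \<in> Ar C" "b \<in> Ar C" "e \<in> Ar C" "Dom C b = M" "Dom C e = Cod C b" "Cod C e = ShO C 1 (Dom C a)"
    "M \<in> Ob C"
  using assms triD[of a b e] Cod_Ob[of a] unfolding wdec_def by auto

lemma wdec_exists: "M \<in> Ob C \<Longrightarrow> \<exists>a b e. wdec n M a b e"
proof -
  assume M: "M \<in> Ob C"
  then obtain f g h where t: "dist_tri C f g h" "Dom C f \<in> w_le0 w" "Cod C f = ShO C (- n) M" "Cod C g \<in> w_ge C w 1"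
    using decomposition[of "ShO C (- n) M"] ShO_in by blast
  note [simp] = triD[OF t(1)] t(3) M
  have [simp]: "Dom C f \<in> Ob C" "Cod C g \<in> Ob C" by (simp_all add: Dom_Ob Cod_Ob)
  have "Dom C f \<in> w_le C w 0" using t(2) le0_sub by (simp add: w_le_iff sh_simps)
  then have "wdec n M (ShA C n f) (ShA C n g) (sgn_arrow n (ShA C n h))"
    unfolding wdec_def using tri_shift[OF t(1), of n] t(4)
    by (simp add: tcat_simps w_le_shift w_ge_shift)
  then show ?thesis by blast
qed

text \<open>The obstruction to lifting \<open>t\<close> lives in weights at least
  \<open>n + 1\<close>, so orthogonality removes it.\<close>

lemma wdec_lift:
  assumes d: "wdec n M a b e" and X: "X \<in> w_le C w k" "k \<le> n" and t: "t \<in> Homs C X M"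
  shows "\<exists>s \<in> Homs C X (Dom C a). a \<cdot> s = t"
proof -
  note [simp] = wdecD(3,5-)[OF d] HomsD[OF t]
  have "b \<cdot> t = Zro C X (Cod C b)"
    by (rule w_orth[OF X(1) wdecD(4)[OF d]]) (use X(2) in \<open>simp_all add: cat_simps\<close>)
  then show ?thesis using tri_lift[OF wdecD(1)[OF d], of t X] t by simp
qed

text \<open>A map into the truncation that dies in \<open>M\<close> comes from the desuspended
  cofibre, which has weights at least \<open>n\<close>. Orthogonality therefore needs the strict
  inequality \<open>k < n\<close>, whereas lifts exist for \<open>k = n\<close> too.\<close>

lemma wdec_mono:
  assumes d: "wdec n M a b e" and X: "X \<in> w_le C w k" "k < n" and s: "s \<in> Homs C X (Dom C a)"
    and z: "a \<cdot> s = Zro C X M"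
  shows "s = Zro C X (Dom C a)"
proof -
  note [simp] = wdecD(3,5-)[OF d] HomsD[OF s]
  have XO [simp]: "X \<in> Ob C" using w_le_Ob[OF X(1)] .
  obtain r where r: "r \<in> Homs C X (ShO C (- 1) (Cod C b))" "ShA C (- 1) e \<cdot> r = s"
    using tri_lift0[OF wdecD(1)[OF d] s] z by auto
  have "ShO C (- 1) (Cod C b) \<in> w_ge C w n"
    using w_ge_shift[of "Cod C b" "- 1" n] wdecD(4)[OF d] by (simp add: Cod_Ob)
  from w_orth[OF X(1) this X(2) r(1)] r(2) show ?thesis by (auto simp: tcat_simps)
qed

lemma wdec_unique:
  assumes d: "wdec n M a b e" and X: "X \<in> w_le C w k" "k < n" and s: "s \<in> Homs C X (Dom C a)" "s' \<in> Homs C X (Dom C a)"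
    and z: "a \<cdot> s = a \<cdot> s'"
  shows "s = s'"
proof -
  note [simp] = wdecD(3,5-)[OF d] HomsD[OF s(1)] HomsD[OF s(2)] w_le_Ob[OF X(1)]
  have "s \<boxplus> neg_arrow C s' = Zro C X (Dom C a)"
    by (rule wdec_mono[OF d X]) (use z in \<open>simp_all add: cat_simps Pls_neg(1)[of "a \<cdot> s'" X M]\<close>)
  then show ?thesis by (rule minus_zero_eq[OF s])
qed

text \<open>For a decomposition of such an \<open>M\<close> the arrow to the second part is zero, so
  \<open>M\<close> is a retract of the first part. Closure under extensions follows, because
  vanishing of maps to a fixed object passes to extensions.\<close>

lemma w_le_char:
  assumes M: "M \<in> Ob C" and z: "\<And>Y t. Y \<in> w_ge C w (n + 1) \<Longrightarrow> t \<in> Homs C M Y \<Longrightarrow> t = Zro C M Y"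
  shows "M \<in> w_le C w n"
proof -
  obtain a b e where d: "wdec n M a b e" using wdec_exists[OF M] by blast
  note [simp] = wdecD(3,5-)[OF d]
  have "b = Zro C M (Cod C b)" by (rule z[OF wdecD(4)[OF d]]) (simp add: Homs_def)
  then have "b \<cdot> Idn C M = Zro C M (Cod C b)" by (simp add: cat_simps)
  then obtain s where "s \<in> Homs C M (Dom C a)" "a \<cdot> s = Idn C M"
    using tri_lift[OF wdecD(1)[OF d], of "Idn C M" M] by (auto simp: cat_simps)
  then show ?thesis using w_le_retract[OF wdecD(2)[OF d], of s M a] by (simp add: Homs_def)
qed

lemma w_ge_char:
  assumes M: "M \<in> Ob C" and z: "\<And>X t. X \<in> w_le C w (n - 1) \<Longrightarrow> t \<in> Homs C X M \<Longrightarrow> t = Zro C X M"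
  shows "M \<in> w_ge C w n"
proof -
  obtain a b e where d: "wdec (n - 1) M a b e" using wdec_exists[OF M] by blast
  note [simp] = wdecD(3,5-)[OF d]
  have "a = Zro C (Dom C a) M" by (rule z[OF wdecD(2)[OF d]]) (simp add: Homs_def)
  then have "Idn C M \<cdot> a = Zro C (Dom C a) M" by (simp add: cat_simps)
  then obtain s where "s \<in> Homs C (Cod C b) M" "s \<cdot> b = Idn C M"
    using tri_extend[OF wdecD(1)[OF d], of "Idn C M" M] by (auto simp: cat_simps)
  then show ?thesis using w_ge_retract[of "Cod C b" n b M s] wdecD(4)[OF d] by (simp add: Homs_def)
qed

lemma w_le_ext:
  assumes t: "dist_tri C f g h" and f: "Dom C f \<in> w_le C w n" and g: "Cod C g \<in> w_le C w n"
  shows "Cod C f \<in> w_le C w n"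
proof (rule w_le_char)
  note [simp] = triD[OF t]
  show "Cod C f \<in> Ob C" by (simp add: Cod_Ob)
  fix Y s assume Y: "Y \<in> w_ge C w (n + 1)" and s: "s \<in> Homs C (Cod C f) Y"
  note [simp] = w_ge_Ob[OF Y] HomsD[OF s]
  have "s \<cdot> f = Zro C (Dom C f) Y" by (rule w_orth[OF f Y]) (simp_all add: cat_simps)
  then obtain r where r: "r \<in> Homs C (Cod C g) Y" "r \<cdot> g = s" using tri_extend[OF t s] by blast
  with w_orth[OF g Y _ r(1)] show "s = Zro C (Cod C f) Y" by (auto simp: cat_simps)
qed

lemma w_ge_ext:
  assumes t: "dist_tri C f g h" and f: "Dom C f \<in> w_ge C w n" and g: "Cod C g \<in> w_ge C w n"
  shows "Cod C f \<in> w_ge C w n"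
proof (rule w_ge_char)
  note [simp] = triD[OF t]
  show "Cod C f \<in> Ob C" by (simp add: Cod_Ob)
  fix X s assume X: "X \<in> w_le C w (n - 1)" and s: "s \<in> Homs C X (Cod C f)"
  note [simp] = w_le_Ob[OF X] HomsD[OF s]
  have "g \<cdot> s = Zro C X (Cod C g)" by (rule w_orth[OF X g]) (simp_all add: cat_simps)
  then obtain r where r: "r \<in> Homs C X (Dom C f)" "f \<cdot> r = s" using tri_lift[OF t s] by blast
  with w_orth[OF X f _ r(1)] show "s = Zro C X (Cod C f)" by (auto simp: cat_simps)
qed

lemma w_le_cone:
  assumes t: "dist_tri C f g h" and f: "Dom C f \<in> w_le C w (n - 1)" "Cod C f \<in> w_le C w n"
  shows "Cod C g \<in> w_le C w n"
  using w_le_ext[OF rotate[OF t], of n] f triD[OF t] w_le_shift[of "Dom C f" 1 n]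
  by (simp add: tcat_simps)

lemma w_ge_fibre:
  assumes t: "dist_tri C f g h" and f: "Cod C f \<in> w_ge C w n" "Cod C g \<in> w_ge C w (n + 1)"
  shows "Dom C f \<in> w_ge C w n"
  using w_ge_ext[OF rotate_back[OF t], of n] f triD[OF t] w_ge_shift[of "Cod C g" "- 1" n]
  by (simp add: tcat_simps)

lemma zero_in_w:
  assumes "is_zero_object C Z"
  shows "Z \<in> w_le C w n" "Z \<in> w_ge C w n"
proof -
  have "Z \<in> Ob C" using assms by (simp add: zero_object_iff)
  then show "Z \<in> w_le C w n" "Z \<in> w_ge C w n"
    by (auto intro!: w_le_char w_ge_char zero_object_arrow[OF assms])
qed

lemma biproduct_tri:
  assumes "is_biproduct C A D B"
  shows "\<exists>f g h. dist_tri C f g h \<and> Dom C f = A \<and> Cod C f = B \<and> Cod C g = D"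
proof -
  obtain i j p q where b: "i \<in> Homs C A B" "j \<in> Homs C D B" "p \<in> Homs C B A" "q \<in> Homs C B D"
    "p \<cdot> i = Idn C A" "q \<cdot> j = Idn C D" "q \<cdot> i = Zro C A D" "p \<cdot> j = Zro C D A" "i \<cdot> p \<boxplus> j \<cdot> q = Idn C B"
    using assms unfolding is_biproduct_def by blast
  from split_tri[OF b] show ?thesis using b(1,4) by (auto simp: Homs_def)
qed

lemma w_eq_iff: "X \<in> w_eq C w n \<longleftrightarrow> X \<in> w_le C w n \<and> X \<in> w_ge C w n"
  by (simp add: w_eq_def)

lemma w_eq_Ob: "X \<in> w_eq C w n \<Longrightarrow> X \<in> Ob C"
  using w_le_Ob[of X n] by (simp add: w_eq_iff)

lemma w_eq_shift: "X \<in> Ob C \<Longrightarrow> ShO C j X \<in> w_eq C w i \<longleftrightarrow> X \<in> w_eq C w (i - j)"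
  by (simp add: w_eq_iff w_le_shift w_ge_shift)

lemma biproduct_w_eq: "is_biproduct C A D B \<Longrightarrow> A \<in> w_eq C w n \<Longrightarrow> D \<in> w_eq C w n \<Longrightarrow> B \<in> w_eq C w n"
  using biproduct_tri[of A D B] w_le_ext[of _ _ _ n] w_ge_ext[of _ _ _ n] unfolding w_eq_iff by blast

lemma heart_simps [simp]: "Ob (heart C w) = w_eq C w 0"
  by (simp add: heart_def)

lemma heart_additive: "additive_category (heart C w)"
proof -
  have sub: "w_eq C w 0 \<subseteq> Ob C" using w_eq_Ob by blast
  have "\<exists>S. is_biproduct (heart C w) X Y S" if "X \<in> w_eq C w 0" "Y \<in> w_eq C w 0" for X Y
  proof -
    have "X \<in> Ob C" "Y \<in> Ob C" using that w_eq_Ob by blast+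
    then obtain S where "is_biproduct C X Y S" using has_biproducts by blast
    then show ?thesis using that biproduct_w_eq unfolding heart_def full_sub_biproduct[OF sub] by blast
  qed
  moreover have "\<exists>Z. is_zero_object (heart C w) Z"
    using has_zero zero_in_w unfolding heart_def full_sub_zero_object[OF sub] w_eq_iff by blast
  ultimately show ?thesis
    unfolding additive_category_def additive_category_axioms_def
    using full_sub_preadditive[OF sub] by (simp add: heart_def)
qed

section \<open>Weight complexes\<close>

definition weight_tower :: "'o \<Rightarrow> (int \<Rightarrow> 'm) \<Rightarrow> (int \<Rightarrow> 'm) \<Rightarrow> (int \<Rightarrow> 'm) \<Rightarrow> (int \<Rightarrow> 'm) \<Rightarrow> (int \<Rightarrow> 'm) \<Rightarrow> (int \<Rightarrow> 'm) \<Rightarrow> bool" where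
  "weight_tower M a b e c p q \<longleftrightarrow> (\<forall>n. wdec n M (a n) (b n) (e n) \<and>
     c n \<in> Homs C (Dom C (a (n - 1))) (Dom C (a n)) \<and> a n \<cdot> c n = a (n - 1) \<and> dist_tri C (c n) (p n) (q n))"

text \<open>Here \<open>i\<close> is the cohomological degree, so the filtration index is
  \<open>- i\<close>. The differential is one shift of the composite of \<open>q\<close> with the
  shifted \<open>p\<close>, and compatibilities can be checked on this composite before
  shifting.\<close>

definition tower_cpx :: "(int \<Rightarrow> 'm) \<Rightarrow> (int \<Rightarrow> 'm) \<Rightarrow> ('o, 'm) cpx" where
  "tower_cpx p q = \<lparr>obj = (\<lambda>i. ShO C i (Cod C (p (- i)))), dif = (\<lambda>i. ShA C i (ShA C 1 (p (- i - 1)) \<cdot> q (- i)))\<rparr>"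

lemma weight_towerD:
  assumes "weight_tower M a b e c p q"
  shows "wdec n M (a n) (b n) (e n)" "c n \<in> Homs C (Dom C (a (n - 1))) (Dom C (a n))" "a n \<cdot> c n = a (n - 1)"
    "dist_tri C (c n) (p n) (q n)"
    "c n \<in> Ar C" "Dom C (c n) = Dom C (a (n - 1))" "Cod C (c n) = Dom C (a n)"
    "p n \<in> Ar C" "Dom C (p n) = Dom C (a n)" "q n \<in> Ar C" "Dom C (q n) = Cod C (p n)"
    "Cod C (q n) = ShO C 1 (Dom C (a (n - 1)))"
  using assms triD[of "c n" "p n" "q n"] unfolding weight_tower_def by (auto simp: Homs_def)

lemma is_weight_complex_iff:
  "is_weight_complex C w M K \<longleftrightarrow> (\<exists>a b e c p q. weight_tower M a b e c p q \<and> K = tower_cpx p q)"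
proof -
  have *: "K = tower_cpx p q \<longleftrightarrow> (\<forall>n. obj K (- n) = ShO C (- n) (Cod C (p n)) \<and>
      dif K (- n) = ShA C (1 - n) (p (n - 1)) \<cdot> ShA C (- n) (q n))" if "weight_tower M a b e c p q" for a b e c p q
  proof -
    have "ShA C i (ShA C 1 (p (- i - 1)) \<cdot> q (- i)) = ShA C (1 - - i) (p (- i - 1)) \<cdot> ShA C (- (- i)) (q (- i))" for i
      using weight_towerD(8-)[OF that, of "- i"] weight_towerD(8-)[OF that, of "- i - 1"]
      by (simp add: tcat_simps add.commute)
    then have "tower_cpx p q = \<lparr>obj = (\<lambda>i. ShO C i (Cod C (p (- i)))), dif = (\<lambda>i. ShA C (1 - - i) (p (- i - 1)) \<cdot> ShA C (- (- i)) (q (- i)))\<rparr>"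
      by (simp add: tower_cpx_def)
    then have "K = tower_cpx p q \<longleftrightarrow> (\<forall>i. obj K i = ShO C i (Cod C (p (- i)))) \<and>
        (\<forall>i. dif K i = ShA C (1 - - i) (p (- i - 1)) \<cdot> ShA C (- (- i)) (q (- i)))"
      by (cases K) auto
    also have "\<dots> \<longleftrightarrow> (\<forall>n. obj K (- n) = ShO C (- n) (Cod C (p n))) \<and>
        (\<forall>n. dif K (- n) = ShA C (1 - n) (p (n - 1)) \<cdot> ShA C (- n) (q n))"
      by (metis minus_minus)
    finally show ?thesis by blast
  qed
  have "is_weight_complex C w M K \<longleftrightarrow> (\<exists>a b e c p q. weight_tower M a b e c p q \<and>
      (\<forall>n. obj K (- n) = ShO C (- n) (Cod C (p n)) \<and>
      dif K (- n) = ShA C (1 - n) (p (n - 1)) \<cdot> ShA C (- n) (q n)))"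
    unfolding is_weight_complex_def weight_tower_def wdec_def by (simp only: all_conj_distrib conj_assoc)
  then show ?thesis using * by metis
qed

text \<open>The octahedron for \<open>a n\<close> after \<open>c n\<close> shows that the cone of
  \<open>c n\<close> is also the fibre of the step between the cofibres. This second description
  gives the lower weight bound and drives the upward construction for triangles.\<close>

lemma tower_step:
  assumes T: "weight_tower M a b e c p q"
  shows "\<exists>\<sigma> \<rho>. \<sigma> \<in> Homs C (Cod C (p n)) (Cod C (b (n - 1))) \<and> \<rho> \<in> Homs C (Cod C (b (n - 1))) (Cod C (b n)) \<and>
    dist_tri C \<sigma> \<rho> (ShA C 1 (p n) \<cdot> e n) \<and> e (n - 1) \<cdot> \<sigma> = q n \<and> \<rho> \<cdot> b (n - 1) = b n"
proof -
  note d = weight_towerD(1)[OF T]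
  have td: "dist_tri C (a n \<cdot> c n) (b (n - 1)) (e (n - 1))"
    using wdecD(1)[OF d, of "n - 1"] by (simp add: weight_towerD(3)[OF T])
  have a: "a n \<in> Homs C (Dom C (a n)) M" using wdecD(3,5)[OF d, of n] by (simp add: Homs_def)
  show ?thesis
    using TR4[OF weight_towerD(2)[OF T] a weight_towerD(4)[OF T] wdecD(1)[OF d] td] by blast
qed

text \<open>The upper bound comes from the cone of \<open>c n\<close>, the lower one from the fibre
  of the step between the cofibres.\<close>

lemma tower_w_eq:
  assumes T: "weight_tower M a b e c p q"
  shows "Cod C (p n) \<in> w_eq C w n"
proof -
  note d = weight_towerD(1)[OF T]
  obtain \<sigma> \<rho> where s: "\<sigma> \<in> Homs C (Cod C (p n)) (Cod C (b (n - 1)))" "\<rho> \<in> Homs C (Cod C (b (n - 1))) (Cod C (b n))"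
    "dist_tri C \<sigma> \<rho> (ShA C 1 (p n) \<cdot> e n)" using tower_step[OF T, of n] by blast
  have "Cod C (p n) \<in> w_le C w n"
    by (rule w_le_cone[OF weight_towerD(4)[OF T]])
      (use wdecD(2)[OF d, of n] wdecD(2)[OF d, of "n - 1"] in \<open>simp_all add: weight_towerD(6,7)[OF T]\<close>)
  moreover have "Dom C \<sigma> \<in> w_ge C w n"
    by (rule w_ge_fibre[OF s(3)])
      (use s(1,2) wdecD(4)[OF d, of n] wdecD(4)[OF d, of "n - 1"] in \<open>simp_all add: Homs_def\<close>)
  ultimately show ?thesis using s(1) by (simp add: w_eq_iff Homs_def)
qed

lemma tower_Ob:
  assumes T: "weight_tower M a b e c p q"
  shows "Cod C (p n) \<in> Ob C" "Dom C (a n) \<in> Ob C" "Cod C (b n) \<in> Ob C"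
  using w_eq_Ob[OF tower_w_eq[OF T]] w_le_Ob[OF wdecD(2)[OF weight_towerD(1)[OF T]]]
    w_ge_Ob[OF wdecD(4)[OF weight_towerD(1)[OF T]]] by auto

lemma tower_cpx_in_heart:
  assumes T: "weight_tower M a b e c p q"
  shows "obj (tower_cpx p q) i \<in> w_eq C w 0"
  using tower_w_eq[OF T, of "- i"] w_eq_shift[OF w_eq_Ob[OF tower_w_eq[OF T, of "- i"]], of i 0]
  by (simp add: tower_cpx_def)

lemma tower_cpx_is_complex:
  assumes T: "weight_tower M a b e c p q"
  shows "is_complex C (tower_cpx p q)"
proof (rule is_complexI)
  note [simp] = weight_towerD(5-)[OF T]
  have aO [simp]: "Dom C (a n) \<in> Ob C" for n using w_le_Ob[OF wdecD(2)[OF weight_towerD(1)[OF T]]] .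
  have pO [simp]: "Cod C (p n) \<in> Ob C" for n using w_eq_Ob[OF tower_w_eq[OF T]] .
  show "obj (tower_cpx p q) m \<in> Ob C" for m
    using w_eq_Ob[OF tower_cpx_in_heart[OF T]] .
  show "dif (tower_cpx p q) m \<in> Homs C (obj (tower_cpx p q) m) (obj (tower_cpx p q) (m + 1))" for m
    by (simp add: tower_cpx_def tcat_simps)
  show "dif (tower_cpx p q) m \<cdot> dif (tower_cpx p q) (m - 1) = Zro C (obj (tower_cpx p q) (m - 1)) (obj (tower_cpx p q) (m + 1))" for m
  proof -
    have z: "q (- m) \<cdot> p (- m) = Zro C (Dom C (a (- m))) (ShO C 1 (Dom C (a (- m - 1))))"
      using tri_comp_zero(2)[OF weight_towerD(4)[OF T, of "- m"]] by simp
    have "dif (tower_cpx p q) m \<cdot> dif (tower_cpx p q) (m - 1) =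
      ShA C m (ShA C 1 (p (- m - 1))) \<cdot> (ShA C m (q (- m) \<cdot> p (- m)) \<cdot> ShA C (m - 1) (q (- m + 1)))"
      by (simp add: tower_cpx_def tcat_simps)
    also have "\<dots> = Zro C (obj (tower_cpx p q) (m - 1)) (obj (tower_cpx p q) (m + 1))"
      unfolding z by (simp add: tower_cpx_def tcat_simps)
    finally show ?thesis .
  qed
qed

definition tower_map where
  "tower_map a p q a' p' q' \<phi> u \<longleftrightarrow> (\<forall>n. \<phi> n \<in> Homs C (Dom C (a n)) (Dom C (a' n)) \<and> a' n \<cdot> \<phi> n = a n \<and>
     u n \<in> Homs C (Cod C (p n)) (Cod C (p' n)) \<and> u n \<cdot> p n = p' n \<cdot> \<phi> n \<and>
     q' n \<cdot> u n = ShA C 1 (\<phi> (n - 1)) \<cdot> q n)"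

lemma tower_mapD:
  assumes "tower_map a p q a' p' q' \<phi> u"
  shows "\<phi> n \<in> Ar C" "Dom C (\<phi> n) = Dom C (a n)" "Cod C (\<phi> n) = Dom C (a' n)" "a' n \<cdot> \<phi> n = a n"
    "u n \<in> Ar C" "Dom C (u n) = Cod C (p n)" "Cod C (u n) = Cod C (p' n)" "u n \<cdot> p n = p' n \<cdot> \<phi> n"
    "q' n \<cdot> u n = ShA C 1 (\<phi> (n - 1)) \<cdot> q n"
  using assms unfolding tower_map_def Homs_def by blast+

text \<open>The maps \<phi> lift the identity of \<open>M\<close>. They are not unique, but the
  squares with \<open>c\<close> commute since two lifts into level \<open>n\<close> from weights at
  most \<open>n - 1\<close> coincide.\<close>

lemma tower_map_exists:
  assumes T: "weight_tower M a b e c p q" and T': "weight_tower M a' b' e' c' p' q'"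
  shows "\<exists>\<phi> u. tower_map a p q a' p' q' \<phi> u"
proof -
  note d = weight_towerD(1)[OF T] and d' = weight_towerD(1)[OF T']
  note [simp] = weight_towerD(5-)[OF T] weight_towerD(5-)[OF T'] wdecD(3,5-)[OF d] wdecD(3,5-)[OF d']
  have "\<exists>s \<in> Homs C (Dom C (a n)) (Dom C (a' n)). a' n \<cdot> s = a n" for n
    by (rule wdec_lift[OF d' wdecD(2)[OF d]]) (simp_all add: Homs_def)
  then obtain \<phi> where \<phi>: "\<And>n. \<phi> n \<in> Homs C (Dom C (a n)) (Dom C (a' n))" "\<And>n. a' n \<cdot> \<phi> n = a n" by metis
  note [simp] = HomsD[OF \<phi>(1)]
  \<comment> \<open>Both sides become equal in \<open>M\<close>, and the source has weight at most
    \<open>n - 1\<close>, strictly below the level of the target.\<close>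
  have sq: "\<phi> n \<cdot> c n = c' n \<cdot> \<phi> (n - 1)" for n
  proof (rule wdec_unique[OF d' wdecD(2)[OF d, of "n - 1"]])
    have "a' n \<cdot> (\<phi> n \<cdot> c n) = (a' n \<cdot> \<phi> n) \<cdot> c n" by (simp add: cat_simps)
    also have "\<dots> = (a' n \<cdot> c' n) \<cdot> \<phi> (n - 1)" by (simp add: \<phi>(2) weight_towerD(3)[OF T] weight_towerD(3)[OF T'])
    finally show "a' n \<cdot> (\<phi> n \<cdot> c n) = a' n \<cdot> (c' n \<cdot> \<phi> (n - 1))" by (simp add: cat_simps)
  qed (simp_all add: cat_simps)
  have "\<exists>u \<in> Homs C (Cod C (p n)) (Cod C (p' n)). u \<cdot> p n = p' n \<cdot> \<phi> n \<and> q' n \<cdot> u = ShA C 1 (\<phi> (n - 1)) \<cdot> q n" for n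
    by (rule TR3[OF weight_towerD(4)[OF T] weight_towerD(4)[OF T'] _ _ sq]) (simp_all add: Homs_def)
  then obtain u where "\<And>n. u n \<in> Homs C (Cod C (p n)) (Cod C (p' n))" "\<And>n. u n \<cdot> p n = p' n \<cdot> \<phi> n"
      "\<And>n. q' n \<cdot> u n = ShA C 1 (\<phi> (n - 1)) \<cdot> q n" by metis
  then show ?thesis using \<phi> unfolding tower_map_def by blast
qed

lemma tower_map_comp:
  assumes T: "weight_tower M a b e c p q" and T': "weight_tower M' a' b' e' c' p' q'" and T'': "weight_tower M'' a'' b'' e'' c'' p'' q''"
    and m: "tower_map a p q a' p' q' \<phi> u" and m': "tower_map a' p' q' a'' p'' q'' \<phi>' u'"
  shows "tower_map a p q a'' p'' q'' (\<lambda>n. \<phi>' n \<cdot> \<phi> n) (\<lambda>n. u' n \<cdot> u n)"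
proof -
  note [simp] = weight_towerD(5-)[OF T] weight_towerD(5-)[OF T'] weight_towerD(5-)[OF T'']
    tower_mapD(1-3,5-7)[OF m] tower_mapD(1-3,5-7)[OF m'] wdecD(5)[OF weight_towerD(1)[OF T]]
    wdecD(5)[OF weight_towerD(1)[OF T']] wdecD(5)[OF weight_towerD(1)[OF T'']]
  note ee = tower_mapD(4,8,9)[OF m] tower_mapD(4,8,9)[OF m']
    tower_mapD(4)[OF m, THEN Cmp_assoc_eq] tower_mapD(8)[OF m, THEN Cmp_assoc_eq] tower_mapD(9)[OF m, THEN Cmp_assoc_eq]
    tower_mapD(4)[OF m', THEN Cmp_assoc_eq] tower_mapD(8)[OF m', THEN Cmp_assoc_eq] tower_mapD(9)[OF m', THEN Cmp_assoc_eq]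
  show ?thesis unfolding tower_map_def by (simp add: tcat_simps ee)
qed

lemma tower_map_chain_map:
  assumes T: "weight_tower M a b e c p q" and T': "weight_tower M' a' b' e' c' p' q'"
    and m: "tower_map a p q a' p' q' \<phi> u"
  shows "is_chain_map C (tower_cpx p q) (tower_cpx p' q') (\<lambda>i. ShA C i (u (- i)))"
proof (rule chain_mapI)
  note [simp] = weight_towerD(5-)[OF T] weight_towerD(5-)[OF T'] tower_mapD(1-3,5-7)[OF m]
    wdecD(5)[OF weight_towerD(1)[OF T]] wdecD(5)[OF weight_towerD(1)[OF T']]
  show "ShA C i (u (- i)) \<in> Homs C (obj (tower_cpx p q) i) (obj (tower_cpx p' q') i)" for i
    by (simp add: tower_cpx_def tcat_simps)
  have e: "ShA C 1 (u n) \<cdot> (ShA C 1 (p n) \<cdot> q (n + 1)) = (ShA C 1 (p' n) \<cdot> q' (n + 1)) \<cdot> u (n + 1)" for n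
  proof -
    have "ShA C 1 (u n) \<cdot> (ShA C 1 (p n) \<cdot> q (n + 1)) = ShA C 1 (u n \<cdot> p n) \<cdot> q (n + 1)"
      by (simp add: tcat_simps)
    also have "\<dots> = ShA C 1 (p' n) \<cdot> (ShA C 1 (\<phi> n) \<cdot> q (n + 1))"
      unfolding tower_mapD(8)[OF m] by (simp add: tcat_simps)
    also have "ShA C 1 (\<phi> n) \<cdot> q (n + 1) = q' (n + 1) \<cdot> u (n + 1)"
      using tower_mapD(9)[OF m, of "n + 1"] by simp
    finally show ?thesis by (simp add: tcat_simps)
  qed
  show "ShA C m (u (- m)) \<cdot> dif (tower_cpx p q) (m - 1) = dif (tower_cpx p' q') (m - 1) \<cdot> ShA C (m - 1) (u (- (m - 1)))" for m
  proof -
    have "ShA C m (u (- m)) \<cdot> dif (tower_cpx p q) (m - 1) = ShA C (m - 1) (ShA C 1 (u (- m)) \<cdot> (ShA C 1 (p (- m)) \<cdot> q (- m + 1)))"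
      by (simp add: tower_cpx_def tcat_simps)
    also have "\<dots> = dif (tower_cpx p' q') (m - 1) \<cdot> ShA C (m - 1) (u (- (m - 1)))"
      unfolding e by (simp add: tower_cpx_def tcat_simps)
    finally show ?thesis .
  qed
qed

text \<open>The deviation of \<open>u\<close> from the identity is split into a part coming from the
  deviation \<epsilon> of \<phi>, which factors as \<open>d h\<close>, and a remainder killing
  \<open>p n\<close>, which factors as \<open>j d\<close>. The two factorisations are independent
  choices, so only a weak homotopy results.\<close>

lemma tower_endo_weakly_homotopic_id:
  assumes T: "weight_tower M a b e c p q" and m: "tower_map a p q a p q \<phi> u"
  shows "\<exists>h j. \<forall>n. h n \<in> Homs C (Cod C (p n)) (ShO C (- 1) (Cod C (p (n + 1)))) \<and>
    j n \<in> Homs C (ShO C 1 (Cod C (p (n - 1)))) (Cod C (p n)) \<and>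
    u n = Idn C (Cod C (p n)) \<boxplus> (p n \<cdot> (ShA C (- 1) (q (n + 1)) \<cdot> h n) \<boxplus> j n \<cdot> (ShA C 1 (p (n - 1)) \<cdot> q n))"
proof -
  note d = weight_towerD(1)[OF T]
  have aO [simp]: "Dom C (a n) \<in> Ob C" for n using w_le_Ob[OF wdecD(2)[OF d]] .
  have pO [simp]: "Cod C (p n) \<in> Ob C" for n using w_eq_Ob[OF tower_w_eq[OF T]] .
  note [simp] = weight_towerD(5-)[OF T] tower_mapD(1-3,5-7)[OF m] wdecD(3,5-)[OF d]
  have "\<exists>h j. h \<in> Homs C (Cod C (p n)) (ShO C (- 1) (Cod C (p (n + 1)))) \<and>
    j \<in> Homs C (ShO C 1 (Cod C (p (n - 1)))) (Cod C (p n)) \<and>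
    u n = Idn C (Cod C (p n)) \<boxplus> (p n \<cdot> (ShA C (- 1) (q (n + 1)) \<cdot> h) \<boxplus> j \<cdot> (ShA C 1 (p (n - 1)) \<cdot> q n))" for n
  proof -
    let ?X = "Dom C (a n)" and ?B = "Cod C (p n)"
    define \<epsilon> where "\<epsilon> = \<phi> n \<boxplus> neg_arrow C (Idn C ?X)"
    have \<epsilon>: "\<epsilon> \<in> Homs C ?X ?X" unfolding \<epsilon>_def by (simp add: tcat_simps)
    note [simp] = HomsD[OF \<epsilon>]
    have phi: "\<phi> n = Idn C ?X \<boxplus> \<epsilon>"
      unfolding \<epsilon>_def
      apply (rule lin_eqI[of ?X ?X])
      apply (rule lin_Pls lin_neg lin_Zro lin_atom' | (simp add: cat_simps; fail) | (simp add: algebra_simps; fail))+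
      done
    have a\<epsilon>: "a n \<cdot> \<epsilon> = Zro C ?X M"
      unfolding \<epsilon>_def using tower_mapD(4)[OF m, of n] by (simp add: tcat_simps Pls_neg(1)[of "a n" ?X M])
    \<comment> \<open>Since \<epsilon> dies in \<open>M\<close> and its source has weights at most
      \<open>n\<close>, it already dies in level \<open>n + 1\<close>; hence it factors through the
      cone of that step.\<close>
    have "c (n + 1) \<cdot> \<epsilon> = Zro C ?X (Dom C (a (n + 1)))"
    proof (rule wdec_mono[OF d wdecD(2)[OF d, of n]])
      have "a (n + 1) \<cdot> (c (n + 1) \<cdot> \<epsilon>) = (a (n + 1) \<cdot> c (n + 1)) \<cdot> \<epsilon>" by (simp add: cat_simps)
      also have "\<dots> = Zro C ?X M" unfolding weight_towerD(3)[OF T] using a\<epsilon> by simp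
      finally show "a (n + 1) \<cdot> (c (n + 1) \<cdot> \<epsilon>) = Zro C ?X M" .
    qed (simp_all add: cat_simps)
    then obtain s where s: "s \<in> Homs C ?X (ShO C (- 1) (Cod C (p (n + 1))))" "ShA C (- 1) (q (n + 1)) \<cdot> s = \<epsilon>"
      using tri_lift0[OF weight_towerD(4)[OF T, of "n + 1"], of \<epsilon> ?X] \<epsilon> by auto
    note [simp] = HomsD[OF s(1)]
    \<comment> \<open>The desuspended cone has weight \<open>n\<close>, so \<open>s\<close> vanishes
      on level \<open>n - 1\<close> and descends to the cone at level \<open>n\<close>.\<close>
    have "ShO C (- 1) (Cod C (p (n + 1))) \<in> w_ge C w n"
      using tower_w_eq[OF T, of "n + 1"] w_ge_shift[of "Cod C (p (n + 1))" "- 1" n] by (simp add: w_eq_iff)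
    from w_orth[OF wdecD(2)[OF d, of "n - 1"] this, of "s \<cdot> c n"]
    have "s \<cdot> c n = Zro C (Dom C (a (n - 1))) (ShO C (- 1) (Cod C (p (n + 1))))"
      by (simp add: cat_simps)
    then obtain h where h: "h \<in> Homs C ?B (ShO C (- 1) (Cod C (p (n + 1))))" "h \<cdot> p n = s"
      using tri_extend[OF weight_towerD(4)[OF T, of n], of s] s(1) by auto
    note [simp] = HomsD[OF h(1)]
    define x where "x = p n \<cdot> (ShA C (- 1) (q (n + 1)) \<cdot> h)"
    have x: "x \<in> Homs C ?B ?B" unfolding x_def by (simp add: tcat_simps)
    note [simp] = HomsD[OF x]
    have xp: "x \<cdot> p n = p n \<cdot> \<epsilon>" unfolding x_def s(2)[symmetric] h(2)[symmetric] by (simp add: tcat_simps)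
    \<comment> \<open>The remainder after removing the \<open>d h\<close> part; it kills
      \<open>p n\<close> because \<epsilon> was accounted for by \<open>x\<close>.\<close>
    define y where "y = u n \<boxplus> neg_arrow C (Idn C ?B \<boxplus> x)"
    have y: "y \<in> Homs C ?B ?B" unfolding y_def by (simp add: tcat_simps)
    note [simp] = HomsD[OF y]
    have uy: "u n = Idn C ?B \<boxplus> (x \<boxplus> y)"
      unfolding y_def
      apply (rule lin_eqI[of ?B ?B])
      apply (rule lin_Pls lin_neg lin_Zro lin_atom' | (simp add: cat_simps; fail) | (simp add: algebra_simps; fail))+
      done
    have "y \<cdot> p n = u n \<cdot> p n \<boxplus> neg_arrow C (p n \<boxplus> p n \<cdot> \<epsilon>)"
      unfolding y_def by (simp add: tcat_simps xp)
    also have "u n \<cdot> p n = p n \<boxplus> p n \<cdot> \<epsilon>" unfolding tower_mapD(8)[OF m] phi by (simp add: tcat_simps)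
    finally have "y \<cdot> p n = Zro C ?X ?B" by (simp add: tcat_simps Pls_neg(1)[of "p n \<boxplus> p n \<cdot> \<epsilon>" ?X ?B] del: neg_Pls')
    then obtain t where t: "t \<in> Homs C (ShO C 1 (Dom C (a (n - 1)))) ?B" "t \<cdot> q n = y"
      using tri_extend2[OF weight_towerD(4)[OF T, of n], of y] y by auto
    note [simp] = HomsD[OF t(1)]
    \<comment> \<open>The shift of level \<open>n - 2\<close> has weights at most
      \<open>n - 1\<close>, orthogonal to the cone of weight \<open>n\<close>; so \<open>t\<close>
      extends over the shifted cone of the step below.\<close>
    have "ShO C 1 (Dom C (a (n - 1 - 1))) \<in> w_le C w (n - 1)"
      using wdecD(2)[OF d, of "n - 1 - 1"] w_le_shift[of "Dom C (a (n - 1 - 1))" 1 "n - 1"] by simp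
    from w_orth[OF this, of ?B n "t \<cdot> ShA C 1 (c (n - 1))"] tower_w_eq[OF T, of n]
    have "t \<cdot> ShA C 1 (c (n - 1)) = Zro C (ShO C 1 (Dom C (a (n - 1 - 1)))) ?B"
      by (simp add: tcat_simps w_eq_iff)
    then obtain j where j: "j \<in> Homs C (ShO C 1 (Cod C (p (n - 1)))) ?B" "j \<cdot> ShA C 1 (p (n - 1)) = t"
      using tri_extend[OF tri_shift1(1)[OF weight_towerD(4)[OF T, of "n - 1"]], of t ?B] t(1)
      by (auto simp: tcat_simps)
    have "j \<cdot> (ShA C 1 (p (n - 1)) \<cdot> q n) = y"
      unfolding t(2)[symmetric] j(2)[symmetric] using HomsD[OF j(1)] by (simp add: tcat_simps)
    then show ?thesis using uy h(1) j(1) unfolding x_def by blast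
  qed
  then show ?thesis by metis
qed

lemma tower_endo_invertible:
  assumes T: "weight_tower M a b e c p q" and m: "tower_map a p q a p q \<phi> u"
  shows "\<exists>v. is_chain_map C (tower_cpx p q) (tower_cpx p q) v \<and>
    chain_homotopic C (tower_cpx p q) (tower_cpx p q) (\<lambda>i. v i \<cdot> ShA C i (u (- i))) (\<lambda>i. Idn C (obj (tower_cpx p q) i)) \<and>
    chain_homotopic C (tower_cpx p q) (tower_cpx p q) (\<lambda>i. ShA C i (u (- i)) \<cdot> v i) (\<lambda>i. Idn C (obj (tower_cpx p q) i))"
proof -
  obtain h j where hj: "\<And>n. h n \<in> Homs C (Cod C (p n)) (ShO C (- 1) (Cod C (p (n + 1))))"
    "\<And>n. j n \<in> Homs C (ShO C 1 (Cod C (p (n - 1)))) (Cod C (p n))"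
    "\<And>n. u n = Idn C (Cod C (p n)) \<boxplus> (p n \<cdot> (ShA C (- 1) (q (n + 1)) \<cdot> h n) \<boxplus> j n \<cdot> (ShA C 1 (p (n - 1)) \<cdot> q n))"
    using tower_endo_weakly_homotopic_id[OF T m] by metis
  have aO [simp]: "Dom C (a n) \<in> Ob C" for n using w_le_Ob[OF wdecD(2)[OF weight_towerD(1)[OF T]]] .
  have pO [simp]: "Cod C (p n) \<in> Ob C" for n using w_eq_Ob[OF tower_w_eq[OF T]] .
  note [simp] = weight_towerD(5-)[OF T] HomsD[OF hj(1)] HomsD[OF hj(2)]
  show ?thesis
  proof (rule weakly_homotopic_id_invertible[OF tower_cpx_is_complex[OF T] tower_map_chain_map[OF T T m],
        where h = "\<lambda>i. ShA C i (h (- i))" and j = "\<lambda>i. ShA C (i - 1) (j (1 - i))"])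
    show "ShA C i (h (- i)) \<in> Homs C (obj (tower_cpx p q) i) (obj (tower_cpx p q) (i - 1))"
      "ShA C (i - 1) (j (1 - i)) \<in> Homs C (obj (tower_cpx p q) i) (obj (tower_cpx p q) (i - 1))" for i
      by (simp_all add: tower_cpx_def tcat_simps)
    show "ShA C i (u (- i)) = Idn C (obj (tower_cpx p q) i) \<boxplus>
        (dif (tower_cpx p q) (i - 1) \<cdot> ShA C i (h (- i)) \<boxplus> ShA C (i + 1 - 1) (j (1 - (i + 1))) \<cdot> dif (tower_cpx p q) i)" for i
      unfolding hj(3) by (simp add: tower_cpx_def tcat_simps)
  qed
qed

text \<open>Maps of towers exist in both directions, and their composites are endomorphisms of a
  tower over the identity, hence invertible up to homotopy. The two maps themselves need not be
  inverse to each other.\<close>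

theorem weight_complex_unique:
  assumes "is_weight_complex C w M K" "is_weight_complex C w M K'"
  shows "homotopy_equivalent C K K'"
proof -
  obtain a b e c p q where T: "weight_tower M a b e c p q" "K = tower_cpx p q"
    using assms(1) is_weight_complex_iff by blast
  obtain a' b' e' c' p' q' where T': "weight_tower M a' b' e' c' p' q'" "K' = tower_cpx p' q'"
    using assms(2) is_weight_complex_iff by blast
  obtain \<phi> u where m: "tower_map a p q a' p' q' \<phi> u" using tower_map_exists[OF T(1) T'(1)] by blast
  obtain \<phi>' u' where m': "tower_map a' p' q' a p q \<phi>' u'" using tower_map_exists[OF T'(1) T(1)] by blast
  note K = tower_cpx_is_complex[OF T(1)] and K' = tower_cpx_is_complex[OF T'(1)]
  note f = tower_map_chain_map[OF T(1) T'(1) m] and f' = tower_map_chain_map[OF T'(1) T(1) m']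
  note [simp] = tower_mapD(5-7)[OF m] tower_mapD(5-7)[OF m']
  obtain v where v: "is_chain_map C (tower_cpx p q) (tower_cpx p q) v"
    "chain_homotopic C (tower_cpx p q) (tower_cpx p q) (\<lambda>i. v i \<cdot> ShA C i (u' (- i) \<cdot> u (- i))) (\<lambda>i. Idn C (obj (tower_cpx p q) i))"
    using tower_endo_invertible[OF T(1) tower_map_comp[OF T(1) T'(1) T(1) m m']] by blast
  obtain v' where v': "is_chain_map C (tower_cpx p' q') (tower_cpx p' q') v'"
    "chain_homotopic C (tower_cpx p' q') (tower_cpx p' q') (\<lambda>i. ShA C i (u (- i) \<cdot> u' (- i)) \<cdot> v' i) (\<lambda>i. Idn C (obj (tower_cpx p' q') i))"
    using tower_endo_invertible[OF T'(1) tower_map_comp[OF T'(1) T(1) T'(1) m' m]] by blast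
  note [simp] = chain_mapD[OF v(1)] chain_mapD[OF v'(1)]
  have "homotopy_equivalent C (tower_cpx p q) (tower_cpx p' q')"
    by (rule homotopy_equivalentI_one_sided[OF K K' f chain_map_comp[OF K' K K f' v(1)] chain_map_comp[OF K' K' K v'(1) f']])
      (use v(2) v'(2) in \<open>simp_all add: tcat_simps tower_cpx_def\<close>)
  then show ?thesis by (simp add: T T')
qed

end

section \<open>Weight complexes of distinguished triangles\<close>

context preadditive_category
begin

text \<open>The arrows of a biproduct made explicit, with its objects read off from them;
  \<open>j, r\<close> is the short exact sequence and \<open>p, s\<close> are its
  splittings.\<close>

definition split_seq :: "'m \<Rightarrow> 'm \<Rightarrow> 'm \<Rightarrow> 'm \<Rightarrow> bool" where
  "split_seq j p s r \<longleftrightarrow> j \<in> Ar C \<and> p \<in> Homs C (Cod C j) (Dom C j) \<and> r \<in> Ar C \<and> Dom C r = Cod C j \<and>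
     s \<in> Homs C (Cod C r) (Cod C j) \<and> p \<cdot> j = Idn C (Dom C j) \<and> r \<cdot> s = Idn C (Cod C r) \<and>
     r \<cdot> j = Zro C (Dom C j) (Cod C r) \<and> p \<cdot> s = Zro C (Cod C r) (Dom C j) \<and>
     j \<cdot> p \<boxplus> s \<cdot> r = Idn C (Cod C j)"

lemma split_seqD:
  assumes "split_seq j p s r"
  shows "j \<in> Ar C" "p \<in> Ar C" "Dom C p = Cod C j" "Cod C p = Dom C j" "r \<in> Ar C" "Dom C r = Cod C j"
    "s \<in> Ar C" "Dom C s = Cod C r" "Cod C s = Cod C j" "p \<cdot> j = Idn C (Dom C j)" "r \<cdot> s = Idn C (Cod C r)"
    "r \<cdot> j = Zro C (Dom C j) (Cod C r)" "p \<cdot> s = Zro C (Cod C r) (Dom C j)"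
    "j \<cdot> p \<boxplus> s \<cdot> r = Idn C (Cod C j)"
  using assms unfolding split_seq_def Homs_def by blast+

lemma biproduct_split_seq:
  "is_biproduct C A D B \<longleftrightarrow> A \<in> Ob C \<and> D \<in> Ob C \<and> B \<in> Ob C \<and>
    (\<exists>j p s r. split_seq j p s r \<and> Dom C j = A \<and> Cod C j = B \<and> Cod C r = D)"
  unfolding is_biproduct_def split_seq_def Homs_def by auto metis+

lemma split_seq_cancel:
  assumes S: "split_seq j p s r"
  shows "f \<in> Ar C \<Longrightarrow> g \<in> Ar C \<Longrightarrow> Dom C f = Cod C r \<Longrightarrow> Dom C g = Cod C r \<Longrightarrow> f \<cdot> r = g \<cdot> r \<Longrightarrow> f = g"
    "f \<in> Ar C \<Longrightarrow> g \<in> Ar C \<Longrightarrow> Cod C f = Dom C j \<Longrightarrow> Cod C g = Dom C j \<Longrightarrow> j \<cdot> f = j \<cdot> g \<Longrightarrow> f = g"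
proof -
  note [simp] = split_seqD(1-9)[OF S]
  assume f: "f \<in> Ar C" "g \<in> Ar C"
  show "f = g" if "Dom C f = Cod C r" "Dom C g = Cod C r" "f \<cdot> r = g \<cdot> r"
  proof -
    have "f \<cdot> (r \<cdot> s) = (g \<cdot> r) \<cdot> s" using that f by (simp add: Cmp_assoc'[symmetric] Cmp_arr)
    then show ?thesis using that f split_seqD(11)[OF S] by (simp add: cat_simps)
  qed
  show "f = g" if "Cod C f = Dom C j" "Cod C g = Dom C j" "j \<cdot> f = j \<cdot> g"
  proof -
    have "(p \<cdot> j) \<cdot> f = p \<cdot> (j \<cdot> g)" using that f by (simp add: Cmp_assoc' Cmp_arr)
    then have "(p \<cdot> j) \<cdot> f = (p \<cdot> j) \<cdot> g" using that f by (simp add: Cmp_assoc' Cmp_arr)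
    then show ?thesis using that f split_seqD(10)[OF S] by (simp add: cat_simps)
  qed
qed

end

context triangulated_category
begin

lemma split_seq_tri: "split_seq j p s r \<Longrightarrow> dist_tri C j r (Zro C (Cod C r) (ShO C 1 (Dom C j)))"
  using split_tri[of j "Dom C j" "Cod C j" s "Cod C r" p r] split_seqD[of j p s r] by (simp add: Homs_def)

lemma split_seq_shift:
  assumes "split_seq j p s r"
  shows "split_seq (ShA C i j) (ShA C i p) (ShA C i s) (ShA C i r)"
proof -
  note S = split_seqD[OF assms]
  note [simp] = S(1-9)
  have [simp]: "Dom C j \<in> Ob C" "Cod C j \<in> Ob C" "Cod C r \<in> Ob C" by (simp_all add: Dom_Ob Cod_Ob)
  have "ShA C i p \<cdot> ShA C i j = ShA C i (p \<cdot> j)" "ShA C i r \<cdot> ShA C i s = ShA C i (r \<cdot> s)"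
    "ShA C i r \<cdot> ShA C i j = ShA C i (r \<cdot> j)" "ShA C i p \<cdot> ShA C i s = ShA C i (p \<cdot> s)"
    "ShA C i j \<cdot> ShA C i p \<boxplus> ShA C i s \<cdot> ShA C i r = ShA C i (j \<cdot> p \<boxplus> s \<cdot> r)"
    by (simp_all add: tcat_simps)
  then show ?thesis unfolding split_seq_def S(10-14) by (simp add: tcat_simps)
qed

end

context weight_structure
begin

text \<open>One downward step of a tower of \<open>Y\<close> whose cone is the prescribed middle
  term of the split sequence \<open>j, r\<close>. Of the compatibility with the towers of
  \<open>X\<close> and \<open>Z\<close>, only the squares with the arrows into and out of the cones
  are recorded, since only these enter the differentials.\<close>

definition fibre_link where
  "fibre_link j r x y x' y' a i \<pi> a' i' \<pi>' c P Q \<longleftrightarrow>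
    dist_tri C c P Q \<and> Dom C c = Dom C a' \<and> Cod C c = Dom C a \<and> a \<cdot> c = a' \<and> Cod C P = Cod C j \<and>
    P \<cdot> i = j \<cdot> x \<and> r \<cdot> P = x' \<cdot> \<pi> \<and> Q \<cdot> j = ShA C 1 i' \<cdot> y \<and> ShA C 1 \<pi>' \<cdot> Q = y' \<cdot> r"

text \<open>The counterpart on the cofibres, where the cone of a step appears as a fibre: \<beta>
  leaves the prescribed middle term, and \<rho> is the step from one cofibre to the next.\<close>

definition cofibre_link where
  "cofibre_link j r x y x' y' b i \<pi> b' i' \<pi>' \<beta> \<rho> \<kappa> \<longleftrightarrow>
    dist_tri C \<beta> \<rho> \<kappa> \<and> Dom C \<beta> = Cod C j \<and> Cod C \<beta> = Cod C b \<and> Cod C \<rho> = Cod C b' \<and> \<rho> \<cdot> b = b' \<and>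
    \<beta> \<cdot> j = i \<cdot> x \<and> \<pi> \<cdot> \<beta> = x' \<cdot> r \<and> \<kappa> \<cdot> i' = ShA C 1 j \<cdot> y \<and> y' \<cdot> \<pi>' = ShA C 1 r \<cdot> \<kappa>"

lemma wdec_wD:
  assumes "wdec n M a b e"
  shows "Dom C a \<in> Ob C" "Cod C b \<in> Ob C"
  using w_le_Ob[OF wdecD(2)[OF assms]] w_ge_Ob[OF wdecD(4)[OF assms]] by auto

text \<open>An arrow \<open>P\<close> from the current truncation of \<open>Y\<close> onto the
  prescribed sum of the two cones is assembled, and its fibre is the next truncation. The 3 by 3
  lemma presents this fibre as an extension of the next truncations of \<open>Z\<close> and
  \<open>X\<close>, which bounds its weights.\<close>

lemma step_down:
  assumes TX: "weight_tower X aX bX eX cX pX qX" and TZ: "weight_tower Z aZ bZ eZ cZ pZ qZ"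
    and d: "wdec n Y a b e" and t: "dist_tri C i \<pi> \<delta>"
    and O: "Dom C i = Dom C (aX n)" "Cod C i = Dom C a" "Cod C \<pi> = Dom C (aZ n)"
    and S: "split_seq j p s r" "Dom C j = Cod C (pX n)" "Cod C r = Cod C (pZ n)"
  shows "\<exists>a' b' e' i' \<pi>' \<delta>' c P Q. wdec (n - 1) Y a' b' e' \<and> dist_tri C i' \<pi>' \<delta>' \<and>
    Dom C i' = Dom C (aX (n - 1)) \<and> Cod C i' = Dom C a' \<and> Cod C \<pi>' = Dom C (aZ (n - 1)) \<and>
    fibre_link j r (pX n) (qX n) (pZ n) (qZ n) a i \<pi> a' i' \<pi>' c P Q"
proof -
  note dX = weight_towerD(1)[OF TX] and dZ = weight_towerD(1)[OF TZ]
  note [simp] = weight_towerD(5-)[OF TX] weight_towerD(5-)[OF TZ] wdecD(3,5-)[OF d] triD[OF t] O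
    split_seqD(1-9)[OF S(1)] S(2,3) wdecD(3,5-)[OF dX] wdecD(3,5-)[OF dZ] wdec_wD[OF d] wdec_wD[OF dX] wdec_wD[OF dZ]
  have wA: "Cod C (pX n) \<in> w_eq C w n" and wC: "Cod C (pZ n) \<in> w_eq C w n"
    using tower_w_eq[OF TX] tower_w_eq[OF TZ] .
  note [simp] = w_eq_Ob[OF wA] w_eq_Ob[OF wC]
  have "is_biproduct C (Cod C (pX n)) (Cod C (pZ n)) (Cod C j)"
    unfolding biproduct_split_seq
    by (intro conjI exI[of _ j] exI[of _ p] exI[of _ s] exI[of _ r]) (use S(1) in \<open>simp_all add: Cod_Ob\<close>)
  then have wB: "Cod C j \<in> w_eq C w n" using biproduct_w_eq wA wC by blast
  note [simp] = w_eq_Ob[OF wB]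
  \<comment> \<open>The obstruction to extending \<open>pX n\<close> along \<open>i\<close> is a map
    from weights at most \<open>n - 1\<close> to an object of weight \<open>n\<close>, hence
    zero.\<close>
  have "ShO C (- 1) (Dom C (aZ n)) \<in> w_le C w (n - 1)"
    using wdecD(2)[OF dZ, of n] w_le_shift[of "Dom C (aZ n)" "- 1" "n - 1"] by simp
  from w_orth[OF this, of "Cod C (pX n)" n "pX n \<cdot> ShA C (- 1) \<delta>"] wA
  have "pX n \<cdot> ShA C (- 1) \<delta> = Zro C (ShO C (- 1) (Dom C (aZ n))) (Cod C (pX n))"
    by (simp add: tcat_simps w_eq_iff)
  then have "\<exists>x \<in> Homs C (Cod C i) (Cod C (pX n)). x \<cdot> i = pX n"
    by (intro tri_extend0[OF t] HomsI) simp_all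
  then obtain x where x: "x \<in> Homs C (Dom C a) (Cod C (pX n))" "x \<cdot> i = pX n" unfolding O(2) by blast
  note [simp] = HomsD[OF x(1)]
  \<comment> \<open>The first component is the chosen extension of \<open>pX n\<close>, the second
    is \<open>pZ n\<close> after \<pi>; thus both squares with the arrows into the cones
    commute.\<close>
  define P where "P = j \<cdot> x \<boxplus> s \<cdot> (pZ n \<cdot> \<pi>)"
  have [simp]: "P \<in> Ar C" "Dom C P = Dom C a" "Cod C P = Cod C j" unfolding P_def by (simp_all add: cat_simps)
  have "\<pi> \<cdot> i = Zro C (Dom C (aX n)) (Dom C (aZ n))" using tri_comp_zero(1)[OF t] by simp
  then have Pi: "P \<cdot> i = j \<cdot> pX n" unfolding P_def by (simp add: tcat_simps x(2))
  have rP: "r \<cdot> P = pZ n \<cdot> \<pi>"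
    unfolding P_def using split_seqD(11,12)[OF S(1)] split_seqD(11,12)[OF S(1), THEN Cmp_assoc_eq]
    by (simp add: tcat_simps)
  obtain v1 v2 where tv: "dist_tri C P v1 v2" using TR1_cone[of P] by auto
  note [simp] = triD[OF tv]
  have [simp]: "Cod C v1 \<in> Ob C" by (simp add: Cod_Ob)
  define c where "c = neg_arrow C (ShA C (- 1) v2)"
  have tc: "dist_tri C c P v1" unfolding c_def by (rule rotate_back[OF tv])
  have [simp]: "c \<in> Ar C" "Dom C c = ShO C (- 1) (Cod C v1)" "Cod C c = Dom C a"
    unfolding c_def by (simp_all add: tcat_simps)
  have t1: "dist_tri C r (Zro C (Cod C (pZ n)) (ShO C 1 (Cod C (pX n)))) (neg_arrow C (ShA C 1 j))"
    using rotate[OF split_seq_tri[OF S(1)]] by simp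
  have t2: "dist_tri C (pZ n) (qZ n) (neg_arrow C (ShA C 1 (cZ n)))"
    by (rule rotate[OF weight_towerD(4)[OF TZ]])
  have O4: "Dom C P = Dom C \<pi>" "Cod C P = Dom C r" "Dom C (pZ n) = Cod C \<pi>" "Cod C (pZ n) = Cod C r" by simp_all
  \<comment> \<open>The square has \<pi> and \<open>r\<close> as horizontal arrows and
    \<open>P\<close> and \<open>pZ n\<close> as vertical ones; the fibres of the vertical arrows are
    what is wanted.\<close>
  obtain w0 f'' where w0: "w0 \<in> Homs C (Cod C \<delta>) (Cod C (Zro C (Cod C (pZ n)) (ShO C 1 (Cod C (pX n)))))"
    and f'': "f'' \<in> Homs C (Cod C v1) (Cod C (qZ n))"
    and e1: "neg_arrow C (ShA C 1 j) \<cdot> w0 = ShA C 1 P \<cdot> neg_arrow C (ShA C 1 i)" "f'' \<cdot> v1 = qZ n \<cdot> r"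
    and ex: "\<And>w1 w2. dist_tri C w0 w1 w2 \<Longrightarrow> \<exists>g'' h''. dist_tri C f'' g'' h'' \<and> Cod C g'' = Cod C w1 \<and>
      h'' \<cdot> w1 = ShA C 1 v1 \<cdot> neg_arrow C (ShA C 1 j)"
    using three_by_three[OF rotate[OF t] t1 tv t2 O4 rP[symmetric]] by blast
  have w0': "w0 \<in> Homs C (ShO C 1 (Dom C (aX n))) (ShO C 1 (Cod C (pX n)))" using w0 by (simp add: tcat_simps)
  have f3: "f'' \<in> Homs C (Cod C v1) (ShO C 1 (Dom C (aZ (n - 1))))" using f'' by simp
  note [simp] = HomsD[OF w0'] HomsD[OF f3]
  have "neg_arrow C (neg_arrow C (ShA C 1 j) \<cdot> w0) = neg_arrow C (neg_arrow C (ShA C 1 (P \<cdot> i)))"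
    unfolding e1(1) by (simp add: tcat_simps)
  then have "ShA C 1 j \<cdot> w0 = ShA C 1 j \<cdot> ShA C 1 (pX n)" unfolding Pi by (simp add: tcat_simps)
  \<comment> \<open>As \<open>j\<close> is a split monomorphism, the induced arrow is forced to be
    the shifted \<open>pX n\<close>, so the known triangle of the tower of \<open>X\<close> can be
    used for its cone.\<close>
  then have w0': "w0 = ShA C 1 (pX n)"
    by (rule split_seq_cancel(2)[OF split_seq_shift[OF S(1), of 1], rotated -1]) (simp_all add: tcat_simps)
  have "dist_tri C (ShA C 1 (pX n)) (ShA C 1 (qX n)) (neg_arrow C (ShA C 1 (neg_arrow C (ShA C 1 (cX n)))))"
    by (rule tri_shift1(1)[OF rotate[OF weight_towerD(4)[OF TX]]])
  from ex[unfolded w0', OF this] obtain g'' h'' where t3: "dist_tri C f'' g'' h''"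
    and g'': "Cod C g'' = ShO C 2 (Dom C (aX (n - 1)))"
    and e2: "h'' \<cdot> ShA C 1 (qX n) = ShA C 1 v1 \<cdot> neg_arrow C (ShA C 1 j)" by (auto simp: tcat_simps)
  note [simp] = triD[OF t3] g''
  define i' where "i' = neg_arrow C (ShA C (- 2) h'')"
  define \<pi>' where "\<pi>' = ShA C (- 1) f''"
  have t4: "dist_tri C i' \<pi>' (neg_arrow C (ShA C (- 1) g''))"
    using tri_shift1(2)[OF rotate_back[OF t3]] unfolding i'_def \<pi>'_def by (simp add: tcat_simps)
  have i': "Dom C i' = Dom C (aX (n - 1))" "Cod C i' = Dom C c" "i' \<in> Ar C" unfolding i'_def by (simp_all add: tcat_simps)
  have \<pi>': "Cod C \<pi>' = Dom C (aZ (n - 1))" "\<pi>' \<in> Ar C" "Dom C \<pi>' = Dom C c" unfolding \<pi>'_def by (simp_all add: tcat_simps)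
  have "ShA C 1 i' \<cdot> qX n = neg_arrow C (ShA C (- 1) (h'' \<cdot> ShA C 1 (qX n)))"
    unfolding i'_def by (simp add: tcat_simps)
  then have Qj: "v1 \<cdot> j = ShA C 1 i' \<cdot> qX n" unfolding e2 by (simp add: tcat_simps)
  have \<pi>Q: "ShA C 1 \<pi>' \<cdot> v1 = qZ n \<cdot> r" unfolding \<pi>'_def using e1(2) by (simp add: tcat_simps)
  have ac: "a \<cdot> c \<in> Ar C" "Dom C (a \<cdot> c) = Dom C c" "Cod C (a \<cdot> c) = Y" by (simp_all add: cat_simps)
  obtain b' e' where t5: "dist_tri C (a \<cdot> c) b' e'" using TR1_cone[OF ac(1)] by blast
  note [simp] = ac triD[OF t5]
  have ca: "c \<in> Homs C (Dom C c) (Dom C a)" "a \<in> Homs C (Dom C a) Y" by (simp_all add: Homs_def)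
  \<comment> \<open>The new cofibre is an extension of the old one, of weights at least
    \<open>n + 1\<close>, by the cone of weight \<open>n\<close>; it has weights at least
    \<open>n\<close>.\<close>
  obtain m k where mk: "m \<in> Homs C (Cod C P) (Cod C b')" "k \<in> Homs C (Cod C b') (Cod C b)" "dist_tri C m k (ShA C 1 P \<cdot> e)"
    using TR4[OF ca tc wdecD(1)[OF d] t5] by blast
  have "Cod C b \<in> w_ge C w n" by (rule w_ge_mono[OF _ wdecD(4)[OF d]]) simp
  then have "Cod C b' \<in> w_ge C w n"
    using w_ge_ext[OF mk(3), of n] wB HomsD[OF mk(1)] HomsD[OF mk(2)] by (simp add: w_eq_iff)
  moreover have "Dom C c \<in> w_le C w (n - 1)"
    using w_le_ext[OF t4, of "n - 1"] wdecD(2)[OF dX, of "n - 1"] wdecD(2)[OF dZ, of "n - 1"] i' \<pi>' by simp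
  ultimately have "wdec (n - 1) Y (a \<cdot> c) b' e'" unfolding wdec_def using t5 by simp
  then show ?thesis
    using t4 i' \<pi>' tc Pi rP Qj \<pi>Q ac
    by - (rule exI[of _ "a \<cdot> c"], rule exI[of _ b'], rule exI[of _ e'], rule exI[of _ i'], rule exI[of _ \<pi>'], rule exI[of _ "neg_arrow C (ShA C (- 1) g'')"], rule exI[of _ c], rule exI[of _ P], rule exI[of _ v1], simp add: fibre_link_def)
qed

text \<open>The dual move, made on cofibres: an arrow \<beta> from the prescribed sum into the
  current cofibre of \<open>Y\<close> is assembled and its cone is the next cofibre. The
  corresponding truncation is obtained afterwards as the fibre of \<open>\<rho> b\<close>.\<close>

lemma step_up:
  assumes d: "wdec n Y a b e" and t: "dist_tri C i \<pi> \<delta>"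
    and O: "Cod C i = Cod C b"
    and S: "split_seq j p s r"
    and tX: "dist_tri C \<sigma>X \<rho>X \<kappa>X" and OX: "Dom C \<sigma>X = Dom C j" "Cod C \<sigma>X = Dom C i"
    and tZ: "dist_tri C \<sigma>Z \<rho>Z \<kappa>Z" and OZ: "Dom C \<sigma>Z = Cod C r" "Cod C \<sigma>Z = Cod C \<pi>"
    and wj: "Dom C j \<in> w_eq C w (n + 1)" "Cod C r \<in> w_eq C w (n + 1)"
    and wg: "Dom C i \<in> w_ge C w (n + 1)" "Cod C \<rho>X \<in> w_ge C w (n + 1 + 1)" "Cod C \<rho>Z \<in> w_ge C w (n + 1 + 1)"
  shows "\<exists>a' b' e' i' \<pi>' \<delta>' \<beta> \<rho> \<kappa>. wdec (n + 1) Y a' b' e' \<and> dist_tri C i' \<pi>' \<delta>' \<and>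
    Dom C i' = Cod C \<rho>X \<and> Cod C i' = Cod C b' \<and> Cod C \<pi>' = Cod C \<rho>Z \<and>
    cofibre_link j r \<sigma>X \<kappa>X \<sigma>Z \<kappa>Z b i \<pi> b' i' \<pi>' \<beta> \<rho> \<kappa>"
proof -
  note [simp] = wdecD(3,5-)[OF d] triD[OF t] O split_seqD(1-9)[OF S] triD[OF tX] OX triD[OF tZ] OZ wdec_wD[OF d]
  have [simp]: "Dom C j \<in> Ob C" "Cod C j \<in> Ob C" "Cod C r \<in> Ob C" "Dom C i \<in> Ob C" by (simp_all add: Cod_Ob Dom_Ob)
  have "is_biproduct C (Dom C j) (Cod C r) (Cod C j)"
    unfolding biproduct_split_seq
    by (intro conjI exI[of _ j] exI[of _ p] exI[of _ s] exI[of _ r]) (use S in simp_all)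
  then have wB: "Cod C j \<in> w_eq C w (n + 1)" using biproduct_w_eq wj by blast
  \<comment> \<open>Here the obstruction to lifting \<sigma>Z along \<pi> maps weight
    \<open>n + 1\<close> to weights at least \<open>n + 2\<close>, and vanishes.\<close>
  have "ShO C 1 (Dom C i) \<in> w_ge C w (n + 1 + 1)" using wg(1) by (simp only: w_ge_shift[OF \<open>Dom C i \<in> Ob C\<close>] add_diff_cancel_right')
  from w_orth[OF _ this, of "Cod C r" "n + 1" "\<delta> \<cdot> \<sigma>Z"] wj(2)
  have "\<delta> \<cdot> \<sigma>Z = Zro C (Cod C r) (ShO C 1 (Dom C i))" by (simp add: cat_simps w_eq_iff)
  then have "\<exists>x \<in> Homs C (Cod C r) (Cod C i). \<pi> \<cdot> x = \<sigma>Z"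
    by (intro tri_lift2[OF t] HomsI) simp_all
  then obtain x where x: "x \<in> Homs C (Cod C r) (Cod C b)" "\<pi> \<cdot> x = \<sigma>Z" unfolding O by blast
  note [simp] = HomsD[OF x(1)]
  \<comment> \<open>On the first summand it is \<sigma>X followed by \<open>i\<close>, on the second
    the chosen lift of \<sigma>Z.\<close>
  define \<beta> where "\<beta> = i \<cdot> (\<sigma>X \<cdot> p) \<boxplus> x \<cdot> r"
  have [simp]: "\<beta> \<in> Ar C" "Dom C \<beta> = Cod C j" "Cod C \<beta> = Cod C b" unfolding \<beta>_def by (simp_all add: cat_simps)
  have "\<pi> \<cdot> i = Zro C (Dom C i) (Cod C \<pi>)" using tri_comp_zero(1)[OF t] by simp
  from this[THEN Cmp_assoc_eq, of "\<sigma>X \<cdot> p"] have \<pi>\<beta>: "\<pi> \<cdot> \<beta> = \<sigma>Z \<cdot> r"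
    unfolding \<beta>_def using x(2) x(2)[THEN Cmp_assoc_eq, of r] by (simp add: tcat_simps)
  have \<beta>j: "\<beta> \<cdot> j = i \<cdot> \<sigma>X"
    unfolding \<beta>_def using split_seqD(10,12)[OF S] by (simp add: tcat_simps)
  obtain \<rho> \<kappa> where t\<beta>: "dist_tri C \<beta> \<rho> \<kappa>" using TR1_cone[of \<beta>] by auto
  note [simp] = triD[OF t\<beta>]
  have [simp]: "Cod C \<rho> \<in> Ob C" by (simp add: Cod_Ob)
  have O4: "Dom C \<sigma>X = Dom C j" "Cod C \<sigma>X = Dom C i" "Dom C \<beta> = Cod C j" "Cod C \<beta> = Cod C i" by simp_all
  obtain w0 f'' where w0: "w0 \<in> Homs C (Cod C r) (Cod C \<pi>)" and f'': "f'' \<in> Homs C (Cod C \<rho>X) (Cod C \<rho>)"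
    and e1: "w0 \<cdot> r = \<pi> \<cdot> \<beta>" "\<kappa> \<cdot> f'' = ShA C 1 j \<cdot> \<kappa>X"
    and ex: "\<And>w1 w2. dist_tri C w0 w1 w2 \<Longrightarrow> \<exists>g'' h''. dist_tri C f'' g'' h'' \<and> Cod C g'' = Cod C w1 \<and>
      w2 \<cdot> g'' = ShA C 1 r \<cdot> \<kappa>"
    using three_by_three[OF split_seq_tri[OF S] t tX t\<beta> O4 \<beta>j] by blast
  note [simp] = HomsD[OF w0] HomsD[OF f'']
  \<comment> \<open>Since \<open>r\<close> is a split epimorphism, the induced arrow is determined,
    and the given triangle on \<sigma>Z supplies its cone.\<close>
  have "w0 = \<sigma>Z" by (rule split_seq_cancel(1)[OF S]) (simp_all add: e1 \<pi>\<beta>)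
  with ex tZ obtain \<pi>' \<delta>' where t3: "dist_tri C f'' \<pi>' \<delta>'" and \<pi>': "Cod C \<pi>' = Cod C \<rho>Z" "\<kappa>Z \<cdot> \<pi>' = ShA C 1 r \<cdot> \<kappa>"
    by blast
  note [simp] = triD[OF t3] \<pi>'(1)
  have rb: "\<rho> \<cdot> b \<in> Ar C" "Dom C (\<rho> \<cdot> b) = Y" "Cod C (\<rho> \<cdot> b) = Cod C \<rho>" by (simp_all add: cat_simps)
  obtain y z where ty: "dist_tri C (\<rho> \<cdot> b) y z" using TR1_cone[OF rb(1)] by blast
  note [simp] = rb triD[OF ty]
  have [simp]: "Cod C y \<in> Ob C" by (simp add: Cod_Ob)
  have br: "b \<in> Homs C Y (Cod C b)" "\<rho> \<in> Homs C (Cod C b) (Cod C \<rho>)" by (simp_all add: Homs_def)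
  \<comment> \<open>The shifted new fibre is an extension of the shifted cone by the shifted old
    fibre, so it satisfies the required upper weight bound.\<close>
  obtain m k where "m \<in> Homs C (Cod C e) (Cod C y)" "k \<in> Homs C (Cod C y) (Cod C \<kappa>)"
    and mk3: "dist_tri C m k (ShA C 1 e \<cdot> neg_arrow C (ShA C 1 \<beta>))"
    using TR4[OF br rotate[OF wdecD(1)[OF d]] rotate[OF t\<beta>] ty] by blast
  then have mk: "m \<in> Homs C (ShO C 1 (Dom C a)) (Cod C y)" "k \<in> Homs C (Cod C y) (ShO C 1 (Cod C j))"
    "dist_tri C m k (ShA C 1 e \<cdot> neg_arrow C (ShA C 1 \<beta>))" by simp_all
  have "Dom C a \<in> w_le C w (n + 1)" by (rule w_le_mono[OF _ wdecD(2)[OF d]]) simp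
  then have "ShO C 1 (Dom C a) \<in> w_le C w (n + 1 + 1)" "ShO C 1 (Cod C j) \<in> w_le C w (n + 1 + 1)"
    using wB by (simp_all only: w_le_shift[OF \<open>Dom C a \<in> Ob C\<close>] w_le_shift[OF \<open>Cod C j \<in> Ob C\<close>] add_diff_cancel_right' w_eq_iff)
  then have "Cod C y \<in> w_le C w (n + 1 + 1)" using w_le_ext[OF mk(3)] mk(1,2) by (simp add: Homs_def)
  then have "ShO C (- 1) (Cod C y) \<in> w_le C w (n + 1)" by (simp only: w_le_shift[OF \<open>Cod C y \<in> Ob C\<close>]) simp
  moreover have "Cod C \<rho> \<in> w_ge C w (n + 1 + 1)" using w_ge_ext[OF t3] wg(2,3) by simp
  ultimately have "wdec (n + 1) Y (neg_arrow C (ShA C (- 1) z)) (\<rho> \<cdot> b) y"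
    unfolding wdec_def using rotate_back[OF ty] by (simp add: tcat_simps)
  then show ?thesis
    using t3 \<pi>' t\<beta> \<beta>j \<pi>\<beta> e1(2) rb
    by - (rule exI[of _ "neg_arrow C (ShA C (- 1) z)"], rule exI[of _ "\<rho> \<cdot> b"], rule exI[of _ y], rule exI[of _ f''], rule exI[of _ \<pi>'], rule exI[of _ \<delta>'], rule exI[of _ \<beta>], rule exI[of _ \<rho>], rule exI[of _ \<kappa>], simp add: cofibre_link_def)
qed

text \<open>The connecting arrow of the triangle is lifted to the truncations, and its cone serves
  as the truncation of \<open>Y\<close>. Besides the two triangles, the compatibility of the
  connecting arrows \<open>eX\<close>, \<open>e\<close>, \<open>eZ\<close> is kept: it is what later
  joins the part built from fibres to the part built from cofibres.\<close>

lemma step_base: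
  assumes t: "dist_tri C f g h" and dX: "wdec n (Dom C f) aX bX eX" and dZ: "wdec n (Cod C g) aZ bZ eZ"
  shows "\<exists>a b e i \<pi> \<delta> i' \<pi>' \<delta>'. wdec n (Cod C f) a b e \<and> dist_tri C i \<pi> \<delta> \<and>
    Dom C i = Dom C aX \<and> Cod C i = Dom C a \<and> Cod C \<pi> = Dom C aZ \<and> dist_tri C i' \<pi>' \<delta>' \<and>
    Dom C i' = Cod C bX \<and> Cod C i' = Cod C b \<and> Cod C \<pi>' = Cod C bZ \<and>
    e \<cdot> i' = ShA C 1 i \<cdot> eX \<and> eZ \<cdot> \<pi>' = ShA C 1 \<pi> \<cdot> e"
proof -
  note [simp] = triD[OF t] wdecD(3,5-)[OF dX] wdecD(3,5-)[OF dZ] wdec_wD[OF dX] wdec_wD[OF dZ]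
  have [simp]: "Dom C f \<in> Ob C" "Cod C f \<in> Ob C" "Cod C g \<in> Ob C" by (simp_all add: Cod_Ob Dom_Ob)
  let ?h = "neg_arrow C (ShA C (- 1) h)"
  \<comment> \<open>The shifted truncation of \<open>Z\<close> has weights at most
    \<open>n - 1\<close>, so the desuspended connecting arrow, restricted to it, lifts to the
    truncation of \<open>Dom C f\<close>.\<close>
  have "ShO C (- 1) (Dom C aZ) \<in> w_le C w (n - 1)" using wdecD(2)[OF dZ] by (simp add: w_le_shift)
  then obtain k where k: "k \<in> Homs C (ShO C (- 1) (Dom C aZ)) (Dom C aX)" "aX \<cdot> k = ?h \<cdot> ShA C (- 1) aZ"
    using wdec_lift[OF dX, of _ "n - 1" "?h \<cdot> ShA C (- 1) aZ"] by (auto simp: tcat_simps)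
  note [simp] = HomsD[OF k(1)]
  obtain i \<pi> where ti: "dist_tri C k i \<pi>" using TR1_cone[of k] by auto
  note [simp] = triD[OF ti]
  have O4: "Dom C (ShA C (- 1) aZ) = Dom C k" "Cod C (ShA C (- 1) aZ) = Dom C ?h" "Dom C aX = Cod C k" "Cod C aX = Cod C ?h"
    by (simp_all add: tcat_simps)
  obtain w0 f'' where w0: "w0 \<in> Homs C (Cod C i) (Cod C f)"
    and f'': "f'' \<in> Homs C (Cod C (ShA C (- 1) bZ)) (Cod C bX)"
    and ex: "\<And>w1 w2. dist_tri C w0 w1 w2 \<Longrightarrow> \<exists>g'' h''. dist_tri C f'' g'' h'' \<and> Cod C g'' = Cod C w1 \<and>
      w2 \<cdot> g'' = ShA C 1 i \<cdot> eX \<and> ShA C 1 \<pi> \<cdot> w2 = neg_arrow C (ShA C 1 (neg_arrow C (ShA C (- 1) eZ)) \<cdot> h'')"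
    using three_by_three[OF ti rotate_back[OF t] tri_shift1(2)[OF wdecD(1)[OF dZ]] wdecD(1)[OF dX] O4 k(2)] by blast
  have f3: "Dom C f'' = ShO C (- 1) (Cod C bZ)" using f'' by (simp add: tcat_simps)
  note [simp] = HomsD[OF w0] HomsD(1,3)[OF f''] f3
  obtain b e where tw: "dist_tri C w0 b e" using TR1_cone[of w0] by auto
  obtain i' \<pi>' where t': "dist_tri C f'' i' \<pi>'" and e: "Cod C i' = Cod C b" "e \<cdot> i' = ShA C 1 i \<cdot> eX"
    "ShA C 1 \<pi> \<cdot> e = neg_arrow C (ShA C 1 (neg_arrow C (ShA C (- 1) eZ)) \<cdot> \<pi>')" using ex[OF tw] by blast
  note [simp] = triD[OF tw] triD[OF t'] e(1)
  have e': "eZ \<cdot> \<pi>' = ShA C 1 \<pi> \<cdot> e" unfolding e(3) by (simp add: tcat_simps)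
  note r = rotate[OF ti] rotate[OF t']
  have "Cod C i \<in> w_le C w n" using w_le_ext[OF r(1)] wdecD(2)[OF dX] wdecD(2)[OF dZ] by (simp add: tcat_simps)
  moreover have "Cod C b \<in> w_ge C w (n + 1)" using w_ge_ext[OF r(2)] wdecD(4)[OF dX] wdecD(4)[OF dZ] by (simp add: tcat_simps)
  ultimately have "wdec n (Cod C f) w0 b e" unfolding wdec_def using tw by simp
  then show ?thesis using r e(2) e'
    by - (rule exI[of _ w0], rule exI[of _ b], rule exI[of _ e], rule exI[of _ i], rule exI[of _ \<pi>], rule exI[of _ "neg_arrow C (ShA C 1 k)"], rule exI[of _ i'], rule exI[of _ \<pi>'], rule exI[of _ "neg_arrow C (ShA C 1 f'')"], simp add: tcat_simps)
qed

text \<open>Dependent choice along \<open>step_down\<close>; the natural number \<open>k\<close>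
  stands for level \<open>- k\<close>.\<close>

lemma tower_down:
  fixes j pp s r :: "int \<Rightarrow> 'm"
  assumes TX: "weight_tower X aX bX eX cX pX qX" and TZ: "weight_tower Z aZ bZ eZ cZ pZ qZ"
    and S: "\<And>n. split_seq (j n) (pp n) (s n) (r n)" "\<And>n. Dom C (j n) = Cod C (pX n)" "\<And>n. Cod C (r n) = Cod C (pZ n)"
    and d: "wdec 0 Y a0 b0 e0" and t: "dist_tri C i0 \<pi>0 \<delta>0"
    and O: "Dom C i0 = Dom C (aX 0)" "Cod C i0 = Dom C a0" "Cod C \<pi>0 = Dom C (aZ 0)"
  shows "\<exists>a b e i \<pi> c P Q. a 0 = a0 \<and> b 0 = b0 \<and> e 0 = e0 \<and> i 0 = i0 \<and> \<pi> 0 = \<pi>0 \<and>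
    (\<forall>n\<le>0. wdec n Y (a n) (b n) (e n) \<and> i n \<in> Homs C (Dom C (aX n)) (Dom C (a n)) \<and>
      \<pi> n \<in> Homs C (Dom C (a n)) (Dom C (aZ n)) \<and> fibre_link (j n) (r n) (pX n) (qX n) (pZ n) (qZ n) (a n) (i n) (\<pi> n) (a (n - 1)) (i (n - 1)) (\<pi> (n - 1)) (c n) (P n) (Q n))"
proof -
  \<comment> \<open>The first conjunct pins the start to the given data, which are shared with the
    upward half.\<close>
  define \<Phi> where "\<Phi> k x \<longleftrightarrow> (k = 0 \<longrightarrow> x = (a0, b0, e0, i0, \<pi>0)) \<and> (case x of (a, b, e, i, \<pi>) \<Rightarrow>
    wdec (- int k) Y a b e \<and> (\<exists>\<delta>. dist_tri C i \<pi> \<delta>) \<and>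
    Dom C i = Dom C (aX (- int k)) \<and> Cod C i = Dom C a \<and> Cod C \<pi> = Dom C (aZ (- int k)))" for k x
  define \<Psi> where "\<Psi> k x y \<longleftrightarrow> (case x of (a, b, e, i, \<pi>) \<Rightarrow> case y of (a', b', e', i', \<pi>') \<Rightarrow> \<exists>c P Q.
    fibre_link (j (- int k)) (r (- int k)) (pX (- int k)) (qX (- int k)) (pZ (- int k)) (qZ (- int k)) a i \<pi> a' i' \<pi>' c P Q)" for k and x y :: "'m \<times> 'm \<times> 'm \<times> 'm \<times> 'm"
  have "\<exists>f. \<forall>k. \<Phi> k (f k) \<and> \<Psi> k (f k) (f (Suc k))"
  proof (rule dependent_nat_choice)
    have "\<Phi> 0 (a0, b0, e0, i0, \<pi>0)" unfolding \<Phi>_def using d t O by auto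
    then show "\<exists>x. \<Phi> 0 x" ..
    fix x k assume x: "\<Phi> k x"
    obtain a b e i \<pi> where x': "x = (a, b, e, i, \<pi>)" by (cases x)
    obtain \<delta> where h: "wdec (- int k) Y a b e" "dist_tri C i \<pi> \<delta>"
      "Dom C i = Dom C (aX (- int k))" "Cod C i = Dom C a" "Cod C \<pi> = Dom C (aZ (- int k))"
      using x unfolding \<Phi>_def x' by blast
    obtain a' b' e' i' \<pi>' \<delta>' c P Q where y: "wdec (- int k - 1) Y a' b' e'" "dist_tri C i' \<pi>' \<delta>'"
        "Dom C i' = Dom C (aX (- int k - 1))" "Cod C i' = Dom C a'" "Cod C \<pi>' = Dom C (aZ (- int k - 1))"
      and z: "fibre_link (j (- int k)) (r (- int k)) (pX (- int k)) (qX (- int k)) (pZ (- int k)) (qZ (- int k)) a i \<pi> a' i' \<pi>' c P Q"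
      using step_down[OF TX TZ h S(1) S(2) S(3)] by blast
    have *: "- int (Suc k) = - int k - 1" by simp
    have "\<Phi> (Suc k) (a', b', e', i', \<pi>')" unfolding \<Phi>_def * prod.case using y by blast
    moreover have "\<Psi> k x (a', b', e', i', \<pi>')" unfolding \<Psi>_def x' prod.case using z by blast
    ultimately show "\<exists>y. \<Phi> (Suc k) y \<and> \<Psi> k x y" by blast
  qed
  then obtain f where f: "\<And>k. \<Phi> k (f k)" "\<And>k. \<Psi> k (f k) (f (Suc k))" by blast
  define a where "a n = fst (f (nat (- n)))" for n
  define b where "b n = fst (snd (f (nat (- n))))" for n
  define e where "e n = fst (snd (snd (f (nat (- n)))))" for n
  define i where "i n = fst (snd (snd (snd (f (nat (- n))))))" for n
  define \<pi> where "\<pi> n = snd (snd (snd (snd (f (nat (- n))))))" for n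
  have fn: "f (nat (- n)) = (a n, b n, e n, i n, \<pi> n)" for n
    unfolding a_def b_def e_def i_def \<pi>_def by simp
  have "(a 0, b 0, e 0, i 0, \<pi> 0) = (a0, b0, e0, i0, \<pi>0)" using f(1)[of 0] fn[of 0] unfolding \<Phi>_def by simp
  moreover have 1: "wdec n Y (a n) (b n) (e n) \<and> (\<exists>\<delta>. dist_tri C (i n) (\<pi> n) \<delta>) \<and>
    Dom C (i n) = Dom C (aX n) \<and> Cod C (i n) = Dom C (a n) \<and> Cod C (\<pi> n) = Dom C (aZ n)" if "n \<le> 0" for n
    using f(1)[of "nat (- n)"] that unfolding fn \<Phi>_def by simp
  have "\<forall>n. \<exists>c P Q. n \<le> 0 \<longrightarrow> fibre_link (j n) (r n) (pX n) (qX n) (pZ n) (qZ n) (a n) (i n) (\<pi> n) (a (n - 1)) (i (n - 1)) (\<pi> (n - 1)) c P Q"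
  proof
    fix n :: int
    have "n \<le> 0 \<Longrightarrow> Suc (nat (- n)) = nat (- (n - 1))" "n \<le> 0 \<Longrightarrow> - int (nat (- n)) = n" by linarith+
    then show "\<exists>c P Q. n \<le> 0 \<longrightarrow> fibre_link (j n) (r n) (pX n) (qX n) (pZ n) (qZ n) (a n) (i n) (\<pi> n) (a (n - 1)) (i (n - 1)) (\<pi> (n - 1)) c P Q"
      using f(2)[of "nat (- n)"] fn[of n] fn[of "n - 1"] unfolding \<Psi>_def by (cases "n \<le> 0") auto
  qed
  from this[unfolded choice_iff] obtain c P Q where
    cPQ: "\<And>n. n \<le> 0 \<Longrightarrow> fibre_link (j n) (r n) (pX n) (qX n) (pZ n) (qZ n) (a n) (i n) (\<pi> n) (a (n - 1)) (i (n - 1)) (\<pi> (n - 1)) (c n) (P n) (Q n)" by blast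
  have 3: "i n \<in> Homs C (Dom C (aX n)) (Dom C (a n)) \<and> \<pi> n \<in> Homs C (Dom C (a n)) (Dom C (aZ n))" if "n \<le> 0" for n
    using 1[OF that] triD[of "i n" "\<pi> n"] by (auto simp: Homs_def)
  show ?thesis
    apply (rule exI[of _ a], rule exI[of _ b], rule exI[of _ e], rule exI[of _ i], rule exI[of _ \<pi>],
      rule exI[of _ c], rule exI[of _ P], rule exI[of _ Q])
    using calculation 1 3 cPQ by simp
qed

text \<open>Dependent choice along \<open>step_up\<close>, with \<open>k\<close> standing for level
  \<open>k\<close>. The families \<open>BX\<close> and \<open>BZ\<close> are the cofibres of the two
  outer towers.\<close>

lemma tower_up:
  fixes j pp s r \<sigma>X \<rho>X \<kappa>X \<sigma>Z \<rho>Z \<kappa>Z :: "int \<Rightarrow> 'm"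
  assumes S: "\<And>n. split_seq (j n) (pp n) (s n) (r n)"
    and tX: "\<And>n. dist_tri C (\<sigma>X n) (\<rho>X n) (\<kappa>X n)" and OX: "\<And>n. Dom C (\<sigma>X n) = Dom C (j n)" "\<And>n. Cod C (\<sigma>X n) = BX (n - 1)" "\<And>n. Cod C (\<rho>X n) = BX n"
    and tZ: "\<And>n. dist_tri C (\<sigma>Z n) (\<rho>Z n) (\<kappa>Z n)" and OZ: "\<And>n. Dom C (\<sigma>Z n) = Cod C (r n)" "\<And>n. Cod C (\<sigma>Z n) = BZ (n - 1)" "\<And>n. Cod C (\<rho>Z n) = BZ n"
    and wj: "\<And>n. Dom C (j n) \<in> w_eq C w n" "\<And>n. Cod C (r n) \<in> w_eq C w n"
    and wg: "\<And>n. BX n \<in> w_ge C w (n + 1)" "\<And>n. BZ n \<in> w_ge C w (n + 1)"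
    and d: "wdec 0 Y a0 b0 e0" and t: "dist_tri C i0 \<pi>0 \<delta>0"
    and O: "Dom C i0 = BX 0" "Cod C i0 = Cod C b0" "Cod C \<pi>0 = BZ 0"
  shows "\<exists>a b e i \<pi> \<beta> \<rho> \<kappa>. a 0 = a0 \<and> b 0 = b0 \<and> e 0 = e0 \<and> i 0 = i0 \<and> \<pi> 0 = \<pi>0 \<and>
    (\<forall>n\<ge>0. wdec n Y (a n) (b n) (e n) \<and> i n \<in> Homs C (BX n) (Cod C (b n)) \<and>
      \<pi> n \<in> Homs C (Cod C (b n)) (BZ n) \<and>
      cofibre_link (j (n + 1)) (r (n + 1)) (\<sigma>X (n + 1)) (\<kappa>X (n + 1)) (\<sigma>Z (n + 1)) (\<kappa>Z (n + 1)) (b n) (i n) (\<pi> n) (b (n + 1)) (i (n + 1)) (\<pi> (n + 1)) (\<beta> n) (\<rho> n) (\<kappa> n))"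
proof -
  define \<Phi> where "\<Phi> k x \<longleftrightarrow> (k = 0 \<longrightarrow> x = (a0, b0, e0, i0, \<pi>0)) \<and> (case x of (a, b, e, i, \<pi>) \<Rightarrow>
    wdec (int k) Y a b e \<and> (\<exists>\<delta>. dist_tri C i \<pi> \<delta>) \<and>
    Dom C i = BX (int k) \<and> Cod C i = Cod C b \<and> Cod C \<pi> = BZ (int k))" for k x
  define \<Theta> where "\<Theta> n = cofibre_link (j (n + 1)) (r (n + 1)) (\<sigma>X (n + 1)) (\<kappa>X (n + 1)) (\<sigma>Z (n + 1)) (\<kappa>Z (n + 1))" for n
  define \<Psi> where "\<Psi> k x y \<longleftrightarrow> (case x of (a, b, e, i, \<pi>) \<Rightarrow> case y of (a', b', e', i', \<pi>') \<Rightarrow> \<exists>\<beta> \<rho> \<kappa>.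
    \<Theta> (int k) b i \<pi> b' i' \<pi>' \<beta> \<rho> \<kappa>)" for k and x y :: "'m \<times> 'm \<times> 'm \<times> 'm \<times> 'm"
  have "\<exists>f. \<forall>k. \<Phi> k (f k) \<and> \<Psi> k (f k) (f (Suc k))"
  proof (rule dependent_nat_choice)
    have "\<Phi> 0 (a0, b0, e0, i0, \<pi>0)" unfolding \<Phi>_def using d t O by auto
    then show "\<exists>x. \<Phi> 0 x" ..
    fix x k assume x: "\<Phi> k x"
    obtain a b e i \<pi> where x': "x = (a, b, e, i, \<pi>)" by (cases x)
    obtain \<delta> where h: "wdec (int k) Y a b e" "dist_tri C i \<pi> \<delta>"
      "Dom C i = BX (int k)" "Cod C i = Cod C b" "Cod C \<pi> = BZ (int k)"
      using x unfolding \<Phi>_def x' by blast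
    have O': "Cod C (\<sigma>X (int k + 1)) = Dom C i" "Cod C (\<sigma>Z (int k + 1)) = Cod C \<pi>" "Dom C i \<in> w_ge C w (int k + 1)"
      "Cod C (\<rho>X (int k + 1)) \<in> w_ge C w (int k + 1 + 1)" "Cod C (\<rho>Z (int k + 1)) \<in> w_ge C w (int k + 1 + 1)"
      unfolding OX OZ h using wg[of "int k"] wg[of "int k + 1"] by simp_all
    obtain a' b' e' i' \<pi>' \<delta>' \<beta> \<rho> \<kappa> where y: "wdec (int k + 1) Y a' b' e'" "dist_tri C i' \<pi>' \<delta>'"
        "Dom C i' = Cod C (\<rho>X (int k + 1))" "Cod C i' = Cod C b'" "Cod C \<pi>' = Cod C (\<rho>Z (int k + 1))"
      and z: "\<Theta> (int k) b i \<pi> b' i' \<pi>' \<beta> \<rho> \<kappa>"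
      unfolding \<Theta>_def
      using step_up[OF h(1,2,4) S[of "int k + 1"] tX[of "int k + 1"] OX(1) O'(1) tZ[of "int k + 1"] OZ(1) O'(2) wj O'(3-5)] by blast
    have *: "int (Suc k) = int k + 1" by simp
    have "\<Phi> (Suc k) (a', b', e', i', \<pi>')" unfolding \<Phi>_def * prod.case using y[unfolded OX OZ] by blast
    moreover have "\<Psi> k x (a', b', e', i', \<pi>')" unfolding \<Psi>_def x' prod.case using z by blast
    ultimately show "\<exists>y. \<Phi> (Suc k) y \<and> \<Psi> k x y" by blast
  qed
  then obtain f where f: "\<And>k. \<Phi> k (f k)" "\<And>k. \<Psi> k (f k) (f (Suc k))" by blast
  define a where "a n = fst (f (nat n))" for n
  define b where "b n = fst (snd (f (nat n)))" for n
  define e where "e n = fst (snd (snd (f (nat n))))" for n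
  define i where "i n = fst (snd (snd (snd (f (nat n)))))" for n
  define \<pi> where "\<pi> n = snd (snd (snd (snd (f (nat n)))))" for n
  have fn: "f (nat n) = (a n, b n, e n, i n, \<pi> n)" for n
    unfolding a_def b_def e_def i_def \<pi>_def by simp
  have "(a 0, b 0, e 0, i 0, \<pi> 0) = (a0, b0, e0, i0, \<pi>0)" using f(1)[of 0] fn[of 0] unfolding \<Phi>_def by simp
  moreover have 1: "wdec n Y (a n) (b n) (e n) \<and> (\<exists>\<delta>. dist_tri C (i n) (\<pi> n) \<delta>) \<and>
    Dom C (i n) = BX n \<and> Cod C (i n) = Cod C (b n) \<and> Cod C (\<pi> n) = BZ n" if "n \<ge> 0" for n
    using f(1)[of "nat n"] that unfolding fn \<Phi>_def by simp
  have "\<forall>n. \<exists>\<beta> \<rho> \<kappa>. n \<ge> 0 \<longrightarrow> \<Theta> n (b n) (i n) (\<pi> n) (b (n + 1)) (i (n + 1)) (\<pi> (n + 1)) \<beta> \<rho> \<kappa>"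
  proof
    fix n :: int
    have "n \<ge> 0 \<Longrightarrow> Suc (nat n) = nat (n + 1)" "n \<ge> 0 \<Longrightarrow> int (nat n) = n" by linarith+
    then show "\<exists>\<beta> \<rho> \<kappa>. n \<ge> 0 \<longrightarrow> \<Theta> n (b n) (i n) (\<pi> n) (b (n + 1)) (i (n + 1)) (\<pi> (n + 1)) \<beta> \<rho> \<kappa>"
      using f(2)[of "nat n"] fn[of n] fn[of "n + 1"] unfolding \<Psi>_def by (cases "n \<ge> 0") auto
  qed
  from this[unfolded choice_iff] obtain \<beta> \<rho> \<kappa> where
    cPQ: "\<And>n. n \<ge> 0 \<Longrightarrow> \<Theta> n (b n) (i n) (\<pi> n) (b (n + 1)) (i (n + 1)) (\<pi> (n + 1)) (\<beta> n) (\<rho> n) (\<kappa> n)" by blast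
  have 3: "i n \<in> Homs C (BX n) (Cod C (b n)) \<and> \<pi> n \<in> Homs C (Cod C (b n)) (BZ n)" if "n \<ge> 0" for n
    using 1[OF that] triD[of "i n" "\<pi> n"] by (auto simp: Homs_def)
  show ?thesis
    apply (rule exI[of _ a], rule exI[of _ b], rule exI[of _ e], rule exI[of _ i], rule exI[of _ \<pi>],
      rule exI[of _ \<beta>], rule exI[of _ \<rho>], rule exI[of _ \<kappa>])
    using calculation 1 3 cPQ[unfolded \<Theta>_def] by simp
qed

text \<open>The octahedron turns a step between the cofibres of two weight decompositions into a step
  between their fibres.\<close>

lemma cofibre_step:
  assumes d: "wdec n Y a b e" and d': "wdec n' Y a' b' e'" and t: "dist_tri C \<beta> \<rho> \<kappa>"
    and O: "Cod C \<beta> = Cod C b" "\<rho> \<cdot> b = b'"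
  shows "\<exists>c p. dist_tri C c p (e \<cdot> \<beta>) \<and> Dom C c = Dom C a \<and> Cod C c = Dom C a' \<and> Cod C p = Dom C \<beta> \<and> a' \<cdot> c = a \<and> ShA C 1 p \<cdot> e' = \<kappa>"
proof -
  note [simp] = wdecD(3,5-)[OF d] wdecD(3,5-)[OF d'] triD[OF t] O(1) wdec_wD[OF d] wdec_wD[OF d']
  have [simp]: "Dom C \<beta> \<in> Ob C" by (simp add: Dom_Ob)
  have "Cod C (\<rho> \<cdot> b) = Cod C \<rho>" by (rule Cmp_arr) simp_all
  then have [simp]: "Cod C \<rho> = Cod C b'" unfolding O(2) by simp
  have br: "b \<in> Homs C Y (Cod C b)" "\<rho> \<in> Homs C (Cod C b) (Cod C \<rho>)" by (simp_all add: Homs_def)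
  obtain m k where "m \<in> Homs C (Cod C e) (Cod C e')" "k \<in> Homs C (Cod C e') (Cod C \<kappa>)"
    and mk: "dist_tri C m k (ShA C 1 e \<cdot> neg_arrow C (ShA C 1 \<beta>))" "neg_arrow C (ShA C 1 a') \<cdot> m = neg_arrow C (ShA C 1 a)"
      "k \<cdot> e' = \<kappa>"
    using TR4[OF br rotate[OF wdecD(1)[OF d]] rotate[OF t] rotate[OF wdecD(1)[OF d'], folded O(2)]] by blast
  then have mk': "m \<in> Homs C (ShO C 1 (Dom C a)) (ShO C 1 (Dom C a'))" "k \<in> Homs C (ShO C 1 (Dom C a')) (ShO C 1 (Dom C \<beta>))"
    by simp_all
  note [simp] = HomsD[OF mk'(1)] HomsD[OF mk'(2)]
  have "dist_tri C (ShA C (- 1) m) (ShA C (- 1) k) (e \<cdot> \<beta>)"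
    using tri_shift1(2)[OF mk(1)] by (simp add: tcat_simps)
  moreover have "neg_arrow C (ShA C (- 1) (neg_arrow C (ShA C 1 a') \<cdot> m)) = a" unfolding mk(2) by (simp add: tcat_simps)
  then have "a' \<cdot> ShA C (- 1) m = a" by (simp add: tcat_simps)
  ultimately show ?thesis using mk(3)
    by - (rule exI[of _ "ShA C (- 1) m"], rule exI[of _ "ShA C (- 1) k"], simp add: tcat_simps)
qed

text \<open>Only the composites of \<open>q\<close> with shifted \<open>p\<close> enter the
  differentials. Hence \<open>j\<close> and \<open>r\<close> are required to be compatible with
  these composites alone and need not come from maps of towers.\<close>

lemma tower_extension:
  fixes j pp s r :: "int \<Rightarrow> 'm"
  assumes TX: "weight_tower X aX bX eX cX pX qX" and TY: "weight_tower Y a b e c p q"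
    and TZ: "weight_tower Z aZ bZ eZ cZ pZ qZ"
    and S: "\<And>n. split_seq (j n) (pp n) (s n) (r n)"
    and O: "\<And>n. Dom C (j n) = Cod C (pX n)" "\<And>n. Cod C (j n) = Cod C (p n)" "\<And>n. Cod C (r n) = Cod C (pZ n)"
    and hj: "\<And>n. ShA C 1 (p (n - 1)) \<cdot> q n \<cdot> j n = ShA C 1 (j (n - 1)) \<cdot> (ShA C 1 (pX (n - 1)) \<cdot> qX n)"
    and hr: "\<And>n. ShA C 1 (r (n - 1)) \<cdot> (ShA C 1 (p (n - 1)) \<cdot> q n) = ShA C 1 (pZ (n - 1)) \<cdot> qZ n \<cdot> r n"
  shows "\<exists>\<delta>. split_extension C (tower_cpx pX qX) (tower_cpx p q) (tower_cpx pZ qZ)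
    (\<lambda>i. ShA C i (j (- i))) (\<lambda>i. ShA C i (pp (- i))) (\<lambda>i. ShA C i (s (- i))) (\<lambda>i. ShA C i (r (- i))) \<delta>"
proof -
  note [simp] = split_seqD(1-9)[OF S] O weight_towerD(8-)[OF TX] weight_towerD(8-)[OF TY] weight_towerD(8-)[OF TZ]
  note [simp] = tower_Ob(1,2)[OF TX] tower_Ob(1,2)[OF TY] tower_Ob(1,2)[OF TZ]
  have 1: "is_chain_map C (tower_cpx pX qX) (tower_cpx p q) (\<lambda>i. ShA C i (j (- i)))"
  proof (rule chain_mapI)
    show "ShA C m (j (- m)) \<in> Homs C (obj (tower_cpx pX qX) m) (obj (tower_cpx p q) m)" for m
      by (simp add: tower_cpx_def tcat_simps)
    show "ShA C m (j (- m)) \<cdot> dif (tower_cpx pX qX) (m - 1) = dif (tower_cpx p q) (m - 1) \<cdot> ShA C (m - 1) (j (- (m - 1)))" for m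
      using arg_cong[OF hj[of "1 - m"], of "ShA C (m - 1)"] by (simp add: tower_cpx_def tcat_simps)
  qed
  have 2: "is_chain_map C (tower_cpx p q) (tower_cpx pZ qZ) (\<lambda>i. ShA C i (r (- i)))"
  proof (rule chain_mapI)
    show "ShA C m (r (- m)) \<in> Homs C (obj (tower_cpx p q) m) (obj (tower_cpx pZ qZ) m)" for m
      by (simp add: tower_cpx_def tcat_simps)
    show "ShA C m (r (- m)) \<cdot> dif (tower_cpx p q) (m - 1) = dif (tower_cpx pZ qZ) (m - 1) \<cdot> ShA C (m - 1) (r (- (m - 1)))" for m
      using arg_cong[OF hr[of "1 - m"], of "ShA C (m - 1)"] by (simp add: tower_cpx_def tcat_simps)
  qed
  note T = split_seqD[OF split_seq_shift[OF S]]
  show ?thesis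
    apply (rule exI)
    apply (rule split_extensionI[OF tower_cpx_is_complex[OF TX] tower_cpx_is_complex[OF TY] tower_cpx_is_complex[OF TZ] 1 2])
    using T(10-14) by (simp_all add: tower_cpx_def tcat_simps)
qed

text \<open>Both complexes at the ends are kept as given; only the complex of the middle object is
  constructed. Its tower is glued at level 0 from a lower half described by fibres and an upper half
  described by cofibres.\<close>

theorem weight_complex_extension:
  assumes t: "dist_tri C f g h" and X: "is_weight_complex C w (Dom C f) KX" and Z: "is_weight_complex C w (Cod C g) KZ"
  shows "\<exists>KY i p j q \<delta>. is_weight_complex C w (Cod C f) KY \<and> split_extension C KX KY KZ i p j q \<delta>"
proof -
  obtain aX bX eX cX pX qX where TX: "weight_tower (Dom C f) aX bX eX cX pX qX" and KX: "KX = tower_cpx pX qX"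
    using X is_weight_complex_iff by blast
  obtain aZ bZ eZ cZ pZ qZ where TZ: "weight_tower (Cod C g) aZ bZ eZ cZ pZ qZ" and KZ: "KZ = tower_cpx pZ qZ"
    using Z is_weight_complex_iff by blast
  note dX = weight_towerD(1)[OF TX] and dZ = weight_towerD(1)[OF TZ]
  note wX = tower_w_eq[OF TX] and wZ = tower_w_eq[OF TZ]
  define Y where "Y = Cod C f"
  obtain a0 b0 e0 i0 \<pi>0 \<delta>0 i1 \<pi>1 \<delta>1 where d0: "wdec 0 Y a0 b0 e0"
    and t0: "dist_tri C i0 \<pi>0 \<delta>0" "Dom C i0 = Dom C (aX 0)" "Cod C i0 = Dom C a0" "Cod C \<pi>0 = Dom C (aZ 0)"
    and t1: "dist_tri C i1 \<pi>1 \<delta>1" "Dom C i1 = Cod C (bX 0)" "Cod C i1 = Cod C b0" "Cod C \<pi>1 = Cod C (bZ 0)"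
    and base: "e0 \<cdot> i1 = ShA C 1 i0 \<cdot> eX 0" "eZ 0 \<cdot> \<pi>1 = ShA C 1 \<pi>0 \<cdot> e0"
    using step_base[OF t dX[of 0] dZ[of 0]] unfolding Y_def by blast
  have "\<exists>j p s r. split_seq j p s r \<and> Dom C j = Cod C (pX n) \<and> Cod C r = Cod C (pZ n)" for n
    using has_biproducts[OF w_eq_Ob[OF wX[of n]] w_eq_Ob[OF wZ[of n]]] unfolding biproduct_split_seq by blast
  then obtain j pp s r where S: "\<And>n. split_seq (j n) (pp n) (s n) (r n)"
    and OS: "\<And>n. Dom C (j n) = Cod C (pX n)" "\<And>n. Cod C (r n) = Cod C (pZ n)" by metis
  obtain aD bD eD iD \<pi>D cD PD QD where D0: "aD 0 = a0" "bD 0 = b0" "eD 0 = e0" "iD 0 = i0" "\<pi>D 0 = \<pi>0"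
    and D: "\<And>n. n \<le> 0 \<Longrightarrow> wdec n Y (aD n) (bD n) (eD n) \<and> iD n \<in> Homs C (Dom C (aX n)) (Dom C (aD n)) \<and>
      \<pi>D n \<in> Homs C (Dom C (aD n)) (Dom C (aZ n)) \<and>
      fibre_link (j n) (r n) (pX n) (qX n) (pZ n) (qZ n) (aD n) (iD n) (\<pi>D n) (aD (n - 1)) (iD (n - 1)) (\<pi>D (n - 1)) (cD n) (PD n) (QD n)"
    using tower_down[OF TX TZ S OS d0 t0] by blast
  note D = D[unfolded fibre_link_def]
  have "\<forall>n. \<exists>\<sigma> \<rho>. \<sigma> \<in> Homs C (Cod C (pX n)) (Cod C (bX (n - 1))) \<and> \<rho> \<in> Homs C (Cod C (bX (n - 1))) (Cod C (bX n)) \<and>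
    dist_tri C \<sigma> \<rho> (ShA C 1 (pX n) \<cdot> eX n) \<and> eX (n - 1) \<cdot> \<sigma> = qX n" using tower_step[OF TX] by blast
  from this[unfolded choice_iff] obtain \<sigma>X \<rho>X where sX: "\<And>n. \<sigma>X n \<in> Homs C (Cod C (pX n)) (Cod C (bX (n - 1)))"
    "\<And>n. \<rho>X n \<in> Homs C (Cod C (bX (n - 1))) (Cod C (bX n))" "\<And>n. dist_tri C (\<sigma>X n) (\<rho>X n) (ShA C 1 (pX n) \<cdot> eX n)"
    "\<And>n. eX (n - 1) \<cdot> \<sigma>X n = qX n" by blast
  have "\<forall>n. \<exists>\<sigma> \<rho>. \<sigma> \<in> Homs C (Cod C (pZ n)) (Cod C (bZ (n - 1))) \<and> \<rho> \<in> Homs C (Cod C (bZ (n - 1))) (Cod C (bZ n)) \<and>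
    dist_tri C \<sigma> \<rho> (ShA C 1 (pZ n) \<cdot> eZ n) \<and> eZ (n - 1) \<cdot> \<sigma> = qZ n" using tower_step[OF TZ] by blast
  from this[unfolded choice_iff] obtain \<sigma>Z \<rho>Z where sZ: "\<And>n. \<sigma>Z n \<in> Homs C (Cod C (pZ n)) (Cod C (bZ (n - 1)))"
    "\<And>n. \<rho>Z n \<in> Homs C (Cod C (bZ (n - 1))) (Cod C (bZ n))" "\<And>n. dist_tri C (\<sigma>Z n) (\<rho>Z n) (ShA C 1 (pZ n) \<cdot> eZ n)"
    "\<And>n. eZ (n - 1) \<cdot> \<sigma>Z n = qZ n" by blast
  have A: "\<And>n. Dom C (\<sigma>X n) = Dom C (j n)" "\<And>n. Cod C (\<sigma>X n) = Cod C (bX (n - 1))" "\<And>n. Cod C (\<rho>X n) = Cod C (bX n)"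
    "\<And>n. Dom C (\<sigma>Z n) = Cod C (r n)" "\<And>n. Cod C (\<sigma>Z n) = Cod C (bZ (n - 1))" "\<And>n. Cod C (\<rho>Z n) = Cod C (bZ n)"
    "\<And>n. Dom C (j n) \<in> w_eq C w n" "\<And>n. Cod C (r n) \<in> w_eq C w n"
    "\<And>n. Cod C (bX n) \<in> w_ge C w (n + 1)" "\<And>n. Cod C (bZ n) \<in> w_ge C w (n + 1)"
    using sX(1,2) sZ(1,2) wX wZ OS wdecD(4)[OF dX] wdecD(4)[OF dZ] by (simp_all add: Homs_def)
  obtain aU bU eU iU \<pi>U \<beta> \<rho> \<kappa> where U0: "aU 0 = a0" "bU 0 = b0" "eU 0 = e0" "iU 0 = i1" "\<pi>U 0 = \<pi>1"
    and U: "\<And>n. n \<ge> 0 \<Longrightarrow> wdec n Y (aU n) (bU n) (eU n) \<and> iU n \<in> Homs C (Cod C (bX n)) (Cod C (bU n)) \<and>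
      \<pi>U n \<in> Homs C (Cod C (bU n)) (Cod C (bZ n)) \<and>
      cofibre_link (j (n + 1)) (r (n + 1)) (\<sigma>X (n + 1)) (ShA C 1 (pX (n + 1)) \<cdot> eX (n + 1)) (\<sigma>Z (n + 1)) (ShA C 1 (pZ (n + 1)) \<cdot> eZ (n + 1))
        (bU n) (iU n) (\<pi>U n) (bU (n + 1)) (iU (n + 1)) (\<pi>U (n + 1)) (\<beta> n) (\<rho> n) (\<kappa> n)"
    using tower_up[OF S sX(3) A(1-3) sZ(3) A(4-10) d0 t1] by blast
  have U': "wdec (n - 1) Y (aU (n - 1)) (bU (n - 1)) (eU (n - 1))" "wdec n Y (aU n) (bU n) (eU n)"
    "iU (n - 1) \<in> Homs C (Cod C (bX (n - 1))) (Cod C (bU (n - 1)))"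
    "\<pi>U (n - 1) \<in> Homs C (Cod C (bU (n - 1))) (Cod C (bZ (n - 1)))" "dist_tri C (\<beta> (n - 1)) (\<rho> (n - 1)) (\<kappa> (n - 1))"
    "Dom C (\<beta> (n - 1)) = Cod C (j n)" "Cod C (\<beta> (n - 1)) = Cod C (bU (n - 1))" "\<rho> (n - 1) \<cdot> bU (n - 1) = bU n"
    "\<beta> (n - 1) \<cdot> j n = iU (n - 1) \<cdot> \<sigma>X n" "\<pi>U (n - 1) \<cdot> \<beta> (n - 1) = \<sigma>Z n \<cdot> r n"
    "\<kappa> (n - 1) \<cdot> iU n = ShA C 1 (j n) \<cdot> (ShA C 1 (pX n) \<cdot> eX n)"
    "(ShA C 1 (pZ n) \<cdot> eZ n) \<cdot> \<pi>U n = ShA C 1 (r n) \<cdot> \<kappa> (n - 1)" if "n > 0" for n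
    using U[of "n - 1"] U[of n] that unfolding cofibre_link_def by simp_all
  \<comment> \<open>In the upper half only steps between cofibres are available so far; the
    octahedron recovers the steps between truncations that a tower consists of.\<close>
  have "\<forall>n. \<exists>c p. n > 0 \<longrightarrow> dist_tri C c p (eU (n - 1) \<cdot> \<beta> (n - 1)) \<and> Dom C c = Dom C (aU (n - 1)) \<and> Cod C c = Dom C (aU n) \<and>
    Cod C p = Dom C (\<beta> (n - 1)) \<and> aU n \<cdot> c = aU (n - 1) \<and> ShA C 1 p \<cdot> eU n = \<kappa> (n - 1)"
    using cofibre_step[OF U'(1,2,5,7,8)] by blast
  from this[unfolded choice_iff] obtain cU pU where V: "\<And>n. n > 0 \<Longrightarrow> dist_tri C (cU n) (pU n) (eU (n - 1) \<cdot> \<beta> (n - 1)) \<and>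
    Dom C (cU n) = Dom C (aU (n - 1)) \<and> Cod C (cU n) = Dom C (aU n) \<and>
    Cod C (pU n) = Dom C (\<beta> (n - 1)) \<and> aU n \<cdot> cU n = aU (n - 1) \<and> ShA C 1 (pU n) \<cdot> eU n = \<kappa> (n - 1)" by blast
  \<comment> \<open>The halves overlap at level 0, where their decompositions agree; the step
    indexed by \<open>n\<close> joins levels \<open>n - 1\<close> and \<open>n\<close>, so the steps
    with \<open>n > 0\<close> belong to the upper half.\<close>
  define a where "a n = (if n \<le> 0 then aD n else aU n)" for n
  define b where "b n = (if n \<le> 0 then bD n else bU n)" for n
  define e where "e n = (if n \<le> 0 then eD n else eU n)" for n
  define c where "c n = (if n \<le> 0 then cD n else cU n)" for n
  define p where "p n = (if n \<le> 0 then PD n else pU n)" for n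
  define q where "q n = (if n \<le> 0 then QD n else eU (n - 1) \<cdot> \<beta> (n - 1))" for n
  have aU: "a n = aU n" "b n = bU n" "e n = eU n" if "n \<ge> 0" for n
    using that U0 D0 unfolding a_def b_def e_def by auto
  have TY: "weight_tower Y a b e c p q"
    unfolding weight_tower_def
  proof (intro allI)
    fix n
    show "wdec n Y (a n) (b n) (e n) \<and> c n \<in> Homs C (Dom C (a (n - 1))) (Dom C (a n)) \<and> a n \<cdot> c n = a (n - 1) \<and> dist_tri C (c n) (p n) (q n)"
    proof (cases "n \<le> 0")
      case True
      then show ?thesis using D[OF True] triD(1)[of "cD n" "PD n" "QD n"] unfolding a_def b_def e_def c_def p_def q_def Homs_def by simp
    next
      case False
      then have n: "n > 0" by simp
      show ?thesis using V[OF n] U'(2)[OF n] triD(1)[of "cU n" "pU n" "eU (n - 1) \<cdot> \<beta> (n - 1)"] n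
        unfolding aU[of n, OF less_imp_le[OF n]] aU[of "n - 1", simplified, OF n] c_def p_def q_def Homs_def by simp
    qed
  qed
  have Op: "Cod C (j n) = Cod C (p n)" for n
    using D[of n] V[of n] U'(6)[of n] unfolding p_def by auto
  have pe: "ShA C 1 (p n) \<cdot> e n = \<kappa> (n - 1)" if "n > 0" for n using V[OF that] that unfolding p_def aU[OF less_imp_le[OF that]] by simp
  note [simp] = split_seqD(1-9)[OF S] OS Op weight_towerD(8-)[OF TX] weight_towerD(8-)[OF TY] weight_towerD(8-)[OF TZ]
    HomsD[OF sX(1)] HomsD[OF sZ(1)] wdecD(3,5-)[OF dX] wdecD(3,5-)[OF dZ] wdecD(3,5-)[OF weight_towerD(1)[OF TY]]
  note [simp] = tower_Ob[OF TX] tower_Ob[OF TY] tower_Ob[OF TZ]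
  have hjr: "ShA C 1 (p (n - 1)) \<cdot> q n \<cdot> j n = ShA C 1 (j (n - 1)) \<cdot> (ShA C 1 (pX (n - 1)) \<cdot> qX n) \<and>
    ShA C 1 (r (n - 1)) \<cdot> (ShA C 1 (p (n - 1)) \<cdot> q n) = ShA C 1 (pZ (n - 1)) \<cdot> qZ n \<cdot> r n" for n
  proof -
    \<comment> \<open>The differential at \<open>n\<close> uses the steps \<open>n - 1\<close> and
      \<open>n\<close>. Both lie in one half unless \<open>n = 1\<close>, where \<open>p 0\<close>
      comes from fibres and \<open>q 1\<close> from cofibres.\<close>
    consider (d) "n \<le> 0" | (o) "n = 1" | (u) "n > 1" by linarith
    then show ?thesis
    proof cases
      case d
      then have d': "n - 1 \<le> 0" by simp
      have pq: "p (n - 1) = PD (n - 1)" "q n = QD n" "a n = aD n" "a (n - 1) = aD (n - 1)" using d unfolding p_def q_def a_def by auto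
      note D1 = D[OF d, folded pq] and D2 = D[OF d', folded pq]
      have [simp]: "iD (n - 1) \<in> Ar C" "Dom C (iD (n - 1)) = Dom C (aX (n - 1))" "Cod C (iD (n - 1)) = Dom C (a (n - 1))"
        "\<pi>D (n - 1) \<in> Ar C" "Dom C (\<pi>D (n - 1)) = Dom C (a (n - 1))" "Cod C (\<pi>D (n - 1)) = Dom C (aZ (n - 1))"
        using D2 by (auto simp: Homs_def)
      have "ShA C 1 (p (n - 1)) \<cdot> q n \<cdot> j n = ShA C 1 (p (n - 1) \<cdot> iD (n - 1)) \<cdot> qX n"
        using D1 by (simp add: tcat_simps)
      moreover have "ShA C 1 (r (n - 1)) \<cdot> (ShA C 1 (p (n - 1)) \<cdot> q n) = ShA C 1 (r (n - 1) \<cdot> p (n - 1)) \<cdot> q n"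
        by (simp add: tcat_simps)
      moreover have "p (n - 1) \<cdot> iD (n - 1) = j (n - 1) \<cdot> pX (n - 1)" "r (n - 1) \<cdot> p (n - 1) = pZ (n - 1) \<cdot> \<pi>D (n - 1)"
        "ShA C 1 (\<pi>D (n - 1)) \<cdot> q n = qZ n \<cdot> r n" using D1 D2 by blast+
      ultimately show ?thesis by (simp add: tcat_simps)
    next
      \<comment> \<open>At the seam, the compatibility of the connecting arrows in the base step
        transfers \<open>i\<close> and \<pi> from cofibres to fibres.\<close>
      case o
      have pq: "p 0 = PD 0" "q n = eU 0 \<cdot> \<beta> 0" "a 0 = aD 0" "eU 0 = e 0" "e0 = e 0" using D0 U0 o unfolding p_def q_def a_def e_def by auto
      note D1 = D[of 0, folded pq, simplified]
      have U1: "iU 0 \<in> Homs C (Cod C (bX 0)) (Cod C (b 0))"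
        "\<pi>U 0 \<in> Homs C (Cod C (b 0)) (Cod C (bZ 0))" "\<beta> 0 \<in> Homs C (Cod C (p n)) (Cod C (b 0))"
        "\<beta> 0 \<cdot> j n = iU 0 \<cdot> \<sigma>X n" "\<pi>U 0 \<cdot> \<beta> 0 = \<sigma>Z n \<cdot> r n"
        using U'(3-10)[of n] triD(1)[OF U'(5), of n] o unfolding Homs_def by (simp_all add: aU)
      note [simp] = HomsD[OF U1(1)] HomsD[OF U1(2)] HomsD[OF U1(3)]
      have [simp]: "iD 0 \<in> Ar C" "Dom C (iD 0) = Dom C (aX 0)" "Cod C (iD 0) = Dom C (a 0)"
        "\<pi>D 0 \<in> Ar C" "Dom C (\<pi>D 0) = Dom C (a 0)" "Cod C (\<pi>D 0) = Dom C (aZ 0)"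
        using D1 by (auto simp: Homs_def)
      have B: "e 0 \<cdot> iU 0 = ShA C 1 (iD 0) \<cdot> eX 0" "eZ 0 \<cdot> \<pi>U 0 = ShA C 1 (\<pi>D 0) \<cdot> e 0"
        using base D0 U0 pq by simp_all
      have sq: "eX 0 \<cdot> \<sigma>X n = qX n" "eZ 0 \<cdot> \<sigma>Z n = qZ n" using sX(4)[of n] sZ(4)[of n] o by simp_all
      have n: "n - 1 = 0" using o by simp
      have "ShA C 1 (p 0) \<cdot> q n \<cdot> j n = ShA C 1 (p 0) \<cdot> (e 0 \<cdot> iU 0 \<cdot> \<sigma>X n)"
        unfolding pq(2) pq(4) using U1(4) o by (simp add: tcat_simps)
      also have "\<dots> = ShA C 1 (p 0 \<cdot> iD 0) \<cdot> qX n"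
        unfolding B(1) using o sq(1) by (simp add: tcat_simps)
      also have "p 0 \<cdot> iD 0 = j 0 \<cdot> pX 0" using D1 by simp
      finally have 1: "ShA C 1 (p 0) \<cdot> q n \<cdot> j n = ShA C 1 (j 0) \<cdot> (ShA C 1 (pX 0) \<cdot> qX n)" using o by (simp add: tcat_simps)
      have "ShA C 1 (r 0) \<cdot> (ShA C 1 (p 0) \<cdot> q n) = ShA C 1 (r 0 \<cdot> p 0) \<cdot> (e 0 \<cdot> \<beta> 0)"
        unfolding pq(2) pq(4) by (simp add: tcat_simps)
      also have "r 0 \<cdot> p 0 = pZ 0 \<cdot> \<pi>D 0" using D1 by simp
      also have "ShA C 1 (pZ 0 \<cdot> \<pi>D 0) \<cdot> (e 0 \<cdot> \<beta> 0) = ShA C 1 (pZ 0) \<cdot> (ShA C 1 (\<pi>D 0) \<cdot> e 0 \<cdot> \<beta> 0)" by (simp add: tcat_simps)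
      also have "\<dots> = ShA C 1 (pZ 0) \<cdot> (eZ 0 \<cdot> (\<pi>U 0 \<cdot> \<beta> 0))" unfolding B(2)[symmetric] by (simp add: tcat_simps)
      also have "\<dots> = ShA C 1 (pZ 0) \<cdot> (eZ 0 \<cdot> \<sigma>Z n \<cdot> r n)" unfolding U1(5) using o by (simp add: tcat_simps)
      also have "\<dots> = ShA C 1 (pZ 0) \<cdot> qZ n \<cdot> r n" unfolding sq(2) using o by (simp add: tcat_simps)
      finally show ?thesis using 1 unfolding n by blast
    next
      case u
      then have n: "n > 0" "n - 1 > 0" by auto
      have "n - 1 - 1 \<ge> 0" using u by simp
      note aU' = aU[OF less_imp_le[OF n(2)]]
      have q: "q n = e (n - 1) \<cdot> \<beta> (n - 1)" using u unfolding q_def by (simp add: aU')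
      have U1: "iU (n - 1) \<in> Homs C (Cod C (bX (n - 1))) (Cod C (b (n - 1)))"
        "\<pi>U (n - 1) \<in> Homs C (Cod C (b (n - 1))) (Cod C (bZ (n - 1)))" "\<beta> (n - 1) \<in> Homs C (Cod C (p n)) (Cod C (b (n - 1)))"
        using U'(3-7)[OF n(1)] triD(1)[OF U'(5)[OF n(1)]] unfolding Homs_def by (simp_all add: aU')
      note [simp] = HomsD[OF U1(1)] HomsD[OF U1(2)] HomsD[OF U1(3)]
      \<comment> \<open>The shifted \<open>p\<close> after \<open>e\<close> is \<kappa>, so the
        differential can be expressed by arrows between cofibres only, for which the links give the
        equations.\<close>
      have D: "ShA C 1 (p (n - 1)) \<cdot> q n = \<kappa> (n - 2) \<cdot> \<beta> (n - 1)"
        using pe[OF n(2)] unfolding q by (simp add: Cmp_assoc'[symmetric] tcat_simps(1) Cmp_arr ShA_arr)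
      have [simp]: "\<kappa> (n - 2) \<in> Ar C" "Dom C (\<kappa> (n - 2)) = Cod C (b (n - 1))" "Cod C (\<kappa> (n - 2)) = ShO C 1 (Cod C (p (n - 1)))"
        unfolding pe[OF n(2), simplified, symmetric] by (simp_all add: tcat_simps)
      have K: "\<kappa> (n - 2) \<cdot> iU (n - 1) = ShA C 1 (j (n - 1)) \<cdot> (ShA C 1 (pX (n - 1)) \<cdot> eX (n - 1))"
        "ShA C 1 (r (n - 1)) \<cdot> \<kappa> (n - 2) = (ShA C 1 (pZ (n - 1)) \<cdot> eZ (n - 1)) \<cdot> \<pi>U (n - 1)"
        using U'(11,12)[OF n(2)] by simp_all
      have "\<kappa> (n - 2) \<cdot> \<beta> (n - 1) \<cdot> j n = \<kappa> (n - 2) \<cdot> iU (n - 1) \<cdot> \<sigma>X n"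
        using U'(9)[OF n(1)] by (simp add: tcat_simps)
      also have "\<dots> = ShA C 1 (j (n - 1)) \<cdot> (ShA C 1 (pX (n - 1)) \<cdot> qX n)"
        unfolding K(1) by (simp add: tcat_simps sX(4))
      finally have 1: "\<kappa> (n - 2) \<cdot> \<beta> (n - 1) \<cdot> j n = ShA C 1 (j (n - 1)) \<cdot> (ShA C 1 (pX (n - 1)) \<cdot> qX n)" .
      have "ShA C 1 (r (n - 1)) \<cdot> (\<kappa> (n - 2) \<cdot> \<beta> (n - 1)) = ShA C 1 (r (n - 1)) \<cdot> \<kappa> (n - 2) \<cdot> \<beta> (n - 1)" by (simp add: tcat_simps)
      also have "\<dots> = ShA C 1 (pZ (n - 1)) \<cdot> (eZ (n - 1) \<cdot> (\<pi>U (n - 1) \<cdot> \<beta> (n - 1)))"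
        unfolding K(2) by (simp add: tcat_simps)
      also have "\<dots> = ShA C 1 (pZ (n - 1)) \<cdot> (eZ (n - 1) \<cdot> \<sigma>Z n \<cdot> r n)"
        unfolding U'(10)[OF n(1)] by (simp add: tcat_simps)
      also have "\<dots> = ShA C 1 (pZ (n - 1)) \<cdot> qZ n \<cdot> r n"
        unfolding sZ(4) by (simp add: tcat_simps)
      finally show ?thesis unfolding D using 1 by blast
    qed
  qed
  then have hj: "\<And>n. ShA C 1 (p (n - 1)) \<cdot> q n \<cdot> j n = ShA C 1 (j (n - 1)) \<cdot> (ShA C 1 (pX (n - 1)) \<cdot> qX n)"
    and hr: "\<And>n. ShA C 1 (r (n - 1)) \<cdot> (ShA C 1 (p (n - 1)) \<cdot> q n) = ShA C 1 (pZ (n - 1)) \<cdot> qZ n \<cdot> r n" by blast+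
  have "is_weight_complex C w Y (tower_cpx p q)" using TY is_weight_complex_iff by blast
  then show ?thesis
    using tower_extension[OF TX TY TZ S OS(1) Op OS(2) hj hr] unfolding KX KZ Y_def by blast
qed

end

section \<open>Shifts, existence and representatives of weight complexes\<close>

definition shift_cpx :: "int \<Rightarrow> ('o, 'm) cpx \<Rightarrow> ('o, 'm) cpx" where
  "shift_cpx i K = \<lparr>obj = (\<lambda>m. obj K (m + i)), dif = (\<lambda>m. dif K (m + i))\<rparr>"

lemma shift_cpx_simps [simp]: "obj (shift_cpx i K) m = obj K (m + i)" "dif (shift_cpx i K) m = dif K (m + i)"
  by (simp_all add: shift_cpx_def)

lemma map_shift_cpx: "map_cpx F (shift_cpx i K) = shift_cpx i (map_cpx F K)"
  by (simp add: map_cpx_def shift_cpx_def)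

lemma shift_cpx_complex: "is_complex C K \<Longrightarrow> is_complex C (shift_cpx i K)"
  unfolding is_complex_def by (auto simp: add.assoc add.commute[of _ i])
    (metis add.assoc add.commute)+

lemma shift_cpx_chain_map: "is_chain_map C K L f \<Longrightarrow> is_chain_map C (shift_cpx i K) (shift_cpx i L) (\<lambda>m. f (m + i))"
  unfolding is_chain_map_def by (metis add.assoc add.commute shift_cpx_simps)

lemma shift_cpx_chain_homotopic:
  assumes "chain_homotopic C K L f g"
  shows "chain_homotopic C (shift_cpx i K) (shift_cpx i L) (\<lambda>m. f (m + i)) (\<lambda>m. g (m + i))"
proof -
  obtain h where h: "\<And>m. h m \<in> Homs C (obj K m) (obj L (m - 1))"
    "\<And>m. f m = g m \<boxplus>\<^bsub>C\<^esub> (dif L (m - 1) \<cdot>\<^bsub>C\<^esub> h m \<boxplus>\<^bsub>C\<^esub> h (m + 1) \<cdot>\<^bsub>C\<^esub> dif K m)"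
    using assms unfolding chain_homotopic_def by blast
  show ?thesis
    unfolding chain_homotopic_def
    using h(1)[of "_ + i"] h(2)[of "_ + i"]
    by (intro exI[of _ "\<lambda>m. h (m + i)"]) (simp add: algebra_simps)
qed

lemma shift_cpx_homotopy_equivalent:
  assumes "homotopy_equivalent C K L"
  shows "homotopy_equivalent C (shift_cpx i K) (shift_cpx i L)"
proof -
  obtain f g where fg: "is_chain_map C K L f" "is_chain_map C L K g"
     "chain_homotopic C K K (\<lambda>i. g i \<cdot>\<^bsub>C\<^esub> f i) (\<lambda>i. Idn C (obj K i))"
     "chain_homotopic C L L (\<lambda>i. f i \<cdot>\<^bsub>C\<^esub> g i) (\<lambda>i. Idn C (obj L i))" "is_complex C K" "is_complex C L"
    using assms unfolding homotopy_equivalent_def by blast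
  show ?thesis
    unfolding homotopy_equivalent_def
    using shift_cpx_chain_map[OF fg(1), of i] shift_cpx_chain_map[OF fg(2), of i]
      shift_cpx_chain_homotopic[OF fg(3), of i] shift_cpx_chain_homotopic[OF fg(4), of i]
      shift_cpx_complex[OF fg(5), of i] shift_cpx_complex[OF fg(6), of i]
    by (simp only: shift_cpx_simps) blast
qed

context weight_structure
begin

lemma weight_complex_exists:
  assumes M: "M \<in> Ob C"
  shows "\<exists>K. is_weight_complex C w M K"
proof -
  have "\<forall>n. \<exists>a b e. wdec n M a b e" using wdec_exists[OF M] by blast
  from this[unfolded choice_iff] obtain a b e where d: "\<And>n. wdec n M (a n) (b n) (e n)" by blast
  have "\<exists>c p q. c \<in> Homs C (Dom C (a (n - 1))) (Dom C (a n)) \<and> a n \<cdot> c = a (n - 1) \<and> dist_tri C c p q" for n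
  proof -
    have "a (n - 1) \<in> Homs C (Dom C (a (n - 1))) M" using wdecD(3,5)[OF d] by (simp add: Homs_def)
    then obtain c where c: "c \<in> Homs C (Dom C (a (n - 1))) (Dom C (a n))" "a n \<cdot> c = a (n - 1)"
      using wdec_lift[OF d[of n] wdecD(2)[OF d[of "n - 1"]], of "a (n - 1)"] by auto
    then show ?thesis using TR1_cone[OF HomsD(1)[OF c(1)]] by blast
  qed
  then have "\<forall>n. \<exists>c p q. c \<in> Homs C (Dom C (a (n - 1))) (Dom C (a n)) \<and> a n \<cdot> c = a (n - 1) \<and> dist_tri C c p q" by blast
  from this[unfolded choice_iff] obtain c p q where "weight_tower M a b e c p q"
    unfolding weight_tower_def using d by blast
  then show ?thesis using is_weight_complex_iff by blast
qed

lemma sgn_mult: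
  assumes "f \<in> Ar C" "g \<in> Ar C" "Cod C f = Dom C g"
  shows "sgn_arrow i g \<cdot> sgn_arrow j f = sgn_arrow (i + j) (g \<cdot> f)"
  using assms by (auto simp: sgn_arrow_def tcat_simps)

text \<open>The shifted complex carries no sign in its differential; the signs caused by shifting
  triangles are absorbed in the choice of the cone arrows.\<close>

lemma weight_complex_shift:
  assumes "is_weight_complex C w M K"
  shows "is_weight_complex C w (ShO C i M) (shift_cpx i K)"
proof -
  obtain a b e c p q where T: "weight_tower M a b e c p q" and K: "K = tower_cpx p q"
    using assms is_weight_complex_iff by blast
  note d = weight_towerD(1)[OF T]
  note [simp] = weight_towerD(3,5-)[OF T] wdecD(3,5-)[OF d] wdec_wD[OF d]
  have [simp]: "Cod C (p n) \<in> Ob C" for n using w_eq_Ob[OF tower_w_eq[OF T]] .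
  define a' where "a' n = ShA C i (a (n - i))" for n
  define b' where "b' n = ShA C i (b (n - i))" for n
  define e' where "e' n = sgn_arrow i (ShA C i (e (n - i)))" for n
  define c' where "c' n = ShA C i (c (n - i))" for n
  \<comment> \<open>Shifting a triangle by \<open>i\<close> puts the sign of exponent
    \<open>i\<close> on its third arrow, and the second and third arrows may be negated together.
    With exponents \<open>i n\<close> and \<open>i n + i\<close>, the total exponent in the
    differential is \<open>2 i n\<close>, which is even.\<close>
  define p' where "p' n = sgn_arrow (i * n) (ShA C i (p (n - i)))" for n
  define q' where "q' n = sgn_arrow (i * n + i) (ShA C i (q (n - i)))" for n
  have "weight_tower (ShO C i M) a' b' e' c' p' q'"
    unfolding weight_tower_def
  proof (intro allI conjI)
    fix n
    have "Dom C (a (n - i)) \<in> w_le C w (n - i)" "Cod C (b (n - i)) \<in> w_ge C w (n - i + 1)"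
      using wdecD(2,4)[OF d] by auto
    then show "wdec n (ShO C i M) (a' n) (b' n) (e' n)"
      unfolding wdec_def a'_def b'_def e'_def using tri_shift[OF wdecD(1)[OF d], of i]
      by (simp add: tcat_simps w_le_shift w_ge_shift algebra_simps)
    have "a (n - i) \<cdot> c (n - i) = a (n - i - 1)" by simp
    then have "ShA C i (a (n - i)) \<cdot> ShA C i (c (n - i)) = ShA C i (a (n - i - 1))"
      by (metis ShA_Cmp' weight_towerD(5,7)[OF T] wdecD(5)[OF d])
    then show "c' n \<in> Homs C (Dom C (a' (n - 1))) (Dom C (a' n))" "a' n \<cdot> c' n = a' (n - 1)"
      unfolding a'_def c'_def by (simp_all add: tcat_simps algebra_simps)
    have "dist_tri C (ShA C i (c (n - i))) (ShA C i (p (n - i))) (sgn_arrow i (ShA C i (q (n - i))))"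
      by (rule tri_shift[OF weight_towerD(4)[OF T]])
    from this tri_sign(2)[OF this] show "dist_tri C (c' n) (p' n) (q' n)"
      unfolding c'_def p'_def q'_def by (auto simp: sgn_arrow_def tcat_simps split: if_splits)
  qed
  moreover have "tower_cpx p' q' = shift_cpx i K"
  proof -
    have "ShO C m (Cod C (p' (- m))) = ShO C (m + i) (Cod C (p (- (m + i))))" for m
      unfolding p'_def by (simp add: tcat_simps sgn_arr)
    moreover have "ShA C m (ShA C 1 (p' (- m - 1)) \<cdot> q' (- m)) = ShA C (m + i) (ShA C 1 (p (- (m + i) - 1)) \<cdot> q (- (m + i)))" for m
    proof -
      have s: "ShA C 1 (sgn_arrow k f) = sgn_arrow k (ShA C 1 f)" if "f \<in> Ar C" for k f
        using that by (simp add: sgn_arrow_def tcat_simps)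
      have 0: "- m - 1 - i = - i - m - 1" "- m - i = - i - m" by simp_all
      have "ShA C 1 (p' (- m - 1)) \<cdot> q' (- m) =
        sgn_arrow (i * (- m - 1) + (i * (- m) + i)) (ShA C 1 (ShA C i (p (- i - m - 1))) \<cdot> ShA C i (q (- i - m)))"
        unfolding p'_def q'_def 0
        by (subst s, simp add: tcat_simps, rule sgn_mult) (simp_all add: tcat_simps add.commute)
      also have "\<dots> = ShA C 1 (ShA C i (p (- i - m - 1))) \<cdot> ShA C i (q (- i - m))"
        by (simp add: sgn_arrow_def algebra_simps)
      finally show ?thesis by (simp add: tcat_simps algebra_simps)
    qed
    ultimately show ?thesis unfolding tower_cpx_def shift_cpx_def K by simp
  qed
  ultimately show ?thesis using is_weight_complex_iff by metis
qed

lemma weight_complex_isomorphic: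
  assumes K: "is_weight_complex C w M K" and "isomorphic C M M'"
  shows "is_weight_complex C w M' K"
proof -
  obtain a b e c p q where T: "weight_tower M a b e c p q" and K: "K = tower_cpx p q"
    using K is_weight_complex_iff by blast
  obtain f g where f: "f \<in> Homs C M M'" "g \<in> Homs C M' M" "g \<cdot> f = Idn C M" "f \<cdot> g = Idn C M'"
    using assms(2) isomorphicE by blast
  then have fi: "is_iso_arrow C f" using isomorphicI(2) by blast
  note d = weight_towerD(1)[OF T]
  note [simp] = weight_towerD(3,5-)[OF T] wdecD(3,5-)[OF d] wdec_wD[OF d] HomsD[OF f(1)] HomsD[OF f(2)]
  have [simp]: "M' \<in> Ob C" "M \<in> Ob C" using Homs_Ob[OF f(1)] by auto
  have "wdec n M' (f \<cdot> a n) (b n \<cdot> g) (e n)" for n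
  proof -
    have "dist_tri C (f \<cdot> a n) (b n \<cdot> g) (e n)"
      by (rule tri_iso[OF wdecD(1)[OF d[of n]], of "Idn C (Dom C (a n))" "Dom C (a n)" f M' "Idn C (Cod C (b n))" "Cod C (b n)"])
        (use fi in \<open>simp_all add: tcat_simps Idn_iso f(3)\<close>)
    then show ?thesis using wdecD(2,4)[OF d[of n]] unfolding wdec_def by (simp add: cat_simps)
  qed
  then have "weight_tower M' (\<lambda>n. f \<cdot> a n) (\<lambda>n. b n \<cdot> g) e c p q"
    unfolding weight_tower_def using weight_towerD(4)[OF T] by (simp add: cat_simps)
  then show ?thesis using is_weight_complex_iff K by metis
qed

lemma zero_object_shift: "is_zero_object C Z \<Longrightarrow> is_zero_object C (ShO C i Z)"
  by (metis ShA_Idn ShA_Zro ShO_in zero_object_iff)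

text \<open>The truncations can be chosen to be zero below \<open>j\<close> and \<open>X\<close>
  from \<open>j\<close> on, so that the only step with nontrivial cone is the one at
  \<open>j\<close>; it sits in cohomological degree \<open>- j\<close>.\<close>

lemma weight_complex_pure:
  assumes X: "X \<in> w_eq C w j"
  shows "\<exists>K. is_weight_complex C w X K \<and> obj K (- j) = ShO C (- j) X \<and> (\<forall>i. i \<noteq> - j \<longrightarrow> is_zero_object C (obj K i))"
proof -
  obtain Z where Z: "is_zero_object C Z" using has_zero by blast
  have O [simp]: "X \<in> Ob C" "Z \<in> Ob C" using w_eq_Ob[OF X] Z zero_object_iff by auto
  define a where "a n = (if n < j then Zro C Z X else Idn C X)" for n
  define b where "b n = (if n < j then Idn C X else Zro C X Z)" for n
  define e where "e n = (if n < j then Zro C X (ShO C 1 Z) else Zro C Z (ShO C 1 X))" for n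
  define c where "c n = (if n < j then Idn C Z else if n = j then Zro C Z X else Idn C X)" for n
  define p where "p n = (if n < j then Zro C Z Z else if n = j then Idn C X else Zro C X Z)" for n
  define q where "q n = (if n < j then Zro C Z (ShO C 1 Z) else if n = j then Zro C X (ShO C 1 Z) else Zro C Z (ShO C 1 X))" for n
  have "wdec n X (a n) (b n) (e n)" for n
  proof (cases "n < j")
    case True
    then have "X \<in> w_ge C w (n + 1)" using X w_ge_mono[of "n + 1" j X] by (simp add: w_eq_iff)
    then show ?thesis using True tri_id_right[OF O(1) Z] zero_in_w[OF Z] unfolding wdec_def a_def b_def e_def by (simp add: cat_simps)
  next
    case False
    then have "X \<in> w_le C w n" using X w_le_mono[of j n X] by (simp add: w_eq_iff)
    then show ?thesis using False TR1_id[OF O(1) Z] zero_in_w[OF Z] unfolding wdec_def a_def b_def e_def by (simp add: cat_simps)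
  qed
  moreover have "c n \<in> Homs C (Dom C (a (n - 1))) (Dom C (a n)) \<and> a n \<cdot> c n = a (n - 1) \<and> dist_tri C (c n) (p n) (q n)" for n
  proof -
    consider "n < j" | "n = j" | "n > j" by linarith
    then show ?thesis
      using tri_id_right[OF O(1) Z] TR1_id[OF O(1) Z] TR1_id[OF O(2) Z] unfolding a_def c_def p_def q_def
      by cases (simp_all add: cat_simps)
  qed
  ultimately have T: "weight_tower X a b e c p q" unfolding weight_tower_def by blast
  have "obj (tower_cpx p q) (- j) = ShO C (- j) X" unfolding tower_cpx_def p_def by (simp add: cat_simps)
  moreover have "is_zero_object C (obj (tower_cpx p q) i)" if "i \<noteq> - j" for i
  proof -
    have "Cod C (p (- i)) = Z" unfolding p_def using that by (auto simp: cat_simps)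
    then show ?thesis unfolding tower_cpx_def using zero_object_shift[OF Z] by simp
  qed
  ultimately show ?thesis using T is_weight_complex_iff by blast
qed

lemma w_eq_sub: "w_eq C w i \<subseteq> Ob C" using w_eq_Ob by blast

lemma weight_complex_in_heart: "is_weight_complex C w M K \<Longrightarrow> obj K i \<in> w_eq C w 0"
  using tower_cpx_in_heart by (auto simp: is_weight_complex_iff)

lemma weight_complex_is_complex: "is_weight_complex C w M K \<Longrightarrow> is_complex C K"
  using tower_cpx_is_complex by (auto simp: is_weight_complex_iff)

lemma represents_t_iff:
  assumes "B \<subseteq> w_eq C w 0"
  shows "represents_t C w B M L \<longleftrightarrow> (\<forall>i. obj L i \<in> B) \<and> (\<exists>K. is_weight_complex C w M K \<and> homotopy_equivalent C K L)"
proof -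
  have B: "B \<subseteq> Ob C" using assms w_eq_sub by blast
  have "is_complex C L" if "homotopy_equivalent C K L" for K using that unfolding homotopy_equivalent_def by blast
  then show ?thesis
    using assms weight_complex_in_heart
    unfolding represents_t_def full_sub_complex[OF B] heart_def full_sub_homotopy_equivalent[OF w_eq_sub] by blast
qed

text \<open>Both complexes are equivalent to weight complexes of \<open>M\<close>, which are
  equivalent to each other; fullness of \<open>B\<close> moves the resulting equivalence into
  \<open>B\<close>, where \<open>F\<close> can be applied.\<close>

lemma represents_unique:
  assumes B: "B \<subseteq> w_eq C w 0" and L: "represents_t C w B M L" and L': "represents_t C w B M L'"
  shows "homotopy_equivalent (full_sub C B) L L'"
proof -
  have sub: "B \<subseteq> Ob C" using B w_eq_sub by blast
  obtain K K' where "is_weight_complex C w M K" "homotopy_equivalent C K L" "is_weight_complex C w M K'" "homotopy_equivalent C K' L'"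
    using L L' represents_t_iff[OF B] by blast
  then have "homotopy_equivalent C L L'"
    using weight_complex_unique homotopy_equivalent_trans homotopy_equivalent_sym by metis
  then show ?thesis using L L' represents_t_iff[OF B] full_sub_homotopy_equivalent[OF sub] by blast
qed

text \<open>The weight complex of the middle object is an extension over the heart. Replacing its
  ends by the given complexes over \<open>B\<close>, with sums formed in \<open>B\<close>, yields a
  representative whose terms are biproducts in \<open>B\<close>.\<close>

lemma represents_extension:
  assumes B: "B \<subseteq> w_eq C w 0" and add: "additive_category (full_sub C B)" and t: "dist_tri C f g h"
    and X: "represents_t C w B (Dom C f) LX" and Z: "represents_t C w B (Cod C g) LZ"
  shows "\<exists>LY. represents_t C w B (Cod C f) LY \<and> (\<forall>n. is_biproduct (full_sub C B) (obj LX n) (obj LZ n) (obj LY n))"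
proof -
  have sub: "B \<subseteq> Ob C" using B w_eq_sub by blast
  obtain KX KZ where K: "is_weight_complex C w (Dom C f) KX" "homotopy_equivalent C KX LX"
    "is_weight_complex C w (Cod C g) KZ" "homotopy_equivalent C KZ LZ"
    and LB: "\<And>n. obj LX n \<in> B" "\<And>n. obj LZ n \<in> B"
    using X Z represents_t_iff[OF B] by blast
  obtain KY i p j q \<delta> where KY: "is_weight_complex C w (Cod C f) KY" and E: "split_extension C KX KY KZ i p j q \<delta>"
    using weight_complex_extension[OF t K(1,3)] by blast
  have "\<forall>n. \<exists>S. is_biproduct (full_sub C B) (obj LX n) (obj LZ n) S"
    using additive_category.has_biproducts[OF add] LB by simp
  then obtain S where S: "\<And>n. is_biproduct (full_sub C B) (obj LX n) (obj LZ n) (S n)" by metis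
  then have S': "is_biproduct C (obj LX n) (obj LZ n) (S n)" "S n \<in> B" for n using full_sub_biproduct[OF sub] by blast+
  obtain LY where "obj LY = S" "homotopy_equivalent C KY LY"
    using split_extension_homotopy_equivalent[OF E K(2,4) S'(1)] by blast
  then show ?thesis using S S' KY represents_t_iff[OF B] by auto
qed

lemma represents_shift:
  assumes B: "B \<subseteq> w_eq C w 0" and "represents_t C w B M L"
  shows "represents_t C w B (ShO C i M) (shift_cpx i L)"
  using assms weight_complex_shift[of M _ i] shift_cpx_homotopy_equivalent[of C _ L i] unfolding represents_t_iff[OF B] shift_cpx_simps
  by blast

lemma represents_isomorphic:
  assumes "isomorphic C M M'" and "represents_t C w B M L"
  shows "represents_t C w B M' L"
  using assms weight_complex_isomorphic unfolding represents_t_def by blast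

end

section \<open>The homomorphism induced by \<open>F\<close> on Grothendieck groups\<close>

lemma full_tri_simps [simp]:
  "Ob (full_tri C S) = S" "Dom (full_tri C S) = Dom C" "Cod (full_tri C S) = Cod C"
  "Idn (full_tri C S) = Idn C" "Cmp (full_tri C S) = Cmp C" "Pls (full_tri C S) = Pls C"
  "Zro (full_tri C S) = Zro C" "ShO (full_tri C S) = ShO C" "ShA (full_tri C S) = ShA C"
  "f \<in> Ar (full_tri C S) \<longleftrightarrow> f \<in> Ar C \<and> Dom C f \<in> S \<and> Cod C f \<in> S"
  "f \<in> Homs (full_tri C S) X Y \<longleftrightarrow> f \<in> Homs C X Y \<and> X \<in> S \<and> Y \<in> S"
  "dist_tri (full_tri C S) f g h \<longleftrightarrow> dist_tri C f g h \<and> Dom C f \<in> S \<and> Cod C f \<in> S \<and> Cod C g \<in> S"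
  by (auto simp: full_tri_def Homs_def)

lemma (in weight_structure) full_tri_isomorphic: "isomorphic (full_tri C S) X Y \<longleftrightarrow> isomorphic (full_sub C S) X Y"
  by (simp add: isomorphic_def is_iso_arrow_def Bex_def)

lemma K0_presentation_triangles: "K0_presentation (full_tri C S) (triangle_triples (full_tri C S))"
  by unfold_locales (auto simp: triangle_triples_def)

text \<open>The standing hypotheses, kept general in \<open>C'\<close>, \<open>A\<close> and
  \<open>F\<close>: the isomorphism statement instantiates them with all of \<open>C\<close> and the
  identity functor of \<open>B\<close>.\<close>

locale weight_K0 = weight_structure C w
  for C :: "('o, 'm) tricat" (structure) and w +
  fixes C' B :: "'o set" and A :: "('a, 'b) cat" and F :: "('o, 'm, 'a, 'b) fnctr"
  assumes sub: "full_triangulated_subcategory C C'" and B: "B \<subseteq> w_eq C w 0"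
    and B_additive: "additive_category (full_sub C B)" and A_additive: "additive_category A"
    and F: "additive_functor (full_sub C B) A F" and fin: "has_F_finite_complexes C w C' B A F"
begin

sublocale A: additive_category A by (rule A_additive)
sublocale B: additive_category "full_sub C B" by (rule B_additive)
sublocale F: additive_functor_between "full_sub C B" A F by unfold_locales (rule F)
sublocale T: K0_presentation "full_tri C C'" "triangle_triples (full_tri C C')" by (rule K0_presentation_triangles)
sublocale T': triangulated_category "full_tri C C'" using sub unfolding full_triangulated_subcategory_def by blast

lemma C'_sub: "C' \<subseteq> Ob C" using sub unfolding full_triangulated_subcategory_def by blast

lemma B_sub: "B \<subseteq> Ob C" using B w_eq_sub by blast

lemma image_homotopy_equivalent:
  "represents_t C w B M L \<Longrightarrow> represents_t C w B M L' \<Longrightarrow> homotopy_equivalent A (map_cpx F L) (map_cpx F L')"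
  using F.map_homotopy_equivalent represents_unique[OF B] by blast

abbreviation "FK M \<equiv> FK0 C w C' B A F (K0_tr_class (full_tri C C') M)"

definition admissible :: "'o \<Rightarrow> ('o, 'm) cpx \<Rightarrow> bool" where
  "admissible M L \<longleftrightarrow> represents_t C w B M L \<and> almost_all_zero A (map_cpx F L)"

definition euler :: "'o \<Rightarrow> ('a set \<Rightarrow>\<^sub>0 int) set" where
  "euler M = euler_class A (obj (map_cpx F (SOME L. admissible M L)))"

lemma admissible_exists: "M \<in> C' \<Longrightarrow> \<exists>L. admissible M L"
  using fin unfolding has_F_finite_complexes_def admissible_def by blast

text \<open>The equivalence between two admissible complexes is found over \<open>B\<close>, where
  they may be unbounded; their images under \<open>F\<close> are bounded and equivalent in
  \<open>A\<close>, where the Euler class is invariant. This justifies the choice in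
  \<open>euler\<close>.\<close>

lemma euler_eq:
  assumes "admissible M L"
  shows "euler M = euler_class A (obj (map_cpx F L))"
proof -
  define L' where "L' = (SOME L. admissible M L)"
  have "admissible M L'" unfolding L'_def using assms by (rule someI)
  then have "euler_class A (obj (map_cpx F L')) = euler_class A (obj (map_cpx F L))"
    using assms A.euler_class_homotopy_equivalent image_homotopy_equivalent unfolding admissible_def by blast
  then show ?thesis unfolding euler_def L'_def .
qed

lemma euler_closed:
  assumes "M \<in> C'"
  shows "euler M \<in> carrier (K0_add A)"
proof -
  obtain L where L: "admissible M L" using admissible_exists[OF assms] by blast
  have "obj (map_cpx F L) i \<in> Ob A" for i
    using L F.FOb_in unfolding admissible_def represents_t_iff[OF B] by (simp add: map_cpx_def)
  then show ?thesis
    unfolding euler_eq[OF L] using L A.euler_class_closed unfolding admissible_def by blast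
qed

lemma admissible_isomorphic: "isomorphic C M M' \<Longrightarrow> admissible M L \<Longrightarrow> admissible M' L"
  using represents_isomorphic unfolding admissible_def by blast

text \<open>The termwise sum of two complexes with bounded image has bounded image. So the complex
  built for the middle object is itself admissible, and additivity follows from additivity of Euler
  classes.\<close>

lemma admissible_extension:
  assumes t: "dist_tri C f g h" and X: "admissible (Dom C f) LX" and Z: "admissible (Cod C g) LZ"
  shows "\<exists>LY. admissible (Cod C f) LY \<and> (\<forall>n. is_biproduct (full_sub C B) (obj LX n) (obj LZ n) (obj LY n)) \<and>
    euler (Cod C f) = euler (Dom C f) \<otimes>\<^bsub>K0_add A\<^esub> euler (Cod C g)"
proof -
  obtain LY where LY: "represents_t C w B (Cod C f) LY" and
    bp: "\<And>n. is_biproduct (full_sub C B) (obj LX n) (obj LZ n) (obj LY n)"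
    using represents_extension[OF B B_additive t] X Z unfolding admissible_def by blast
  have bpA: "is_biproduct A (obj (map_cpx F LX) n) (obj (map_cpx F LZ) n) (obj (map_cpx F LY) n)" for n
    using F.map_biproduct[OF bp] by (simp add: map_cpx_def)
  have "almost_all_zero A (map_cpx F LX)" "almost_all_zero A (map_cpx F LZ)" using X Z unfolding admissible_def by blast+
  from A.euler_class_biproduct[OF bpA this]
  have "admissible (Cod C f) LY" and "euler_class A (obj (map_cpx F LY)) = euler_class A (obj (map_cpx F LX)) \<otimes>\<^bsub>K0_add A\<^esub> euler_class A (obj (map_cpx F LZ))"
    unfolding admissible_def using LY by blast+
  then show ?thesis using bp euler_eq[OF X] euler_eq[OF Z] euler_eq[of "Cod C f" LY] by auto
qed

lemma euler_triangle:
  assumes "dist_tri (full_tri C C') f g h"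
  shows "euler (Cod C f) = euler (Dom C f) \<otimes>\<^bsub>K0_add A\<^esub> euler (Cod C g)"
proof -
  have t: "dist_tri C f g h" and "Dom C f \<in> C'" "Cod C g \<in> C'" using assms by simp_all
  then obtain LX LZ where "admissible (Dom C f) LX" "admissible (Cod C g) LZ" using admissible_exists by blast
  from admissible_extension[OF t this] show ?thesis by blast
qed

theorem is_FK0_exists_unique: "\<exists>!\<phi>. is_FK0 C w C' B A F \<phi>"
proof -
  let ?T = "full_tri C C'"
  have eq: "is_FK0 C w C' B A F \<phi> \<longleftrightarrow> \<phi> \<in> hom (K0_tr (?T)) (K0_add A) \<and>
    \<phi> \<in> extensional (carrier (K0_tr (?T))) \<and> (\<forall>M \<in> C'. \<phi> (K0_tr_class (?T) M) = euler M)" for \<phi>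
    unfolding is_FK0_def admissible_def[symmetric] using euler_eq admissible_exists by (intro conj_cong refl) fastforce
  have iso: "euler X = euler Y" if "X \<in> C'" "Y \<in> C'" "iso_class (?T) X = iso_class (?T) Y" for X Y
  proof -
    have "isomorphic (?T) X Y" using that T'.iso_class_eq_iff by simp
    then have i: "isomorphic C X Y" unfolding full_tri_isomorphic full_sub_isomorphic by blast
    obtain L where L: "admissible X L" using admissible_exists[OF \<open>X \<in> C'\<close>] by blast
    show ?thesis using euler_eq[OF admissible_isomorphic[OF i L]] euler_eq[OF L] by simp
  qed
  have tri: "euler Y = euler X \<otimes>\<^bsub>K0_add A\<^esub> euler Z" if r: "(X, Y, Z) \<in> triangle_triples (?T)" for X Y Z
  proof -
    obtain f g h where "dist_tri (?T) f g h" "X = Dom C f" "Y = Cod C f" "Z = Cod C g"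
      using r unfolding triangle_triples_def full_tri_simps(2,3) by blast
    then show ?thesis using euler_triangle by blast
  qed
  have "\<exists>\<phi> \<in> hom (K0_group (?T) (triangle_triples (?T))) (K0_add A).
    \<forall>X \<in> Ob (?T). \<phi> (K0_class (?T) (triangle_triples (?T)) X) = euler X"
    apply (rule T.universal[OF A.K0_add_comm_group])
      apply (simp only: full_tri_simps(1) euler_closed)
     apply (rule iso, simp_all only: full_tri_simps(1))
    apply (erule tri)
    done
  then obtain \<phi> where \<phi>: "\<phi> \<in> hom (K0_tr (?T)) (K0_add A)" "\<And>X. X \<in> C' \<Longrightarrow> \<phi> (K0_tr_class (?T) X) = euler X"
    unfolding K0_tr_def K0_tr_class_def full_tri_simps(1) by blast
  have cl: "K0_tr_class (?T) X \<in> carrier (K0_tr (?T))" if "X \<in> C'" for X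
    using T.class_closed[of X] that unfolding K0_tr_def K0_tr_class_def full_tri_simps(1) by blast
  have "monoid (K0_tr (?T))" unfolding K0_tr_def by (rule T.K.is_monoid)
  \<comment> \<open>The homomorphism from the presentation has arbitrary values outside the carrier;
    restriction makes it extensional.\<close>
  then have "restrict \<phi> (carrier (K0_tr (?T))) \<in> hom (K0_tr (?T)) (K0_add A)"
    using \<phi>(1) unfolding hom_def by (simp add: Pi_iff monoid.m_closed)
  then have "is_FK0 C w C' B A F (restrict \<phi> (carrier (K0_tr (?T))))"
    unfolding eq using \<phi>(2) cl by simp
  moreover have "\<phi>1 = \<phi>2" if "is_FK0 C w C' B A F \<phi>1" "is_FK0 C w C' B A F \<phi>2" for \<phi>1 \<phi>2
  proof (rule extensionalityI)
    show "\<phi>1 \<in> extensional (carrier (K0_tr (?T)))" "\<phi>2 \<in> extensional (carrier (K0_tr (?T)))"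
      using that unfolding eq by blast+
    have h: "\<phi>1 \<in> hom (K0_tr (?T)) (K0_add A)" "\<phi>2 \<in> hom (K0_tr (?T)) (K0_add A)"
      using that unfolding eq by blast+
    have "\<phi>1 (K0_tr_class (?T) X) = \<phi>2 (K0_tr_class (?T) X)" if "X \<in> Ob (?T)" for X
      using \<open>is_FK0 C w C' B A F \<phi>1\<close> \<open>is_FK0 C w C' B A F \<phi>2\<close> that unfolding eq full_tri_simps(1) by simp
    then show "\<phi>1 x = \<phi>2 x" if "x \<in> carrier (K0_tr (?T))" for x
      by (rule T.hom_eqI[OF A.K0_add_comm_group h[unfolded K0_tr_def], folded K0_tr_class_def K0_tr_def, OF _ that])
  qed
  ultimately show ?thesis by blast
qed

lemma
  shows FK0_hom: "FK0 C w C' B A F \<in> hom (K0_tr (full_tri C C')) (K0_add A)"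
    and FK0_class: "M \<in> C' \<Longrightarrow> FK M = euler M"
proof -
  have *: "is_FK0 C w C' B A F (FK0 C w C' B A F)" unfolding FK0_def by (rule theI'[OF is_FK0_exists_unique])
  then show "FK0 C w C' B A F \<in> hom (K0_tr (full_tri C C')) (K0_add A)" unfolding is_FK0_def by blast
  assume "M \<in> C'"
  then show "FK M = euler M"
    using * admissible_exists[of M] euler_eq unfolding is_FK0_def admissible_def[symmetric] by fastforce
qed

end

section \<open>Cohomology in abelian categories\<close>

context preadditive_category
begin

lemma is_kernelD:
  assumes "is_kernel C f k"
  shows "f \<in> Ar C" "k \<in> Ar C" "Cod C k = Dom C f" "f \<cdot> k = Zro C (Dom C k) (Cod C f)"
    and kernel_lift: "t \<in> Homs C W (Dom C f) \<Longrightarrow> f \<cdot> t = Zro C W (Cod C f) \<Longrightarrow> \<exists>u \<in> Homs C W (Dom C k). k \<cdot> u = t"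
    and kernel_mono: "u \<in> Homs C W (Dom C k) \<Longrightarrow> v \<in> Homs C W (Dom C k) \<Longrightarrow> k \<cdot> u = k \<cdot> v \<Longrightarrow> u = v"
proof -
  note K = assms[unfolded is_kernel_def]
  show 1: "f \<in> Ar C" "k \<in> Ar C" "Cod C k = Dom C f" "f \<cdot> k = Zro C (Dom C k) (Cod C f)" using K by blast+
  show "\<exists>u \<in> Homs C W (Dom C k). k \<cdot> u = t" if "t \<in> Homs C W (Dom C f)" "f \<cdot> t = Zro C W (Cod C f)" for t
    using K that unfolding Homs_def by blast
  show "u = v" if "u \<in> Homs C W (Dom C k)" "v \<in> Homs C W (Dom C k)" "k \<cdot> u = k \<cdot> v"
  proof -
    note [simp] = 1 HomsD[OF that(1)] HomsD[OF that(2)]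
    have "f \<cdot> (k \<cdot> u) = Zro C (Dom C u) (Cod C f)"
      using Cmp_assoc'[of u k f] 1(4) by (simp add: cat_simps Cod_Ob Dom_Ob)
    moreover have "k \<cdot> u \<in> Ar C" "Cod C (k \<cdot> u) = Dom C f" "Dom C (k \<cdot> u) = W" by (simp_all add: cat_simps)
    moreover have "\<And>t. t \<in> Ar C \<Longrightarrow> Cod C t = Dom C f \<Longrightarrow> f \<cdot> t = Zro C (Dom C t) (Cod C f) \<Longrightarrow>
        \<exists>!x. x \<in> Homs C (Dom C t) (Dom C k) \<and> k \<cdot> x = t" using K by blast
    from this[of "k \<cdot> u"] have "\<exists>!x. x \<in> Homs C W (Dom C k) \<and> k \<cdot> x = k \<cdot> u" using calculation by simp
    then show ?thesis using that by metis
  qed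
qed

lemma is_cokernelD:
  assumes "is_cokernel C f c"
  shows "f \<in> Ar C" "c \<in> Ar C" "Dom C c = Cod C f" "c \<cdot> f = Zro C (Dom C f) (Cod C c)"
    and cokernel_extend: "t \<in> Homs C (Cod C f) W \<Longrightarrow> t \<cdot> f = Zro C (Dom C f) W \<Longrightarrow> \<exists>u \<in> Homs C (Cod C c) W. u \<cdot> c = t"
    and cokernel_epi: "u \<in> Homs C (Cod C c) W \<Longrightarrow> v \<in> Homs C (Cod C c) W \<Longrightarrow> u \<cdot> c = v \<cdot> c \<Longrightarrow> u = v"
proof -
  note K = assms[unfolded is_cokernel_def]
  show 1: "f \<in> Ar C" "c \<in> Ar C" "Dom C c = Cod C f" "c \<cdot> f = Zro C (Dom C f) (Cod C c)" using K by blast+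
  show "\<exists>u \<in> Homs C (Cod C c) W. u \<cdot> c = t" if "t \<in> Homs C (Cod C f) W" "t \<cdot> f = Zro C (Dom C f) W" for t
    using K that unfolding Homs_def by blast
  show "u = v" if "u \<in> Homs C (Cod C c) W" "v \<in> Homs C (Cod C c) W" "u \<cdot> c = v \<cdot> c"
  proof -
    note [simp] = 1 HomsD[OF that(1)] HomsD[OF that(2)]
    have "u \<cdot> c \<cdot> f = Zro C (Dom C f) (Cod C u)"
      by (simp add: cat_simps Cod_Ob Dom_Ob)
    moreover have "u \<cdot> c \<in> Ar C" "Dom C (u \<cdot> c) = Cod C f" "Cod C (u \<cdot> c) = W" by (simp_all add: cat_simps)
    moreover have "\<And>t. t \<in> Ar C \<Longrightarrow> Dom C t = Cod C f \<Longrightarrow> t \<cdot> f = Zro C (Dom C f) (Cod C t) \<Longrightarrow>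
        \<exists>!x. x \<in> Homs C (Cod C c) (Cod C t) \<and> x \<cdot> c = t" using K by blast
    from this[of "u \<cdot> c"] have "\<exists>!x. x \<in> Homs C (Cod C c) W \<and> x \<cdot> c = u \<cdot> c" using calculation by simp
    then show ?thesis using that by metis
  qed
qed

lemma is_kernelI:
  assumes "f \<in> Ar C" "k \<in> Ar C" "Cod C k = Dom C f" "f \<cdot> k = Zro C (Dom C k) (Cod C f)"
    and "\<And>W t. t \<in> Homs C W (Dom C f) \<Longrightarrow> f \<cdot> t = Zro C W (Cod C f) \<Longrightarrow> \<exists>u \<in> Homs C W (Dom C k). k \<cdot> u = t"
    and "\<And>W u v. u \<in> Homs C W (Dom C k) \<Longrightarrow> v \<in> Homs C W (Dom C k) \<Longrightarrow> k \<cdot> u = k \<cdot> v \<Longrightarrow> u = v"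
  shows "is_kernel C f k"
  unfolding is_kernel_def
proof (intro conjI ballI impI assms(1-4))
  fix t assume "t \<in> Ar C" "Cod C t = Dom C f \<and> f \<cdot> t = Zro C (Dom C t) (Cod C f)"
  then obtain u where "u \<in> Homs C (Dom C t) (Dom C k)" "k \<cdot> u = t" using assms(5)[of t "Dom C t"] unfolding Homs_def by blast
  then show "\<exists>!u. u \<in> Homs C (Dom C t) (Dom C k) \<and> k \<cdot> u = t" using assms(6) by metis
qed

lemma is_cokernelI:
  assumes "f \<in> Ar C" "c \<in> Ar C" "Dom C c = Cod C f" "c \<cdot> f = Zro C (Dom C f) (Cod C c)"
    and "\<And>W t. t \<in> Homs C (Cod C f) W \<Longrightarrow> t \<cdot> f = Zro C (Dom C f) W \<Longrightarrow> \<exists>u \<in> Homs C (Cod C c) W. u \<cdot> c = t"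
    and "\<And>W u v. u \<in> Homs C (Cod C c) W \<Longrightarrow> v \<in> Homs C (Cod C c) W \<Longrightarrow> u \<cdot> c = v \<cdot> c \<Longrightarrow> u = v"
  shows "is_cokernel C f c"
  unfolding is_cokernel_def
proof (intro conjI ballI impI assms(1-4))
  fix t assume "t \<in> Ar C" "Dom C t = Cod C f \<and> t \<cdot> f = Zro C (Dom C f) (Cod C t)"
  then obtain u where "u \<in> Homs C (Cod C c) (Cod C t)" "u \<cdot> c = t" using assms(5)[of t "Cod C t"] unfolding Homs_def by blast
  then show "\<exists>!u. u \<in> Homs C (Cod C c) (Cod C t) \<and> u \<cdot> c = t" using assms(6) by metis
qed

lemma is_epiI:
  assumes f: "f \<in> Ar C" and z: "\<And>W t. t \<in> Homs C (Cod C f) W \<Longrightarrow> t \<cdot> f = Zro C (Dom C f) W \<Longrightarrow> t = Zro C (Cod C f) W"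
  shows "is_epi C f"
  unfolding is_epi_def
proof (intro conjI allI ballI impI f)
  fix W s t assume st: "s \<in> Homs C (Cod C f) W" "t \<in> Homs C (Cod C f) W" and e: "s \<cdot> f = t \<cdot> f"
  note [simp] = f HomsD[OF st(1)] HomsD[OF st(2)] Dom_Ob[OF f]
  have W: "Cod C f \<in> Ob C" "W \<in> Ob C" using Homs_Ob[OF st(1)] by auto
  have "(s \<boxplus> neg_arrow C t) \<cdot> f = s \<cdot> f \<boxplus> neg_arrow C (t \<cdot> f)" using W by (simp add: cat_simps)
  also have "\<dots> = Zro C (Dom C f) W" unfolding e using W by (simp add: Pls_neg cat_simps)
  finally have "s \<boxplus> neg_arrow C t = Zro C (Cod C f) W" using st by (intro z) (simp_all add: Pls_in neg_arrow_in)
  then show "s = t" by (rule minus_zero_eq[OF st])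
qed

lemma is_epiD:
  assumes "is_epi C f" "t \<in> Homs C (Cod C f) W" "t \<cdot> f = Zro C (Dom C f) W"
  shows "t = Zro C (Cod C f) W"
proof -
  have "f \<in> Ar C" using assms(1) unfolding is_epi_def by blast
  then have "Zro C (Cod C f) W \<in> Homs C (Cod C f) W" "Zro C (Cod C f) W \<cdot> f = Zro C (Dom C f) W"
    using Homs_Ob[OF assms(2)] Dom_Ob[of f] by (simp_all add: cat_simps)
  then show ?thesis using assms unfolding is_epi_def by metis
qed

definition cohomology_data :: "('o, 'm) cpx \<Rightarrow> 'm \<Rightarrow> 'm \<Rightarrow> 'm \<Rightarrow> bool" where
  "cohomology_data K k e c \<longleftrightarrow> is_kernel C (dif K 0) k \<and>
        e \<in> Homs C (obj K (- 1)) (Dom C k) \<and> k \<cdot> e = dif K (- 1) \<and> is_cokernel C e c"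

lemma is_cohomology0_iff: "is_cohomology0 C K H \<longleftrightarrow> (\<exists>k e c. cohomology_data K k e c \<and> Cod C c = H)"
  unfolding is_cohomology0_def cohomology_data_def by blast

lemma cohomology_dataD:
  assumes "is_complex C K" "cohomology_data K k e c"
  shows "is_kernel C (dif K 0) k" "is_cokernel C e c" "k \<cdot> e = dif K (- 1)"
    "k \<in> Ar C" "Cod C k = obj K 0" "dif K 0 \<cdot> k = Zro C (Dom C k) (obj K 1)"
    "e \<in> Ar C" "Dom C e = obj K (- 1)" "Cod C e = Dom C k"
    "c \<in> Ar C" "Dom C c = Dom C k" "c \<cdot> e = Zro C (obj K (- 1)) (Cod C c)" "Dom C k \<in> Ob C" "Cod C c \<in> Ob C"
proof -
  note D = assms(2)[unfolded cohomology_data_def]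
  show 1: "is_kernel C (dif K 0) k" "is_cokernel C e c" "k \<cdot> e = dif K (- 1)" using D by blast+
  show 2: "e \<in> Ar C" "Dom C e = obj K (- 1)" "Cod C e = Dom C k" using D by (auto simp: Homs_def)
  show 3: "k \<in> Ar C" "Cod C k = obj K 0" "dif K 0 \<cdot> k = Zro C (Dom C k) (obj K 1)"
    using is_kernelD(1-4)[OF 1(1)] is_complexD[OF assms(1)] by auto
  show "c \<in> Ar C" "Dom C c = Dom C k" "c \<cdot> e = Zro C (obj K (- 1)) (Cod C c)" "Dom C k \<in> Ob C" "Cod C c \<in> Ob C"
    using is_cokernelD(1-4)[OF 1(2)] 2 3 Dom_Ob Cod_Ob by auto
qed

lemma cohomology_map:
  assumes K: "is_complex C K" "cohomology_data K k e c" and L: "is_complex C L" "cohomology_data L k' e' c'"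
    and f: "is_chain_map C K L f"
  shows "\<exists>u \<in> Homs C (Dom C k) (Dom C k'). \<exists>v \<in> Homs C (Cod C c) (Cod C c'). k' \<cdot> u = f 0 \<cdot> k \<and> v \<cdot> c = c' \<cdot> u"
proof -
  note dK = cohomology_dataD[OF K] and dL = cohomology_dataD[OF L]
  note [simp] = is_complexD[OF K(1)] is_complexD[OF L(1)] chain_mapD[OF f] dK(4-14) dL(4-14)
  have f0: "f 1 \<cdot> dif K 0 = dif L 0 \<cdot> f 0" "f 0 \<cdot> dif K (- 1) = dif L (- 1) \<cdot> f (- 1)"
    using chain_map_dif(1)[OF K(1) L(1) f, of 1 0] chain_map_dif(1)[OF K(1) L(1) f, of 0 "- 1"] by simp_all
  have "dif L 0 \<cdot> (f 0 \<cdot> k) = (f 1 \<cdot> dif K 0) \<cdot> k" unfolding f0(1) by (rule Cmp_assoc'[symmetric]) simp_all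
  also have "\<dots> = Zro C (Dom C k) (obj L 1)" by (simp add: cat_simps)
  finally have "\<exists>u \<in> Homs C (Dom C k) (Dom C k'). k' \<cdot> u = f 0 \<cdot> k"
    by (intro kernel_lift[OF dL(1)]) (simp_all add: HomsI Cmp_arr)
  then obtain u where u: "u \<in> Homs C (Dom C k) (Dom C k')" "k' \<cdot> u = f 0 \<cdot> k" by blast
  note [simp] = HomsD[OF u(1)]
  have "k' \<cdot> (u \<cdot> e) = f 0 \<cdot> dif K (- 1)"
    unfolding dK(3)[symmetric] using u(2)[THEN Cmp_assoc_eq, of e] by (simp add: cat_simps)
  also have "\<dots> = k' \<cdot> (e' \<cdot> f (- 1))" unfolding f0(2) dL(3)[symmetric] by (simp add: cat_simps)
  finally have ue: "u \<cdot> e = e' \<cdot> f (- 1)"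
    by (rule kernel_mono[OF dL(1), rotated -1, where W = "obj K (- 1)"]) (simp_all add: HomsI Cmp_arr)
  have "c' \<cdot> u \<cdot> e = Zro C (obj K (- 1)) (Cod C c')"
    using ue dL(12)[THEN Cmp_assoc_eq, of "f (- 1)"] by (simp add: cat_simps)
  then have "\<exists>v \<in> Homs C (Cod C c) (Cod C c'). v \<cdot> c = c' \<cdot> u"
    by (intro cokernel_extend[OF dK(2)]) (simp_all add: HomsI Cmp_arr)
  then show ?thesis using u by blast
qed

text \<open>On cocycles a null-homotopic endomorphism reduces to \<open>d h\<close>, which factors
  through the coboundary map \<open>e\<close>; the cokernel \<open>c\<close> kills it.\<close>

lemma cohomology_homotopic_identity:
  assumes K: "is_complex C K" "cohomology_data K k e c" and f: "is_chain_map C K K f"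
    and h: "chain_homotopic C K K f (\<lambda>i. Idn C (obj K i))"
    and u: "u \<in> Homs C (Dom C k) (Dom C k)" "k \<cdot> u = f 0 \<cdot> k"
  shows "c \<cdot> u = c"
proof -
  note dK = cohomology_dataD[OF K]
  note [simp] = is_complexD[OF K(1)] chain_mapD[OF f] dK(4-14) HomsD[OF u(1)]
  obtain h where h: "\<And>i. h i \<in> Homs C (obj K i) (obj K (i - 1))"
    "\<And>i. f i = Idn C (obj K i) \<boxplus> (dif K (i - 1) \<cdot> h i \<boxplus> h (i + 1) \<cdot> dif K i)"
    using h unfolding chain_homotopic_def by blast
  note [simp] = HomsD[OF h(1)]
  have [simp]: "Cod C (h 0) = obj K (- 1)" "Cod C (h 1) = obj K 0" by simp_all
  have f0: "f 0 = Idn C (obj K 0) \<boxplus> (dif K (- 1) \<cdot> h 0 \<boxplus> h 1 \<cdot> dif K 0)" using h(2)[of 0] by simp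
  have "k \<cdot> u = k \<boxplus> dif K (- 1) \<cdot> (h 0 \<cdot> k)" unfolding u(2) f0 by (simp add: cat_simps)
  also have "\<dots> = k \<cdot> (Idn C (Dom C k) \<boxplus> e \<cdot> (h 0 \<cdot> k))"
    unfolding dK(3)[symmetric] by (simp add: cat_simps)
  finally have "u = Idn C (Dom C k) \<boxplus> e \<cdot> (h 0 \<cdot> k)"
    by (rule kernel_mono[OF dK(1), rotated -1, where W = "Dom C k"]) (simp_all add: HomsI cat_simps)
  then show ?thesis using dK(12)[THEN Cmp_assoc_eq, of "h 0 \<cdot> k"] by (simp add: cat_simps)
qed

lemma cohomology_homotopy_equivalent:
  assumes he: "homotopy_equivalent C K L" and H: "is_cohomology0 C K H" and H': "is_cohomology0 C L H'"
  shows "isomorphic C H H'"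
proof -
  obtain f g where KL: "is_complex C K" "is_complex C L" and f: "is_chain_map C K L f" and g: "is_chain_map C L K g"
    and gf: "chain_homotopic C K K (\<lambda>i. g i \<cdot> f i) (\<lambda>i. Idn C (obj K i))"
    and fg: "chain_homotopic C L L (\<lambda>i. f i \<cdot> g i) (\<lambda>i. Idn C (obj L i))"
    by (rule homotopy_equivalentE[OF he])
  obtain k e c k' e' c' where d: "cohomology_data K k e c" "cohomology_data L k' e' c'" and HH: "Cod C c = H" "Cod C c' = H'"
    using H H' unfolding is_cohomology0_iff by blast
  note dK = cohomology_dataD[OF KL(1) d(1)] and dL = cohomology_dataD[OF KL(2) d(2)]
  note [simp] = is_complexD[OF KL(1)] is_complexD[OF KL(2)] chain_mapD[OF f] chain_mapD[OF g] dK(4-14) dL(4-14)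
  obtain u v where u: "u \<in> Homs C (Dom C k) (Dom C k')" "k' \<cdot> u = f 0 \<cdot> k"
    and v: "v \<in> Homs C (Cod C c) (Cod C c')" "v \<cdot> c = c' \<cdot> u"
    using cohomology_map[OF KL(1) d(1) KL(2) d(2) f] by blast
  obtain x y where x: "x \<in> Homs C (Dom C k') (Dom C k)" "k \<cdot> x = g 0 \<cdot> k'"
    and y: "y \<in> Homs C (Cod C c') (Cod C c)" "y \<cdot> c' = c \<cdot> x"
    using cohomology_map[OF KL(2) d(2) KL(1) d(1) g] by blast
  note [simp] = HomsD[OF u(1)] HomsD[OF v(1)] HomsD[OF x(1)] HomsD[OF y(1)]
  have "k \<cdot> (x \<cdot> u) = g 0 \<cdot> f 0 \<cdot> k" using u(2) x(2)[THEN Cmp_assoc_eq, of u] by (simp add: cat_simps)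
  then have 1: "c \<cdot> (x \<cdot> u) = c"
    by - (rule cohomology_homotopic_identity[OF KL(1) d(1) chain_map_comp[OF KL(1) KL(2) KL(1) f g] gf], simp_all add: HomsI Cmp_arr)
  have "k' \<cdot> (u \<cdot> x) = f 0 \<cdot> g 0 \<cdot> k'" using x(2) u(2)[THEN Cmp_assoc_eq, of x] by (simp add: cat_simps)
  then have 2: "c' \<cdot> (u \<cdot> x) = c'"
    by - (rule cohomology_homotopic_identity[OF KL(2) d(2) chain_map_comp[OF KL(2) KL(1) KL(2) g f] fg], simp_all add: HomsI Cmp_arr)
  have "y \<cdot> v \<cdot> c = c" using v(2) y(2)[THEN Cmp_assoc_eq, of u] 1 by (simp add: cat_simps)
  then have "y \<cdot> v = Idn C (Cod C c)"
    by - (rule cokernel_epi[OF dK(2), rotated -1, where W = "Cod C c"], simp_all add: HomsI cat_simps)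
  moreover have "v \<cdot> y \<cdot> c' = c'" using y(2) v(2)[THEN Cmp_assoc_eq, of x] 2 by (simp add: cat_simps)
  then have "v \<cdot> y = Idn C (Cod C c')"
    by - (rule cokernel_epi[OF dL(2), rotated -1, where W = "Cod C c'"], simp_all add: HomsI cat_simps)
  ultimately show ?thesis using isomorphicI(1)[OF v(1) y(1)] HH by simp
qed

lemma cohomology_Ob: "is_complex C K \<Longrightarrow> is_cohomology0 C K H \<Longrightarrow> H \<in> Ob C"
  unfolding is_cohomology0_iff using cohomology_dataD(14) by blast

text \<open>Vanishing cohomology is used only in this form: arrows out of the cocycles are
  determined by their restriction to the preceding term.\<close>

lemma cohomology_zero_epi:
  assumes K: "is_complex C K" "cohomology_data K k e c" and z: "is_zero_object C (Cod C c)"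
  shows "is_epi C e"
proof (rule is_epiI)
  note dK = cohomology_dataD[OF K]
  show "e \<in> Ar C" using dK(7) .
  fix W t assume t: "t \<in> Homs C (Cod C e) W" "t \<cdot> e = Zro C (Dom C e) W"
  obtain u where u: "u \<in> Homs C (Cod C c) W" "u \<cdot> c = t" using cokernel_extend[OF dK(2) t] by blast
  have "u = Zro C (Cod C c) W" using zero_object_arrow(1)[OF z u(1)] .
  then show "t = Zro C (Cod C e) W" using u dK(4-14) Homs_Ob[OF u(1)] by (auto simp: cat_simps)
qed

end

context abelian_category
begin

text \<open>An epimorphism is the cokernel of some arrow, and that arrow factors through the kernel
  of the epimorphism.\<close>

lemma epi_is_cokernel_of_kernel:
  assumes f: "is_epi C f" and k: "is_kernel C f k" and t: "t \<in> Homs C (Dom C f) W" "t \<cdot> k = Zro C (Dom C k) W"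
  shows "\<exists>u \<in> Homs C (Cod C f) W. u \<cdot> f = t"
proof -
  obtain g where g: "is_cokernel C g f" using epi_is_cokernel[OF f] by blast
  note dg = is_cokernelD[OF g] and dk = is_kernelD[OF k]
  note [simp] = dg(1-3) dk(2,3) HomsD[OF t(1)] Dom_Ob Cod_Ob
  obtain x where x: "x \<in> Homs C (Dom C g) (Dom C k)" "k \<cdot> x = g" using dk(5)[of g "Dom C g"] dg(3,4) by (auto simp: HomsI)
  note [simp] = HomsD[OF x(1)]
  have W: "W \<in> Ob C" using Homs_Ob[OF t(1)] by simp
  have "t \<cdot> g = t \<cdot> k \<cdot> x" unfolding x(2)[symmetric] by (rule Cmp_assoc'[symmetric]) simp_all
  then have "t \<cdot> g = Zro C (Dom C g) W" unfolding t(2) using W by (simp add: cat_simps)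
  then show ?thesis using cokernel_extend[OF g, of t W] t(1) by simp
qed

lemma cohomology_exists:
  assumes K: "is_complex C K"
  shows "\<exists>H. is_cohomology0 C K H"
proof -
  note [simp] = is_complexD[OF K]
  obtain k where k: "is_kernel C (dif K 0) k" using has_kernels[of "dif K 0"] by auto
  have "dif K 0 \<cdot> dif K (- 1) = Zro C (obj K (- 1)) (obj K 1)" using complex_dd[OF K, of 0 "- 1"] by simp
  then obtain e where e: "e \<in> Homs C (obj K (- 1)) (Dom C k)" "k \<cdot> e = dif K (- 1)"
    using kernel_lift[OF k, of "dif K (- 1)" "obj K (- 1)"] by (auto simp: HomsI)
  obtain c where "is_cokernel C e c" using has_cokernels[OF HomsD(1)[OF e(1)]] by blast
  then show ?thesis using k e unfolding is_cohomology0_def by blast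
qed

text \<open>In this lemma and the next, a piece of the long exact sequence: one outer term is concentrated in
  degree 0, so that the isomorphism can be written down directly.\<close>

lemma cohomology_extension_sub:
  assumes E: "split_extension C X Y Z i p j q \<delta>"
    and zX: "is_zero_object C (obj X 1)" "is_zero_object C (obj X (- 1))"
    and H0: "is_cohomology0 C Z H0" "is_zero_object C H0"
    and H1: "is_cohomology0 C (shift_cpx (- 1) Z) H1" "is_zero_object C H1"
  shows "is_cohomology0 C Y (obj X 0)"
proof -
  have cX: "is_complex C X" and cY: "is_complex C Y" and cZ: "is_complex C Z" using E unfolding split_extension_def by blast+
  note h = split_extension_facts[OF E]
  note [simp] = is_complexD[OF cX] is_complexD[OF cY] is_complexD[OF cZ] HomsD[OF h(1)] HomsD[OF h(2)] HomsD[OF h(3)] HomsD[OF h(4)] HomsD[OF h(5)]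
  \<comment> \<open>The connecting arrow, the only component of \<delta> near degree 0 that is not
    forced to vanish.\<close>
  define d where "d = \<delta> (- 1)"
  have d: "d \<in> Homs C (obj Z (- 1)) (obj X 0)" unfolding d_def using h(5)[of "- 1"] by simp
  note [simp] = HomsD[OF d]
  have zz: "dif X 0 = Zro C (obj X 0) (obj X 1)" "\<delta> 0 = Zro C (obj Z 0) (obj X 1)" "dif X (- 1) = Zro C (obj X (- 1)) (obj X 0)"
    "\<delta> (- 2) = Zro C (obj Z (- 2)) (obj X (- 1))" "p (- 1) = Zro C (obj Y (- 1)) (obj X (- 1))" "i (- 1) = Zro C (obj X (- 1)) (obj Y (- 1))"
    using zero_object_arrow(2)[OF zX(1), of "dif X 0" "obj X 0"] zero_object_arrow(2)[OF zX(1), of "\<delta> 0" "obj Z 0"]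
      zero_object_arrow(1)[OF zX(2), of "dif X (- 1)"] zero_object_arrow(2)[OF zX(2), of "\<delta> (- 2)" "obj Z (- 2)"]
      zero_object_arrow(2)[OF zX(2), of "p (- 1)" "obj Y (- 1)"] zero_object_arrow(1)[OF zX(2), of "i (- 1)"] by (simp_all add: HomsI)
  have dY0: "dif Y 0 = j 1 \<cdot> (dif Z 0 \<cdot> q 0)"
    using h(11)[of 0] by (simp add: zz cat_simps)
  have dY1: "dif Y (- 1) = j 0 \<cdot> (dif Z (- 1) \<cdot> q (- 1)) \<boxplus> i 0 \<cdot> (d \<cdot> q (- 1))"
    using h(11)[of "- 1"] by (simp add: zz cat_simps flip: d_def)
  have jq: "j (- 1) \<cdot> q (- 1) = Idn C (obj Y (- 1))" using h(10)[of "- 1"] by (simp add: zz cat_simps)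
  have dd: "d \<cdot> dif Z (- 2) = Zro C (obj Z (- 2)) (obj X 0)" using h(12)[of "- 1"] by (simp add: zz cat_simps flip: d_def)
  obtain kY where kY: "is_kernel C (dif Y 0) kY" using has_kernels[of "dif Y 0"] by auto
  have "dif Y 0 \<cdot> dif Y (- 1) = Zro C (obj Y (- 1)) (obj Y 1)" using complex_dd[OF cY, of 0 "- 1"] by simp
  then obtain eY where eY: "eY \<in> Homs C (obj Y (- 1)) (Dom C kY)" "kY \<cdot> eY = dif Y (- 1)"
    using kernel_lift[OF kY, of "dif Y (- 1)" "obj Y (- 1)"] by (auto simp: HomsI)
  obtain kZ eZ cz where dZ: "cohomology_data Z kZ eZ cz" "is_zero_object C (Cod C cz)" using H0 unfolding is_cohomology0_iff by blast
  have eZepi: "is_epi C eZ" by (rule cohomology_zero_epi[OF cZ dZ])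
  note dZ' = cohomology_dataD[OF cZ dZ(1)]
  let ?S = "shift_cpx (- 1) Z"
  have cS: "is_complex C ?S" by (rule shift_cpx_complex[OF cZ])
  obtain kS eS cs where dS: "cohomology_data ?S kS eS cs" "is_zero_object C (Cod C cs)" using H1 unfolding is_cohomology0_iff by blast
  have eSepi: "is_epi C eS" by (rule cohomology_zero_epi[OF cS dS])
  note dS' = cohomology_dataD[OF cS dS(1), simplified]
  note [simp] = is_kernelD(2,3)[OF kY] HomsD[OF eY(1)] dZ'(4-14) dS'(4-14)
  have OY [simp]: "Dom C kY \<in> Ob C" by (simp add: Dom_Ob)
  have kYz: "dif Y 0 \<cdot> kY = Zro C (Dom C kY) (obj Y 1)" using is_kernelD(4)[OF kY] by simp
  \<comment> \<open>The cocycles of \<open>Z\<close> in degree -1, taken from the shifted complex,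
    are the kernel of the epimorphism onto the cocycles in degree 0.\<close>
  have "is_kernel C eZ kS"
  proof (rule is_kernelI)
    have "kZ \<cdot> (eZ \<cdot> kS) = kZ \<cdot> Zro C (Dom C kS) (Dom C kZ)"
      using dZ'(3)[THEN Cmp_assoc_eq, of kS] dS'(6) by (simp add: cat_simps)
    then show "eZ \<cdot> kS = Zro C (Dom C kS) (Cod C eZ)"
      by - (rule kernel_mono[OF dZ'(1), where W = "Dom C kS"], simp_all add: HomsI cat_simps)
    show "\<exists>u\<in>Homs C W (Dom C kS). kS \<cdot> u = t" if t: "t \<in> Homs C W (Dom C eZ)" "eZ \<cdot> t = Zro C W (Cod C eZ)" for W t
    proof -
      note [simp] = HomsD[OF t(1)]
      have "dif Z (- 1) \<cdot> t = Zro C W (obj Z 0)"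
        unfolding dZ'(3)[symmetric] using t(2) Homs_Ob[OF t(1)] by (simp add: cat_simps)
      then show ?thesis using kernel_lift[OF dS'(1), of t W] t(1) by simp
    qed
    show "u = v" if "u \<in> Homs C W (Dom C kS)" "v \<in> Homs C W (Dom C kS)" "kS \<cdot> u = kS \<cdot> v" for W u v
      using kernel_mono[OF dS'(1) that] .
  qed simp_all
  \<comment> \<open>By \<open>dd\<close> the arrow \<open>d\<close> vanishes on coboundaries, and
    these fill the cocycles in degree -1 by the second vanishing assumption.\<close>
  moreover have "d \<cdot> kS = Zro C (Dom C kS) (obj X 0)"
  proof -
    have "d \<cdot> kS \<cdot> eS = Zro C (obj Z (- 2)) (obj X 0)" using dS'(3) dd by (simp add: cat_simps)
    then show ?thesis using is_epiD[OF eSepi, of "d \<cdot> kS" "obj X 0"] by (simp add: HomsI cat_simps)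
  qed
  ultimately obtain s where s: "s \<in> Homs C (Dom C kZ) (obj X 0)" "s \<cdot> eZ = d"
    using epi_is_cokernel_of_kernel[OF eZepi, of kS d "obj X 0"] d by (auto simp: HomsI)
  note [simp] = HomsD[OF s(1)]
  have "q 1 \<cdot> (j 1 \<cdot> (dif Z 0 \<cdot> (q 0 \<cdot> kY))) = Zro C (Dom C kY) (obj Z 1)"
    using kYz unfolding dY0 by (simp add: cat_simps)
  then have "dif Z 0 \<cdot> (q 0 \<cdot> kY) = Zro C (Dom C kY) (obj Z 1)"
    using h(7)[THEN Cmp_assoc_eq, of 1 "dif Z 0 \<cdot> (q 0 \<cdot> kY)"] by (simp add: cat_simps)
  then obtain u where u: "u \<in> Homs C (Dom C kY) (Dom C kZ)" "kZ \<cdot> u = q 0 \<cdot> kY"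
    using kernel_lift[OF dZ'(1), of "q 0 \<cdot> kY" "Dom C kY"] by (auto simp: HomsI cat_simps)
  note [simp] = HomsD[OF u(1)]
  have "dif Y 0 \<cdot> i 0 = Zro C (obj X 0) (obj Y 1)" unfolding dY0 by (simp add: cat_simps h(8))
  then obtain i' where i': "i' \<in> Homs C (obj X 0) (Dom C kY)" "kY \<cdot> i' = i 0"
    using kernel_lift[OF kY, of "i 0" "obj X 0"] by (auto simp: HomsI)
  note [simp] = HomsD[OF i'(1)]
  have "dif Y 0 \<cdot> (j 0 \<cdot> kZ) = Zro C (Dom C kZ) (obj Y 1)"
    unfolding dY0 using h(7)[THEN Cmp_assoc_eq, of 0 kZ] dZ'(6) by (simp add: cat_simps)
  then obtain v where v: "v \<in> Homs C (Dom C kZ) (Dom C kY)" "kY \<cdot> v = j 0 \<cdot> kZ"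
    using kernel_lift[OF kY, of "j 0 \<cdot> kZ" "Dom C kZ"] by (auto simp: HomsI cat_simps)
  note [simp] = HomsD[OF v(1)]
  \<comment> \<open>The projection of a cocycle of \<open>Y\<close> to \<open>obj X 0\<close>,
    corrected by \<open>s\<close> so that coboundaries are killed.\<close>
  define c where "c = p 0 \<cdot> kY \<boxplus> neg_arrow C (s \<cdot> u)"
  have c [simp]: "c \<in> Ar C" "Dom C c = Dom C kY" "Cod C c = obj X 0" unfolding c_def by (simp_all add: cat_simps)
  have ueY: "u \<cdot> eY = eZ \<cdot> q (- 1)"
  proof -
    have "kZ \<cdot> (u \<cdot> eY) = q 0 \<cdot> dif Y (- 1)" unfolding eY(2)[symmetric] using u(2)[THEN Cmp_assoc_eq, of eY] by (simp add: cat_simps)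
    also have "\<dots> = dif Z (- 1) \<cdot> q (- 1)"
      unfolding dY1 using h(7)[THEN Cmp_assoc_eq, of 0 "dif Z (- 1) \<cdot> q (- 1)"] h(8)[THEN Cmp_assoc_eq, of 0 "d \<cdot> q (- 1)"] by (simp add: cat_simps)
    also have "\<dots> = kZ \<cdot> (eZ \<cdot> q (- 1))" unfolding dZ'(3)[symmetric] by (simp add: cat_simps)
    finally show ?thesis by (rule kernel_mono[OF dZ'(1), rotated -1, where W = "obj Y (- 1)"]) (simp_all add: HomsI cat_simps)
  qed
  have ui': "u \<cdot> i' = Zro C (obj X 0) (Dom C kZ)"
  proof (rule kernel_mono[OF dZ'(1), where W = "obj X 0"])
    show "kZ \<cdot> (u \<cdot> i') = kZ \<cdot> Zro C (obj X 0) (Dom C kZ)"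
      using u(2)[THEN Cmp_assoc_eq, of i'] i'(2) h(8) by (simp add: cat_simps)
  qed (simp_all add: HomsI cat_simps)
  have ceY: "c \<cdot> eY = Zro C (obj Y (- 1)) (obj X 0)"
  proof -
    have "p 0 \<cdot> kY \<cdot> eY = d \<cdot> q (- 1)"
      using h(6)[THEN Cmp_assoc_eq, of 0 "d \<cdot> q (- 1)"] h(9)[THEN Cmp_assoc_eq, of 0 "dif Z (- 1) \<cdot> q (- 1)"]
      by (simp add: cat_simps eY(2) dY1)
    moreover have "s \<cdot> u \<cdot> eY = d \<cdot> q (- 1)" using ueY s(2)[THEN Cmp_assoc_eq, of "q (- 1)"] by (simp add: cat_simps)
    ultimately show ?thesis unfolding c_def using Pls_neg(1)[of "d \<cdot> q (- 1)" "obj Y (- 1)" "obj X 0"] by (simp add: cat_simps HomsI)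
  qed
  have ci': "c \<cdot> i' = Idn C (obj X 0)" unfolding c_def by (simp add: cat_simps i'(2) h(6) ui')
  \<comment> \<open>The cocycles of \<open>Y\<close> are the sum of \<open>obj X 0\<close> and the
    cocycles of \<open>Z\<close>, since \<delta> and the differential of \<open>X\<close> vanish in
    degree 0.\<close>
  have split: "i' \<cdot> (p 0 \<cdot> kY) \<boxplus> v \<cdot> u = Idn C (Dom C kY)"
  proof (rule kernel_mono[OF kY, where W = "Dom C kY"])
    have "kY \<cdot> (i' \<cdot> (p 0 \<cdot> kY) \<boxplus> v \<cdot> u) = (i 0 \<cdot> p 0 \<boxplus> j 0 \<cdot> q 0) \<cdot> kY"
      using i'(2)[THEN Cmp_assoc_eq, of "p 0 \<cdot> kY"] v(2)[THEN Cmp_assoc_eq, of u] u(2) by (simp add: cat_simps)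
    then show "kY \<cdot> (i' \<cdot> (p 0 \<cdot> kY) \<boxplus> v \<cdot> u) = kY \<cdot> Idn C (Dom C kY)" unfolding h(10) by (simp add: cat_simps)
  qed (simp_all add: HomsI cat_simps)
  have "is_cokernel C eY c"
  proof (rule is_cokernelI)
    show "c \<cdot> eY = Zro C (Dom C eY) (Cod C c)" using ceY by simp
    fix W
    show "x = y" if xy: "x \<in> Homs C (Cod C c) W" "y \<in> Homs C (Cod C c) W" "x \<cdot> c = y \<cdot> c" for x y
    proof -
      note [simp] = HomsD[OF xy(1)] HomsD[OF xy(2)]
      have "x \<cdot> c \<cdot> i' = y \<cdot> c \<cdot> i'" using xy(3) by simp
      then show ?thesis using ci' by (simp add: cat_simps)
    qed
    fix t assume t: "t \<in> Homs C (Cod C eY) W" "t \<cdot> eY = Zro C (Dom C eY) W"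
    note [simp] = HomsD[OF t(1)]
    have W [simp]: "W \<in> Ob C" using Homs_Ob[OF t(1)] by simp
    \<comment> \<open>The section of \<open>u\<close> whose image is the coboundaries: on
      \<open>eZ\<close> it is \<open>eY\<close> after \<open>j\<close>. An arrow killing
      \<open>eY\<close> therefore kills \<open>r\<close> and factors through
      \<open>c\<close>.\<close>
    define r where "r = v \<boxplus> i' \<cdot> s"
    have r [simp]: "r \<in> Ar C" "Dom C r = Dom C kZ" "Cod C r = Dom C kY" unfolding r_def by (simp_all add: cat_simps)
    have "r \<cdot> eZ = eY \<cdot> j (- 1)"
    proof (rule kernel_mono[OF kY, where W = "obj Z (- 1)"])
      have "kY \<cdot> (r \<cdot> eZ) = j 0 \<cdot> dif Z (- 1) \<boxplus> i 0 \<cdot> d"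
        unfolding r_def using v(2)[THEN Cmp_assoc_eq, of eZ] i'(2)[THEN Cmp_assoc_eq, of "s \<cdot> eZ"] dZ'(3) s(2) by (simp add: cat_simps)
      also have "\<dots> = kY \<cdot> (eY \<cdot> j (- 1))"
        using eY(2)[THEN Cmp_assoc_eq, of "j (- 1)"] h(7) by (simp add: cat_simps dY1)
      finally show "kY \<cdot> (r \<cdot> eZ) = kY \<cdot> (eY \<cdot> j (- 1))" .
    qed (simp_all add: HomsI cat_simps)
    then have "t \<cdot> r \<cdot> eZ = Zro C (Dom C eZ) W" using t(2)[THEN Cmp_assoc_eq, of "j (- 1)"] by (simp add: cat_simps)
    then have tr: "t \<cdot> r = Zro C (Dom C kZ) W" using is_epiD[OF eZepi, of "t \<cdot> r" W] by (simp add: HomsI cat_simps)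
    have "t = t \<cdot> (i' \<cdot> c \<boxplus> r \<cdot> u)"
    proof -
      have e: "i' \<cdot> c = i' \<cdot> (p 0 \<cdot> kY) \<boxplus> neg_arrow C (i' \<cdot> (s \<cdot> u))" "r \<cdot> u = v \<cdot> u \<boxplus> i' \<cdot> (s \<cdot> u)"
        unfolding c_def r_def by (simp_all add: cat_simps)
      have "i' \<cdot> c \<boxplus> r \<cdot> u = i' \<cdot> (p 0 \<cdot> kY) \<boxplus> v \<cdot> u"
        unfolding e
        apply (rule lin_eqI[of "Dom C kY" "Dom C kY"])
        apply (rule lin_Pls lin_neg lin_Zro lin_atom' | (simp add: cat_simps; fail) | (simp add: algebra_simps; fail))+
        done
      then show ?thesis using split by (simp add: cat_simps)
    qed
    also have "\<dots> = t \<cdot> i' \<cdot> c" using tr[THEN Cmp_assoc_eq, of u] by (simp add: cat_simps)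
    finally show "\<exists>x\<in>Homs C (Cod C c) W. x \<cdot> c = t" by (intro bexI[of _ "t \<cdot> i'"]) (simp_all add: HomsI cat_simps)
  qed simp_all
  then have "cohomology_data Y kY eY c" unfolding cohomology_data_def using kY eY by blast
  then show ?thesis unfolding is_cohomology0_iff using c(3) by blast
qed

lemma cohomology_extension_quotient:
  assumes E: "split_extension C X Y Z i p j q \<delta>"
    and zZ: "is_zero_object C (obj Z 1)" "is_zero_object C (obj Z (- 1))"
    and H0: "is_cohomology0 C X H0" "is_zero_object C H0"
    and H1: "is_cohomology0 C (shift_cpx 1 X) H1" "is_zero_object C H1"
  shows "is_cohomology0 C Y (obj Z 0)"
proof -
  have cX: "is_complex C X" and cY: "is_complex C Y" and cZ: "is_complex C Z" using E unfolding split_extension_def by blast+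
  note h = split_extension_facts[OF E]
  note [simp] = is_complexD[OF cX] is_complexD[OF cY] is_complexD[OF cZ] HomsD[OF h(1)] HomsD[OF h(2)] HomsD[OF h(3)] HomsD[OF h(4)] HomsD[OF h(5)]
  \<comment> \<open>The connecting arrow again; by \<open>dd\<close> it lands in the cocycles of
    \<open>X\<close> in degree 1, which will be all coboundaries.\<close>
  define d where "d = \<delta> 0"
  have d: "d \<in> Homs C (obj Z 0) (obj X 1)" unfolding d_def using h(5)[of 0] by simp
  note [simp] = HomsD[OF d]
  have zz: "dif Z 0 = Zro C (obj Z 0) (obj Z 1)" "dif Z (- 1) = Zro C (obj Z (- 1)) (obj Z 0)"
    "q (- 1) = Zro C (obj Y (- 1)) (obj Z (- 1))"
    using zero_object_arrow(2)[OF zZ(1), of "dif Z 0" "obj Z 0"] zero_object_arrow(1)[OF zZ(2), of "dif Z (- 1)"]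
      zero_object_arrow(2)[OF zZ(2), of "q (- 1)" "obj Y (- 1)"] by (simp_all add: HomsI)
  have dY0: "dif Y 0 = i 1 \<cdot> (dif X 0 \<cdot> p 0) \<boxplus> i 1 \<cdot> (d \<cdot> q 0)"
    using h(11)[of 0] by (simp add: zz cat_simps flip: d_def)
  have dY1: "dif Y (- 1) = i 0 \<cdot> (dif X (- 1) \<cdot> p (- 1))"
    using h(11)[of "- 1"] by (simp add: zz cat_simps)
  have dd: "dif X 1 \<cdot> d = Zro C (obj Z 0) (obj X 2)" using h(12)[of 1] by (simp add: zz cat_simps flip: d_def)
  obtain kY where kY: "is_kernel C (dif Y 0) kY" using has_kernels[of "dif Y 0"] by auto
  have "dif Y 0 \<cdot> dif Y (- 1) = Zro C (obj Y (- 1)) (obj Y 1)" using complex_dd[OF cY, of 0 "- 1"] by simp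
  then obtain eY where eY: "eY \<in> Homs C (obj Y (- 1)) (Dom C kY)" "kY \<cdot> eY = dif Y (- 1)"
    using kernel_lift[OF kY, of "dif Y (- 1)" "obj Y (- 1)"] by (auto simp: HomsI)
  obtain kX eX cx where dX: "cohomology_data X kX eX cx" "is_zero_object C (Cod C cx)" using H0 unfolding is_cohomology0_iff by blast
  have eXepi: "is_epi C eX" by (rule cohomology_zero_epi[OF cX dX])
  note dX' = cohomology_dataD[OF cX dX(1)]
  let ?S = "shift_cpx 1 X"
  have cS: "is_complex C ?S" by (rule shift_cpx_complex[OF cX])
  obtain kS eS cs where dS: "cohomology_data ?S kS eS cs" "is_zero_object C (Cod C cs)" using H1 unfolding is_cohomology0_iff by blast
  have eSepi: "is_epi C eS" by (rule cohomology_zero_epi[OF cS dS])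
  note dS' = cohomology_dataD[OF cS dS(1), simplified]
  note [simp] = is_kernelD(2,3)[OF kY] HomsD[OF eY(1)] dX'(4-14) dS'(4-14)
  have OY [simp]: "Dom C kY \<in> Ob C" by (simp add: Dom_Ob)
  have kYz: "dif Y 0 \<cdot> kY = Zro C (Dom C kY) (obj Y 1)" using is_kernelD(4)[OF kY] by simp
  have rXY: "f = g" if "f \<in> Homs C W (obj X n)" "g \<in> Homs C W (obj X n)" "i n \<cdot> f = i n \<cdot> g" for f g W n
  proof -
    note [simp] = HomsD[OF that(1)] HomsD[OF that(2)]
    have "p n \<cdot> i n \<cdot> f = p n \<cdot> i n \<cdot> g" using that(3) by (simp add: Cmp_assoc' Cmp_arr)
    then show ?thesis unfolding h(6) by (simp add: cat_simps)
  qed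
  obtain s where s: "s \<in> Homs C (obj Z 0) (Dom C kS)" "kS \<cdot> s = d"
    using kernel_lift[OF dS'(1), of d "obj Z 0"] dd by (auto simp: HomsI)
  note [simp] = HomsD[OF s(1)]
  \<comment> \<open>The differential of \<open>Y\<close> in degree 0, viewed as an arrow to the
    cocycles of \<open>X\<close> in degree 1. It is an epimorphism since already its restriction to
    \<open>X\<close> is one.\<close>
  define m where "m = eS \<cdot> p 0 \<boxplus> s \<cdot> q 0"
  have m [simp]: "m \<in> Ar C" "Dom C m = obj Y 0" "Cod C m = Dom C kS" unfolding m_def by (simp_all add: cat_simps)
  have dYm: "dif Y 0 = i 1 \<cdot> (kS \<cdot> m)"
    unfolding dY0 m_def using dS'(3)[THEN Cmp_assoc_eq, of "p 0"] s(2)[THEN Cmp_assoc_eq, of "q 0"] by (simp add: cat_simps)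
  have mi: "m \<cdot> i 0 = eS" unfolding m_def by (simp add: cat_simps h(6,8))
  have mepi: "is_epi C m"
  proof (rule is_epiI)
    fix W t assume t: "t \<in> Homs C (Cod C m) W" "t \<cdot> m = Zro C (Dom C m) W"
    note [simp] = HomsD[OF t(1)]
    have "W \<in> Ob C" using Homs_Ob[OF t(1)] by simp
    then have "t \<cdot> eS = Zro C (obj X 0) W" using t(2)[THEN Cmp_assoc_eq, of "i 0"] by (simp add: mi cat_simps)
    then show "t = Zro C (Cod C m) W" using is_epiD[OF eSepi, of t W] by (simp add: HomsI)
  qed simp
  have mker: "is_kernel C m kY"
  proof (rule is_kernelI)
    have "i 1 \<cdot> (kS \<cdot> (m \<cdot> kY)) = i 1 \<cdot> (kS \<cdot> Zro C (Dom C kY) (Dom C kS))" using kYz unfolding dYm by (simp add: cat_simps)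
    then have "kS \<cdot> (m \<cdot> kY) = kS \<cdot> Zro C (Dom C kY) (Dom C kS)"
      by (rule rXY[rotated -1, where W = "Dom C kY"]) (simp_all add: HomsI cat_simps)
    then show "m \<cdot> kY = Zro C (Dom C kY) (Cod C m)"
      by - (rule kernel_mono[OF dS'(1), where W = "Dom C kY"], simp_all add: HomsI cat_simps)
    show "\<exists>u\<in>Homs C W (Dom C kY). kY \<cdot> u = t" if t: "t \<in> Homs C W (Dom C m)" "m \<cdot> t = Zro C W (Cod C m)" for W t
    proof -
      note [simp] = HomsD[OF t(1)]
      have "dif Y 0 \<cdot> t = Zro C W (obj Y 1)"
        unfolding dYm using t(2) Homs_Ob[OF t(1)] by (simp add: cat_simps)
      then show ?thesis using kernel_lift[OF kY, of t W] t(1) by simp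
    qed
    show "u = v" if "u \<in> Homs C W (Dom C kY)" "v \<in> Homs C W (Dom C kY)" "kY \<cdot> u = kY \<cdot> v" for W u v
      using kernel_mono[OF kY that] .
  qed simp_all
  \<comment> \<open>An arrow vanishing on the image of the cocycles, pulled back along
    \<open>q\<close>, factors through \<open>m\<close>; restricted to \<open>X\<close> it is zero,
    so the factor is zero.\<close>
  have qepi: "is_epi C (q 0 \<cdot> kY)"
  proof (rule is_epiI)
    fix W t assume "t \<in> Homs C (Cod C (q 0 \<cdot> kY)) W" "t \<cdot> (q 0 \<cdot> kY) = Zro C (Dom C (q 0 \<cdot> kY)) W"
    then have t: "t \<in> Homs C (obj Z 0) W" "t \<cdot> (q 0 \<cdot> kY) = Zro C (Dom C kY) W" by (simp_all add: cat_simps)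
    note [simp] = HomsD[OF t(1)]
    have [simp]: "W \<in> Ob C" using Homs_Ob[OF t(1)] by simp
    obtain r where r: "r \<in> Homs C (Dom C kS) W" "r \<cdot> m = t \<cdot> q 0"
      using epi_is_cokernel_of_kernel[OF mepi mker, of "t \<cdot> q 0" W] t(2) by (auto simp: HomsI cat_simps)
    note [simp] = HomsD[OF r(1)]
    have "r \<cdot> eS = Zro C (obj X 0) W" using r(2)[THEN Cmp_assoc_eq, of "i 0"] by (simp add: mi h(8) cat_simps)
    then have "r = Zro C (Dom C kS) W" using is_epiD[OF eSepi, of r W] by (simp add: HomsI)
    then have tq: "t \<cdot> q 0 = Zro C (obj Y 0) W" using r(2) by (simp add: cat_simps)
    then show "t = Zro C (Cod C (q 0 \<cdot> kY)) W" using tq[THEN Cmp_assoc_eq, of "j 0"] by (simp add: cat_simps h(7))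
  qed (simp add: cat_simps)
  have "is_cokernel C eY (q 0 \<cdot> kY)"
  proof (rule is_cokernelI)
    show "q 0 \<cdot> kY \<cdot> eY = Zro C (Dom C eY) (Cod C (q 0 \<cdot> kY))"
      using h(8)[THEN Cmp_assoc_eq, of 0 "dif X (- 1) \<cdot> p (- 1)"] by (simp add: cat_simps eY(2) dY1)
    fix W
    show "x = y" if "x \<in> Homs C (Cod C (q 0 \<cdot> kY)) W" "y \<in> Homs C (Cod C (q 0 \<cdot> kY)) W" "x \<cdot> (q 0 \<cdot> kY) = y \<cdot> (q 0 \<cdot> kY)" for x y
      using qepi that unfolding is_epi_def by blast
    fix t assume t: "t \<in> Homs C (Cod C eY) W" "t \<cdot> eY = Zro C (Dom C eY) W"
    note [simp] = HomsD[OF t(1)]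
    have W [simp]: "W \<in> Ob C" using Homs_Ob[OF t(1)] by simp
    \<comment> \<open>Elements of this kernel are cocycles coming from \<open>X\<close>, hence
      coboundaries as the cohomology of \<open>X\<close> in degree 0 vanishes. So \<open>t\<close>
      kills them and factors through the epimorphism.\<close>
    obtain \<kappa> where \<kappa>: "is_kernel C (q 0 \<cdot> kY) \<kappa>" using has_kernels[of "q 0 \<cdot> kY"] by (auto simp: cat_simps)
    have dk: "\<kappa> \<in> Ar C" "Cod C \<kappa> = Dom C kY" using is_kernelD(2,3)[OF \<kappa>] by (simp_all add: cat_simps)
    note [simp] = dk
    have [simp]: "Dom C \<kappa> \<in> Ob C" by (simp add: Dom_Ob)
    have qk: "q 0 \<cdot> (kY \<cdot> \<kappa>) = Zro C (Dom C \<kappa>) (obj Z 0)" using is_kernelD(4)[OF \<kappa>] by (simp add: cat_simps)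
    have "dif Y 0 \<cdot> kY \<cdot> \<kappa> = Zro C (Dom C \<kappa>) (obj Y 1)" unfolding kYz by (simp add: cat_simps)
    then have "i 1 \<cdot> (dif X 0 \<cdot> (p 0 \<cdot> (kY \<cdot> \<kappa>))) = i 1 \<cdot> Zro C (Dom C \<kappa>) (obj X 1)" unfolding dY0 by (simp add: cat_simps qk)
    then have "dif X 0 \<cdot> (p 0 \<cdot> (kY \<cdot> \<kappa>)) = Zro C (Dom C \<kappa>) (obj X 1)"
      by (rule rXY[rotated -1, where W = "Dom C \<kappa>"]) (simp_all add: HomsI cat_simps)
    then obtain y where y: "y \<in> Homs C (Dom C \<kappa>) (Dom C kX)" "kX \<cdot> y = p 0 \<cdot> (kY \<cdot> \<kappa>)"
      using kernel_lift[OF dX'(1), of "p 0 \<cdot> (kY \<cdot> \<kappa>)" "Dom C \<kappa>"] by (auto simp: HomsI cat_simps)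
    note [simp] = HomsD[OF y(1)]
    have "dif Y 0 \<cdot> (i 0 \<cdot> kX) = Zro C (Dom C kX) (obj Y 1)"
      unfolding dY0 using h(6)[THEN Cmp_assoc_eq, of 0 kX] h(8)[THEN Cmp_assoc_eq, of 0 kX] dX'(6) by (simp add: cat_simps)
    then obtain g where g: "g \<in> Homs C (Dom C kX) (Dom C kY)" "kY \<cdot> g = i 0 \<cdot> kX"
      using kernel_lift[OF kY, of "i 0 \<cdot> kX" "Dom C kX"] by (auto simp: HomsI cat_simps)
    note [simp] = HomsD[OF g(1)]
    have "(i 0 \<cdot> p 0 \<boxplus> j 0 \<cdot> q 0) \<cdot> (kY \<cdot> \<kappa>) = i 0 \<cdot> (kX \<cdot> y)" unfolding y(2) by (simp add: cat_simps qk)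
    then have "kY \<cdot> \<kappa> = kY \<cdot> (g \<cdot> y)" unfolding h(10) using g(2)[THEN Cmp_assoc_eq, of y] by (simp add: cat_simps)
    then have \<kappa>g: "\<kappa> = g \<cdot> y"
      by (rule kernel_mono[OF kY, rotated -1, where W = "Dom C \<kappa>"]) (simp_all add: HomsI cat_simps)
    have "kY \<cdot> (g \<cdot> eX) = kY \<cdot> (eY \<cdot> i (- 1))"
      using g(2)[THEN Cmp_assoc_eq, of eX] eY(2)[THEN Cmp_assoc_eq, of "i (- 1)"] by (simp add: cat_simps dX'(3) dY1 h(6))
    then have "g \<cdot> eX = eY \<cdot> i (- 1)"
      by (rule kernel_mono[OF kY, rotated -1, where W = "obj X (- 1)"]) (simp_all add: HomsI cat_simps)
    then have "t \<cdot> g \<cdot> eX = Zro C (Dom C eX) W" using t(2)[THEN Cmp_assoc_eq, of "i (- 1)"] by (simp add: cat_simps)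
    then have "t \<cdot> g = Zro C (Dom C kX) W" using is_epiD[OF eXepi, of "t \<cdot> g" W] by (simp add: HomsI cat_simps)
    then have "t \<cdot> \<kappa> = Zro C (Dom C \<kappa>) W" unfolding \<kappa>g using Cmp_assoc_eq[of t g _ y] by (simp add: cat_simps)
    then show "\<exists>x\<in>Homs C (Cod C (q 0 \<cdot> kY)) W. x \<cdot> (q 0 \<cdot> kY) = t"
      using epi_is_cokernel_of_kernel[OF qepi \<kappa>, of t W] by (simp add: HomsI cat_simps)
  qed (simp_all add: cat_simps)
  then have "cohomology_data Y kY eY (q 0 \<cdot> kY)" unfolding cohomology_data_def using kY eY by blast
  moreover have "Cod C (q 0 \<cdot> kY) = obj Z 0" by (simp add: cat_simps)
  ultimately show ?thesis unfolding is_cohomology0_iff by blast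
qed

end

context additive_functor_between
begin

lemma map_split_extension:
  assumes E: "split_extension C X Y Z i p j q \<delta>"
  shows "split_extension D (map_cpx F X) (map_cpx F Y) (map_cpx F Z) (\<lambda>n. FAr F (i n)) (\<lambda>n. FAr F (p n))
    (\<lambda>n. FAr F (j n)) (\<lambda>n. FAr F (q n)) (\<lambda>n. FAr F (\<delta> n))"
proof -
  have cX: "is_complex C X" and cY: "is_complex C Y" and cZ: "is_complex C Z" using E unfolding split_extension_def by blast+
  note h = C.split_extension_facts[OF E]
  note [simp] = C.split_extensionD(4-)[OF E] C.is_complexD[OF cX] C.is_complexD[OF cY] C.is_complexD[OF cZ]
  have [simp]: "Cod C (\<delta> (n - 1)) = obj X n" "Cod C (dif Z (n - 1)) = obj Z n" for n by simp_all
  show ?thesis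
    unfolding split_extension_def
    using map_complex[OF cX] map_complex[OF cY] map_complex[OF cZ] h(1-5)[THEN FAr_in] h(6-12)[THEN arg_cong, of "FAr F"]
    by (simp add: map_cpx_def FAr_Cmp' FAr_Pls' FAr_Idn FAr_Zro C.arr_simps)
qed

end

section \<open>Euler class and cohomology in the semi-simple case\<close>

lemma (in preadditive_category) biproduct_zero_summands:
  assumes "is_biproduct C X Y S" "is_zero_object C S"
  shows "is_zero_object C X" "is_zero_object C Y"
proof -
  obtain i j p q where bp: "i \<in> Homs C X S" "j \<in> Homs C Y S" "p \<in> Homs C S X" "q \<in> Homs C S Y"
      "p \<cdot> i = Idn C X" "q \<cdot> j = Idn C Y" and O: "X \<in> Ob C" "Y \<in> Ob C"
    using assms(1) unfolding is_biproduct_def by blast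
  have "i = Zro C X S" "j = Zro C Y S" using zero_object_arrow(2)[OF assms(2)] bp by blast+
  then show "is_zero_object C X" "is_zero_object C Y"
    using bp O HomsD[OF bp(3)] HomsD[OF bp(4)] by (simp_all add: zero_object_iff cat_simps)
qed

text \<open>For the classes of coboundaries: each enters once as a source part and once as a target
  part, in adjacent degrees.\<close>

lemma sum_alt_telescope:
  "(\<Sum>n\<in>{b..b + int m}. alt n (x n + x (n + 1))) = alt b (x b) + alt (b + int m) (x (b + int m + 1))"
proof (induction m)
  case (Suc m)
  have "{b..b + int (Suc m)} = insert (b + int m + 1) {b..b + int m}" by auto
  then show ?case using Suc by (simp add: alt_add alt_shift add.assoc[of b _ 1, symmetric]) (simp add: alt_def algebra_simps)
qed (simp add: alt_add)

context semisimple_abelian_category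
begin

text \<open>With a section \<open>s\<close> of \<open>g\<close>, the arrow \<open>1 - s g\<close> is
  killed by \<open>g\<close> and factors through the kernel \<open>f\<close>; this factor is the
  missing retraction.\<close>

lemma short_exact_biproduct:
  assumes k: "is_kernel C g f" and c: "is_cokernel C f g"
  shows "is_biproduct C (Dom C f) (Cod C g) (Cod C f)"
proof -
  note dk = is_kernelD(1-4)[OF k] and dc = is_cokernelD(1-4)[OF c]
  obtain s where s: "s \<in> Homs C (Cod C g) (Dom C g)" "g \<cdot> s = Idn C (Cod C g)"
    using short_exact_splits[OF k c] by blast
  note [simp] = dk(1-3) HomsD[OF s(1)] Dom_Ob Cod_Ob
  have gB: "Dom C g = Cod C f" by simp
  note gf = dk(4)
  define r where "r = Idn C (Cod C f) \<boxplus> neg_arrow C (s \<cdot> g)"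
  have r [simp]: "r \<in> Ar C" "Dom C r = Cod C f" "Cod C r = Cod C f" unfolding r_def by (simp_all add: cat_simps)
  have gr: "g \<cdot> r = Zro C (Cod C f) (Cod C g)"
    unfolding r_def using s(2)[THEN Cmp_assoc_eq, of g] Pls_neg(1)[of g "Cod C f" "Cod C g"] by (simp add: cat_simps HomsI)
  have fr: "r \<cdot> f = f" and rs: "r \<cdot> s = Zro C (Cod C g) (Cod C f)"
    unfolding r_def using gf s(2) Pls_neg(1)[of s "Cod C g" "Cod C f"] by (simp_all add: cat_simps HomsI)
  obtain p where p: "p \<in> Homs C (Cod C f) (Dom C f)" "f \<cdot> p = r" using kernel_lift[OF k, of r "Cod C f"] gr by (auto simp: HomsI)
  note [simp] = HomsD[OF p(1)]
  have "f \<cdot> (p \<cdot> f) = f \<cdot> Idn C (Dom C f)" using p(2)[THEN Cmp_assoc_eq, of f] fr by (simp add: cat_simps)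
  then have pf: "p \<cdot> f = Idn C (Dom C f)" by (rule kernel_mono[OF k, rotated -1, where W = "Dom C f"]) (simp_all add: HomsI cat_simps)
  have "f \<cdot> (p \<cdot> s) = f \<cdot> Zro C (Cod C g) (Dom C f)" using p(2)[THEN Cmp_assoc_eq, of s] rs by (simp add: cat_simps)
  then have ps: "p \<cdot> s = Zro C (Cod C g) (Dom C f)" by (rule kernel_mono[OF k, rotated -1, where W = "Cod C g"]) (simp_all add: HomsI cat_simps)
  have sum: "f \<cdot> p \<boxplus> s \<cdot> g = Idn C (Cod C f)"
    unfolding p(2) r_def
    apply (rule lin_eqI[of "Cod C f" "Cod C f"])
    apply (rule lin_Pls lin_neg lin_Zro lin_atom' | (simp add: cat_simps; fail) | (simp add: algebra_simps; fail))+
    done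
  show ?thesis
    unfolding is_biproduct_def
    apply (intro conjI)
       apply simp_all[3]
    apply (rule bexI[of _ f], rule bexI[of _ s], rule bexI[of _ p], rule bexI[of _ g])
    using pf ps sum gf s(2) by (simp_all add: HomsI)
qed

text \<open>The object \<open>I\<close> is the object of coboundaries, common to both
  decompositions: the term in degree -1 is cocycles plus \<open>I\<close>, and the cocycles in
  degree 0 are \<open>I\<close> plus the cohomology.\<close>

lemma cohomology_biproducts:
  assumes K: "is_complex C K" "cohomology_data K k e c" and k': "is_kernel C (dif K (- 1)) k'"
  shows "\<exists>I. is_biproduct C (Dom C k') I (obj K (- 1)) \<and> is_biproduct C I (Cod C c) (Dom C k)"
proof -
  note dK = cohomology_dataD[OF K] and dk' = is_kernelD(1-4)[OF k']
  note [simp] = is_complexD[OF K(1)] dK(4-14) dk'(2)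
  have [simp]: "Cod C k' = obj K (- 1)" "Dom C k' \<in> Ob C" using dk'(3) by (simp_all add: Dom_Ob)
  have dk0: "dif K (- 1) \<cdot> k' = Zro C (Dom C k') (obj K 0)" using dk'(4) by simp
  \<comment> \<open>Coboundaries are realised as the coimage of the differential; the comparison
    arrow \<mu> embeds them into the cocycles.\<close>
  obtain \<gamma> where \<gamma>: "is_cokernel C k' \<gamma>" using has_cokernels[of k'] by auto
  have [simp]: "\<gamma> \<in> Ar C" "Dom C \<gamma> = obj K (- 1)" using is_cokernelD(2,3)[OF \<gamma>] by simp_all
  have [simp]: "Cod C \<gamma> \<in> Ob C" by (simp add: Cod_Ob)
  have \<gamma>k': "\<gamma> \<cdot> k' = Zro C (Dom C k') (Cod C \<gamma>)" using is_cokernelD(4)[OF \<gamma>] .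
  have "k \<cdot> (e \<cdot> k') = k \<cdot> Zro C (Dom C k') (Dom C k)" using dK(3)[THEN Cmp_assoc_eq, of k'] dk0 by (simp add: cat_simps)
  then have ek': "e \<cdot> k' = Zro C (Dom C k') (Dom C k)"
    by (rule kernel_mono[OF dK(1), rotated -1, where W = "Dom C k'"]) (simp_all add: HomsI cat_simps)
  then obtain \<mu> where \<mu>: "\<mu> \<in> Homs C (Cod C \<gamma>) (Dom C k)" "\<mu> \<cdot> \<gamma> = e"
    using cokernel_extend[OF \<gamma>, of e "Dom C k"] by (auto simp: HomsI)
  note [simp] = HomsD[OF \<mu>(1)]
  have kg: "is_kernel C \<gamma> k'"
  proof (rule is_kernelI)
    show "\<exists>u\<in>Homs C W (Dom C k'). k' \<cdot> u = t" if t: "t \<in> Homs C W (Dom C \<gamma>)" "\<gamma> \<cdot> t = Zro C W (Cod C \<gamma>)" for W t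
    proof -
      note [simp] = HomsD[OF t(1)]
      have [simp]: "W \<in> Ob C" using Homs_Ob[OF t(1)] by simp
      have "k \<cdot> (\<mu> \<cdot> (\<gamma> \<cdot> t)) = dif K (- 1) \<cdot> t" using \<mu>(2)[THEN Cmp_assoc_eq, of t] dK(3)[THEN Cmp_assoc_eq, of t] by (simp add: cat_simps)
      then have "dif K (- 1) \<cdot> t = Zro C W (obj K 0)" unfolding t(2) by (simp add: cat_simps)
      then show ?thesis using kernel_lift[OF k', of t W] t(1) by simp
    qed
    show "u = v" if "u \<in> Homs C W (Dom C k')" "v \<in> Homs C W (Dom C k')" "k' \<cdot> u = k' \<cdot> v" for W u v
      using kernel_mono[OF k' that] .
  qed (simp_all add: \<gamma>k')
  obtain \<sigma> where \<sigma>: "\<sigma> \<in> Homs C (Cod C \<gamma>) (obj K (- 1))" "\<gamma> \<cdot> \<sigma> = Idn C (Cod C \<gamma>)"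
    using short_exact_splits[OF kg \<gamma>] by auto
  note [simp] = HomsD[OF \<sigma>(1)]
  \<comment> \<open>The section \<sigma> lifts a difference killed by \<mu> to a cocycle in degree
    -1, which \<gamma> annihilates.\<close>
  have "is_mono C \<mu>"
    unfolding is_mono_def
  proof (intro conjI allI ballI impI)
    fix W s t assume st: "s \<in> Homs C W (Dom C \<mu>)" "t \<in> Homs C W (Dom C \<mu>)" and eq: "\<mu> \<cdot> s = \<mu> \<cdot> t"
    note [simp] = HomsD[OF st(1)] HomsD[OF st(2)]
    have [simp]: "W \<in> Ob C" using Homs_Ob[OF st(1)] by simp
    define x where "x = s \<boxplus> neg_arrow C t"
    have x [simp]: "x \<in> Ar C" "Dom C x = W" "Cod C x = Cod C \<gamma>" unfolding x_def by (simp_all add: cat_simps)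
    have mx: "\<mu> \<cdot> x = Zro C W (Dom C k)" unfolding x_def using eq Pls_neg(1)[of "\<mu> \<cdot> t" W "Dom C k"] by (simp add: cat_simps HomsI)
    have "dif K (- 1) \<cdot> (\<sigma> \<cdot> x) = k \<cdot> (\<mu> \<cdot> (\<gamma> \<cdot> (\<sigma> \<cdot> x)))"
      using \<mu>(2)[THEN Cmp_assoc_eq, of "\<sigma> \<cdot> x"] dK(3)[THEN Cmp_assoc_eq, of "\<sigma> \<cdot> x"] by (simp add: cat_simps)
    also have "\<gamma> \<cdot> (\<sigma> \<cdot> x) = x" using \<sigma>(2)[THEN Cmp_assoc_eq, of x] by (simp add: cat_simps)
    finally have "dif K (- 1) \<cdot> (\<sigma> \<cdot> x) = Zro C W (obj K 0)" unfolding mx by (simp add: cat_simps)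
    then obtain y where y: "y \<in> Homs C W (Dom C k')" "k' \<cdot> y = \<sigma> \<cdot> x"
      using kernel_lift[OF k', of "\<sigma> \<cdot> x" W] by (auto simp: HomsI cat_simps)
    note [simp] = HomsD[OF y(1)]
    have "x = \<gamma> \<cdot> (\<sigma> \<cdot> x)" using \<sigma>(2)[THEN Cmp_assoc_eq, of x] by (simp add: cat_simps)
    also have "\<dots> = Zro C W (Cod C \<gamma>)" unfolding y(2)[symmetric] using \<gamma>k'[THEN Cmp_assoc_eq, of y] by (simp add: cat_simps)
    finally show "s = t" unfolding x_def using minus_zero_eq[of s W "Cod C \<gamma>" t] st by simp
  qed simp
  then obtain g where g: "is_kernel C g \<mu>" using mono_is_kernel by blast
  note dg = is_kernelD(1-4)[OF g]
  have [simp]: "g \<in> Ar C" "Dom C g = Dom C k" using dg(1,3) by simp_all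
  have [simp]: "Cod C g \<in> Ob C" by (simp add: Cod_Ob)
  have "g \<cdot> e = Zro C (obj K (- 1)) (Cod C g)" using dg(4)[THEN Cmp_assoc_eq, of \<gamma>] \<mu>(2) by (simp add: cat_simps)
  then obtain g' where g': "g' \<in> Homs C (Cod C c) (Cod C g)" "g' \<cdot> c = g" using cokernel_extend[OF dK(2), of g "Cod C g"] by (auto simp: HomsI)
  note [simp] = HomsD[OF g'(1)]
  have "c \<cdot> \<mu> \<cdot> \<gamma> = Zro C (Cod C \<gamma>) (Cod C c) \<cdot> \<gamma>" using dK(12) \<mu>(2) by (simp add: cat_simps)
  then have c\<mu>: "c \<cdot> \<mu> = Zro C (Cod C \<gamma>) (Cod C c)"
    by (rule cokernel_epi[OF \<gamma>, rotated -1, where W = "Cod C c"]) (simp_all add: HomsI cat_simps)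
  have "is_kernel C c \<mu>"
  proof (rule is_kernelI)
    show "\<exists>u\<in>Homs C W (Dom C \<mu>). \<mu> \<cdot> u = t" if t: "t \<in> Homs C W (Dom C c)" "c \<cdot> t = Zro C W (Cod C c)" for W t
    proof -
      note [simp] = HomsD[OF t(1)]
      have "g \<cdot> t = Zro C W (Cod C g)" using g'(2)[THEN Cmp_assoc_eq, of t] t(2) Homs_Ob[OF t(1)] by (simp add: cat_simps)
      then show ?thesis using kernel_lift[OF g, of t W] t(1) by simp
    qed
    show "u = v" if "u \<in> Homs C W (Dom C \<mu>)" "v \<in> Homs C W (Dom C \<mu>)" "\<mu> \<cdot> u = \<mu> \<cdot> v" for W u v
      using kernel_mono[OF g that] .
  qed (simp_all add: c\<mu>)
  moreover have "is_cokernel C \<mu> c"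
  proof (rule is_cokernelI)
    show "\<exists>u\<in>Homs C (Cod C c) W. u \<cdot> c = t" if t: "t \<in> Homs C (Cod C \<mu>) W" "t \<cdot> \<mu> = Zro C (Dom C \<mu>) W" for W t
    proof -
      note [simp] = HomsD[OF t(1)]
      have "t \<cdot> e = Zro C (obj K (- 1)) W" using t(2)[THEN Cmp_assoc_eq, of \<gamma>] \<mu>(2) Homs_Ob[OF t(1)] by (simp add: cat_simps)
      then show ?thesis using cokernel_extend[OF dK(2), of t W] t(1) by simp
    qed
    show "u = v" if "u \<in> Homs C (Cod C c) W" "v \<in> Homs C (Cod C c) W" "u \<cdot> c = v \<cdot> c" for W u v
      using cokernel_epi[OF dK(2) that] .
  qed (simp_all add: c\<mu>)
  ultimately show ?thesis using short_exact_biproduct[OF kg \<gamma>] short_exact_biproduct[of c \<mu>] by auto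
qed

lemma euler_cohomology:
  assumes K: "is_complex C K" "almost_all_zero C K" and H: "\<And>n. is_cohomology0 C (shift_cpx n K) (H n)"
  shows "finite {n. \<not> is_zero_object C (H n)}" "euler_class C (obj K) = euler_class C H"
proof -
  have cS: "is_complex C (shift_cpx n K)" for n by (rule shift_cpx_complex[OF K(1)])
  have "\<forall>n. \<exists>k e c. cohomology_data (shift_cpx n K) k e c \<and> Cod C c = H n" using H unfolding is_cohomology0_iff by blast
  from this[unfolded choice_iff] obtain k e c where d: "\<And>n. cohomology_data (shift_cpx n K) (k n) (e n) (c n)" "\<And>n. Cod C (c n) = H n" by blast
  have "is_kernel C (dif (shift_cpx n K) (- 1)) (k (n - 1))" for n
    using cohomology_dataD(1)[OF cS d(1), of "n - 1"] by simp
  from cohomology_biproducts[OF cS d(1) this] have "\<forall>n. \<exists>I. is_biproduct C (Dom C (k (n - 1))) I (obj K (n - 1)) \<and> is_biproduct C I (H n) (Dom C (k n))"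
    unfolding d(2) by simp
  from this[unfolded choice_iff] obtain I where I: "\<And>n. is_biproduct C (Dom C (k (n - 1))) (I n) (obj K (n - 1))" "\<And>n. is_biproduct C (I n) (H n) (Dom C (k n))" by blast
  have I': "is_biproduct C (Dom C (k n)) (I (n + 1)) (obj K n)" for n using I(1)[of "n + 1"] by simp
  have zero: "is_zero_object C (I (n + 1))" "is_zero_object C (I n)" "is_zero_object C (H n)" if "is_zero_object C (obj K n)" for n
    using biproduct_zero_summands[OF I' that] biproduct_zero_summands[OF I(2)[of n]] by blast+
  obtain b m where bm: "\<And>i. i < b \<or> b + int m < i \<Longrightarrow> is_zero_object C (obj K i)" by (rule almost_all_zero_interval[OF K(2)]) blast
  define J where "J = {b..b + int m}"
  have J: "finite J" "i \<notin> J \<Longrightarrow> is_zero_object C (obj K i)" "i \<notin> J \<Longrightarrow> is_zero_object C (H i)" for i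
    using bm[of i] zero(3)[of i] unfolding J_def by auto
  have "{n. \<not> is_zero_object C (H n)} \<subseteq> J" using J(3) by blast
  then show "finite {n. \<not> is_zero_object C (H n)}" using J(1) finite_subset by blast
  have O: "obj K i \<in> Ob C" "H i \<in> Ob C" for i using I(2)[of i] is_complexD(1)[OF K(1)] unfolding is_biproduct_def by auto
  \<comment> \<open>Adding the two decompositions leaves the coboundaries of two adjacent degrees,
    and their alternating sum telescopes to zero objects at the ends.\<close>
  have 1: "add.fr (obj K n) - add.fr (H n) - (add.fr (I n) + add.fr (I (n + 1))) \<in> add.N" for n
    using add.N_add[OF fr_biproduct[OF I'] fr_biproduct[OF I(2)], of n n] by (simp add: algebra_simps)
  have "(\<Sum>n\<in>J. alt n (add.fr (obj K n) - add.fr (H n) - (add.fr (I n) + add.fr (I (n + 1))))) \<in> add.N"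
    by (rule add.N_sum, rule N_alt, rule 1)
  moreover have "(\<Sum>n\<in>J. alt n (add.fr (I n) + add.fr (I (n + 1)))) \<in> add.N"
    unfolding J_def sum_alt_telescope[where x = "\<lambda>n. add.fr (I n)"]
    using zero(1)[OF bm[of "b - 1"]] zero(2)[OF bm[of "b + int m + 1"]]
    by (intro add.N_add N_alt fr_zero) simp_all
  ultimately have "(\<Sum>n\<in>J. alt n (add.fr (obj K n))) - (\<Sum>n\<in>J. alt n (add.fr (H n))) \<in> add.N"
    using add.N_add by (fastforce simp: alt_diff sum_subtractf)
  moreover have "(\<Sum>n\<in>J. alt n (add.fr (obj K n))) \<in> carrier add.Fr" "(\<Sum>n\<in>J. alt n (add.fr (H n))) \<in> carrier add.Fr"
    by (rule add.sum_closed, rule alt_fr_closed, rule O)+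
  ultimately show "euler_class C (obj K) = euler_class C H"
    using euler_class_coset[OF O(1) J(1,2)] euler_class_coset[OF O(2) J(1,3)] add.coset_eq_iff by simp
qed

text \<open>Needed because the homological index of \<open>HF\<close> is the negative of the
  cohomological degree; the sign depends only on parity, which the reflection preserves.\<close>

lemma euler_class_reflect:
  assumes X: "\<And>i. X i \<in> Ob C" "finite {i. \<not> is_zero_object C (X i)}" and Y: "\<And>i. Y i \<in> Ob C" "\<And>i. isomorphic C (X i) (Y (- i))"
  shows "finite {i. \<not> is_zero_object C (Y i)}" "euler_class C X = euler_class C Y"
proof -
  define I where "I = {i. \<not> is_zero_object C (X i)}"
  have z: "is_zero_object C (Y i)" if "i \<notin> uminus ` I" for i
  proof -
    have "- i \<notin> I" using that by (metis image_eqI minus_minus)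
    then show ?thesis using zero_object_iso[of "X (- i)" "Y i"] Y(2)[of "- i"] unfolding I_def by auto
  qed
  have I: "finite I" "finite (uminus ` I)" using X(2) unfolding I_def by auto
  then show "finite {i. \<not> is_zero_object C (Y i)}" by (rule_tac finite_subset[OF _ I(2)]) (use z in auto)
  have zX: "i \<notin> I \<Longrightarrow> is_zero_object C (X i)" for i unfolding I_def by blast
  have "(\<Sum>i\<in>uminus ` I. alt i (add.fr (Y i))) = (\<Sum>i\<in>I. alt i (add.fr (X i)))"
    by (subst sum.reindex) (auto simp: inj_on_def alt_shift fr_iso[OF Y(2)])
  then show "euler_class C X = euler_class C Y"
    using euler_class_coset[OF X(1) I(1) zX] euler_class_coset[OF Y(1) I(2) z] by simp
qed

end

section \<open>Invariance of cohomology, complexes in one degree, and the functors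
  \<open>HF\<close>\<close>

lemma shift_cpx_0 [simp]: "shift_cpx 0 K = (K :: ('o, 'm) cpx)"
  by (simp add: shift_cpx_def)

lemma shift_cpx_add: "shift_cpx i (shift_cpx j K) = shift_cpx (i + j) (K :: ('o, 'm) cpx)"
  by (simp add: shift_cpx_def add.assoc)

context preadditive_category
begin

lemma full_sub_split_extension:
  assumes S: "S \<subseteq> Ob C" and E: "split_extension C X Y Z i p j q \<delta>"
    and O: "\<And>n. obj X n \<in> S" "\<And>n. obj Y n \<in> S" "\<And>n. obj Z n \<in> S"
  shows "split_extension (full_sub C S) X Y Z i p j q \<delta>"
  using E O unfolding split_extension_def full_sub_complex[OF S] by (auto simp: full_sub_Homs)

text \<open>The cokernel arrow may be followed by any isomorphism. Hence statements about cohomology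
  up to isomorphism become statements about \<open>is_cohomology0\<close>.\<close>

lemma cohomology_isomorphic:
  assumes K: "is_complex C K" "is_cohomology0 C K H" and "isomorphic C H H'"
  shows "is_cohomology0 C K H'"
proof -
  obtain k e c where d: "cohomology_data K k e c" "Cod C c = H" using K(2) unfolding is_cohomology0_iff by blast
  note dK = cohomology_dataD[OF K(1) d(1)]
  obtain f g where f: "f \<in> Homs C H H'" "g \<in> Homs C H' H" "g \<cdot> f = Idn C H" "f \<cdot> g = Idn C H'"
    using assms(3) isomorphicE by blast
  note [simp] = is_complexD[OF K(1)] dK(4-14) d(2) HomsD[OF f(1)] HomsD[OF f(2)]
  have [simp]: "H \<in> Ob C" "H' \<in> Ob C" using Homs_Ob[OF f(1)] by auto
  have "is_cokernel C e (f \<cdot> c)"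
  proof (rule is_cokernelI)
    show "f \<cdot> c \<cdot> e = Zro C (Dom C e) (Cod C (f \<cdot> c))" using dK(12) by (simp add: cat_simps)
    fix W
    show "\<exists>u\<in>Homs C (Cod C (f \<cdot> c)) W. u \<cdot> (f \<cdot> c) = t" if t: "t \<in> Homs C (Cod C e) W" "t \<cdot> e = Zro C (Dom C e) W" for t
    proof -
      obtain u where u: "u \<in> Homs C H W" "u \<cdot> c = t" using cokernel_extend[OF dK(2) t] d(2) by auto
      note [simp] = HomsD[OF u(1)]
      have "u \<cdot> g \<cdot> (f \<cdot> c) = t" using f(3)[THEN Cmp_assoc_eq, of c] u(2) by (simp add: cat_simps)
      then show ?thesis by (intro bexI[of _ "u \<cdot> g"]) (simp_all add: HomsI cat_simps)
    qed
    show "u = v" if "u \<in> Homs C (Cod C (f \<cdot> c)) W" "v \<in> Homs C (Cod C (f \<cdot> c)) W" "u \<cdot> (f \<cdot> c) = v \<cdot> (f \<cdot> c)" for u v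
    proof -
      have uv: "u \<in> Homs C H' W" "v \<in> Homs C H' W" using that by (simp_all add: cat_simps)
      note [simp] = HomsD[OF uv(1)] HomsD[OF uv(2)]
      have "u \<cdot> f \<cdot> c = v \<cdot> f \<cdot> c" using that(3) by (simp add: cat_simps)
      then have "u \<cdot> f = v \<cdot> f" by (rule cokernel_epi[OF dK(2), rotated -1, where W = W]) (simp_all add: HomsI cat_simps)
      then have "u \<cdot> f \<cdot> g = v \<cdot> f \<cdot> g" by simp
      then show ?thesis using f(4) by (simp add: cat_simps)
    qed
  qed (simp_all add: cat_simps)
  then have "cohomology_data K k e (f \<cdot> c)" using d(1) unfolding cohomology_data_def by blast
  then show ?thesis unfolding is_cohomology0_iff by (intro exI[of _ k] exI[of _ e] exI[of _ "f \<cdot> c"]) (simp add: cat_simps)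
qed

lemma cohomology_single:
  assumes K: "is_complex C K" and z: "is_zero_object C (obj K 1)" "is_zero_object C (obj K (- 1))"
  shows "is_cohomology0 C K (obj K 0)"
proof -
  note [simp] = is_complexD[OF K]
  have zz: "dif K 0 = Zro C (obj K 0) (obj K 1)" "dif K (- 1) = Zro C (obj K (- 1)) (obj K 0)"
    using zero_object_arrow(2)[OF z(1), of "dif K 0" "obj K 0"] zero_object_arrow(1)[OF z(2), of "dif K (- 1)"] by (simp_all add: HomsI)
  have "is_kernel C (dif K 0) (Idn C (obj K 0))"
    by (rule is_kernelI) (auto simp: zz cat_simps Homs_def)
  moreover have "is_cokernel C (dif K (- 1)) (Idn C (obj K 0))"
    by (rule is_cokernelI) (auto simp: zz cat_simps Homs_def)
  ultimately have "cohomology_data K (Idn C (obj K 0)) (dif K (- 1)) (Idn C (obj K 0))"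
    unfolding cohomology_data_def by (simp add: cat_simps HomsI)
  then show ?thesis unfolding is_cohomology0_iff by (intro exI conjI) (auto simp: cat_simps)
qed

lemma chain_isomorphism_homotopy_equivalent:
  assumes K: "is_complex C K" and L: "is_complex C L" and f: "is_chain_map C K L f" and iso: "\<And>n. is_iso_arrow C (f n)"
  shows "homotopy_equivalent C K L"
proof -
  note [simp] = chain_mapD[OF f]
  have "\<forall>n. \<exists>g. g \<in> Homs C (obj L n) (obj K n) \<and> g \<cdot> f n = Idn C (obj K n) \<and> f n \<cdot> g = Idn C (obj L n)"
    using iso unfolding is_iso_arrow_def by fastforce
  from this[unfolded choice_iff] obtain g where g: "\<And>n. g n \<in> Homs C (obj L n) (obj K n)"
    "\<And>n. g n \<cdot> f n = Idn C (obj K n)" "\<And>n. f n \<cdot> g n = Idn C (obj L n)" by blast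
  show ?thesis
    unfolding homotopy_equivalent_def
    using K L f chain_map_inverse[OF K L f g] g chain_homotopic_refl[OF K K chain_map_id[OF K]] chain_homotopic_refl[OF L L chain_map_id[OF L]]
    by (intro conjI exI[of _ f] exI[of _ g]) simp_all
qed

text \<open>Every square has a zero object at one end or the other, so any choice of termwise
  isomorphisms is a chain map.\<close>

lemma concentrated_homotopy_equivalent:
  assumes K: "is_complex C K" and L: "is_complex C L"
    and z: "\<And>i. i \<noteq> d \<Longrightarrow> is_zero_object C (obj K i)" "\<And>i. i \<noteq> d \<Longrightarrow> is_zero_object C (obj L i)"
    and iso: "isomorphic C (obj K d) (obj L d)"
  shows "homotopy_equivalent C K L"
proof -
  note [simp] = is_complexD[OF K] is_complexD[OF L]
  have "isomorphic C (obj K n) (obj L n)" for n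
    using iso zero_object_isomorphic[OF z] by (cases "n = d") auto
  then have "\<forall>n. \<exists>f \<in> Homs C (obj K n) (obj L n). is_iso_arrow C f" unfolding isomorphic_def by blast
  then obtain f where f: "\<And>n. f n \<in> Homs C (obj K n) (obj L n)" "\<And>n. is_iso_arrow C (f n)" by metis
  note [simp] = HomsD[OF f(1)]
  have "is_chain_map C K L f"
  proof (rule chain_mapI[OF f(1)])
    fix m
    have h: "f m \<cdot> dif K (m - 1) \<in> Homs C (obj K (m - 1)) (obj L m)" "dif L (m - 1) \<cdot> f (m - 1) \<in> Homs C (obj K (m - 1)) (obj L m)"
      by (simp_all add: HomsI cat_simps)
    have "is_zero_object C (obj K (m - 1)) \<or> is_zero_object C (obj L m)" using z[of m] z[of "m - 1"] by (cases "m = d") auto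
    then show "f m \<cdot> dif K (m - 1) = dif L (m - 1) \<cdot> f (m - 1)"
      using zero_object_arrow(1)[OF _ h(1)] zero_object_arrow(1)[OF _ h(2)] zero_object_arrow(2)[OF _ h(1)] zero_object_arrow(2)[OF _ h(2)] by auto
  qed
  then show ?thesis using f(2) by (rule chain_isomorphism_homotopy_equivalent[OF K L])
qed

text \<open>The filler \<open>Z\<close> is a parameter so that a zero object lying in
  \<open>B\<close> can be used.\<close>

definition single_cpx :: "int \<Rightarrow> 'o \<Rightarrow> 'o \<Rightarrow> ('o, 'm) cpx" where
  "single_cpx d X Z = \<lparr>obj = (\<lambda>n. if n = d then X else Z), dif = (\<lambda>n. Zro C (if n = d then X else Z) (if n + 1 = d then X else Z))\<rparr>"

lemma single_cpx_complex: "X \<in> Ob C \<Longrightarrow> Z \<in> Ob C \<Longrightarrow> is_complex C (single_cpx d X Z)"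
  by (rule is_complexI) (auto simp: single_cpx_def cat_simps Zro_in)

lemma euler_class_single:
  assumes "\<And>i. X i \<in> Ob C" "\<And>i. i \<noteq> d \<Longrightarrow> is_zero_object C (X i)"
  shows "euler_class C X = signed_class C d (X d)"
  using euler_class_coset[OF assms(1), of "{d}"] assms(2) signed_class_coset[OF assms(1)[of d]] by simp

end

context abelian_category
begin

lemma cohomology_transfer:
  assumes "homotopy_equivalent C K L" "is_cohomology0 C K H"
  shows "is_cohomology0 C L H"
proof -
  have L: "is_complex C L" using assms(1) unfolding homotopy_equivalent_def by blast
  obtain H' where H': "is_cohomology0 C L H'" using cohomology_exists[OF L] by blast
  show ?thesis using cohomology_isomorphic[OF L H' isomorphic_sym[OF cohomology_homotopy_equivalent[OF assms H']]] .
qed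

end

context weight_structure
begin

lemma represents_weight_complex:
  assumes "is_weight_complex C w M K"
  shows "represents_t C w (w_eq C w 0) M K"
  using assms weight_complex_in_heart homotopy_equivalent_refl[OF weight_complex_is_complex] represents_t_iff[OF order_refl] by blast

end

lemma (in weight_structure) represents_single:
  assumes B: "B \<subseteq> w_eq C w 0" and X: "X \<in> B" and Z: "is_zero_object C Z" "Z \<in> B"
  shows "represents_t C w B X (single_cpx 0 X Z)"
proof -
  have X0: "X \<in> w_eq C w 0" using X B by blast
  obtain K where K: "is_weight_complex C w X K" "obj K 0 = X" "\<And>i. i \<noteq> 0 \<Longrightarrow> is_zero_object C (obj K i)"
    using weight_complex_pure[OF X0] ShO_0[OF w_eq_Ob[OF X0]] by auto
  have "homotopy_equivalent C K (single_cpx 0 X Z)"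
    by (rule concentrated_homotopy_equivalent[OF weight_complex_is_complex[OF K(1)] single_cpx_complex, of X Z 0 0])
      (use K Z X0 w_eq_Ob isomorphic_refl zero_object_iff in \<open>auto simp: single_cpx_def\<close>)
  then show ?thesis using K(1) X Z(2) represents_t_iff[OF B] by (auto simp: single_cpx_def)
qed

context weight_K0
begin

lemma cone_C':
  assumes "is_cone (full_tri C C') h Z"
  obtains g k where "dist_tri (full_tri C C') h g k" "dist_tri C h g k" "Cod C g = Z" "Z \<in> C'" "Dom C h \<in> C'" "Cod C h \<in> C'"
  using assms unfolding is_cone_def by auto

text \<open>Removes the choice hidden in \<open>HF\<close>: it is the cohomology in degree
  \<open>- i\<close> of the image of any representing complex, because cohomology transfers along
  homotopy equivalences.\<close>

lemma HF_cohomology: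
  assumes A: "abelian_category A" and L: "represents_t C w B M L"
  shows "is_cohomology0 A (shift_cpx (- i) (map_cpx F L)) (HF C w B A F i M)"
proof -
  interpret A': abelian_category A by (rule A)
  have L': "represents_t C w B (ShO C (- i) M) (shift_cpx (- i) L)" by (rule represents_shift[OF B L])
  then have "is_complex A (map_cpx F (shift_cpx (- i) L))" using F.map_complex unfolding represents_t_def by blast
  then obtain H where "is_cohomology0 A (map_cpx F (shift_cpx (- i) L)) H" using A'.cohomology_exists by blast
  then have "is_HF C w B A F (ShO C (- i) M) H" unfolding is_HF_def using L' by blast
  then have "is_HF C w B A F (ShO C (- i) M) (HF C w B A F i M)" unfolding HF_def by (rule someI)
  then obtain L'' where "represents_t C w B (ShO C (- i) M) L''" "is_cohomology0 A (map_cpx F L'') (HF C w B A F i M)"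
    unfolding is_HF_def by blast
  then show ?thesis using A'.cohomology_transfer image_homotopy_equivalent[OF _ L'] unfolding map_shift_cpx by blast
qed

lemma euler_cone:
  assumes "is_cone (full_tri C C') h Z" "euler Z = \<one>\<^bsub>K0_add A\<^esub>"
  shows "euler (Cod C h) = euler (Dom C h)"
proof -
  interpret K: comm_group "K0_add A" by (rule A.K0_add_comm_group)
  obtain g k where t: "dist_tri (full_tri C C') h g k" "Cod C g = Z" and O: "Dom C h \<in> C'" using cone_C'[OF assms(1)] by metis
  show ?thesis using euler_triangle[OF t(1)] euler_closed[OF O] assms(2) t(2) by simp
qed

lemma euler_B:
  assumes X: "X \<in> B"
  shows "euler X = K0_add_class A (FOb F X)"
proof -
  obtain Z where "is_zero_object (full_sub C B) Z" using B.has_zero by blast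
  then have Z: "is_zero_object C Z" "Z \<in> B" using full_sub_zero_object[OF B_sub] B_sub by auto
  let ?L = "single_cpx 0 X Z"
  have L: "obj ?L 0 = X" "\<And>i. i \<noteq> 0 \<Longrightarrow> obj ?L i = Z" by (simp_all add: single_cpx_def)
  have OB: "obj ?L i \<in> B" for i using X Z by (simp add: single_cpx_def)
  have r: "represents_t C w B X ?L" by (rule represents_single[OF B X Z(1,2)])
  have z: "is_zero_object A (obj (map_cpx F ?L) i)" if "i \<noteq> 0" for i
    using F.map_zero_object[of Z] Z L(2)[OF that] full_sub_zero_object[OF B_sub] by (simp add: map_cpx_def)
  then have "{i. \<not> is_zero_object A (obj (map_cpx F ?L) i)} \<subseteq> {0}" by blast
  then have "admissible X ?L" unfolding admissible_def almost_all_zero_def using r finite_subset by blast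
  moreover have "euler_class A (obj (map_cpx F ?L)) = signed_class A 0 (obj (map_cpx F ?L) 0)"
    by (rule A.euler_class_single) (use z F.FOb_in OB in \<open>auto simp: map_cpx_def\<close>)
  ultimately have "euler X = signed_class A 0 (FOb F X)" using euler_eq L(1) by (simp add: map_cpx_def)
  moreover have "K0_add_class A (FOb F X) \<in> carrier (K0_add A)"
    using A.K0_add_class_closed[of "FOb F X"] F.FOb_in[of X] X by simp
  ultimately show ?thesis unfolding signed_class_def
    using A.K0_add_comm_group group.int_pow_1[of "K0_add A"] unfolding comm_group_def by simp
qed

text \<open>If \<open>h\<close> starts at \<open>N'\<close>, the complex of \<open>N\<close> is an
  extension of that of the cone by one concentrated in degree 0; if \<open>h\<close> ends at
  \<open>N'\<close>, the rotated triangle exhibits it as an extension with the concentrated complex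
  as quotient.\<close>

lemma cohomology_acyclic_cone:
  assumes A: "abelian_category A" and Bw: "B = w_eq C w 0" and N': "N' \<in> w_eq C w 0"
    and h: "h \<in> Homs C N' N \<union> Homs C N N'" and t: "dist_tri C h g k"
    and z: "is_zero_object A (HF C w B A F 0 (Cod C g))" "is_zero_object A (HF C w B A F 1 (Cod C g))"
  shows "isomorphic A (FOb F N') (HF C w B A F 0 N)"
proof -
  interpret A': abelian_category A by (rule A)
  let ?Z = "Cod C g"
  note [simp] = triD[OF t]
  have Z: "?Z \<in> Ob C" by (simp add: Cod_Ob)
  obtain KZ where KZ: "is_weight_complex C w ?Z KZ" using weight_complex_exists[OF Z] by blast
  have rep: "represents_t C w B M K" if "is_weight_complex C w M K" for M K
    using represents_weight_complex[OF that] Bw by simp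
  have H0: "is_cohomology0 A (map_cpx F KZ) (HF C w B A F 0 ?Z)" and H1: "is_cohomology0 A (shift_cpx (- 1) (map_cpx F KZ)) (HF C w B A F 1 ?Z)"
    using HF_cohomology[OF A rep[OF KZ], of 0] HF_cohomology[OF A rep[OF KZ], of 1] by simp_all
  obtain K where K: "is_weight_complex C w N' K" "obj K 0 = N'" "\<And>i. i \<noteq> 0 \<Longrightarrow> is_zero_object C (obj K i)"
    using weight_complex_pure[OF N'] ShO_0[OF w_eq_Ob[OF N']] by auto
  have OB: "obj L i \<in> B" if "is_weight_complex C w M L" for M L i using weight_complex_in_heart[OF that] Bw by simp
  have zK: "is_zero_object A (obj (map_cpx F K) i)" if "i \<noteq> 0" for i
    using F.map_zero_object[of "obj K i"] K(3)[OF that] OB[OF K(1), of i] full_sub_zero_object[OF B_sub] by (simp add: map_cpx_def)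
  have "\<exists>KY. is_weight_complex C w N KY \<and> is_cohomology0 A (map_cpx F KY) (FOb F N')"
  proof (cases "h \<in> Homs C N' N")
    case True
    then have O: "Dom C h = N'" "Cod C h = N" by (simp_all add: Homs_def)
    obtain KY i p j q \<delta> where KY: "is_weight_complex C w N KY" and E: "split_extension C K KY KZ i p j q \<delta>"
      using weight_complex_extension[OF t, of K KZ] K(1) KZ unfolding O by blast
    note E' = F.map_split_extension[OF full_sub_split_extension[OF B_sub E OB[OF K(1)] OB[OF KY] OB[OF KZ]]]
    have "is_cohomology0 A (map_cpx F KY) (obj (map_cpx F K) 0)"
      using A'.cohomology_extension_sub[OF E' zK zK H0 z(1) H1 z(2)] by simp
    then show ?thesis using KY K(2) by (auto simp: map_cpx_def)
  next
    case False
    then have O: "Dom C h = N" "Cod C h = N'" using False h by (auto simp: Homs_def)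
    have O': "Cod C (neg_arrow C (ShA C (- 1) k)) = N" "Dom C (neg_arrow C (ShA C (- 1) k)) = ShO C (- 1) ?Z"
      using O Dom_Ob[of h] by (simp_all add: tcat_simps)
    note KZ1 = weight_complex_shift[OF KZ, of "- 1"]
    obtain KY i p j q \<delta> where KY: "is_weight_complex C w N KY" and E: "split_extension C (shift_cpx (- 1) KZ) KY K i p j q \<delta>"
      using weight_complex_extension[OF rotate_back[OF t], of "shift_cpx (- 1) KZ" K] K(1) KZ1 unfolding O O' by blast
    note E' = F.map_split_extension[OF full_sub_split_extension[OF B_sub E OB[OF KZ1] OB[OF KY] OB[OF K(1)]], unfolded map_shift_cpx]
    \<comment> \<open>The desuspended cone has its complex moved by one degree, so the two vanishing
      assumptions exchange their roles.\<close>
    have "is_cohomology0 A (shift_cpx 1 (shift_cpx (- 1) (map_cpx F KZ))) (HF C w B A F 0 ?Z)" using H0 by (simp add: shift_cpx_add)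
    then have "is_cohomology0 A (map_cpx F KY) (obj (map_cpx F K) 0)"
      using A'.cohomology_extension_quotient[OF E' zK zK H1 z(2) _ z(1)] by simp
    then show ?thesis using KY K(2) by (auto simp: map_cpx_def)
  qed
  then obtain KY where KY: "is_weight_complex C w N KY" "is_cohomology0 A (map_cpx F KY) (FOb F N')" by blast
  have c: "is_complex A (map_cpx F KY)" using rep[OF KY(1)] F.map_complex unfolding represents_t_def by blast
  show ?thesis
    using A.cohomology_homotopy_equivalent[OF A.homotopy_equivalent_refl[OF c] KY(2)] HF_cohomology[OF A rep[OF KY(1)], of 0] by simp
qed

theorem FK0_cone:
  assumes Bw: "B = w_eq C w 0" and C'w: "w_eq C w 0 \<subseteq> C'" and A: "abelian_category A" and N': "N' \<in> w_eq C w 0"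
    and h: "h \<in> Homs (full_tri C C') N' N \<union> Homs (full_tri C C') N N'" and Z: "is_cone (full_tri C C') h Z"
    and one: "FK Z = \<one>\<^bsub>K0_add A\<^esub>"
  shows "FK N = K0_add_class A (FOb F N')"
    "is_zero_object A (HF C w B A F 0 Z) \<and> is_zero_object A (HF C w B A F 1 Z) \<Longrightarrow>
      FK N = K0_add_class A (HF C w B A F 0 N)"
proof -
  obtain g k where t: "dist_tri C h g k" "Cod C g = Z" "Z \<in> C'" using cone_C'[OF Z] by metis
  have h': "h \<in> Homs C N' N \<union> Homs C N N'" "N \<in> C'" using h by auto
  have "euler (Cod C h) = euler (Dom C h)" using euler_cone[OF Z] one FK0_class[OF t(3)] by simp
  then have "euler N = euler N'" using h' by (auto simp: Homs_def)
  then show 1: "FK N = K0_add_class A (FOb F N')"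
    using FK0_class[OF h'(2)] euler_B[of N'] N' Bw by simp
  assume "is_zero_object A (HF C w B A F 0 Z) \<and> is_zero_object A (HF C w B A F 1 Z)"
  then have "isomorphic A (FOb F N') (HF C w B A F 0 N)"
    using cohomology_acyclic_cone[OF A Bw N' h'(1) t(1)] t(2) by simp
  then show "FK N = K0_add_class A (HF C w B A F 0 N)"
    unfolding 1 by (rule A.K0_add_class_iso)
qed

theorem FK0_semisimple:
  assumes A: "semisimple_abelian_category A" and N: "N \<in> C'"
  shows "finite {i. \<not> is_zero_object A (HF C w B A F i N)}"
    "FK N = euler_class A (\<lambda>i. HF C w B A F i N)"
proof -
  interpret A': semisimple_abelian_category A by (rule A)
  have A'': "abelian_category A" by unfold_locales
  obtain L where L: "admissible N L" using admissible_exists[OF N] by blast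
  then have r: "represents_t C w B N L" and z: "almost_all_zero A (map_cpx F L)" unfolding admissible_def by blast+
  have c: "is_complex A (map_cpx F L)" using r F.map_complex unfolding represents_t_def by blast
  have H: "is_cohomology0 A (shift_cpx n (map_cpx F L)) (HF C w B A F (- n) N)" for n
    using HF_cohomology[OF A'' r, of "- n"] by simp
  have O: "HF C w B A F n N \<in> Ob A" for n
    using A.cohomology_Ob[OF shift_cpx_complex[OF c] H[of "- n"]] by simp
  note e = A'.euler_cohomology[OF c z H]
  have "isomorphic A (HF C w B A F (- i) N) (HF C w B A F (- i) N)" for i using A.isomorphic_refl[OF O] .
  note f = A'.euler_class_reflect[of "\<lambda>n. HF C w B A F (- n) N" "\<lambda>n. HF C w B A F n N", OF O e(1) O this]
  show "finite {i. \<not> is_zero_object A (HF C w B A F i N)}" by (rule f(1))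
  show "FK N = euler_class A (\<lambda>i. HF C w B A F i N)"
    unfolding FK0_class[OF N] euler_eq[OF L] e(2) f(2) ..
qed

end

section \<open>Strong generation\<close>

context weight_structure
begin

lemma full_tri_Ob: "full_tri C (Ob C) = C"
proof -
  have "{f \<in> Ar C. Dom C f \<in> Ob C \<and> Cod C f \<in> Ob C} = Ar C" using Dom_Ob Cod_Ob by blast
  moreover have "(\<lambda>f g h. dist_tri C f g h \<and> Dom C f \<in> Ob C \<and> Cod C f \<in> Ob C \<and> Cod C g \<in> Ob C) = dist_tri C"
    using triD Dom_Ob Cod_Ob by (intro ext) blast
  ultimately show ?thesis unfolding full_tri_def by simp
qed

lemma full_triangulated_Ob: "full_triangulated_subcategory C (Ob C)"
  unfolding full_triangulated_subcategory_def full_tri_Ob using triangulated_category_axioms by blast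

text \<open>\<open>full_tri\<close> and \<open>full_sub\<close> are records of different types with
  the same additive structure; these equivalences let the results on full subcategories be
  reused.\<close>

lemma full_tri_sub:
  "hom_group (full_tri C S) X Y = hom_group (full_sub C S) X Y"
  "preadditive_category (full_tri C S) \<longleftrightarrow> preadditive_category (full_sub C S)"
  "is_zero_object (full_tri C S) Z \<longleftrightarrow> is_zero_object (full_sub C S) Z"
  "is_biproduct (full_tri C S) X Y Z \<longleftrightarrow> is_biproduct (full_sub C S) X Y Z"
  "is_iso_arrow (full_tri C S) f \<longleftrightarrow> is_iso_arrow (full_sub C S) f"
proof -
  have H: "Homs (full_tri C S) X Y = Homs (full_sub C S) X Y" for X Y by auto
  show 1: "hom_group (full_tri C S) X Y = hom_group (full_sub C S) X Y" for X Y unfolding hom_group_def H by simp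
  show "preadditive_category (full_tri C S) \<longleftrightarrow> preadditive_category (full_sub C S)"
    unfolding preadditive_category_def 1 by simp
  show "is_zero_object (full_tri C S) Z \<longleftrightarrow> is_zero_object (full_sub C S) Z" unfolding is_zero_object_def H by simp
  show "is_biproduct (full_tri C S) X Y Z \<longleftrightarrow> is_biproduct (full_sub C S) X Y Z" unfolding is_biproduct_def H by simp
  show "is_iso_arrow (full_tri C S) f \<longleftrightarrow> is_iso_arrow (full_sub C S) f" unfolding is_iso_arrow_def H by simp
qed

text \<open>Closure under extensions and shifts gives closure under cones by rotation; all axioms
  that assert existence then stay inside \<open>S\<close>, and the others are inherited.\<close>

lemma strictly_full_triangulatedI:
  assumes sub: "S \<subseteq> Ob C" and zero: "\<exists>Z \<in> S. is_zero_object C Z"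
    and iso: "\<And>X Y. X \<in> S \<Longrightarrow> isomorphic C X Y \<Longrightarrow> Y \<in> S"
    and shift: "\<And>X i. X \<in> S \<Longrightarrow> ShO C i X \<in> S"
    and ext: "\<And>f g h. dist_tri C f g h \<Longrightarrow> Dom C f \<in> S \<Longrightarrow> Cod C g \<in> S \<Longrightarrow> Cod C f \<in> S"
  shows "strictly_full_triangulated_subcategory C S"
proof -
  let ?T = "full_tri C S"
  interpret S: preadditive_category "?T" unfolding full_tri_sub by (rule full_sub_preadditive[OF sub])
  have neg: "neg_arrow (?T) f = neg_arrow C f" if "f \<in> Ar (?T)" for f
    using that full_sub_hom_group[of "Dom C f" S "Cod C f"] unfolding neg_arrow_def full_tri_sub by simp
  have cone: "Cod C g \<in> S" if "dist_tri C f g h" "Dom C f \<in> S" "Cod C f \<in> S" for f g h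
    using ext[OF rotate[OF that(1)]] that(3) shift[OF that(2), of 1] triD[OF that(1)] by (simp add: tcat_simps)
  have "triangulated_category (?T)"
  proof unfold_locales
    show "\<exists>Z. is_zero_object (?T) Z" unfolding full_tri_sub using zero full_sub_zero_object[OF sub] by blast
    show "\<exists>B. is_biproduct (?T) X Y B" if "X \<in> Ob (?T)" "Y \<in> Ob (?T)" for X Y
    proof -
      have XY: "X \<in> S" "Y \<in> S" using that by simp_all
      then obtain B where B: "is_biproduct C X Y B" using has_biproducts sub by blast
      then obtain i q z where "dist_tri C i q z" "Dom C i = X" "Cod C i = B" "Cod C q = Y"
        using biproduct_tri[OF B] by blast
      then have "B \<in> S" using ext XY by blast
      then show ?thesis unfolding full_tri_sub using B XY full_sub_biproduct[OF sub] by blast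
    qed
    show "\<exists>g h. dist_tri (?T) f g h" if "f \<in> Ar (?T)" for f
    proof -
      have "f \<in> Ar C" using that by simp
      then obtain g h where "dist_tri C f g h" using TR1_cone by blast
      then show ?thesis using cone[of f g h] that by auto
    qed
    show "dist_tri (?T) f g h = dist_tri (?T) g h (neg_arrow (?T) (ShA (?T) 1 f))"
      if "f \<in> Homs (?T) X Y" "g \<in> Homs (?T) Y Z" "h \<in> Homs (?T) Z (ShO (?T) 1 X)" for f g h X Y Z
    proof -
      have "ShA C 1 f \<in> Ar (?T)" using that(1) shift by (auto simp: Homs_def tcat_simps)
      from neg[OF this] show ?thesis using that TR2[of f X Y g Z h] by (auto simp: Homs_def)
    qed
    show "\<exists>c\<in>Homs (?T) (Cod (?T) g) (Cod (?T) g').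
        c \<cdot>\<^bsub>?T\<^esub> g = g' \<cdot>\<^bsub>?T\<^esub> b \<and> h' \<cdot>\<^bsub>?T\<^esub> c = ShA (?T) 1 a \<cdot>\<^bsub>?T\<^esub> h"
      if "dist_tri (?T) f g h" "dist_tri (?T) f' g' h'"
        "a \<in> Homs (?T) (Dom (?T) f) (Dom (?T) f')"
        "b \<in> Homs (?T) (Cod (?T) f) (Cod (?T) f')"
        "b \<cdot>\<^bsub>?T\<^esub> f = f' \<cdot>\<^bsub>?T\<^esub> a" for f g h f' g' h' a b
      using that TR3[of f g h f' g' h' a b] by (simp add: Bex_def)
    show "\<exists>m\<in>Homs (?T) (Cod (?T) a) (Cod (?T) c).
       \<exists>n\<in>Homs (?T) (Cod (?T) c) (Cod (?T) b).
          dist_tri (?T) m n (ShA (?T) 1 a \<cdot>\<^bsub>?T\<^esub> b') \<and>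
          m \<cdot>\<^bsub>?T\<^esub> a = c \<cdot>\<^bsub>?T\<^esub> v \<and> c' \<cdot>\<^bsub>?T\<^esub> m = a' \<and>
          n \<cdot>\<^bsub>?T\<^esub> c = b \<and> b' \<cdot>\<^bsub>?T\<^esub> n = ShA (?T) 1 u \<cdot>\<^bsub>?T\<^esub> c'"
      if t: "u \<in> Homs (?T) X Y" "v \<in> Homs (?T) Y Z"
        "dist_tri (?T) u a a'" "dist_tri (?T) v b b'" "dist_tri (?T) (v \<cdot>\<^bsub>?T\<^esub> u) c c'"
      for u v a a' b b' c c' X Y Z
    proof -
      have O: "Cod C a \<in> S" "Cod C b \<in> S" "Cod C c \<in> S" using t by simp_all
      obtain m n where mn: "m \<in> Homs C (Cod C a) (Cod C c)" "n \<in> Homs C (Cod C c) (Cod C b)" "dist_tri C m n (ShA C 1 a \<cdot> b')"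
        and e: "m \<cdot> a = c \<cdot> v" "c' \<cdot> m = a'" "n \<cdot> c = b" "b' \<cdot> n = ShA C 1 u \<cdot> c'"
        using TR4[of u X Y v Z a a' b b' c c'] t by auto
      show ?thesis
        by (rule bexI[of _ m], rule bexI[of _ n]) (use mn e O in \<open>auto simp: Homs_def\<close>)
    qed
    show "dist_tri (?T) f' g' h'"
      if "dist_tri (?T) f g h" "a \<in> Homs (?T) (Dom (?T) f) X"
        "b \<in> Homs (?T) (Cod (?T) f) Y" "c \<in> Homs (?T) (Cod (?T) g) Z"
        "is_iso_arrow (?T) a" "is_iso_arrow (?T) b" "is_iso_arrow (?T) c"
        "f' \<in> Homs (?T) X Y" "g' \<in> Homs (?T) Y Z" "h' \<in> Homs (?T) Z (ShO (?T) 1 X)"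
        "f' \<cdot>\<^bsub>?T\<^esub> a = b \<cdot>\<^bsub>?T\<^esub> f" "g' \<cdot>\<^bsub>?T\<^esub> b = c \<cdot>\<^bsub>?T\<^esub> g"
        "h' \<cdot>\<^bsub>?T\<^esub> c = ShA (?T) 1 a \<cdot>\<^bsub>?T\<^esub> h" for f g h a b c X Y Z f' g' h'
    proof -
      have "dist_tri C f' g' h'"
        using TR1_iso[of f g h a X b Y c Z f' g' h'] that unfolding full_tri_sub full_sub_iso by simp
      then show ?thesis using that(8-10) by (auto simp: Homs_def)
    qed
  next
    fix X Z assume "X \<in> Ob (?T)" "is_zero_object (?T) Z"
    then have "X \<in> S" "is_zero_object C Z" "Z \<in> S" unfolding full_tri_sub full_sub_zero_object[OF sub] by simp_all
    moreover from this have "X \<in> Ob C" "Z \<in> Ob C" using sub by auto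
    ultimately show "dist_tri (?T) (Idn (?T) X) (Zro (?T) X Z) (Zro (?T) Z (ShO (?T) 1 X))"
      using TR1_id[of X Z] by (simp add: cat_simps)
  next
    fix f i assume "f \<in> Ar (?T)"
    then show "ShA (?T) 0 f = f" "\<And>j. ShA (?T) (i + j) f = ShA (?T) i (ShA (?T) j f)"
      by (simp_all add: ShA_0 ShA_add)
  next
    fix f g h assume t: "dist_tri (?T) f g h"
    then show "f \<in> Ar (?T) \<and> g \<in> Homs (?T) (Cod (?T) f) (Cod (?T) g) \<and>
      h \<in> Homs (?T) (Cod (?T) g) (ShO (?T) 1 (Dom (?T) f))"
      using tri_in[of f g h] shift by (simp add: Homs_def)
  qed (use sub shift in \<open>auto simp: ShO_in ShA_in ShA_Idn ShA_Cmp ShA_Pls ShO_0 ShO_add subset_iff\<close>)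
  then show ?thesis
    unfolding strictly_full_triangulated_subcategory_def full_triangulated_subcategory_def using sub iso by blast
qed

lemma strictly_full_triangulatedD:
  assumes "strictly_full_triangulated_subcategory C S"
  shows "S \<subseteq> Ob C" "\<And>X Y. X \<in> S \<Longrightarrow> isomorphic C X Y \<Longrightarrow> Y \<in> S" "\<And>X i. X \<in> S \<Longrightarrow> ShO C i X \<in> S"
    "\<And>Z. is_zero_object C Z \<Longrightarrow> Z \<in> S" "\<And>f g h. dist_tri C f g h \<Longrightarrow> Dom C f \<in> S \<Longrightarrow> Cod C g \<in> S \<Longrightarrow> Cod C f \<in> S"
proof -
  have sub: "S \<subseteq> Ob C" and T: "triangulated_category (full_tri C S)"
    and i: "\<And>X Y. X \<in> S \<Longrightarrow> Y \<in> Ob C \<Longrightarrow> isomorphic C X Y \<Longrightarrow> Y \<in> S"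
    using assms unfolding strictly_full_triangulated_subcategory_def full_triangulated_subcategory_def by blast+
  interpret T: triangulated_category "full_tri C S" by (rule T)
  show "S \<subseteq> Ob C" by (rule sub)
  show iso: "Y \<in> S" if "X \<in> S" "isomorphic C X Y" for X Y using i that isomorphic_Ob[OF that(2)] by blast
  show shift: "ShO C i X \<in> S" if "X \<in> S" for X i using T.ShO_in[of X i] that by simp
  obtain Z0 where "is_zero_object C Z0" "Z0 \<in> S" using T.has_zero unfolding full_tri_sub full_sub_zero_object[OF sub] by blast
  then show "Z \<in> S" if "is_zero_object C Z" for Z using iso zero_object_isomorphic that by blast
  show "Cod C f \<in> S" if t: "dist_tri C f g h" and O: "Dom C f \<in> S" "Cod C g \<in> S" for f g h
  proof -
    \<comment> \<open>The subcategory is closed under cones only up to the choice of a cone; the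
      middle vertex is one of the cones of this arrow, so it is isomorphic to the cone found inside
      \<open>S\<close>.\<close>
    let ?k = "neg_arrow C (ShA C (- 1) h)"
    note [simp] = triD[OF t]
    have [simp]: "Dom C f \<in> Ob C" "Cod C g \<in> Ob C" by (simp_all add: Dom_Ob Cod_Ob)
    have k: "?k \<in> Ar (full_tri C S)" using O shift by (simp add: tcat_simps)
    obtain u v where "dist_tri (full_tri C S) ?k u v" using T.TR1_cone[OF k] by blast
    then have u: "dist_tri C ?k u v" "Cod C u \<in> S" by simp_all
    obtain c where "c \<in> Homs C (Cod C u) (Cod C f)" "is_iso_arrow C c" using cone_unique[OF u(1) rotate_back[OF t]] by blast
    then show ?thesis using iso[OF u(2)] unfolding isomorphic_def by blast
  qed
qed

lemma strong_generation_induct: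
  assumes g: "strongly_generates C B" and B: "B \<subseteq> S" and sub: "S \<subseteq> Ob C" and zero: "\<exists>Z \<in> S. is_zero_object C Z"
    and iso: "\<And>X Y. X \<in> S \<Longrightarrow> isomorphic C X Y \<Longrightarrow> Y \<in> S"
    and shift: "\<And>X i. X \<in> S \<Longrightarrow> ShO C i X \<in> S"
    and ext: "\<And>f g h. dist_tri C f g h \<Longrightarrow> Dom C f \<in> S \<Longrightarrow> Cod C g \<in> S \<Longrightarrow> Cod C f \<in> S"
  shows "S = Ob C"
proof -
  have "strictly_full_triangulated_subcategory C S"
    apply (rule strictly_full_triangulatedI[OF sub zero])
      apply (erule iso, assumption)
     apply (erule shift)
    apply (erule ext, assumption+)
    done
  then show ?thesis using g B sub unfolding strongly_generates_def by blast
qed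

text \<open>Induction on the number of weights of an object: a weight decomposition just below the
  top weight splits off a piece of one weight, a shift of an object of the heart.\<close>

lemma bounded_strongly_generates:
  assumes b: "bounded_weight_structure C w"
  shows "strongly_generates C (w_eq C w 0)"
proof -
  have "M \<in> S" if S: "strictly_full_triangulated_subcategory C S" "w_eq C w 0 \<subseteq> S" and M: "M \<in> Ob C" for S M
  proof -
    note D = strictly_full_triangulatedD[OF S(1)]
    have eq: "X \<in> S" if "X \<in> w_eq C w n" for X n
    proof -
      have "ShO C (- n) X \<in> w_eq C w 0" using that w_eq_shift[OF w_eq_Ob[OF that], of "- n" 0] by simp
      then have "ShO C n (ShO C (- n) X) \<in> S" using D(3) S(2) by blast
      then show ?thesis using w_eq_Ob[OF that] by (simp add: tcat_simps)
    qed
    have "X \<in> S" if "X \<in> w_le C w (m + int k - 1)" "X \<in> w_ge C w m" for X m k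
      using that
    proof (induction k arbitrary: X)
      case 0
      \<comment> \<open>An empty range of weights makes the object orthogonal to itself.\<close>
      have "Idn C X = Zro C X X"
        by (rule w_orth[OF 0]) (use 0 w_le_Ob Idn_in in auto)
      then show ?case using D(4) w_le_Ob[OF 0(1)] by (simp add: zero_object_iff)
    next
      case (Suc k)
      have X: "X \<in> w_le C w (m + int k)" "X \<in> w_ge C w m" using Suc.prems by simp_all
      show ?case
      proof (cases k)
        case 0
        then show ?thesis using X eq[of X m] by (simp add: w_eq_iff)
      next
        case (Suc k')
        obtain a b' e where d: "wdec (m + int k - 1) X a b' e" using wdec_exists[OF w_le_Ob[OF X(1)]] by blast
        have B': "Cod C b' \<in> w_ge C w (m + int k)" using wdecD(4)[OF d] by simp
        have "Cod C b' \<in> w_ge C w (m + 1)" by (rule w_ge_mono[OF _ B']) (simp add: Suc)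
        then have "Dom C a \<in> w_ge C w m" using w_ge_fibre[OF wdecD(1)[OF d], of m] X(2) wdecD(3)[OF d] by simp
        then have 1: "Dom C a \<in> S" using Suc.IH wdecD(2)[OF d] by blast
        have "Cod C b' \<in> w_le C w (m + int k)" using w_le_cone[OF wdecD(1)[OF d], of "m + int k"] X(1) wdecD(2,3)[OF d] by simp
        then have "Cod C b' \<in> S" using B' eq[of "Cod C b'" "m + int k"] by (simp add: w_eq_iff)
        then show ?thesis using D(5)[OF wdecD(1)[OF d] 1] wdecD(3)[OF d] by simp
      qed
    qed
    moreover obtain i j where ij: "M \<in> w_le C w i" "M \<in> w_ge C w j" using b M unfolding bounded_weight_structure_def by blast
    have "M \<in> w_le C w (j + int (nat (i - j + 1)) - 1)" by (rule w_le_mono[OF _ ij(1)]) simp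
    ultimately show ?thesis using ij(2) by blast
  qed
  moreover have "strictly_full_triangulated_subcategory C (Ob C)"
    unfolding strictly_full_triangulated_subcategory_def using full_triangulated_Ob by blast
  ultimately show ?thesis unfolding strongly_generates_def using w_eq_sub by blast
qed

end

lemma map_cpx_id [simp]: "map_cpx id_functor K = (K :: ('o, 'm) cpx)"
  by (simp add: map_cpx_def id_functor_def)

lemma additive_functor_id: "additive_functor C C id_functor"
  by (simp add: additive_functor_def id_functor_def)

lemma almost_all_zero_shift:
  assumes "almost_all_zero C K"
  shows "almost_all_zero C (shift_cpx i K)"
proof -
  have "{n. \<not> is_zero_object C (obj (shift_cpx i K) n)} = (\<lambda>n. n - i) ` {n. \<not> is_zero_object C (obj K n)}"
    by (auto simp: image_iff) (metis add_diff_cancel_right')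
  then show ?thesis using assms unfolding almost_all_zero_def by simp
qed

context weight_structure
begin

text \<open>The objects represented by bounded complexes over \<open>B\<close> contain
  \<open>B\<close> and are closed under isomorphisms, shifts and extensions, so they are all
  objects.\<close>

lemma strongly_generated_finite:
  assumes B: "B \<subseteq> w_eq C w 0" and add: "additive_category (full_sub C B)" and g: "strongly_generates C B"
  shows "has_F_finite_complexes C w (Ob C) B (full_sub C B) id_functor"
proof -
  have sub: "B \<subseteq> Ob C" using B w_eq_sub by blast
  interpret B: additive_category "full_sub C B" by (rule add)
  define S where "S = {M \<in> Ob C. \<exists>L. represents_t C w B M L \<and> almost_all_zero (full_sub C B) L}"
  obtain Z where Z: "is_zero_object C Z" "Z \<in> B" using B.has_zero unfolding full_sub_zero_object[OF sub] by blast
  have BS: "X \<in> S" if X: "X \<in> B" for X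
  proof -
    have "{i. \<not> is_zero_object (full_sub C B) (obj (single_cpx 0 X Z) i)} \<subseteq> {0}"
      using Z unfolding full_sub_zero_object[OF sub] by (auto simp: single_cpx_def)
    then have "almost_all_zero (full_sub C B) (single_cpx 0 X Z)" unfolding almost_all_zero_def using finite_subset by blast
    then show ?thesis unfolding S_def using represents_single[OF B X Z] X sub by blast
  qed
  have "S = Ob C"
  proof (rule strong_generation_induct[OF g])
    show "B \<subseteq> S" using BS by blast
    show "S \<subseteq> Ob C" unfolding S_def by blast
    show "\<exists>Z\<in>S. is_zero_object C Z" using Z BS by blast
    show "Y \<in> S" if "X \<in> S" "isomorphic C X Y" for X Y
      using that represents_isomorphic[OF that(2)] isomorphic_Ob[OF that(2)] unfolding S_def by blast
    show "ShO C i X \<in> S" if "X \<in> S" for X i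
      using that represents_shift[OF B, of X _ i] almost_all_zero_shift[of "full_sub C B" _ i] ShO_in unfolding S_def by blast
    show "Cod C f \<in> S" if t: "dist_tri C f g h" and O: "Dom C f \<in> S" "Cod C g \<in> S" for f g h
    proof -
      obtain LX LZ where LX: "represents_t C w B (Dom C f) LX" "almost_all_zero (full_sub C B) LX"
        and LZ: "represents_t C w B (Cod C g) LZ" "almost_all_zero (full_sub C B) LZ" using O unfolding S_def by blast
      obtain LY where LY: "represents_t C w B (Cod C f) LY" "\<And>n. is_biproduct (full_sub C B) (obj LX n) (obj LZ n) (obj LY n)"
        using represents_extension[OF B add t LX(1) LZ(1)] by blast
      from B.euler_class_biproduct(1)[OF LY(2) LX(2) LZ(2)] show ?thesis
        unfolding S_def using LY(1) Cod_Ob[OF triD(1)[OF t]] by blast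
    qed
  qed
  then show ?thesis unfolding has_F_finite_complexes_def map_cpx_id using S_def by blast
qed

text \<open>The inverse \<psi> is induced by the inclusion of \<open>B\<close>. One composite is the
  identity by evaluation on generators; for the other it is enough that \<psi> is surjective, which
  is where strong generation enters.\<close>

theorem K0_iso:
  assumes B: "B \<subseteq> w_eq C w 0" and add: "additive_category (full_sub C B)" and g: "strongly_generates C B"
  shows "\<exists>!\<phi>. is_FK0 C w (Ob C) B (full_sub C B) id_functor \<phi>"
    "FK0 C w (Ob C) B (full_sub C B) id_functor \<in> iso (K0_tr C) (K0_add (full_sub C B))"
proof -
  let ?B = "full_sub C B"
  have sub: "B \<subseteq> Ob C" using B w_eq_sub by blast
  interpret B: additive_category "full_sub C B" by (rule add)
  interpret W: weight_K0 C w "Ob C" B "full_sub C B" id_functor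
    by (rule weight_K0.intro[OF weight_structure_axioms weight_K0_axioms.intro])
      (rule full_triangulated_Ob B add additive_functor_id strongly_generated_finite[OF B add g])+
  show "\<exists>!\<phi>. is_FK0 C w (Ob C) B (?B) id_functor \<phi>" by (rule W.is_FK0_exists_unique)
  let ?\<phi> = "FK0 C w (Ob C) B (?B) id_functor"
  interpret T: K0_presentation C "triangle_triples C"
    using K0_presentation_triangles[of C "Ob C"] unfolding full_tri_Ob .
  have \<phi>: "?\<phi> \<in> hom (K0_tr C) (K0_add (?B))" using W.FK0_hom unfolding full_tri_Ob .
  have \<phi>B: "?\<phi> (K0_tr_class C X) = K0_add_class (?B) X" if "X \<in> B" for X
    using W.FK0_class[of X] W.euler_B[OF that] that sub unfolding full_tri_Ob by (auto simp: id_functor_def)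
  have iso: "K0_tr_class C X = K0_tr_class C Y" if "isomorphic C X Y" for X Y
    using T.class_iso that iso_class_eq_iff isomorphic_Ob[OF that] unfolding K0_tr_class_def by blast
  have tri: "K0_tr_class C (Cod C f) = K0_tr_class C (Dom C f) \<otimes>\<^bsub>K0_tr C\<^esub> K0_tr_class C (Cod C g)" if "dist_tri C f g h" for f g h
    using T.class_mult[of "Dom C f" "Cod C f" "Cod C g"] that unfolding K0_tr_class_def K0_tr_def triangle_triples_def by blast
  have cg: "comm_group (K0_tr C)" unfolding K0_tr_def using T.K.comm_group_axioms .
  interpret H: comm_group "K0_tr C" by (rule cg)
  have cl: "K0_tr_class C X \<in> carrier (K0_tr C)" if "X \<in> Ob C" for X
    using T.class_closed[OF that] unfolding K0_tr_class_def K0_tr_def .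
  have "\<exists>\<psi> \<in> hom (K0_group (?B) (split_triples (?B))) (K0_tr C).
    \<forall>X \<in> Ob (?B). \<psi> (K0_class (?B) (split_triples (?B)) X) = K0_tr_class C X"
  proof (rule B.add.universal[OF cg])
    show "K0_tr_class C X \<in> carrier (K0_tr C)" if "X \<in> Ob (?B)" for X using cl sub that by auto
    show "K0_tr_class C X = K0_tr_class C Y" if "X \<in> Ob (?B)" "Y \<in> Ob (?B)"
      "iso_class (?B) X = iso_class (?B) Y" for X Y
    proof -
      have "isomorphic (?B) X Y" using B.iso_class_eq_iff[OF that(1,2)] that(3) by blast
      then show ?thesis using iso full_sub_isomorphic by blast
    qed
    show "K0_tr_class C Y = K0_tr_class C X \<otimes>\<^bsub>K0_tr C\<^esub> K0_tr_class C Z" if "(X, Y, Z) \<in> split_triples (?B)" for X Y Z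
    proof -
      have "is_biproduct C X Z Y" using that full_sub_biproduct[OF sub] unfolding split_triples_def by auto
      then obtain f g h where "dist_tri C f g h" "Dom C f = X" "Cod C f = Y" "Cod C g = Z" using biproduct_tri by blast
      then show ?thesis using tri by blast
    qed
  qed
  then obtain \<psi> where \<psi>: "\<psi> \<in> hom (K0_add (?B)) (K0_tr C)"
    and \<psi>B: "\<And>X. X \<in> B \<Longrightarrow> \<psi> (K0_add_class (?B) X) = K0_tr_class C X"
    unfolding K0_add_def K0_add_class_def full_sub_simps(1) by blast
  interpret A: comm_group "K0_add (?B)" by (rule B.K0_add_comm_group)
  interpret \<psi>: group_hom "K0_add (?B)" "K0_tr C" \<psi>
    by (rule group_hom.intro) (auto simp: group_hom_axioms_def \<psi> A.is_group H.is_group)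
  have clB: "K0_add_class (?B) X \<in> carrier (K0_add (?B))" if "X \<in> B" for X
    using B.K0_add_class_closed[of X] that by simp
  \<comment> \<open>Surjectivity is proved object by object: those whose class lies in the image of
    \<psi> form a subcategory of the required kind.\<close>
  define R where "R = \<psi> ` carrier (K0_add (?B))"
  have R: "subgroup R (K0_tr C)" unfolding R_def by (rule \<psi>.img_is_subgroup)
  define S where "S = {M \<in> Ob C. K0_tr_class C M \<in> R}"
  have BS: "B \<subseteq> S"
  proof
    fix X assume X: "X \<in> B"
    have "\<psi> (K0_add_class (?B) X) \<in> R" unfolding R_def using clB[OF X] by blast
    then show "X \<in> S" unfolding S_def using \<psi>B[OF X] X sub by auto
  qed
  have zero: "K0_tr_class C Z = \<one>\<^bsub>K0_tr C\<^esub>" if Z: "is_zero_object C Z" for Z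
  proof -
    have O: "Z \<in> Ob C" using Z zero_object_iff by blast
    have "K0_tr_class C Z = K0_tr_class C Z \<otimes>\<^bsub>K0_tr C\<^esub> K0_tr_class C Z" using tri[OF TR1_id[OF O Z]] O by (simp add: cat_simps)
    then show ?thesis using H.l_cancel_one'[OF cl[OF O] cl[OF O]] by blast
  qed
  \<comment> \<open>The rotated identity triangle gives that a shift inverts the class, which is
    what closure of \<open>S\<close> under all shifts needs.\<close>
  have sh: "K0_tr_class C (ShO C 1 X) = inv\<^bsub>K0_tr C\<^esub> K0_tr_class C X" if X: "X \<in> Ob C" for X
  proof -
    obtain Z where Z: "is_zero_object C Z" using has_zero by blast
    then have O: "Z \<in> Ob C" using zero_object_iff by blast
    have "\<one>\<^bsub>K0_tr C\<^esub> = K0_tr_class C X \<otimes>\<^bsub>K0_tr C\<^esub> K0_tr_class C (ShO C 1 X)"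
      using tri[OF rotate[OF TR1_id[OF X Z]]] zero[OF Z] O X by (simp add: tcat_simps)
    then show ?thesis using H.inv_equality[of "K0_tr_class C (ShO C 1 X)" "K0_tr_class C X"] cl[OF X] cl[OF ShO_in[OF X]]
      by (simp add: H.m_comm)
  qed
  have "S = Ob C"
  proof (rule strong_generation_induct[OF g BS])
    show "S \<subseteq> Ob C" unfolding S_def by blast
    show "\<exists>Z\<in>S. is_zero_object C Z"
      using B.has_zero BS unfolding full_sub_zero_object[OF sub] by blast
    show "Y \<in> S" if "X \<in> S" "isomorphic C X Y" for X Y
      using that iso[OF that(2)] isomorphic_Ob[OF that(2)] unfolding S_def by auto
    show "ShO C i X \<in> S" if "X \<in> S" for X i
    proof (induction i rule: int_induct[of _ 0])
      case base
      then show ?case using that by (simp add: S_def ShO_0)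
    next
      case (step1 i)
      then have "K0_tr_class C (ShO C 1 (ShO C i X)) \<in> R" using sh subgroup.m_inv_closed[OF R] unfolding S_def by auto
      then show ?case using that unfolding S_def by (simp add: tcat_simps add.commute)
    next
      case (step2 i)
      have X: "X \<in> Ob C" using that unfolding S_def by blast
      have "K0_tr_class C (ShO C i X) = inv\<^bsub>K0_tr C\<^esub> K0_tr_class C (ShO C (i - 1) X)"
        using sh[OF ShO_in[OF X, of "i - 1"]] X by (simp add: tcat_simps)
      then have "K0_tr_class C (ShO C (i - 1) X) = inv\<^bsub>K0_tr C\<^esub> K0_tr_class C (ShO C i X)"
        using cl[OF ShO_in[OF X]] by simp
      then show ?case using step2 X subgroup.m_inv_closed[OF R] unfolding S_def by (simp add: ShO_in)
    qed
    show "Cod C f \<in> S" if t: "dist_tri C f g h" and O: "Dom C f \<in> S" "Cod C g \<in> S" for f g h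
      using O tri[OF t] subgroup.m_closed[OF R] Cod_Ob[OF triD(1)[OF t]] unfolding S_def by auto
  qed
  then have surj: "x \<in> R" if "x \<in> carrier (K0_tr C)" for x
    using T.carrier_induct[of x R] that R unfolding K0_tr_def K0_tr_class_def S_def by blast
  have comp: "(\<lambda>x. ?\<phi> (\<psi> x)) \<in> hom (K0_add (?B)) (K0_add (?B))"
    using \<phi> \<psi> unfolding hom_def by (auto simp: Pi_iff)
  have id: "?\<phi> (\<psi> x) = x" if "x \<in> carrier (K0_add (?B))" for x
  proof (rule B.add.hom_eqI[OF B.K0_add_comm_group, of "\<lambda>x. ?\<phi> (\<psi> x)" "\<lambda>x. x"])
    show "(\<lambda>x. ?\<phi> (\<psi> x)) \<in> hom (K0_group (?B) (split_triples (?B))) (K0_add (?B))"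
      using comp unfolding K0_add_def .
    show "(\<lambda>x. x) \<in> hom (K0_group (?B) (split_triples (?B))) (K0_add (?B))"
      unfolding K0_add_def hom_def by simp
    show "?\<phi> (\<psi> (K0_class (?B) (split_triples (?B)) X)) = K0_class (?B) (split_triples (?B)) X"
      if "X \<in> Ob (?B)" for X
      using \<psi>B[of X] \<phi>B[of X] that unfolding K0_add_class_def by simp
    show "x \<in> carrier (K0_group (?B) (split_triples (?B)))" using that unfolding K0_add_def .
  qed
  have "bij_betw ?\<phi> (carrier (K0_tr C)) (carrier (K0_add (?B)))"
  proof (rule bij_betwI[where g = \<psi>])
    show "?\<phi> \<in> carrier (K0_tr C) \<rightarrow> carrier (K0_add (?B))" using \<phi> unfolding hom_def by blast
    show "\<psi> \<in> carrier (K0_add (?B)) \<rightarrow> carrier (K0_tr C)" using \<psi> unfolding hom_def by blast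
    show "\<psi> (?\<phi> x) = x" if "x \<in> carrier (K0_tr C)" for x using surj[OF that] id unfolding R_def by auto
    show "?\<phi> (\<psi> y) = y" if "y \<in> carrier (K0_add (?B))" for y using id[OF that] .
  qed
  then show "?\<phi> \<in> iso (K0_tr C) (K0_add (?B))" unfolding iso_def using \<phi> by blast
qed

end

section \<open>Weight-exact functors\<close>

lemma (in triangulated_category) iso_arrow_shift:
  assumes "is_iso_arrow C f"
  shows "is_iso_arrow C (ShA C i f)"
proof -
  obtain g where f: "f \<in> Ar C" "g \<in> Homs C (Cod C f) (Dom C f)" "g \<cdot> f = Idn C (Dom C f)" "f \<cdot> g = Idn C (Cod C f)"
    using assms unfolding is_iso_arrow_def by blast
  note [simp] = f(1) HomsD[OF f(2)]
  have "ShA C i g \<cdot> ShA C i f = ShA C i (g \<cdot> f)" "ShA C i f \<cdot> ShA C i g = ShA C i (f \<cdot> g)" by (simp_all add: tcat_simps)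
  then show ?thesis unfolding is_iso_arrow_def f(3,4)
    by (intro conjI bexI[of _ "ShA C i g"]) (simp_all add: HomsI tcat_simps Dom_Ob Cod_Ob)
qed

text \<open>The natural isomorphism is fixed here, because the comparison of all shifts is built
  from it.\<close>

locale exact_functor_between = C: triangulated_category C + D: triangulated_category D
  for C :: "('o, 'm) tricat" and D :: "('p, 'q) tricat" (structure) +
  fixes G :: "('o, 'm, 'p, 'q) fnctr" and \<theta> :: "'o \<Rightarrow> 'q"
  assumes additive: "additive_functor C D G"
    and \<theta>: "X \<in> Ob C \<Longrightarrow> \<theta> X \<in> Homs D (FOb G (ShO C 1 X)) (ShO D 1 (FOb G X))"
      "X \<in> Ob C \<Longrightarrow> is_iso_arrow D (\<theta> X)"
    and \<theta>_natural: "f \<in> Homs C X Y \<Longrightarrow> \<theta> Y \<cdot> FAr G (ShA C 1 f) = ShA D 1 (FAr G f) \<cdot> \<theta> X"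
    and map_dist_tri: "dist_tri C f g h \<Longrightarrow> dist_tri D (FAr G f) (FAr G g) (\<theta> (Dom C f) \<cdot> FAr G h)"
begin

sublocale additive_functor_between C D G
  by unfold_locales (rule additive)

lemma \<theta>_natural': "f \<in> Ar C \<Longrightarrow> \<theta> (Cod C f) \<cdot> FAr G (ShA C 1 f) = ShA D 1 (FAr G f) \<cdot> \<theta> (Dom C f)"
  using \<theta>_natural[of f "Dom C f" "Cod C f"] by (simp add: Homs_def)

lemmas \<theta>_arr = HomsD[OF \<theta>(1)]

definition \<theta>_inv :: "'o \<Rightarrow> 'q" where
  "\<theta>_inv X = (SOME g. g \<in> Homs D (ShO D 1 (FOb G X)) (FOb G (ShO C 1 X)) \<and>
    g \<cdot> \<theta> X = Idn D (FOb G (ShO C 1 X)) \<and> \<theta> X \<cdot> g = Idn D (ShO D 1 (FOb G X)))"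

lemma \<theta>_inv:
  assumes X: "X \<in> Ob C"
  shows "\<theta>_inv X \<in> Homs D (ShO D 1 (FOb G X)) (FOb G (ShO C 1 X))"
    "\<theta>_inv X \<cdot> \<theta> X = Idn D (FOb G (ShO C 1 X))" "\<theta> X \<cdot> \<theta>_inv X = Idn D (ShO D 1 (FOb G X))"
proof -
  have "\<exists>g. g \<in> Homs D (ShO D 1 (FOb G X)) (FOb G (ShO C 1 X)) \<and>
    g \<cdot> \<theta> X = Idn D (FOb G (ShO C 1 X)) \<and> \<theta> X \<cdot> g = Idn D (ShO D 1 (FOb G X))"
    using \<theta>(2)[OF X] HomsD[OF \<theta>(1)[OF X]] unfolding is_iso_arrow_def by auto
  from someI_ex[OF this] show "\<theta>_inv X \<in> Homs D (ShO D 1 (FOb G X)) (FOb G (ShO C 1 X))"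
    "\<theta>_inv X \<cdot> \<theta> X = Idn D (FOb G (ShO C 1 X))" "\<theta> X \<cdot> \<theta>_inv X = Idn D (ShO D 1 (FOb G X))"
    unfolding \<theta>_inv_def by blast+
qed

lemma \<theta>_inv_iso: "X \<in> Ob C \<Longrightarrow> is_iso_arrow D (\<theta>_inv X)"
  using D.isomorphicI(2)[OF \<theta>_inv(1) \<theta>(1) \<theta>_inv(3) \<theta>_inv(2)] by blast

text \<open>Terms of weight complexes involve arbitrary shifts, while an exact functor compares only
  the shift by one. The comparison is iterated with \<theta> upwards and with its inverse
  downwards.\<close>

primrec \<theta>_pos :: "nat \<Rightarrow> 'o \<Rightarrow> 'q" where
  "\<theta>_pos 0 X = Idn D (FOb G X)"
| "\<theta>_pos (Suc k) X = ShA D (int k) (\<theta> X) \<cdot> \<theta>_pos k (ShO C 1 X)"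

primrec \<theta>_neg :: "nat \<Rightarrow> 'o \<Rightarrow> 'q" where
  "\<theta>_neg 0 X = Idn D (FOb G X)"
| "\<theta>_neg (Suc k) X = ShA D (- 1 - int k) (\<theta>_inv (ShO C (- 1) X)) \<cdot> \<theta>_neg k (ShO C (- 1) X)"

definition \<theta>_shift :: "int \<Rightarrow> 'o \<Rightarrow> 'q" where
  "\<theta>_shift m X = (if m \<ge> 0 then \<theta>_pos (nat m) X else \<theta>_neg (nat (- m)) X)"

lemma \<theta>_pos: "X \<in> Ob C \<Longrightarrow> \<theta>_pos k X \<in> Homs D (FOb G (ShO C (int k) X)) (ShO D (int k) (FOb G X)) \<and> is_iso_arrow D (\<theta>_pos k X)"
proof (induction k arbitrary: X)
  case 0
  then show ?case using FOb_in[of X] by (simp add: C.ShO_0 D.ShO_0 D.Idn_in D.Idn_iso)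
next
  case (Suc k)
  have X1: "ShO C 1 X \<in> Ob C" using C.ShO_in[OF Suc.prems] .
  note IH = Suc.IH[OF X1]
  note [simp] = HomsD[OF conjunct1[OF IH]] \<theta>_arr[OF Suc.prems] FOb_in[OF Suc.prems] Suc.prems
  have "Cod D (\<theta>_pos k (ShO C 1 X)) = Dom D (ShA D (int k) (\<theta> X))" by (simp add: D.tcat_simps)
  then show ?case
    using D.iso_arrow_Cmp[OF conjunct2[OF IH] D.iso_arrow_shift[OF \<theta>(2)[OF Suc.prems]]]
    by (auto intro!: HomsI simp: D.tcat_simps C.tcat_simps add.commute)
qed

lemma \<theta>_neg: "X \<in> Ob C \<Longrightarrow> \<theta>_neg k X \<in> Homs D (FOb G (ShO C (- int k) X)) (ShO D (- int k) (FOb G X)) \<and> is_iso_arrow D (\<theta>_neg k X)"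
proof (induction k arbitrary: X)
  case 0
  then show ?case using FOb_in[of X] by (simp add: C.ShO_0 D.ShO_0 D.Idn_in D.Idn_iso)
next
  case (Suc k)
  have X1: "ShO C (- 1) X \<in> Ob C" using C.ShO_in[OF Suc.prems] .
  have X2: "ShO C 1 (ShO C (- 1) X) = X" using Suc.prems by (simp add: C.tcat_simps)
  have e: "- int k - 1 = - 1 - int k" by simp
  note IH = Suc.IH[OF X1]
  note [simp] = HomsD[OF conjunct1[OF IH]] HomsD[OF \<theta>_inv(1)[OF X1]] FOb_in[OF Suc.prems] FOb_in[OF X1] Suc.prems X2
  have "Cod D (\<theta>_neg k (ShO C (- 1) X)) = Dom D (ShA D (- 1 - int k) (\<theta>_inv (ShO C (- 1) X)))" by (simp add: D.tcat_simps)
  then show ?case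
    using D.iso_arrow_Cmp[OF conjunct2[OF IH] D.iso_arrow_shift[OF \<theta>_inv_iso[OF X1]]]
    by (simp add: Homs_def D.tcat_simps C.tcat_simps e)
qed

lemma \<theta>_shift:
  assumes "X \<in> Ob C"
  shows "\<theta>_shift m X \<in> Homs D (FOb G (ShO C m X)) (ShO D m (FOb G X))" "is_iso_arrow D (\<theta>_shift m X)"
  using \<theta>_pos[OF assms, of "nat m"] \<theta>_neg[OF assms, of "nat (- m)"] unfolding \<theta>_shift_def by auto

text \<open>Shows that the two recursions obey one recurrence over all integers; below zero,
  \<theta> cancels the inverse used in the definition.\<close>

lemma \<theta>_shift_step:
  assumes X: "X \<in> Ob C"
  shows "ShA D m (\<theta> X) \<cdot> \<theta>_shift m (ShO C 1 X) = \<theta>_shift (m + 1) X"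
proof (cases "m \<ge> 0")
  case True
  then have "nat (m + 1) = Suc (nat m)" by simp
  then show ?thesis using True unfolding \<theta>_shift_def by simp
next
  case False
  define k where "k = nat (- (m + 1))"
  have m: "m = - 1 - int k" using False unfolding k_def by simp
  have X1: "ShO C (- 1) (ShO C 1 X) = X" using X by (simp add: C.tcat_simps)
  have neg: "\<theta>_neg k X = \<theta>_shift (m + 1) X" unfolding \<theta>_shift_def m by auto
  have 1: "\<theta>_shift m (ShO C 1 X) = ShA D m (\<theta>_inv X) \<cdot> \<theta>_neg k X"
    unfolding \<theta>_shift_def m using X1 by (simp add: Suc_nat_eq_nat_zadd1 nat_add_distrib)
  note [simp] = \<theta>_arr[OF X] HomsD[OF \<theta>_inv(1)[OF X]] FOb_in[OF X] HomsD[OF conjunct1[OF \<theta>_neg[OF X, of k]]]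
  have O: "Cod D (\<theta>_neg k X) = ShO D m (ShO D 1 (FOb G X))" using m by (simp add: D.ShO_ShO)
  have "ShA D m (\<theta> X) \<cdot> (ShA D m (\<theta>_inv X) \<cdot> \<theta>_neg k X) = ShA D m (\<theta> X) \<cdot> ShA D m (\<theta>_inv X) \<cdot> \<theta>_neg k X"
    by (rule D.Cmp_assoc'[symmetric]) (use m in \<open>simp_all add: D.ShA_arr D.ShO_ShO\<close>)
  also have "ShA D m (\<theta> X) \<cdot> ShA D m (\<theta>_inv X) = ShA D m (\<theta> X \<cdot> \<theta>_inv X)" by (simp add: D.tcat_simps)
  also have "\<dots> \<cdot> \<theta>_neg k X = \<theta>_neg k X" unfolding \<theta>_inv(3)[OF X] using O by (simp add: D.tcat_simps)
  finally show ?thesis unfolding 1 neg .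
qed

lemma \<theta>_shift_natural:
  assumes f: "f \<in> Homs C X Y"
  shows "\<theta>_shift m Y \<cdot> FAr G (ShA C m f) = ShA D m (FAr G f) \<cdot> \<theta>_shift m X"
  using f
proof (induction m arbitrary: f X Y rule: int_induct[of _ 0])
  case base
  note [simp] = HomsD[OF base]
  have [simp]: "X \<in> Ob C" "Y \<in> Ob C" using C.Homs_Ob[OF base] by auto
  show ?case using FOb_in[of X] FOb_in[of Y] FAr_arr[of f] by (simp add: \<theta>_shift_def C.ShA_0 D.ShA_0 D.cat_simps)
next
  case (step1 m)
  note [simp] = HomsD[OF step1.prems]
  have X [simp]: "X \<in> Ob C" "Y \<in> Ob C" using C.Homs_Ob[OF step1.prems] by auto
  note [simp] = \<theta>_arr[OF X(1)] \<theta>_arr[OF X(2)] FOb_in[OF X(1)] FOb_in[OF X(2)] FAr_arr HomsD[OF \<theta>_shift(1)] C.sh_simps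
  have IH: "\<theta>_shift m (ShO C 1 Y) \<cdot> FAr G (ShA C m (ShA C 1 f)) = ShA D m (FAr G (ShA C 1 f)) \<cdot> \<theta>_shift m (ShO C 1 X)"
    by (rule step1.IH) (simp add: HomsI C.ShA_arr)
  have nat: "\<theta> Y \<cdot> FAr G (ShA C 1 f) = ShA D 1 (FAr G f) \<cdot> \<theta> X" by (rule \<theta>_natural[OF step1.prems])
  have "\<theta>_shift (m + 1) Y \<cdot> FAr G (ShA C (m + 1) f) = ShA D m (\<theta> Y) \<cdot> (\<theta>_shift m (ShO C 1 Y) \<cdot> FAr G (ShA C m (ShA C 1 f)))"
    unfolding \<theta>_shift_step[OF X(2), symmetric] by (simp add: D.tcat_simps)
  also have "\<dots> = ShA D m (\<theta> Y \<cdot> FAr G (ShA C 1 f)) \<cdot> \<theta>_shift m (ShO C 1 X)"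
    unfolding IH by (simp add: D.tcat_simps)
  also have "\<dots> = ShA D (m + 1) (FAr G f) \<cdot> \<theta>_shift (m + 1) X"
    unfolding nat \<theta>_shift_step[OF X(1), symmetric] by (simp add: D.tcat_simps)
  finally show ?case .
next
  case (step2 m)
  note [simp] = HomsD[OF step2.prems]
  have X [simp]: "X \<in> Ob C" "Y \<in> Ob C" using C.Homs_Ob[OF step2.prems] by auto
  let ?X = "ShO C (- 1) X" and ?Y = "ShO C (- 1) Y" and ?f = "ShA C (- 1) f"
  have X1: "?X \<in> Ob C" "?Y \<in> Ob C" by (simp_all add: C.ShO_in)
  have f1: "?f \<in> Homs C ?X ?Y" by (simp add: HomsI C.ShA_arr)
  have s: "ShO C 1 ?X = X" "ShO C 1 ?Y = Y" "ShA C 1 ?f = f" by (simp_all add: C.sh_simps)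
  note [simp] = X1 FOb_in[OF X1(1)] FOb_in[OF X1(2)] FAr_arr HomsD[OF f1] HomsD[OF \<theta>_shift(1)] C.sh_simps
  have \<theta>a [simp]: "\<theta> ?X \<in> Ar D" "Dom D (\<theta> ?X) = FOb G X" "Cod D (\<theta> ?X) = ShO D 1 (FOb G ?X)"
    "\<theta> ?Y \<in> Ar D" "Dom D (\<theta> ?Y) = FOb G Y" "Cod D (\<theta> ?Y) = ShO D 1 (FOb G ?Y)"
    using \<theta>_arr[OF X1(1)] \<theta>_arr[OF X1(2)] s by simp_all
  have [simp]: "FOb G X \<in> Ob D" "FOb G Y \<in> Ob D" using FOb_in by simp_all
  have st: "ShA D (m - 1) (\<theta> ?X) \<cdot> \<theta>_shift (m - 1) X = \<theta>_shift m ?X" "ShA D (m - 1) (\<theta> ?Y) \<cdot> \<theta>_shift (m - 1) Y = \<theta>_shift m ?Y"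
    using \<theta>_shift_step[OF X1(1), of "m - 1"] \<theta>_shift_step[OF X1(2), of "m - 1"] unfolding s by simp_all
  have IH: "\<theta>_shift m ?Y \<cdot> FAr G (ShA C m ?f) = ShA D m (FAr G ?f) \<cdot> \<theta>_shift m ?X" by (rule step2.IH[OF f1])
  have nat: "\<theta> ?Y \<cdot> FAr G f = ShA D 1 (FAr G ?f) \<cdot> \<theta> ?X" using \<theta>_natural[OF f1] unfolding s .
  have sf: "ShA C m ?f = ShA C (m - 1) f" by simp
  have "ShA D (m - 1) (\<theta> ?Y) \<cdot> (\<theta>_shift (m - 1) Y \<cdot> FAr G (ShA C (m - 1) f)) = ShA D m (FAr G ?f) \<cdot> \<theta>_shift m ?X"
    using IH unfolding st(2)[symmetric] sf by (simp add: D.tcat_simps)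
  also have "\<dots> = ShA D (m - 1) (ShA D 1 (FAr G ?f) \<cdot> \<theta> ?X) \<cdot> \<theta>_shift (m - 1) X"
    unfolding st(1)[symmetric] by (simp add: D.tcat_simps)
  also have "\<dots> = ShA D (m - 1) (\<theta> ?Y) \<cdot> (ShA D (m - 1) (FAr G f) \<cdot> \<theta>_shift (m - 1) X)"
    unfolding nat[symmetric] by (simp add: D.tcat_simps)
  finally have eq: "ShA D (m - 1) (\<theta> ?Y) \<cdot> (\<theta>_shift (m - 1) Y \<cdot> FAr G (ShA C (m - 1) f)) =
    ShA D (m - 1) (\<theta> ?Y) \<cdot> (ShA D (m - 1) (FAr G f) \<cdot> \<theta>_shift (m - 1) X)" .
  \<comment> \<open>In the downward step the equation is obtained after composing with a shifted
    \<theta>, which is cancelled by this inverse.\<close>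
  obtain r where r: "r \<in> Homs D (Cod D (ShA D (m - 1) (\<theta> ?Y))) (Dom D (ShA D (m - 1) (\<theta> ?Y)))" "r \<cdot> ShA D (m - 1) (\<theta> ?Y) = Idn D (Dom D (ShA D (m - 1) (\<theta> ?Y)))"
    using D.iso_arrow_shift[OF \<theta>(2)[OF X1(2)], of "m - 1"] unfolding is_iso_arrow_def by blast
  have cancel: "u = v" if "u \<in> Homs D W (ShO D (m - 1) (FOb G Y))" "v \<in> Homs D W (ShO D (m - 1) (FOb G Y))"
    "ShA D (m - 1) (\<theta> ?Y) \<cdot> u = ShA D (m - 1) (\<theta> ?Y) \<cdot> v" for u v W
  proof -
    note [simp] = HomsD[OF that(1)] HomsD[OF that(2)] HomsD[OF r(1)]
    have "r \<cdot> ShA D (m - 1) (\<theta> ?Y) \<cdot> u = r \<cdot> ShA D (m - 1) (\<theta> ?Y) \<cdot> v"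
      using that(3) by (simp add: D.Cmp_assoc' D.ShA_arr)
    then show ?thesis unfolding r(2) by (simp add: D.tcat_simps)
  qed
  show ?case
    by (rule cancel[where W = "FOb G (ShO C (m - 1) X)", OF _ _ eq]) (simp_all add: HomsI D.tcat_simps)
qed

end

locale weight_exact_between = exact_functor_between C D G \<theta> + C: weight_structure C w + D: weight_structure D v
  for C :: "('o, 'm) tricat" and D :: "('p, 'q) tricat" (structure) and G \<theta> w v +
  assumes G_le0: "FOb G ` w_le0 w \<subseteq> w_le0 v" and G_ge0: "FOb G ` w_ge0 w \<subseteq> w_ge0 v"
begin

lemma G_shift_isomorphic: "X \<in> Ob C \<Longrightarrow> isomorphic D (ShO D n (FOb G X)) (FOb G (ShO C n X))"
  using \<theta>_shift[of X n] D.isomorphic_sym unfolding isomorphic_def by blast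

lemma G_w_le: "X \<in> w_le C w n \<Longrightarrow> FOb G X \<in> w_le D v n"
  using G_le0 D.w_le_iso[OF G_shift_isomorphic] C.le0_sub unfolding w_le_def by blast

lemma G_w_ge: "X \<in> w_ge C w n \<Longrightarrow> FOb G X \<in> w_ge D v n"
  using G_ge0 D.w_ge_iso[OF G_shift_isomorphic] C.ge0_sub unfolding w_ge_def by blast

lemma G_w_eq: "X \<in> w_eq C w n \<Longrightarrow> FOb G X \<in> w_eq D v n"
  using G_w_le G_w_ge by (simp add: w_eq_def)

text \<open>The image of a tower is a tower once \<theta> is inserted in the third arrows. Its
  complex is isomorphic to the image of the original one, not equal to it, as \<open>G\<close>
  commutes with shifts only up to isomorphism.\<close>

lemma map_weight_complex:
  assumes K: "is_weight_complex C w M K"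
  shows "\<exists>K'. is_weight_complex D v (FOb G M) K' \<and> homotopy_equivalent D (map_cpx G K) K'"
proof -
  obtain a b e c p q where T: "C.weight_tower M a b e c p q" and K': "K = C.tower_cpx p q"
    using K C.is_weight_complex_iff by blast
  note d = C.weight_towerD(1)[OF T]
  note [simp] = C.weight_towerD(3,5-)[OF T] C.wdecD(3,5-)[OF d] C.wdec_wD[OF d]
  have pO [simp]: "Cod C (p n) \<in> Ob C" for n using C.w_eq_Ob[OF C.tower_w_eq[OF T]] .
  define q' where "q' n = \<theta> (Dom C (a (n - 1))) \<cdot> FAr G (q n)" for n
  have "D.weight_tower (FOb G M) (\<lambda>n. FAr G (a n)) (\<lambda>n. FAr G (b n)) (\<lambda>n. \<theta> (Dom C (a n)) \<cdot> FAr G (e n))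
    (\<lambda>n. FAr G (c n)) (\<lambda>n. FAr G (p n)) q'"
    unfolding D.weight_tower_def
  proof (intro allI conjI)
    fix n
    show "D.wdec n (FOb G M) (FAr G (a n)) (FAr G (b n)) (\<theta> (Dom C (a n)) \<cdot> FAr G (e n))"
      using map_dist_tri[OF C.wdecD(1)[OF d[of n]]] G_w_le[OF C.wdecD(2)[OF d[of n]]] G_w_ge[OF C.wdecD(4)[OF d[of n]]]
      unfolding D.wdec_def by (simp add: FAr_arr)
    show "FAr G (c n) \<in> Homs D (Dom D (FAr G (a (n - 1)))) (Dom D (FAr G (a n)))"
      by (simp add: FAr_arr HomsI)
    show "FAr G (a n) \<cdot> FAr G (c n) = FAr G (a (n - 1))" by (simp add: FAr_Cmp'[symmetric])
    show "dist_tri D (FAr G (c n)) (FAr G (p n)) (q' n)"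
      using map_dist_tri[OF C.weight_towerD(4)[OF T, of n]] unfolding q'_def by simp
  qed
  then have W: "is_weight_complex D v (FOb G M) (D.tower_cpx (\<lambda>n. FAr G (p n)) q')" (is "is_weight_complex D v _ ?K'")
    using D.is_weight_complex_iff by blast
  have cK: "is_complex C K" by (rule C.weight_complex_is_complex[OF K])
  note cGK = map_complex[OF cK]
  have GO [simp]: "FOb G (Cod C (p n)) \<in> Ob D" "FOb G (Dom C (a n)) \<in> Ob D" for n using FOb_in by simp_all
  \<comment> \<open>In degree \<open>m\<close> the term is a shift by \<open>m\<close>, compared by
    \<open>\<theta>_shift m\<close>; the square commutes by naturality together with the
    recurrence.\<close>
  have "is_chain_map D (map_cpx G K) ?K' (\<lambda>m. \<theta>_shift m (Cod C (p (- m))))"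
    unfolding is_chain_map_def
  proof (intro conjI allI)
    fix m
    show "\<theta>_shift m (Cod C (p (- m))) \<in> Homs D (obj (map_cpx G K) m) (obj ?K' m)"
      using \<theta>_shift(1)[of "Cod C (p (- m))" m] unfolding K' by (simp add: map_cpx_def C.tower_cpx_def D.tower_cpx_def FAr_arr)
    let ?P = "Cod C (p (- m))" and ?P' = "Cod C (p (- m - 1))"
    define f where "f = ShA C 1 (p (- m - 1)) \<cdot>\<^bsub>C\<^esub> q (- m)"
    have f: "f \<in> Homs C ?P (ShO C 1 ?P')" unfolding f_def by (simp add: C.tcat_simps HomsI)
    note [simp] = HomsD[OF f] HomsD[OF \<theta>_shift(1)[of ?P m]] HomsD[OF \<theta>_shift(1)[of "ShO C 1 ?P'" m]] \<theta>_arr FAr_arr C.ShO_in FOb_in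
    have "ShA D 1 (FAr G (p (- m - 1))) \<cdot> q' (- m) = \<theta> ?P' \<cdot> FAr G f"
      unfolding q'_def f_def using \<theta>_natural'[of "p (- m - 1)"]
      by (simp add: FAr_Cmp' C.ShA_arr D.Cmp_assoc'[symmetric] D.ShA_arr)
    then have "dif ?K' m = ShA D m (\<theta> ?P' \<cdot> FAr G f)" unfolding D.tower_cpx_def by simp
    then have "dif ?K' m \<cdot> \<theta>_shift m ?P = ShA D m (\<theta> ?P') \<cdot> (ShA D m (FAr G f) \<cdot> \<theta>_shift m ?P)"
      by (simp add: D.tcat_simps)
    also have "\<dots> = ShA D m (\<theta> ?P') \<cdot> \<theta>_shift m (ShO C 1 ?P') \<cdot> FAr G (ShA C m f)"
      unfolding \<theta>_shift_natural[OF f, symmetric] by (simp add: D.tcat_simps C.ShA_arr)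
    also have "\<dots> = \<theta>_shift (m + 1) ?P' \<cdot> FAr G (ShA C m f)" unfolding \<theta>_shift_step[OF pO] ..
    also have "ShA C m f = dif K m" unfolding K' f_def C.tower_cpx_def by simp
    finally show "\<theta>_shift (m + 1) (Cod C (p (- (m + 1)))) \<cdot> dif (map_cpx G K) m = dif ?K' m \<cdot> \<theta>_shift m ?P"
      by (simp add: map_cpx_def)
  qed
  from D.chain_isomorphism_homotopy_equivalent[OF cGK D.weight_complex_is_complex[OF W] this] W show ?thesis
    using \<theta>_shift(2) pO by blast
qed

end

context weight_K0
begin

text \<open>The functors agree on the heart, so \<open>F\<close> applied to t(N) is
  \<open>F'\<close> applied to the image of t(N) under \<open>G\<close>; purity of the image object
  makes this equivalent to a complex with a single term in degree \<open>- j\<close>.\<close>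

theorem FK0_weight_exact:
  fixes D :: "('p, 'q) tricat" and v :: "'p wstr" and G :: "('o, 'm, 'p, 'q) fnctr" and F' :: "('p, 'q, 'a, 'b) fnctr"
  assumes A: "abelian_category A" and Bw: "B = w_eq C w 0" and D: "weight_structure D v" and G: "weight_exact_functor C w D v G"
    and F': "additive_functor (heart D v) A F'" and FO: "\<And>X. X \<in> w_eq C w 0 \<Longrightarrow> FOb F X = FOb F' (FOb G X)"
    and FM: "\<And>f. f \<in> Ar (heart C w) \<Longrightarrow> FAr F f = FAr F' (FAr G f)"
    and N: "N \<in> C'" and GN: "FOb G N \<in> w_eq D v j"
  shows "FK N = signed_class A j (HF C w B A F j N)"
proof -
  interpret D: weight_structure D v by (rule D)
  have ex: "exact_functor C D G" and G0: "FOb G ` w_le0 w \<subseteq> w_le0 v" "FOb G ` w_ge0 w \<subseteq> w_ge0 v"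
    using G unfolding weight_exact_functor_def by auto
  obtain \<theta> where \<theta>: "\<forall>X \<in> Ob C. \<theta> X \<in> Homs D (FOb G (ShO C 1 X)) (ShO D 1 (FOb G X)) \<and> is_iso_arrow D (\<theta> X)"
    "\<forall>X Y. \<forall>f \<in> Homs C X Y. \<theta> Y \<cdot>\<^bsub>D\<^esub> FAr G (ShA C 1 f) = ShA D 1 (FAr G f) \<cdot>\<^bsub>D\<^esub> \<theta> X"
    "\<forall>f g h. dist_tri C f g h \<longrightarrow> dist_tri D (FAr G f) (FAr G g) (\<theta> (Dom C f) \<cdot>\<^bsub>D\<^esub> FAr G h)"
    and addG: "additive_functor C D G"
    using ex unfolding exact_functor_def by (elim conjE exE) rule
  have "exact_functor_between C D G \<theta>"
    by (intro exact_functor_between.intro exact_functor_between_axioms.intro triangulated_category_axioms D.triangulated_category_axioms addG)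
      (use \<theta> in blast)+
  then interpret G: weight_exact_between C D G \<theta> w v
    by (intro weight_exact_between.intro weight_exact_between_axioms.intro weight_structure_axioms D G0)
  interpret Hv: additive_category "heart D v" by (rule D.heart_additive)
  interpret F': additive_functor_between "heart D v" A F' by unfold_locales (rule F')
  obtain K where K: "is_weight_complex C w N K" using weight_complex_exists C'_sub N by blast
  have KB: "obj K i \<in> w_eq C w 0" for i by (rule weight_complex_in_heart[OF K])
  have cK: "is_complex C K" by (rule weight_complex_is_complex[OF K])
  obtain K' where K': "is_weight_complex D v (FOb G N) K'" "homotopy_equivalent D (map_cpx G K) K'"
    using G.map_weight_complex[OF K] by blast
  obtain P where P: "is_weight_complex D v (FOb G N) P" "\<And>i. i \<noteq> - j \<Longrightarrow> is_zero_object D (obj P i)"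
    using D.weight_complex_pure[OF GN] by blast
  \<comment> \<open>The image complex is equivalent to a weight complex of the object
    \<open>FOb G N\<close>, and \<open>P\<close> is another one, concentrated in one degree.\<close>
  have "homotopy_equivalent D (map_cpx G K) P" using D.homotopy_equivalent_trans[OF K'(2) D.weight_complex_unique[OF K'(1) P(1)]] .
  moreover have "obj (map_cpx G K) i \<in> w_eq D v 0 \<and> obj P i \<in> w_eq D v 0" for i
    using G.G_w_eq[OF KB] D.weight_complex_in_heart[OF P(1)] by (simp add: map_cpx_def)
  ultimately have "homotopy_equivalent (heart D v) (map_cpx G K) P"
    unfolding heart_def D.full_sub_homotopy_equivalent[OF D.w_eq_sub] by blast
  from F'.map_homotopy_equivalent[OF this] have he: "homotopy_equivalent A (map_cpx F' (map_cpx G K)) (map_cpx F' P)" .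
  let ?Q = "map_cpx F' P"
  have "dif K i \<in> Ar (heart C w)" for i using is_complexD[OF cK] KB unfolding heart_def by simp
  then have "map_cpx F' (map_cpx G K) = map_cpx F K" unfolding map_cpx_def using FO KB FM by simp
  then have he: "homotopy_equivalent A (map_cpx F K) ?Q" using he by simp
  obtain L where L: "admissible N L" using admissible_exists[OF N] by blast
  have rL: "represents_t C w B N L" and zL: "almost_all_zero A (map_cpx F L)" using L unfolding admissible_def by blast+
  have "homotopy_equivalent A (map_cpx F L) (map_cpx F K)"
    using image_homotopy_equivalent[OF rL] represents_weight_complex[OF K] Bw by simp
  then have LQ: "homotopy_equivalent A (map_cpx F L) ?Q" using A.homotopy_equivalent_trans he by blast
  have cQ: "is_complex A ?Q" using he unfolding homotopy_equivalent_def by blast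
  note OQ = A.is_complexD(1)[OF cQ]
  have zQ: "is_zero_object A (obj ?Q i)" if "i \<noteq> - j" for i
  proof -
    have "is_zero_object (heart D v) (obj P i)"
      using P(2)[OF that] D.weight_complex_in_heart[OF P(1)] unfolding heart_def D.full_sub_zero_object[OF D.w_eq_sub] by blast
    then show ?thesis using F'.map_zero_object by (simp add: map_cpx_def)
  qed
  have "{i. \<not> is_zero_object A (obj ?Q i)} \<subseteq> {- j}" using zQ by blast
  then have aQ: "almost_all_zero A ?Q" unfolding almost_all_zero_def using finite_subset by blast
  have "euler N = euler_class A (obj ?Q)" unfolding euler_eq[OF L] by (rule A.euler_class_homotopy_equivalent[OF LQ zL aQ])
  also have "\<dots> = signed_class A (- j) (obj ?Q (- j))" by (rule A.euler_class_single[OF OQ zQ])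
  finally have e: "euler N = signed_class A (- j) (obj ?Q (- j))" .
  have "is_cohomology0 A (shift_cpx (- j) ?Q) (obj (shift_cpx (- j) ?Q) 0)"
    by (rule A.cohomology_single[OF shift_cpx_complex[OF cQ]]) (use zQ in auto)
  then have "isomorphic A (HF C w B A F j N) (obj ?Q (- j))"
    using A.cohomology_homotopy_equivalent[OF shift_cpx_homotopy_equivalent[OF LQ] HF_cohomology[OF A rL]] by simp
  then have "K0_add_class A (HF C w B A F j N) = K0_add_class A (obj ?Q (- j))" by (rule A.K0_add_class_iso)
  \<comment> \<open>The Euler class carries the sign of degree \<open>- j\<close>, which has the
    parity of \<open>j\<close>.\<close>
  then show ?thesis unfolding FK0_class[OF N] e signed_class_def by simp
qed

end

theorem theorem3p2p4:
  fixes C :: "('o, 'm) tricat" and w :: "'o wstr"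
    and C' :: "'o set" and B :: "'o set" and N :: 'o
    and A :: "('a, 'b) cat" and F :: "('o, 'm, 'a, 'b) fnctr"
    and D :: "('p, 'q) tricat" and v :: "'p wstr"
    and G :: "('o, 'm, 'p, 'q) fnctr" and F' :: "('p, 'q, 'a, 'b) fnctr"
    and j :: int
  assumes "weight_structure C w"
    and "full_triangulated_subcategory C C'"
    and "B \<subseteq> Ob (heart C w)" and "additive_category (full_sub (heart C w) B)"
    and "N \<in> C'"
    and "additive_category A"
    and "additive_functor (full_sub C B) A F"
    and "has_F_finite_complexes C w C' B A F"
  shows
    "(\<exists>!\<phi>. is_FK0 C w C' B A F \<phi>) \<and>
    (B = Ob (heart C w) \<and> Ob (heart C w) \<subseteq> C' \<and> abelian_category A \<longrightarrow>
      (\<forall>N' \<in> w_eq C w 0. \<forall>h \<in> Homs (full_tri C C') N' N \<union> Homs (full_tri C C') N N'. \<forall>Z.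
        is_cone (full_tri C C') h Z \<and>
        FK0 C w C' B A F (K0_tr_class (full_tri C C') Z) = \<one>\<^bsub>K0_add A\<^esub> \<longrightarrow>
          FK0 C w C' B A F (K0_tr_class (full_tri C C') N) = K0_add_class A (FOb F N') \<and>
          (is_zero_object A (HF C w B A F 0 Z) \<and> is_zero_object A (HF C w B A F 1 Z) \<longrightarrow>
            FK0 C w C' B A F (K0_tr_class (full_tri C C') N)
              = K0_add_class A (HF C w B A F 0 N)))) \<and>
    (semisimple_abelian_category A \<longrightarrow>
      finite {i. \<not> is_zero_object A (HF C w B A F i N)} \<and>
      FK0 C w C' B A F (K0_tr_class (full_tri C C') N)
        = euler_class A (\<lambda>i. HF C w B A F i N)) \<and>
    (C' = Ob C \<and> strongly_generates C B \<longrightarrow>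
      has_F_finite_complexes C w (Ob C) B (full_sub C B) id_functor \<and>
      (\<exists>!\<phi>. is_FK0 C w (Ob C) B (full_sub C B) id_functor \<phi>) \<and>
      FK0 C w (Ob C) B (full_sub C B) id_functor \<in> iso (K0_tr C) (K0_add (full_sub C B))) \<and>
    (bounded_weight_structure C w \<longrightarrow>
      has_F_finite_complexes C w (Ob C) (Ob (heart C w)) (heart C w) id_functor \<and>
      (\<exists>!\<phi>. is_FK0 C w (Ob C) (Ob (heart C w)) (heart C w) id_functor \<phi>) \<and>
      FK0 C w (Ob C) (Ob (heart C w)) (heart C w) id_functor
        \<in> iso (K0_tr C) (K0_add (heart C w))) \<and>
    (C' = Ob C \<and> strongly_generates C B \<and> B = Ob (heart C w) \<and> abelian_category A \<and>
      weight_structure D v \<and> weight_exact_functor C w D v G \<and>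
      additive_functor (heart D v) A F' \<and>
      (\<forall>X \<in> Ob (heart C w). FOb F X = FOb F' (FOb G X)) \<and>
      (\<forall>f \<in> Ar (heart C w). FAr F f = FAr F' (FAr G f)) \<and>
      FOb G N \<in> w_eq D v j \<longrightarrow>
        FK0 C w C' B A F (K0_tr_class (full_tri C C') N)
          = signed_class A j (HF C w B A F j N))"
proof -
  interpret weight_structure C w by fact
  have heart: "Ob (heart C w) = w_eq C w 0" by simp
  have B: "B \<subseteq> w_eq C w 0" using assms(3) by simp
  have fs: "full_sub (heart C w) B = full_sub C B" unfolding heart_def by (rule full_sub_full_sub[OF B])
  note add = assms(4)[unfolded fs]
  have h: "full_sub C (w_eq C w 0) = heart C w" by (simp add: heart_def)
  have addh: "additive_category (full_sub C (w_eq C w 0))" unfolding h by (rule heart_additive)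
  interpret weight_K0 C w C' B A F
    by (rule weight_K0.intro[OF weight_structure_axioms weight_K0_axioms.intro]) (fact assms(2) B add assms(6-8))+
  show ?thesis
    unfolding heart
    apply (intro conjI impI)
           apply (rule is_FK0_exists_unique)
          apply (use FK0_cone in blast)
    using FK0_semisimple[OF _ assms(5)] apply blast
    using FK0_semisimple[OF _ assms(5)] apply blast
    using strongly_generated_finite[OF B add] apply blast
    using K0_iso(1)[OF B add] apply blast
    using K0_iso(2)[OF B add] apply blast
    \<comment> \<open>For bounded \<open>w\<close> the whole heart strongly generates, so this case
      is an instance of the preceding one.\<close>
    using strongly_generated_finite[OF order_refl addh bounded_strongly_generates] unfolding h apply blast
    using K0_iso(1)[OF order_refl addh bounded_strongly_generates] unfolding h apply blast
    using K0_iso(2)[OF order_refl addh bounded_strongly_generates] unfolding h apply blast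
    apply (elim conjE)
    apply (rule FK0_weight_exact; (assumption | rule assms(5) | (erule (1) bspec)))
    done
qed

end
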